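(* Assume every object of $\mathcal{A}$ is relatively injective. Let $A\in\mathrm{pro}\text{-}\mathrm{Alg}\,\mathcal{A}$ be quasi-free and let $K\to A$ be a cof-pro-ideal. Then $K^\infty$ is $H$-unital and the inclusion $K^\infty\to K$ is a cofibration.
   Context: **Base category.** $\mathcal{A}$ is an additive category closed under finite limits and finite colimits, with a fixed class $\mathcal{J}$ of objects called basic. A map $i:A'\to A$ is a cofibration if $\hom(i,J)$ is surjective for every $J\in\mathcal{J}$; an object $F$ is relatively injective if $\hom(-,F)$ sends cofibrations to surjections. Here all objects of $\mathcal{A}$ are relatively injective (equivalently, cofibrations of $\mathcal{A}$ are split injections). $\otimes:\mathcal{A}\times\mathcal{A}\to\mathcal{A}$ is a tensor product: $(\mathcal{A},\otimes)$ is symmetric strict monoidal with unit $k$, and for each $V\in\mathcal{A}$ the functors $V\otimes-$, $-\otimes V$ are additive, preserve cofibrations and their pushouts, and preserve all cokernels. $\mathrm{Alg}\,\mathcal{A}$ is the category of (not necessarily unital) associative algebras; $\tilde A=A\oplus k$ is the unitalization. **Pro-objects.** $\mathrm{pro}\text{-}\mathcal{C}$ has as objects inverse systems $\{A_{n+1}\to A_n\}_{n\ge1}$, with $\hom(A,B)=\lim_n\mathrm{colim}_m\hom(A_m,B_n)$; $\mathcal{C}$ is identified with constant pro-objects. Tensor products of pro-objects are levelwise. Cofibrations in $\mathrm{pro}\text{-}\mathcal{A}$ are the maps $i$ with $\hom(i,V)$ surjective for every relatively injective $V\in\mathcal{A}$ (here: all $V\in\mathcal{A}$, constant); relatively injective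 objects of $\mathrm{pro}\text{-}\mathcal{A}$ are those $F$ for which $\hom(-,F)$ sends these cofibrations to surjections. A pro-ideal $K$ of $A\in\mathrm{pro}\text{-}\mathrm{Alg}\,\mathcal{A}$ is a sequence of two-sided ideals $K_n\triangleleft A_n$ compatible with the maps $A_n\to A_{n-1}$; it is a cof-pro-ideal if $K\to A$ is a cofibration in $\mathrm{pro}\text{-}\mathcal{A}$. For an algebra $R$, $R^n$ is the image (cokernel of the kernel) of the $n$-fold multiplication $R^{\otimes n}\to R$. $K^\infty=\{K_n^n\}_{n\in\mathbb{N}}$, with the evident transition maps. **Quasi-free.** $\Omega^2A=\tilde A\otimes A\otimes A$ is the $A$-bimodule of noncommutative 2-forms $a_0\,da_1\,da_2$ (in element notation, to be read in terms of arrows), with left action by multiplication on the first factor and right action $(a_0\,da_1\,da_2)a=a_0\,da_1\,d(a_2a)-a_0\,d(a_1a_2)\,da+a_0a_1\,da_2\,da$. $A\in\mathrm{pro}\text{-}\mathrm{Alg}\,\mathcal{A}$ is quasi-free if the Hochschild 2-cochain $d\cup d:A\otimes A\to\Omega^2A$, $a\otimes a'\mapsto da\,da'=1\otimes a\otimes a'$ (the canonical inclusion), is a coboundary, i.e. there is a map $\phi:A\to\Omega^2A$ in $\mathrm{pro}\text{-}\mathcal{A}$ whose Hochschild coboundary $a\otimes a'\mapsto a\phi(a')-\phi(aa')+\phi(a)a'$ equals $d\cup d$ (up to sign, which is immaterial). **$H$-unital.** For $R\in\mathrm{pro}\text{-}\mathrm{Alg}\,\mathcal{A}$, the bar complex $C^{bar}R$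 is the chain complex of pro-objects with $C^{bar}_nR=R^{\otimes n+1}$ (tensor power, levelwise), $n\ge0$, and boundary (up to sign) $b'(a_0\otimes\cdots\otimes a_n)=\sum_{i=0}^{n-1}(-1)^ia_0\otimes\cdots\otimes a_ia_{i+1}\otimes\cdots\otimes a_n$. $R$ is $H$-unital if for every $V\in\mathrm{pro}\text{-}\mathcal{A}$ the complex $V\otimes C^{bar}R$ is weakly contractible, i.e. the complex of homogeneous maps $\mathrm{HOM}(V\otimes C^{bar}R,J)$ in $\mathrm{pro}\text{-}\mathcal{A}$ is exact for every relatively injective object $J$ of $\mathrm{pro}\text{-}\mathcal{A}$ (placed in degree 0). *)

theory Defs
  imports "HOL-Algebra.FiniteProduct"
begin

section \<open>Categories, finite limits and colimits\<close>

record ('o, 'm) category =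
  Obj :: "'o set"
  Arr :: "'m set"
  Dom :: "'m \<Rightarrow> 'o"
  Cod :: "'m \<Rightarrow> 'o"
  Ide :: "'o \<Rightarrow> 'm"
  Comp :: "'m \<Rightarrow> 'm \<Rightarrow> 'm"  (infixl "\<cdot>\<index>" 70)

definition Hom :: "('o, 'm, 'x) category_scheme \<Rightarrow> 'o \<Rightarrow> 'o \<Rightarrow> 'm set" where
  "Hom C a b = {f \<in> Arr C. Dom C f = a \<and> Cod C f = b}"

locale category =
  fixes C :: "('o, 'm, 'x) category_scheme" (structure)
  assumes dom_obj: "f \<in> Arr C \<Longrightarrow> Dom C f \<in> Obj C"
    and cod_obj: "f \<in> Arr C \<Longrightarrow> Cod C f \<in> Obj C"
    and ide_hom: "a \<in> Obj C \<Longrightarrow> Ide C a \<in> Hom C a a"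
    and comp_hom: "\<lbrakk>f \<in> Hom C a b; g \<in> Hom C b c\<rbrakk> \<Longrightarrow> g \<cdot> f \<in> Hom C a c"
    and comp_ide: "f \<in> Hom C a b \<Longrightarrow> f \<cdot> Ide C a = f"
    and ide_comp: "f \<in> Hom C a b \<Longrightarrow> Ide C b \<cdot> f = f"
    and comp_assoc: "\<lbrakk>f \<in> Hom C a b; g \<in> Hom C b c; h \<in> Hom C c d\<rbrakk>
      \<Longrightarrow> h \<cdot> (g \<cdot> f) = (h \<cdot> g) \<cdot> f"

definition is_mono :: "('o, 'm, 'x) category_scheme \<Rightarrow> 'm \<Rightarrow> bool" where
  "is_mono C i \<longleftrightarrow> i \<in> Arr C \<and>
    (\<forall>x. \<forall>f \<in> Hom C x (Dom C i). \<forall>g \<in> Hom C x (Dom C i). i \<cdot>\<^bsub>C\<^esub> f = i \<cdot>\<^bsub>C\<^esub> g \<longrightarrow> f = g)"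

definition is_pushout :: "('o, 'm, 'x) category_scheme \<Rightarrow> 'm \<Rightarrow> 'm \<Rightarrow> 'm \<Rightarrow> 'm \<Rightarrow> bool" where
  "is_pushout C i f i' f' \<longleftrightarrow>
    i \<in> Arr C \<and> f \<in> Hom C (Dom C i) (Cod C f) \<and>
    i' \<in> Hom C (Cod C f) (Cod C i') \<and> f' \<in> Hom C (Cod C i) (Cod C i') \<and>
    f' \<cdot>\<^bsub>C\<^esub> i = i' \<cdot>\<^bsub>C\<^esub> f \<and>
    (\<forall>y. \<forall>u \<in> Hom C (Cod C i) y. \<forall>v \<in> Hom C (Cod C f) y. u \<cdot>\<^bsub>C\<^esub> i = v \<cdot>\<^bsub>C\<^esub> f \<longrightarrow>
      (\<exists>!h. h \<in> Hom C (Cod C i') y \<and> h \<cdot>\<^bsub>C\<^esub> f' = u \<and> h \<cdot>\<^bsub>C\<^esub> i' = v))"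

definition is_functor :: "('i, 'a, 'y) category_scheme \<Rightarrow> ('o, 'm, 'x) category_scheme
    \<Rightarrow> ('i \<Rightarrow> 'o) \<Rightarrow> ('a \<Rightarrow> 'm) \<Rightarrow> bool" where
  "is_functor I C F0 F1 \<longleftrightarrow>
    (\<forall>i \<in> Obj I. F0 i \<in> Obj C \<and> F1 (Ide I i) = Ide C (F0 i)) \<and>
    (\<forall>i j. \<forall>a \<in> Hom I i j. F1 a \<in> Hom C (F0 i) (F0 j)) \<and>
    (\<forall>i j k. \<forall>a \<in> Hom I i j. \<forall>b \<in> Hom I j k. F1 (b \<cdot>\<^bsub>I\<^esub> a) = F1 b \<cdot>\<^bsub>C\<^esub> F1 a)"

definition is_cone :: "('i, 'a, 'y) category_scheme \<Rightarrow> ('o, 'm, 'x) category_scheme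
    \<Rightarrow> ('i \<Rightarrow> 'o) \<Rightarrow> ('a \<Rightarrow> 'm) \<Rightarrow> 'o \<Rightarrow> ('i \<Rightarrow> 'm) \<Rightarrow> bool" where
  "is_cone I C F0 F1 x p \<longleftrightarrow> x \<in> Obj C \<and>
    (\<forall>i \<in> Obj I. p i \<in> Hom C x (F0 i)) \<and>
    (\<forall>i j. \<forall>a \<in> Hom I i j. F1 a \<cdot>\<^bsub>C\<^esub> p i = p j)"

definition is_cocone :: "('i, 'a, 'y) category_scheme \<Rightarrow> ('o, 'm, 'x) category_scheme
    \<Rightarrow> ('i \<Rightarrow> 'o) \<Rightarrow> ('a \<Rightarrow> 'm) \<Rightarrow> 'o \<Rightarrow> ('i \<Rightarrow> 'm) \<Rightarrow> bool" where
  "is_cocone I C F0 F1 x p \<longleftrightarrow> x \<in> Obj C \<and>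
    (\<forall>i \<in> Obj I. p i \<in> Hom C (F0 i) x) \<and>
    (\<forall>i j. \<forall>a \<in> Hom I i j. p j \<cdot>\<^bsub>C\<^esub> F1 a = p i)"

definition is_limit :: "('i, 'a, 'y) category_scheme \<Rightarrow> ('o, 'm, 'x) category_scheme
    \<Rightarrow> ('i \<Rightarrow> 'o) \<Rightarrow> ('a \<Rightarrow> 'm) \<Rightarrow> 'o \<Rightarrow> ('i \<Rightarrow> 'm) \<Rightarrow> bool" where
  "is_limit I C F0 F1 x p \<longleftrightarrow> is_cone I C F0 F1 x p \<and>
    (\<forall>y q. is_cone I C F0 F1 y q \<longrightarrow>
      (\<exists>!h. h \<in> Hom C y x \<and> (\<forall>i \<in> Obj I. p i \<cdot>\<^bsub>C\<^esub> h = q i)))"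

definition is_colimit :: "('i, 'a, 'y) category_scheme \<Rightarrow> ('o, 'm, 'x) category_scheme
    \<Rightarrow> ('i \<Rightarrow> 'o) \<Rightarrow> ('a \<Rightarrow> 'm) \<Rightarrow> 'o \<Rightarrow> ('i \<Rightarrow> 'm) \<Rightarrow> bool" where
  "is_colimit I C F0 F1 x p \<longleftrightarrow> is_cocone I C F0 F1 x p \<and>
    (\<forall>y q. is_cocone I C F0 F1 y q \<longrightarrow>
      (\<exists>!h. h \<in> Hom C x y \<and> (\<forall>i \<in> Obj I. h \<cdot>\<^bsub>C\<^esub> p i = q i)))"

text \<open>Every finite category is isomorphic to one whose objects and arrows are natural numbers,
  so it is enough to let the index category range over those.\<close>

definition has_finite_limits :: "('o, 'm, 'x) category_scheme \<Rightarrow> bool" where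
  "has_finite_limits C \<longleftrightarrow> (\<forall>(I :: (nat, nat) category) F0 F1.
    category I \<and> finite (Obj I) \<and> finite (Arr I) \<and> is_functor I C F0 F1 \<longrightarrow>
    (\<exists>x p. is_limit I C F0 F1 x p))"

definition has_finite_colimits :: "('o, 'm, 'x) category_scheme \<Rightarrow> bool" where
  "has_finite_colimits C \<longleftrightarrow> (\<forall>(I :: (nat, nat) category) F0 F1.
    category I \<and> finite (Obj I) \<and> finite (Arr I) \<and> is_functor I C F0 F1 \<longrightarrow>
    (\<exists>x p. is_colimit I C F0 F1 x p))"


section \<open>Additive categories\<close>

record ('o, 'm) add_category = "('o, 'm) category" +
  Add :: "'m \<Rightarrow> 'm \<Rightarrow> 'm"  (infixl "\<boxplus>\<index>" 65)
  Zero :: "'o \<Rightarrow> 'o \<Rightarrow> 'm"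

definition hom_group :: "('o, 'm, 'x) add_category_scheme \<Rightarrow> 'o \<Rightarrow> 'o \<Rightarrow> 'm monoid" where
  "hom_group C a b = \<lparr>carrier = Hom C a b, mult = Add C, one = Zero C a b\<rparr>"

definition Neg :: "('o, 'm, 'x) add_category_scheme \<Rightarrow> 'm \<Rightarrow> 'm" where
  "Neg C f = m_inv (hom_group C (Dom C f) (Cod C f)) f"

record ('o, 'm) biproduct =
  Sum :: 'o
  In1 :: 'm
  In2 :: 'm
  Pr1 :: 'm
  Pr2 :: 'm

definition is_biproduct :: "('o, 'm, 'x) add_category_scheme \<Rightarrow> 'o \<Rightarrow> 'o
    \<Rightarrow> ('o, 'm) biproduct \<Rightarrow> bool" where
  "is_biproduct C a b B \<longleftrightarrow> Sum B \<in> Obj C \<and>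
    In1 B \<in> Hom C a (Sum B) \<and> In2 B \<in> Hom C b (Sum B) \<and>
    Pr1 B \<in> Hom C (Sum B) a \<and> Pr2 B \<in> Hom C (Sum B) b \<and>
    Pr1 B \<cdot>\<^bsub>C\<^esub> In1 B = Ide C a \<and> Pr2 B \<cdot>\<^bsub>C\<^esub> In2 B = Ide C b \<and>
    Pr2 B \<cdot>\<^bsub>C\<^esub> In1 B = Zero C a b \<and> Pr1 B \<cdot>\<^bsub>C\<^esub> In2 B = Zero C b a \<and>
    In1 B \<cdot>\<^bsub>C\<^esub> Pr1 B \<boxplus>\<^bsub>C\<^esub> In2 B \<cdot>\<^bsub>C\<^esub> Pr2 B = Ide C (Sum B)"

locale additive_category = category C
  for C :: "('o, 'm, 'x) add_category_scheme" (structure) +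
  assumes hom_comm_group: "\<lbrakk>a \<in> Obj C; b \<in> Obj C\<rbrakk> \<Longrightarrow> comm_group (hom_group C a b)"
    and comp_add_left: "\<lbrakk>f \<in> Hom C a b; g \<in> Hom C b c; g' \<in> Hom C b c\<rbrakk>
      \<Longrightarrow> (g \<boxplus> g') \<cdot> f = g \<cdot> f \<boxplus> g' \<cdot> f"
    and comp_add_right: "\<lbrakk>f \<in> Hom C a b; f' \<in> Hom C a b; g \<in> Hom C b c\<rbrakk>
      \<Longrightarrow> g \<cdot> (f \<boxplus> f') = g \<cdot> f \<boxplus> g \<cdot> f'"
    and zero_object: "\<exists>z \<in> Obj C. \<forall>a \<in> Obj C. (\<exists>!f. f \<in> Hom C a z) \<and> (\<exists>!f. f \<in> Hom C z a)"
    and biproducts: "\<lbrakk>a \<in> Obj C; b \<in> Obj C\<rbrakk> \<Longrightarrow> \<exists>B. is_biproduct C a b B"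

definition is_kernel :: "('o, 'm, 'x) add_category_scheme \<Rightarrow> 'm \<Rightarrow> 'm \<Rightarrow> bool" where
  "is_kernel C f k \<longleftrightarrow> f \<in> Arr C \<and> k \<in> Hom C (Dom C k) (Dom C f) \<and>
    f \<cdot>\<^bsub>C\<^esub> k = Zero C (Dom C k) (Cod C f) \<and>
    (\<forall>x. \<forall>g \<in> Hom C x (Dom C f). f \<cdot>\<^bsub>C\<^esub> g = Zero C x (Cod C f) \<longrightarrow>
      (\<exists>!h. h \<in> Hom C x (Dom C k) \<and> k \<cdot>\<^bsub>C\<^esub> h = g))"

definition is_cokernel :: "('o, 'm, 'x) add_category_scheme \<Rightarrow> 'm \<Rightarrow> 'm \<Rightarrow> bool" where
  "is_cokernel C f q \<longleftrightarrow> f \<in> Arr C \<and> q \<in> Hom C (Cod C f) (Cod C q) \<and>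
    q \<cdot>\<^bsub>C\<^esub> f = Zero C (Dom C f) (Cod C q) \<and>
    (\<forall>y. \<forall>g \<in> Hom C (Cod C f) y. g \<cdot>\<^bsub>C\<^esub> f = Zero C (Dom C f) y \<longrightarrow>
      (\<exists>!h. h \<in> Hom C (Cod C q) y \<and> h \<cdot>\<^bsub>C\<^esub> q = g))"

definition kernel_of :: "('o, 'm, 'x) add_category_scheme \<Rightarrow> 'm \<Rightarrow> 'm" where
  "kernel_of C f = (SOME k. is_kernel C f k)"

definition cokernel_of :: "('o, 'm, 'x) add_category_scheme \<Rightarrow> 'm \<Rightarrow> 'm" where
  "cokernel_of C f = (SOME q. is_cokernel C f q)"


section \<open>Cofibrations and relatively injective objects\<close>

definition cofibrations :: "('o, 'm, 'x) category_scheme \<Rightarrow> 'o set \<Rightarrow> 'm set" where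
  "cofibrations C J = {i \<in> Arr C. \<forall>F \<in> J. \<forall>f \<in> Hom C (Dom C i) F.
    \<exists>g \<in> Hom C (Cod C i) F. g \<cdot>\<^bsub>C\<^esub> i = f}"

definition rel_injectives :: "('o, 'm, 'x) category_scheme \<Rightarrow> 'o set \<Rightarrow> 'o set" where
  "rel_injectives C J = {F \<in> Obj C. \<forall>i \<in> cofibrations C J. \<forall>f \<in> Hom C (Dom C i) F.
    \<exists>g \<in> Hom C (Cod C i) F. g \<cdot>\<^bsub>C\<^esub> i = f}"


section \<open>Tensor products\<close>

record ('o, 'm) tensor_category = "('o, 'm) add_category" +
  Tobj :: "'o \<Rightarrow> 'o \<Rightarrow> 'o"  (infixr "\<boxtimes>\<index>" 75)
  Tarr :: "'m \<Rightarrow> 'm \<Rightarrow> 'm"  (infixr "\<star>\<index>" 75)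
  Unit :: 'o
  Sym :: "'o \<Rightarrow> 'o \<Rightarrow> 'm"

locale symmetric_strict_monoidal = category C
  for C :: "('o, 'm, 'x) tensor_category_scheme" (structure) +
  assumes tobj_obj: "\<lbrakk>a \<in> Obj C; b \<in> Obj C\<rbrakk> \<Longrightarrow> a \<boxtimes> b \<in> Obj C"
    and unit_obj: "Unit C \<in> Obj C"
    and tarr_hom: "\<lbrakk>f \<in> Hom C a b; g \<in> Hom C c d\<rbrakk> \<Longrightarrow> f \<star> g \<in> Hom C (a \<boxtimes> c) (b \<boxtimes> d)"
    and tarr_ide: "\<lbrakk>a \<in> Obj C; b \<in> Obj C\<rbrakk> \<Longrightarrow> Ide C a \<star> Ide C b = Ide C (a \<boxtimes> b)"
    and tarr_comp: "\<lbrakk>f \<in> Hom C a b; f' \<in> Hom C b c; g \<in> Hom C x y; g' \<in> Hom C y z\<rbrakk>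
      \<Longrightarrow> (f' \<cdot> f) \<star> (g' \<cdot> g) = (f' \<star> g') \<cdot> (f \<star> g)"
    and tobj_assoc: "\<lbrakk>a \<in> Obj C; b \<in> Obj C; c \<in> Obj C\<rbrakk> \<Longrightarrow> (a \<boxtimes> b) \<boxtimes> c = a \<boxtimes> (b \<boxtimes> c)"
    and tarr_assoc: "\<lbrakk>f \<in> Arr C; g \<in> Arr C; h \<in> Arr C\<rbrakk> \<Longrightarrow> (f \<star> g) \<star> h = f \<star> (g \<star> h)"
    and tobj_unit: "a \<in> Obj C \<Longrightarrow> Unit C \<boxtimes> a = a" "a \<in> Obj C \<Longrightarrow> a \<boxtimes> Unit C = a"
    and tarr_unit: "f \<in> Arr C \<Longrightarrow> Ide C (Unit C) \<star> f = f" "f \<in> Arr C \<Longrightarrow> f \<star> Ide C (Unit C) = f"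
    and sym_hom: "\<lbrakk>a \<in> Obj C; b \<in> Obj C\<rbrakk> \<Longrightarrow> Sym C a b \<in> Hom C (a \<boxtimes> b) (b \<boxtimes> a)"
    and sym_natural: "\<lbrakk>f \<in> Hom C a b; g \<in> Hom C c d\<rbrakk>
      \<Longrightarrow> Sym C b d \<cdot> (f \<star> g) = (g \<star> f) \<cdot> Sym C a c"
    and sym_inverse: "\<lbrakk>a \<in> Obj C; b \<in> Obj C\<rbrakk> \<Longrightarrow> Sym C b a \<cdot> Sym C a b = Ide C (a \<boxtimes> b)"
    and sym_hexagon: "\<lbrakk>a \<in> Obj C; b \<in> Obj C; c \<in> Obj C\<rbrakk>
      \<Longrightarrow> Sym C a (b \<boxtimes> c) = (Ide C b \<star> Sym C a c) \<cdot> (Sym C a b \<star> Ide C c)"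

locale base_category = additive_category C + symmetric_strict_monoidal C
  for C :: "('o, 'm, 'x) tensor_category_scheme" (structure) +
  fixes J :: "'o set"
  assumes basic_obj: "J \<subseteq> Obj C"
    and finite_limits: "has_finite_limits C"
    and finite_colimits: "has_finite_colimits C"
    and tensor_add: "\<lbrakk>V \<in> Obj C; f \<in> Hom C a b; g \<in> Hom C a b\<rbrakk>
        \<Longrightarrow> Ide C V \<star> (f \<boxplus> g) = Ide C V \<star> f \<boxplus> Ide C V \<star> g"
      "\<lbrakk>V \<in> Obj C; f \<in> Hom C a b; g \<in> Hom C a b\<rbrakk>
        \<Longrightarrow> (f \<boxplus> g) \<star> Ide C V = f \<star> Ide C V \<boxplus> g \<star> Ide C V"
    and tensor_cofibration: "\<lbrakk>V \<in> Obj C; i \<in> cofibrations C J\<rbrakk> \<Longrightarrow> Ide C V \<star> i \<in> cofibrations C J"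
      "\<lbrakk>V \<in> Obj C; i \<in> cofibrations C J\<rbrakk> \<Longrightarrow> i \<star> Ide C V \<in> cofibrations C J"
    and tensor_pushout: "\<lbrakk>V \<in> Obj C; i \<in> cofibrations C J; is_pushout C i f i' f'\<rbrakk>
        \<Longrightarrow> is_pushout C (Ide C V \<star> i) (Ide C V \<star> f) (Ide C V \<star> i') (Ide C V \<star> f')"
      "\<lbrakk>V \<in> Obj C; i \<in> cofibrations C J; is_pushout C i f i' f'\<rbrakk>
        \<Longrightarrow> is_pushout C (i \<star> Ide C V) (f \<star> Ide C V) (i' \<star> Ide C V) (f' \<star> Ide C V)"
    and tensor_cokernel: "\<lbrakk>V \<in> Obj C; is_cokernel C f q\<rbrakk>
        \<Longrightarrow> is_cokernel C (Ide C V \<star> f) (Ide C V \<star> q)"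
      "\<lbrakk>V \<in> Obj C; is_cokernel C f q\<rbrakk> \<Longrightarrow> is_cokernel C (f \<star> Ide C V) (q \<star> Ide C V)"

primrec tpow :: "('o, 'm, 'x) tensor_category_scheme \<Rightarrow> 'o \<Rightarrow> nat \<Rightarrow> 'o" where
  "tpow C a 0 = Unit C"
| "tpow C a (Suc n) = a \<boxtimes>\<^bsub>C\<^esub> tpow C a n"

primrec tpow_arr :: "('o, 'm, 'x) tensor_category_scheme \<Rightarrow> 'm \<Rightarrow> nat \<Rightarrow> 'm" where
  "tpow_arr C f 0 = Ide C (Unit C)"
| "tpow_arr C f (Suc n) = f \<star>\<^bsub>C\<^esub> tpow_arr C f n"


section \<open>Algebras and ideals\<close>

record ('o, 'm) alg =
  Und :: 'o
  Mul :: 'm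

definition is_alg :: "('o, 'm, 'x) tensor_category_scheme \<Rightarrow> ('o, 'm) alg \<Rightarrow> bool" where
  "is_alg C R \<longleftrightarrow> Und R \<in> Obj C \<and> Mul R \<in> Hom C (Und R \<boxtimes>\<^bsub>C\<^esub> Und R) (Und R) \<and>
    Mul R \<cdot>\<^bsub>C\<^esub> (Mul R \<star>\<^bsub>C\<^esub> Ide C (Und R)) = Mul R \<cdot>\<^bsub>C\<^esub> (Ide C (Und R) \<star>\<^bsub>C\<^esub> Mul R)"

definition is_alg_hom :: "('o, 'm, 'x) tensor_category_scheme
    \<Rightarrow> ('o, 'm) alg \<Rightarrow> ('o, 'm) alg \<Rightarrow> 'm \<Rightarrow> bool" where
  "is_alg_hom C R S f \<longleftrightarrow> f \<in> Hom C (Und R) (Und S) \<and>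
    f \<cdot>\<^bsub>C\<^esub> Mul R = Mul S \<cdot>\<^bsub>C\<^esub> (f \<star>\<^bsub>C\<^esub> f)"

text \<open>An ideal is a subobject absorbing multiplication from both sides. The multiplication carried
  along in \<open>K\<close> is no extra datum: it exists by absorption and is unique since \<open>i\<close> is monic.\<close>

definition is_ideal :: "('o, 'm, 'x) tensor_category_scheme
    \<Rightarrow> ('o, 'm) alg \<Rightarrow> ('o, 'm) alg \<Rightarrow> 'm \<Rightarrow> bool" where
  "is_ideal C A K i \<longleftrightarrow> is_alg C A \<and> is_alg C K \<and> is_alg_hom C K A i \<and> is_mono C i \<and>
    (\<exists>l \<in> Hom C (Und A \<boxtimes>\<^bsub>C\<^esub> Und K) (Und K).
      i \<cdot>\<^bsub>C\<^esub> l = Mul A \<cdot>\<^bsub>C\<^esub> (Ide C (Und A) \<star>\<^bsub>C\<^esub> i)) \<and>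
    (\<exists>r \<in> Hom C (Und K \<boxtimes>\<^bsub>C\<^esub> Und A) (Und K).
      i \<cdot>\<^bsub>C\<^esub> r = Mul A \<cdot>\<^bsub>C\<^esub> (i \<star>\<^bsub>C\<^esub> Ide C (Und A)))"

text \<open>The \<open>n\<close>-fold multiplication, for \<open>n \<ge> 1\<close>.\<close>

primrec nmult :: "('o, 'm, 'x) tensor_category_scheme \<Rightarrow> ('o, 'm) alg \<Rightarrow> nat \<Rightarrow> 'm" where
  "nmult C R 0 = undefined"
| "nmult C R (Suc n) = (if n = 0 then Ide C (Und R)
     else Mul R \<cdot>\<^bsub>C\<^esub> (Ide C (Und R) \<star>\<^bsub>C\<^esub> nmult C R n))"

text \<open>The power of an algebra to an exponent \<open>n \<ge> 1\<close> is the cokernel of the kernel of the \<open>n\<close>-fold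
  multiplication, so all maps out of it are determined by their composite with the projection
  \<open>power_proj C R n\<close> from the tensor power, an epimorphism. The map \<open>power_incl\<close>
  to \<open>R\<close> need not be monic for an arbitrary algebra; hence the multiplication and the
  transition maps are specified on the tensor powers, by
  \[ (x_1 \otimes \dots \otimes x_n) \cdot (y_1 \otimes \dots \otimes y_n)
      = x_1 \cdots x_n y_1 \otimes y_2 \otimes \dots \otimes y_n, \qquad
     x_0 \otimes \dots \otimes x_n \mapsto f (x_0 x_1) \otimes f x_2 \otimes \dots \otimes f x_n. \]\<close>

definition power_proj :: "('o, 'm, 'x) tensor_category_scheme \<Rightarrow> ('o, 'm) alg \<Rightarrow> nat \<Rightarrow> 'm" where
  "power_proj C R n = cokernel_of C (kernel_of C (nmult C R n))"

definition power_obj :: "('o, 'm, 'x) tensor_category_scheme \<Rightarrow> ('o, 'm) alg \<Rightarrow> nat \<Rightarrow> 'o" where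
  "power_obj C R n = Cod C (power_proj C R n)"

definition power_incl :: "('o, 'm, 'x) tensor_category_scheme \<Rightarrow> ('o, 'm) alg \<Rightarrow> nat \<Rightarrow> 'm" where
  "power_incl C R n = (THE j. j \<in> Hom C (power_obj C R n) (Und R) \<and>
    j \<cdot>\<^bsub>C\<^esub> power_proj C R n = nmult C R n)"

definition power_alg :: "('o, 'm, 'x) tensor_category_scheme \<Rightarrow> ('o, 'm) alg \<Rightarrow> nat
    \<Rightarrow> ('o, 'm) alg" where
  "power_alg C R n = \<lparr>Und = power_obj C R n,
    Mul = (THE m. m \<in> Hom C (power_obj C R n \<boxtimes>\<^bsub>C\<^esub> power_obj C R n) (power_obj C R n) \<and>
      m \<cdot>\<^bsub>C\<^esub> (power_proj C R n \<star>\<^bsub>C\<^esub> power_proj C R n) =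
        power_proj C R n \<cdot>\<^bsub>C\<^esub> (nmult C R (n + 1) \<star>\<^bsub>C\<^esub> Ide C (tpow C (Und R) (n - 1))))\<rparr>"

definition power_trans :: "('o, 'm, 'x) tensor_category_scheme
    \<Rightarrow> ('o, 'm) alg \<Rightarrow> ('o, 'm) alg \<Rightarrow> 'm \<Rightarrow> nat \<Rightarrow> 'm" where
  "power_trans C R S f n = (THE t. t \<in> Hom C (power_obj C R (n + 1)) (power_obj C S n) \<and>
    t \<cdot>\<^bsub>C\<^esub> power_proj C R (n + 1) =
      power_proj C S n \<cdot>\<^bsub>C\<^esub> (tpow_arr C f n \<cdot>\<^bsub>C\<^esub> (Mul R \<star>\<^bsub>C\<^esub> Ide C (tpow C (Und R) (n - 1)))))"


section \<open>Pro-objects\<close>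

text \<open>Inverse systems are indexed from \<open>0\<close>: level \<open>n\<close> stands for level \<open>n + 1\<close> of a system indexed
  by the positive integers. \<open>Tr A n\<close> is the transition map from level \<open>n + 1\<close> to level \<open>n\<close>.\<close>

record ('a, 'm) inv_sys =
  Lev :: "nat \<Rightarrow> 'a"
  Tr :: "nat \<Rightarrow> 'm"

definition is_inv_sys :: "('o, 'm, 'x) category_scheme \<Rightarrow> ('o, 'm) inv_sys \<Rightarrow> bool" where
  "is_inv_sys C A \<longleftrightarrow> (\<forall>n. Lev A n \<in> Obj C \<and> Tr A n \<in> Hom C (Lev A (Suc n)) (Lev A n))"

text \<open>\<open>bond C A n d\<close> is the composite transition map from level \<open>n + d\<close> to level \<open>n\<close>.\<close>

primrec bond :: "('o, 'm, 'x) category_scheme \<Rightarrow> ('o, 'm) inv_sys \<Rightarrow> nat \<Rightarrow> nat \<Rightarrow> 'm" where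
  "bond C A n 0 = Ide C (Lev A n)"
| "bond C A n (Suc d) = bond C A n d \<cdot>\<^bsub>C\<^esub> Tr A (n + d)"

text \<open>A pair \<open>(m, f)\<close> represents the class of \<open>f : A_m \<rightarrow> Y\<close> in the colimit over \<open>m\<close> of the sets
  of arrows \<open>A_m \<rightarrow> Y\<close>, which is \<open>colim_hom C A Y\<close>.\<close>

definition germ_rel :: "('o, 'm, 'x) category_scheme \<Rightarrow> ('o, 'm) inv_sys \<Rightarrow> 'o
    \<Rightarrow> ((nat \<times> 'm) \<times> (nat \<times> 'm)) set" where
  "germ_rel C A Y = {((m, f), (m', f')). f \<in> Hom C (Lev A m) Y \<and> f' \<in> Hom C (Lev A m') Y \<and>
    (\<exists>d d'. m + d = m' + d' \<and> f \<cdot>\<^bsub>C\<^esub> bond C A m d = f' \<cdot>\<^bsub>C\<^esub> bond C A m' d')}"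

definition colim_hom :: "('o, 'm, 'x) category_scheme \<Rightarrow> ('o, 'm) inv_sys \<Rightarrow> 'o
    \<Rightarrow> (nat \<times> 'm) set set" where
  "colim_hom C A Y = (SIGMA m : UNIV. Hom C (Lev A m) Y) // germ_rel C A Y"

text \<open>A map of pro-objects \<open>A \<rightarrow> B\<close> is a compatible family of elements of \<open>colim_hom C A (Lev B n)\<close>.\<close>

record ('o, 'm) pro_arr =
  PDom :: "('o, 'm) inv_sys"
  PCod :: "('o, 'm) inv_sys"
  Germ :: "nat \<Rightarrow> (nat \<times> 'm) set"

definition pro_arrs :: "('o, 'm, 'x) category_scheme \<Rightarrow> ('o, 'm) pro_arr set" where
  "pro_arrs C = {F. is_inv_sys C (PDom F) \<and> is_inv_sys C (PCod F) \<and>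
    (\<forall>n. Germ F n \<in> colim_hom C (PDom F) (Lev (PCod F) n)) \<and>
    (\<forall>n. germ_rel C (PDom F) (Lev (PCod F) n) ``
        {(m, Tr (PCod F) n \<cdot>\<^bsub>C\<^esub> f) | m f. (m, f) \<in> Germ F (Suc n)} = Germ F n)}"

text \<open>The pro-map given by a family of arrows \<open>u n : A_n \<rightarrow> B_n\<close> commuting with transition maps.\<close>

definition level_map :: "('o, 'm, 'x) category_scheme \<Rightarrow> ('o, 'm) inv_sys \<Rightarrow> ('o, 'm) inv_sys
    \<Rightarrow> (nat \<Rightarrow> 'm) \<Rightarrow> ('o, 'm) pro_arr" where
  "level_map C A B u = \<lparr>PDom = A, PCod = B, Germ = (\<lambda>n. germ_rel C A (Lev B n) `` {(n, u n)})\<rparr>"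

definition const_pro :: "('o, 'm, 'x) category_scheme \<Rightarrow> 'o \<Rightarrow> ('o, 'm) inv_sys" where
  "const_pro C V = \<lparr>Lev = (\<lambda>_. V), Tr = (\<lambda>_. Ide C V)\<rparr>"

definition tensor_pro :: "('o, 'm, 'x) tensor_category_scheme \<Rightarrow> ('o, 'm) inv_sys
    \<Rightarrow> ('o, 'm) inv_sys \<Rightarrow> ('o, 'm) inv_sys" where
  "tensor_pro C A B = \<lparr>Lev = (\<lambda>n. Lev A n \<boxtimes>\<^bsub>C\<^esub> Lev B n), Tr = (\<lambda>n. Tr A n \<star>\<^bsub>C\<^esub> Tr B n)\<rparr>"

text \<open>Operations on pro-maps are performed on representatives; for sums and tensor products the
  two representatives are taken at a common level \<open>m\<close> of the source.\<close>

definition Pro :: "('o, 'm, 'x) tensor_category_scheme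
    \<Rightarrow> (('o, 'm) inv_sys, ('o, 'm) pro_arr) tensor_category" where
  "Pro C = \<lparr>
    Obj = {A. is_inv_sys C A},
    Arr = pro_arrs C,
    Dom = PDom,
    Cod = PCod,
    Ide = (\<lambda>A. level_map C A A (\<lambda>n. Ide C (Lev A n))),
    Comp = (\<lambda>G F. \<lparr>PDom = PDom F, PCod = PCod G,
      Germ = (\<lambda>n. germ_rel C (PDom F) (Lev (PCod G) n) ``
        {(m, g \<cdot>\<^bsub>C\<^esub> f) | l g m f. (l, g) \<in> Germ G n \<and> (m, f) \<in> Germ F l})\<rparr>),
    Add = (\<lambda>F G. \<lparr>PDom = PDom F, PCod = PCod F,
      Germ = (\<lambda>n. germ_rel C (PDom F) (Lev (PCod F) n) ``
        {(m, f \<boxplus>\<^bsub>C\<^esub> g) | m f g. (m, f) \<in> Germ F n \<and> (m, g) \<in> Germ G n})\<rparr>),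
    Zero = (\<lambda>A B. level_map C A B (\<lambda>n. Zero C (Lev A n) (Lev B n))),
    Tobj = tensor_pro C,
    Tarr = (\<lambda>F G. \<lparr>PDom = tensor_pro C (PDom F) (PDom G), PCod = tensor_pro C (PCod F) (PCod G),
      Germ = (\<lambda>n. germ_rel C (tensor_pro C (PDom F) (PDom G)) (Lev (PCod F) n \<boxtimes>\<^bsub>C\<^esub> Lev (PCod G) n) ``
        {(m, f \<star>\<^bsub>C\<^esub> g) | m f g. (m, f) \<in> Germ F n \<and> (m, g) \<in> Germ G n})\<rparr>),
    Unit = const_pro C (Unit C),
    Sym = (\<lambda>A B. level_map C (tensor_pro C A B) (tensor_pro C B A)
      (\<lambda>n. Sym C (Lev A n) (Lev B n)))\<rparr>"

definition pro_test_objects :: "('o, 'm, 'x) category_scheme \<Rightarrow> 'o set \<Rightarrow> ('o, 'm) inv_sys set" where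
  "pro_test_objects C J = const_pro C ` rel_injectives C J"

definition pro_cofibrations :: "('o, 'm, 'x) tensor_category_scheme \<Rightarrow> 'o set
    \<Rightarrow> ('o, 'm) pro_arr set" where
  "pro_cofibrations C J = cofibrations (Pro C) (pro_test_objects C J)"

definition pro_rel_injectives :: "('o, 'm, 'x) tensor_category_scheme \<Rightarrow> 'o set
    \<Rightarrow> ('o, 'm) inv_sys set" where
  "pro_rel_injectives C J = rel_injectives (Pro C) (pro_test_objects C J)"


section \<open>Pro-algebras and pro-ideals\<close>

definition is_pro_alg :: "('o, 'm, 'x) tensor_category_scheme \<Rightarrow> (('o, 'm) alg, 'm) inv_sys
    \<Rightarrow> bool" where
  "is_pro_alg C R \<longleftrightarrow>
    (\<forall>n. is_alg C (Lev R n) \<and> is_alg_hom C (Lev R (Suc n)) (Lev R n) (Tr R n))"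

definition und_sys :: "(('o, 'm) alg, 'm) inv_sys \<Rightarrow> ('o, 'm) inv_sys" where
  "und_sys R = \<lparr>Lev = (\<lambda>n. Und (Lev R n)), Tr = Tr R\<rparr>"

text \<open>The algebra in the monoidal category of pro-objects underlying a pro-algebra.\<close>

definition pro_alg :: "('o, 'm, 'x) tensor_category_scheme \<Rightarrow> (('o, 'm) alg, 'm) inv_sys
    \<Rightarrow> (('o, 'm) inv_sys, ('o, 'm) pro_arr) alg" where
  "pro_alg C R = \<lparr>Und = und_sys R,
    Mul = level_map C (tensor_pro C (und_sys R) (und_sys R)) (und_sys R) (\<lambda>n. Mul (Lev R n))\<rparr>"

definition is_pro_ideal :: "('o, 'm, 'x) tensor_category_scheme \<Rightarrow> (('o, 'm) alg, 'm) inv_sys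
    \<Rightarrow> (('o, 'm) alg, 'm) inv_sys \<Rightarrow> (nat \<Rightarrow> 'm) \<Rightarrow> bool" where
  "is_pro_ideal C A K i \<longleftrightarrow> is_pro_alg C A \<and> is_pro_alg C K \<and>
    (\<forall>n. is_ideal C (Lev A n) (Lev K n) (i n) \<and> Tr A n \<cdot>\<^bsub>C\<^esub> i (Suc n) = i n \<cdot>\<^bsub>C\<^esub> Tr K n)"

definition is_cof_pro_ideal :: "('o, 'm, 'x) tensor_category_scheme \<Rightarrow> 'o set
    \<Rightarrow> (('o, 'm) alg, 'm) inv_sys \<Rightarrow> (('o, 'm) alg, 'm) inv_sys \<Rightarrow> (nat \<Rightarrow> 'm) \<Rightarrow> bool" where
  "is_cof_pro_ideal C J A K i \<longleftrightarrow> is_pro_ideal C A K i \<and>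
    level_map C (und_sys K) (und_sys A) i \<in> pro_cofibrations C J"

text \<open>With levels counted from \<open>0\<close>, level \<open>n\<close> of the pro-algebra of infinite order powers of \<open>K\<close> is
  the power of \<open>K_n\<close> to the exponent \<open>n + 1\<close>.\<close>

definition power_inf :: "('o, 'm, 'x) tensor_category_scheme \<Rightarrow> (('o, 'm) alg, 'm) inv_sys
    \<Rightarrow> (('o, 'm) alg, 'm) inv_sys" where
  "power_inf C K = \<lparr>Lev = (\<lambda>n. power_alg C (Lev K n) (n + 1)),
    Tr = (\<lambda>n. power_trans C (Lev K (Suc n)) (Lev K n) (Tr K n) (n + 1))\<rparr>"

definition power_inf_incl :: "('o, 'm, 'x) tensor_category_scheme \<Rightarrow> (('o, 'm) alg, 'm) inv_sys
    \<Rightarrow> ('o, 'm) pro_arr" where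
  "power_inf_incl C K = level_map C (und_sys (power_inf C K)) (und_sys K)
    (\<lambda>n. power_incl C (Lev K n) (n + 1))"


section \<open>Quasi-free pro-algebras\<close>

text \<open>The following notions are stated for an algebra \<open>A\<close> in any additive tensor category and are
  used for the category of pro-objects, where biproducts (as well as tensor products) are levelwise.
  By strictness, tensoring with the unit object does not change objects or arrows; for instance
  \<open>Ide C A \<star> Pr2 B\<close> goes from \<open>A \<boxtimes> (A \<oplus> k)\<close> to \<open>A \<boxtimes> k = A\<close>.\<close>

definition unitalization :: "('o, 'm, 'x) tensor_category_scheme \<Rightarrow> ('o, 'm) alg
    \<Rightarrow> ('o, 'm) biproduct" where
  "unitalization C A = (SOME B. is_biproduct C (Und A) (Unit C) B)"

definition unitalization_lmult :: "('o, 'm, 'x) tensor_category_scheme \<Rightarrow> ('o, 'm) alg \<Rightarrow> 'm" where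
  "unitalization_lmult C A = (let B = unitalization C A; a = Ide C (Und A) in
    In1 B \<cdot>\<^bsub>C\<^esub> (Mul A \<cdot>\<^bsub>C\<^esub> (a \<star>\<^bsub>C\<^esub> Pr1 B) \<boxplus>\<^bsub>C\<^esub> a \<star>\<^bsub>C\<^esub> Pr2 B))"

definition unitalization_rmult :: "('o, 'm, 'x) tensor_category_scheme \<Rightarrow> ('o, 'm) alg \<Rightarrow> 'm" where
  "unitalization_rmult C A = (let B = unitalization C A; a = Ide C (Und A) in
    In1 B \<cdot>\<^bsub>C\<^esub> (Mul A \<cdot>\<^bsub>C\<^esub> (Pr1 B \<star>\<^bsub>C\<^esub> a) \<boxplus>\<^bsub>C\<^esub> Pr2 B \<star>\<^bsub>C\<^esub> a))"

definition Omega2 :: "('o, 'm, 'x) tensor_category_scheme \<Rightarrow> ('o, 'm) alg \<Rightarrow> 'o" where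
  "Omega2 C A = Sum (unitalization C A) \<boxtimes>\<^bsub>C\<^esub> Und A \<boxtimes>\<^bsub>C\<^esub> Und A"

definition Omega2_lact :: "('o, 'm, 'x) tensor_category_scheme \<Rightarrow> ('o, 'm) alg \<Rightarrow> 'm" where
  "Omega2_lact C A = unitalization_lmult C A \<star>\<^bsub>C\<^esub> Ide C (Und A) \<star>\<^bsub>C\<^esub> Ide C (Und A)"

definition Omega2_ract :: "('o, 'm, 'x) tensor_category_scheme \<Rightarrow> ('o, 'm) alg \<Rightarrow> 'm" where
  "Omega2_ract C A = (let u = Ide C (Sum (unitalization C A)); a = Ide C (Und A) in
    u \<star>\<^bsub>C\<^esub> a \<star>\<^bsub>C\<^esub> Mul A \<boxplus>\<^bsub>C\<^esub> Neg C (u \<star>\<^bsub>C\<^esub> Mul A \<star>\<^bsub>C\<^esub> a) \<boxplus>\<^bsub>C\<^esub> unitalization_rmult C A \<star>\<^bsub>C\<^esub> a \<star>\<^bsub>C\<^esub> a)"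

definition cup_d_d :: "('o, 'm, 'x) tensor_category_scheme \<Rightarrow> ('o, 'm) alg \<Rightarrow> 'm" where
  "cup_d_d C A = In2 (unitalization C A) \<star>\<^bsub>C\<^esub> Ide C (Und A) \<star>\<^bsub>C\<^esub> Ide C (Und A)"

definition hochschild_coboundary :: "('o, 'm, 'x) tensor_category_scheme \<Rightarrow> ('o, 'm) alg
    \<Rightarrow> 'm \<Rightarrow> 'm" where
  "hochschild_coboundary C A \<phi> = (let a = Ide C (Und A) in
    Omega2_lact C A \<cdot>\<^bsub>C\<^esub> (a \<star>\<^bsub>C\<^esub> \<phi>) \<boxplus>\<^bsub>C\<^esub> Neg C (\<phi> \<cdot>\<^bsub>C\<^esub> Mul A) \<boxplus>\<^bsub>C\<^esub> Omega2_ract C A \<cdot>\<^bsub>C\<^esub> (\<phi> \<star>\<^bsub>C\<^esub> a))"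

definition quasi_free :: "('o, 'm, 'x) tensor_category_scheme \<Rightarrow> (('o, 'm) alg, 'm) inv_sys
    \<Rightarrow> bool" where
  "quasi_free C A \<longleftrightarrow> is_pro_alg C A \<and>
    (\<exists>\<phi> \<in> Hom (Pro C) (und_sys A) (Omega2 (Pro C) (pro_alg C A)).
      hochschild_coboundary (Pro C) (pro_alg C A) \<phi> = cup_d_d (Pro C) (pro_alg C A))"


section \<open>The bar complex and H-unitality\<close>

definition bar_obj :: "('o, 'm, 'x) tensor_category_scheme \<Rightarrow> ('o, 'm) alg \<Rightarrow> nat \<Rightarrow> 'o" where
  "bar_obj C R n = tpow C (Und R) (n + 1)"

text \<open>The boundary from degree \<open>n\<close> to degree \<open>n - 1\<close>, for \<open>n \<ge> 1\<close>; the product in the group of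
  arrows is a sum.\<close>

definition bar_bd :: "('o, 'm, 'x) tensor_category_scheme \<Rightarrow> ('o, 'm) alg \<Rightarrow> nat \<Rightarrow> 'm" where
  "bar_bd C R n = finprod (hom_group C (bar_obj C R n) (bar_obj C R (n - 1)))
    (\<lambda>i. let t = Ide C (tpow C (Und R) i) \<star>\<^bsub>C\<^esub> Mul R \<star>\<^bsub>C\<^esub> Ide C (tpow C (Und R) (n - 1 - i))
         in if even i then t else Neg C t) {0..<n}"

text \<open>Exactness of the complex of homogeneous maps from a chain complex \<open>X\<close> (concentrated in degrees
  \<open>p \<ge> 0\<close>, with boundary \<open>d p : X_p \<rightarrow> X_(p-1)\<close> for \<open>p \<ge> 1\<close>) to an object placed in degree \<open>0\<close>:
  the homogeneous maps of degree \<open>-p\<close> are the arrows \<open>X_p \<rightarrow> F\<close>, and the differential is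
  composition with \<open>d\<close>, up to sign.\<close>

definition HOM_exact :: "('o, 'm, 'x) add_category_scheme \<Rightarrow> (nat \<Rightarrow> 'o) \<Rightarrow> (nat \<Rightarrow> 'm) \<Rightarrow> 'o
    \<Rightarrow> bool" where
  "HOM_exact C X d F \<longleftrightarrow>
    {f \<in> Hom C (X 0) F. f \<cdot>\<^bsub>C\<^esub> d 1 = Zero C (X 1) F} = {Zero C (X 0) F} \<and>
    (\<forall>p. {f \<in> Hom C (X (p + 1)) F. f \<cdot>\<^bsub>C\<^esub> d (p + 2) = Zero C (X (p + 2)) F} =
         {g \<cdot>\<^bsub>C\<^esub> d (p + 1) | g. g \<in> Hom C (X p) F})"

definition weakly_contractible :: "('o, 'm, 'x) tensor_category_scheme \<Rightarrow> 'o set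
    \<Rightarrow> (nat \<Rightarrow> ('o, 'm) inv_sys) \<Rightarrow> (nat \<Rightarrow> ('o, 'm) pro_arr) \<Rightarrow> bool" where
  "weakly_contractible C J X d \<longleftrightarrow> (\<forall>F \<in> pro_rel_injectives C J. HOM_exact (Pro C) X d F)"

definition H_unital :: "('o, 'm, 'x) tensor_category_scheme \<Rightarrow> 'o set
    \<Rightarrow> (('o, 'm) alg, 'm) inv_sys \<Rightarrow> bool" where
  "H_unital C J R \<longleftrightarrow> is_pro_alg C R \<and>
    (\<forall>V \<in> Obj (Pro C). weakly_contractible C J
      (\<lambda>n. V \<boxtimes>\<^bsub>Pro C\<^esub> bar_obj (Pro C) (pro_alg C R) n)
      (\<lambda>n. Ide (Pro C) V \<star>\<^bsub>Pro C\<^esub> bar_bd (Pro C) (pro_alg C R) n))"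

end

theory Submission
  imports Defs
begin

text \<open>The cochain \<open>\<phi> : A \<rightarrow> \<Omega>\<^sup>2 A\<close> with coboundary \<open>d \<union> d\<close>, together with linear retractions of \<open>K \<rightarrow> A\<close>,
  which exist level by level because \<open>K\<close> is a cof-pro-ideal, makes \<open>K\<close> projective as a left module. This
  yields maps \<open>\<tau> : K \<rightarrow> K \<otimes> K\<close> (from a deep level to a given one) with \<open>\<tau> (z y x) = z \<tau> (y x)\<close> and
  \<open>\<mu> (\<tau> (y x)) = y x\<close>. Applying \<open>\<tau>\<close> repeatedly to the first factor gives maps \<open>\<tau>_N\<close> from \<open>K\<close> to its \<open>N\<close>-th
  tensor power that split the \<open>N\<close>-fold multiplication on products of \<open>N\<close> elements. Projecting \<open>\<tau>_N\<close> to the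
  \<open>N\<close>-th power of \<open>K\<close> shows that \<open>K\<^sup>\<infinity> \<rightarrow> K\<close> is a cofibration. Projecting \<open>\<tau>_2N\<close> to two copies of the
  \<open>N\<close>-th power gives left linear sections of the multiplication of \<open>K\<^sup>\<infinity>\<close>; applied to the last tensor factor,
  they contract the bar complex.\<close>

section \<open>Additive monoidal categories\<close>

text \<open>A retraction of \<open>K\<close> in \<open>A\<close> is a map of objects, not of
  modules. It respects products only on the ideal itself, where it is a transition map. Hence
  \<open>\<tau>\<close> is linear and a section on products only, and all splittings below are
  controlled only on sufficiently long products; powers consist of such products, so the restriction
  disappears on \<open>K\<^sup>\<infinity>\<close>.

  A power is a coimage whose map to \<open>K\<close> need not be monic. Identities between maps of
  powers are therefore checked on tensor powers, after composition with the projections: these are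
  cokernels, hence remain epimorphisms after tensoring, and two maps into a tensor power agree in
  the power as soon as the iterated multiplication identifies them.

  Every property holds only after passage to a deeper level, so transition maps stand where formulas
  in elements have identities. Finally, H-unitality is tested on relatively injective pro-objects
  that need not be constant, while cofibrations are defined by constant ones; the cokernels of the
  boundary maps mediate between the two.\<close>

lemma Hom_I: "\<lbrakk>f \<in> Arr C; Dom C f = a; Cod C f = b\<rbrakk> \<Longrightarrow> f \<in> Hom C a b"
  by (simp add: Hom_def)

lemma Hom_Arr: "f \<in> Hom C a b \<Longrightarrow> f \<in> Arr C"
  and Hom_Dom: "f \<in> Hom C a b \<Longrightarrow> Dom C f = a"
  and Hom_Cod: "f \<in> Hom C a b \<Longrightarrow> Cod C f = b"
  by (simp_all add: Hom_def)

lemmas HomD = Hom_Arr Hom_Dom Hom_Cod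

text \<open>The structure that the base category and its category of pro-objects have in common.
  Hochschild cochains and the bar complex are treated here once and used in both: in
  \<open>Pro C\<close>, where quasi-freeness and H-unitality are stated, and in \<open>C\<close>,
  where the calculations with levels take place.\<close>

locale additive_monoidal = category C
  for C :: "('o, 'm, 'x) tensor_category_scheme" (structure) +
  assumes hom_comm_group: "\<lbrakk>a \<in> Obj C; b \<in> Obj C\<rbrakk> \<Longrightarrow> comm_group (hom_group C a b)"
    and comp_add_left: "\<lbrakk>f \<in> Hom C a b; g \<in> Hom C b c; g' \<in> Hom C b c\<rbrakk>
      \<Longrightarrow> (g \<boxplus> g') \<cdot> f = g \<cdot> f \<boxplus> g' \<cdot> f"
    and comp_add_right: "\<lbrakk>f \<in> Hom C a b; f' \<in> Hom C a b; g \<in> Hom C b c\<rbrakk>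
      \<Longrightarrow> g \<cdot> (f \<boxplus> f') = g \<cdot> f \<boxplus> g \<cdot> f'"
    and tobj_obj: "\<lbrakk>a \<in> Obj C; b \<in> Obj C\<rbrakk> \<Longrightarrow> a \<boxtimes> b \<in> Obj C"
    and unit_obj: "Unit C \<in> Obj C"
    and tarr_hom: "\<lbrakk>f \<in> Hom C a b; g \<in> Hom C c d\<rbrakk> \<Longrightarrow> f \<star> g \<in> Hom C (a \<boxtimes> c) (b \<boxtimes> d)"
    and tarr_ide: "\<lbrakk>a \<in> Obj C; b \<in> Obj C\<rbrakk> \<Longrightarrow> Ide C a \<star> Ide C b = Ide C (a \<boxtimes> b)"
    and tarr_comp: "\<lbrakk>f \<in> Hom C a b; f' \<in> Hom C b c; g \<in> Hom C x y; g' \<in> Hom C y z\<rbrakk>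
      \<Longrightarrow> (f' \<cdot> f) \<star> (g' \<cdot> g) = (f' \<star> g') \<cdot> (f \<star> g)"
    and tobj_assoc: "\<lbrakk>a \<in> Obj C; b \<in> Obj C; c \<in> Obj C\<rbrakk> \<Longrightarrow> (a \<boxtimes> b) \<boxtimes> c = a \<boxtimes> (b \<boxtimes> c)"
    and tarr_assoc: "\<lbrakk>f \<in> Arr C; g \<in> Arr C; h \<in> Arr C\<rbrakk> \<Longrightarrow> (f \<star> g) \<star> h = f \<star> (g \<star> h)"
    and tobj_unit: "a \<in> Obj C \<Longrightarrow> Unit C \<boxtimes> a = a" "a \<in> Obj C \<Longrightarrow> a \<boxtimes> Unit C = a"
    and tarr_unit: "f \<in> Arr C \<Longrightarrow> Ide C (Unit C) \<star> f = f" "f \<in> Arr C \<Longrightarrow> f \<star> Ide C (Unit C) = f"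
    and tensor_add: "\<lbrakk>V \<in> Obj C; f \<in> Hom C a b; g \<in> Hom C a b\<rbrakk>
        \<Longrightarrow> Ide C V \<star> (f \<boxplus> g) = Ide C V \<star> f \<boxplus> Ide C V \<star> g"
      "\<lbrakk>V \<in> Obj C; f \<in> Hom C a b; g \<in> Hom C a b\<rbrakk>
        \<Longrightarrow> (f \<boxplus> g) \<star> Ide C V = f \<star> Ide C V \<boxplus> g \<star> Ide C V"

sublocale base_category \<subseteq> additive_monoidal C
  by (intro additive_monoidal.intro additive_monoidal_axioms.intro category_axioms)
    (fact hom_comm_group comp_add_left comp_add_right tobj_obj unit_obj tarr_hom tarr_ide tarr_comp
      tobj_assoc tarr_assoc tobj_unit tarr_unit tensor_add)+

context category
begin

lemma Arr_Hom: "f \<in> Arr C \<Longrightarrow> f \<in> Hom C (Dom C f) (Cod C f)"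
  by (simp add: Hom_def)

lemma HomE:
  assumes "f \<in> Hom C a b"
  shows "f \<in> Arr C" "Dom C f = a" "Cod C f = b" "a \<in> Obj C" "b \<in> Obj C"
  using assms dom_obj cod_obj by (auto simp: Hom_def)

lemma ide_arr [simp]:
  assumes "a \<in> Obj C"
  shows "Ide C a \<in> Arr C" "Dom C (Ide C a) = a" "Cod C (Ide C a) = a"
  using ide_hom[OF assms] by (simp_all add: Hom_def)

lemma dom_cod_obj [simp]: "f \<in> Arr C \<Longrightarrow> Dom C f \<in> Obj C" "f \<in> Arr C \<Longrightarrow> Cod C f \<in> Obj C"
  by (simp_all add: dom_obj cod_obj)

lemma comp_arr [simp]:
  assumes "f \<in> Arr C" "g \<in> Arr C" "Cod C f = Dom C g"
  shows "g \<cdot> f \<in> Arr C" "Dom C (g \<cdot> f) = Dom C f" "Cod C (g \<cdot> f) = Cod C g"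
  using comp_hom[of f "Dom C f" "Cod C f" g "Cod C g"] assms by (simp_all add: Hom_def)

lemma comp_ide_simps [simp]:
  "\<lbrakk>f \<in> Arr C; Dom C f = a\<rbrakk> \<Longrightarrow> f \<cdot> Ide C a = f"
  "\<lbrakk>f \<in> Arr C; Cod C f = b\<rbrakk> \<Longrightarrow> Ide C b \<cdot> f = f"
  by (auto intro: comp_ide[OF Arr_Hom] ide_comp[OF Arr_Hom])

lemma comp_comp [simp]:
  assumes "f \<in> Arr C" "g \<in> Arr C" "h \<in> Arr C" "Cod C f = Dom C g" "Cod C g = Dom C h"
  shows "(h \<cdot> g) \<cdot> f = h \<cdot> (g \<cdot> f)"
  using comp_assoc[of f "Dom C f" "Cod C f" g "Cod C g" h "Cod C h"] assms by (simp add: Hom_def)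

text \<open>Composites are normalised to nest to the right, which hides an equation for
  \<open>f \<cdot> g\<close> inside \<open>f \<cdot> (g \<cdot> h)\<close>. This rule and the next
  one apply such an equation to the two leftmost arrows of a longer composite.\<close>

lemma comp_eq_comp:
  assumes "f \<cdot> g = k" "f \<in> Arr C" "g \<in> Arr C" "h \<in> Arr C" "Cod C g = Dom C f" "Cod C h = Dom C g"
  shows "f \<cdot> (g \<cdot> h) = k \<cdot> h"
  using assms comp_comp[of h g f] by simp

lemma comp_eq_extend:
  assumes "f \<cdot> g = f' \<cdot> g'" "h \<in> Arr C" "f \<in> Arr C" "g \<in> Arr C" "f' \<in> Arr C" "g' \<in> Arr C"
    "Cod C g = Dom C f" "Cod C g' = Dom C f'" "Cod C h = Dom C g" "Cod C h = Dom C g'"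
  shows "f \<cdot> (g \<cdot> h) = f' \<cdot> (g' \<cdot> h)"
  using assms comp_comp[of h g f] comp_comp[of h g' f'] by simp

end

context additive_monoidal
begin

lemma obj_simps [simp]:
  "Unit C \<in> Obj C" "\<lbrakk>a \<in> Obj C; b \<in> Obj C\<rbrakk> \<Longrightarrow> a \<boxtimes> b \<in> Obj C"
  "\<lbrakk>a \<in> Obj C; b \<in> Obj C; c \<in> Obj C\<rbrakk> \<Longrightarrow> (a \<boxtimes> b) \<boxtimes> c = a \<boxtimes> (b \<boxtimes> c)"
  "a \<in> Obj C \<Longrightarrow> Unit C \<boxtimes> a = a" "a \<in> Obj C \<Longrightarrow> a \<boxtimes> Unit C = a"
  by (simp_all add: tobj_obj unit_obj tobj_assoc tobj_unit)

lemma tarr_arr [simp]: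
  assumes "f \<in> Arr C" "g \<in> Arr C"
  shows "f \<star> g \<in> Arr C" "Dom C (f \<star> g) = Dom C f \<boxtimes> Dom C g" "Cod C (f \<star> g) = Cod C f \<boxtimes> Cod C g"
  using tarr_hom[OF Arr_Hom[OF assms(1)] Arr_Hom[OF assms(2)]] by (simp_all add: Hom_def)

lemma tarr_simps [simp]:
  "\<lbrakk>f \<in> Arr C; g \<in> Arr C; h \<in> Arr C\<rbrakk> \<Longrightarrow> (f \<star> g) \<star> h = f \<star> (g \<star> h)"
  "f \<in> Arr C \<Longrightarrow> Ide C (Unit C) \<star> f = f" "f \<in> Arr C \<Longrightarrow> f \<star> Ide C (Unit C) = f"
  by (simp_all add: tarr_assoc tarr_unit)

lemma ide_tobj [simp]: "\<lbrakk>a \<in> Obj C; b \<in> Obj C\<rbrakk> \<Longrightarrow> Ide C (a \<boxtimes> b) = Ide C a \<star> Ide C b"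
  by (simp add: tarr_ide)

text \<open>Identities of tensor products are always split into tensor products of identities, so
  the unit laws are needed for the split form as well.\<close>

lemma ide_tarr_simps [simp]:
  assumes "f \<in> Arr C" "a \<in> Obj C" "b \<in> Obj C"
  shows "Cod C f = a \<boxtimes> b \<Longrightarrow> (Ide C a \<star> Ide C b) \<cdot> f = f"
    and "Dom C f = a \<boxtimes> b \<Longrightarrow> f \<cdot> (Ide C a \<star> Ide C b) = f"
    and "\<lbrakk>c \<in> Obj C; Cod C f = a \<boxtimes> b \<boxtimes> c\<rbrakk> \<Longrightarrow> (Ide C a \<star> Ide C b \<star> Ide C c) \<cdot> f = f"
    and "\<lbrakk>c \<in> Obj C; Dom C f = a \<boxtimes> b \<boxtimes> c\<rbrakk> \<Longrightarrow> f \<cdot> (Ide C a \<star> Ide C b \<star> Ide C c) = f"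
  using assms by (simp_all flip: ide_tobj)

lemma interchange [simp]:
  assumes "f \<in> Arr C" "g \<in> Arr C" "f' \<in> Arr C" "g' \<in> Arr C" "Cod C f = Dom C f'" "Cod C g = Dom C g'"
  shows "(f' \<star> g') \<cdot> (f \<star> g) = (f' \<cdot> f) \<star> (g' \<cdot> g)"
  using tarr_comp[of f "Dom C f" "Cod C f" f' "Cod C f'" g "Dom C g" "Cod C g" g' "Cod C g'"] assms
  by (simp add: Hom_def)

text \<open>Since tensor products are kept nested to the right, the interchange law is also needed for the
  other ways in which the factors of two composable tensor products can be grouped.\<close>

lemma interchange_regroup [simp]:
  assumes "f \<in> Arr C" "g \<in> Arr C" "x \<in> Arr C" "y \<in> Arr C" "z \<in> Arr C"
  shows "\<lbrakk>Dom C f = Cod C x \<boxtimes> Cod C y; Dom C g = Cod C z\<rbrakk>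
      \<Longrightarrow> (f \<star> g) \<cdot> (x \<star> y \<star> z) = (f \<cdot> (x \<star> y)) \<star> (g \<cdot> z)"
    and "\<lbrakk>w \<in> Arr C; Dom C f = Cod C x \<boxtimes> Cod C y \<boxtimes> Cod C w; Dom C g = Cod C z\<rbrakk>
      \<Longrightarrow> (f \<star> g) \<cdot> (x \<star> y \<star> w \<star> z) = (f \<cdot> (x \<star> y \<star> w)) \<star> (g \<cdot> z)"
    and "\<lbrakk>Cod C f = Dom C x \<boxtimes> Dom C y; Cod C g = Dom C z\<rbrakk>
      \<Longrightarrow> (x \<star> y \<star> z) \<cdot> (f \<star> g) = ((x \<star> y) \<cdot> f) \<star> (z \<cdot> g)"
    and "\<lbrakk>w \<in> Arr C; Cod C f = Dom C x \<boxtimes> Dom C y \<boxtimes> Dom C w; Cod C g = Dom C z\<rbrakk>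
      \<Longrightarrow> (x \<star> y \<star> w \<star> z) \<cdot> (f \<star> g) = ((x \<star> y \<star> w) \<cdot> f) \<star> (z \<cdot> g)"
  using interchange[of "x \<star> y" z f g] interchange[of "x \<star> y \<star> w" z f g]
    interchange[of f g "x \<star> y" z] interchange[of f g "x \<star> y \<star> w" z] assms
  by (simp_all del: interchange)

lemma interchange_comp [simp]:
  assumes "f \<in> Arr C" "g \<in> Arr C" "h \<in> Arr C" "x \<in> Arr C" "y \<in> Arr C"
  shows "\<lbrakk>Cod C h = Dom C x \<boxtimes> Dom C y; Cod C x = Dom C f; Cod C y = Dom C g\<rbrakk>
      \<Longrightarrow> (f \<star> g) \<cdot> ((x \<star> y) \<cdot> h) = ((f \<cdot> x) \<star> (g \<cdot> y)) \<cdot> h"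
    and "\<lbrakk>z \<in> Arr C; Cod C h = Dom C x \<boxtimes> Dom C y \<boxtimes> Dom C z; Dom C f = Cod C x \<boxtimes> Cod C y; Dom C g = Cod C z\<rbrakk>
      \<Longrightarrow> (f \<star> g) \<cdot> ((x \<star> y \<star> z) \<cdot> h) = ((f \<cdot> (x \<star> y)) \<star> (g \<cdot> z)) \<cdot> h"
    and "\<lbrakk>z \<in> Arr C; Cod C h = Dom C f \<boxtimes> Dom C g; Cod C f = Dom C x \<boxtimes> Dom C y; Cod C g = Dom C z\<rbrakk>
      \<Longrightarrow> (x \<star> y \<star> z) \<cdot> ((f \<star> g) \<cdot> h) = (((x \<star> y) \<cdot> f) \<star> (z \<cdot> g)) \<cdot> h"
  using assms by (simp_all flip: comp_comp)

section \<open>The group structure on arrows\<close>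

lemma hom_group_simps [simp]:
  "carrier (hom_group C a b) = Hom C a b" "mult (hom_group C a b) = (\<boxplus>)" "one (hom_group C a b) = Zero C a b"
  by (simp_all add: hom_group_def)

lemma add_arr [simp]:
  assumes "f \<in> Arr C" "g \<in> Arr C" "Dom C g = Dom C f" "Cod C g = Cod C f"
  shows "f \<boxplus> g \<in> Arr C" "Dom C (f \<boxplus> g) = Dom C f" "Cod C (f \<boxplus> g) = Cod C f"
proof -
  interpret G: comm_group "hom_group C (Dom C f) (Cod C f)"
    using assms by (simp add: hom_comm_group)
  have "f \<boxplus> g \<in> Hom C (Dom C f) (Cod C f)"
    using G.m_closed[of f g] assms by (simp add: Hom_def)
  then show "f \<boxplus> g \<in> Arr C" "Dom C (f \<boxplus> g) = Dom C f" "Cod C (f \<boxplus> g) = Cod C f"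
    by (simp_all add: Hom_def)
qed

lemma zero_arr [simp]:
  assumes "a \<in> Obj C" "b \<in> Obj C"
  shows "Zero C a b \<in> Arr C" "Dom C (Zero C a b) = a" "Cod C (Zero C a b) = b"
proof -
  interpret G: comm_group "hom_group C a b" using assms by (simp add: hom_comm_group)
  show "Zero C a b \<in> Arr C" "Dom C (Zero C a b) = a" "Cod C (Zero C a b) = b"
    using G.one_closed by (simp_all add: Hom_def)
qed

lemma add_zero [simp]:
  assumes "f \<in> Arr C" "Dom C f = a" "Cod C f = b"
  shows "f \<boxplus> Zero C a b = f" "Zero C a b \<boxplus> f = f"
proof -
  interpret G: comm_group "hom_group C a b"
    using assms dom_obj cod_obj by (intro hom_comm_group) auto
  show "f \<boxplus> Zero C a b = f" "Zero C a b \<boxplus> f = f"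
    using G.l_one[of f] G.r_one[of f] assms by (simp_all add: Hom_def)
qed

lemma add_add:
  assumes "f \<in> Arr C" "g \<in> Arr C" "h \<in> Arr C" "Dom C g = Dom C f" "Cod C g = Cod C f"
    "Dom C h = Dom C f" "Cod C h = Cod C f"
  shows "(f \<boxplus> g) \<boxplus> h = f \<boxplus> (g \<boxplus> h)"
proof -
  interpret G: comm_group "hom_group C (Dom C f) (Cod C f)"
    using assms by (simp add: hom_comm_group)
  show ?thesis using G.m_assoc[of f g h] assms by (simp add: Hom_def)
qed

lemma add_commute:
  assumes "f \<in> Arr C" "g \<in> Arr C" "Dom C g = Dom C f" "Cod C g = Cod C f"
  shows "f \<boxplus> g = g \<boxplus> f"
proof -
  interpret G: comm_group "hom_group C (Dom C f) (Cod C f)"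
    using assms by (simp add: hom_comm_group)
  show ?thesis using G.m_comm[of f g] assms by (simp add: Hom_def)
qed

lemma add_left_commute:
  assumes "f \<in> Arr C" "g \<in> Arr C" "h \<in> Arr C" "Dom C g = Dom C f" "Cod C g = Cod C f"
    "Dom C h = Dom C f" "Cod C h = Cod C f"
  shows "f \<boxplus> (g \<boxplus> h) = g \<boxplus> (f \<boxplus> h)"
  using assms add_add[of f g h] add_add[of g f h] add_commute[of f g] by simp

lemmas add_ac = add_add add_commute add_left_commute

lemma add_cancel:
  assumes "f \<in> Arr C" "g \<in> Arr C" "h \<in> Arr C" "Dom C g = Dom C f" "Cod C g = Cod C f"
    "Dom C h = Dom C f" "Cod C h = Cod C f"
  shows "f \<boxplus> g = f \<boxplus> h \<longleftrightarrow> g = h"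
proof -
  interpret G: comm_group "hom_group C (Dom C f) (Cod C f)"
    using assms by (simp add: hom_comm_group)
  show ?thesis using G.Units_l_cancel[of f g h] G.Units_eq assms by (simp add: Hom_def)
qed

lemma neg_arr [simp]:
  assumes "f \<in> Arr C"
  shows "Neg C f \<in> Arr C" "Dom C (Neg C f) = Dom C f" "Cod C (Neg C f) = Cod C f"
    and add_neg [simp]: "f \<boxplus> Neg C f = Zero C (Dom C f) (Cod C f)"
    and neg_add [simp]: "Neg C f \<boxplus> f = Zero C (Dom C f) (Cod C f)"
proof -
  interpret G: comm_group "hom_group C (Dom C f) (Cod C f)"
    using assms by (simp add: hom_comm_group)
  have f: "f \<in> Hom C (Dom C f) (Cod C f)" using assms by (simp add: Hom_def)
  show "Neg C f \<in> Arr C" "Dom C (Neg C f) = Dom C f" "Cod C (Neg C f) = Cod C f"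
    "f \<boxplus> Neg C f = Zero C (Dom C f) (Cod C f)" "Neg C f \<boxplus> f = Zero C (Dom C f) (Cod C f)"
    using G.inv_closed[of f] G.r_inv[of f] G.l_inv[of f] f by (simp_all add: Neg_def Hom_def)
qed

lemma add_neg_cancel [simp]:
  assumes "f \<in> Arr C" "g \<in> Arr C" "Dom C g = Dom C f" "Cod C g = Cod C f"
  shows "f \<boxplus> (Neg C f \<boxplus> g) = g" "Neg C f \<boxplus> (f \<boxplus> g) = g"
  using assms by (simp_all add: add_add[symmetric])

lemma comp_add [simp]:
  "\<lbrakk>f \<in> Arr C; g \<in> Arr C; g' \<in> Arr C; Cod C f = Dom C g; Dom C g' = Dom C g; Cod C g' = Cod C g\<rbrakk>
    \<Longrightarrow> (g \<boxplus> g') \<cdot> f = g \<cdot> f \<boxplus> g' \<cdot> f"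
  "\<lbrakk>f \<in> Arr C; f' \<in> Arr C; g \<in> Arr C; Cod C f = Dom C g; Dom C f' = Dom C f; Cod C f' = Cod C f\<rbrakk>
    \<Longrightarrow> g \<cdot> (f \<boxplus> f') = g \<cdot> f \<boxplus> g \<cdot> f'"
  using comp_add_left[of f "Dom C f" "Cod C f" g "Cod C g" g']
    comp_add_right[of f "Dom C f" "Cod C f" f' g "Cod C g"]
  by (simp_all add: Hom_def)

text \<open>The locale gives additivity when the other factor is an identity. By the interchange
  law, tensoring with \<open>h\<close> is tensoring with an identity and then composing, and
  composition is biadditive.\<close>

lemma tarr_add [simp]:
  assumes "f \<in> Arr C" "g \<in> Arr C" "h \<in> Arr C" "Dom C g = Dom C f" "Cod C g = Cod C f"
  shows "(f \<boxplus> g) \<star> h = f \<star> h \<boxplus> g \<star> h" "h \<star> (f \<boxplus> g) = h \<star> f \<boxplus> h \<star> g"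
proof -
  have "(f \<boxplus> g) \<star> h = ((f \<boxplus> g) \<star> Ide C (Cod C h)) \<cdot> (Ide C (Dom C f) \<star> h)"
    using assms by simp
  also have "\<dots> = (f \<star> Ide C (Cod C h) \<boxplus> g \<star> Ide C (Cod C h)) \<cdot> (Ide C (Dom C f) \<star> h)"
    using assms by (subst tensor_add(2)) (auto simp: Hom_def)
  also have "\<dots> = f \<star> h \<boxplus> g \<star> h" using assms by simp
  finally show "(f \<boxplus> g) \<star> h = f \<star> h \<boxplus> g \<star> h" .
  have "h \<star> (f \<boxplus> g) = (Ide C (Cod C h) \<star> (f \<boxplus> g)) \<cdot> (h \<star> Ide C (Dom C f))"
    using assms by simp
  also have "\<dots> = (Ide C (Cod C h) \<star> f \<boxplus> Ide C (Cod C h) \<star> g) \<cdot> (h \<star> Ide C (Dom C f))"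
    using assms by (subst tensor_add(1)) (auto simp: Hom_def)
  also have "\<dots> = h \<star> f \<boxplus> h \<star> g" using assms by simp
  finally show "h \<star> (f \<boxplus> g) = h \<star> f \<boxplus> h \<star> g" .
qed

text \<open>A group has a single idempotent. By additivity, the composite or tensor product of an
  arrow with a zero arrow is idempotent, which is how these are shown to vanish.\<close>

lemma zero_unique: "\<lbrakk>f \<in> Arr C; f \<boxplus> f = f\<rbrakk> \<Longrightarrow> f = Zero C (Dom C f) (Cod C f)"
  using add_cancel[of f f "Zero C (Dom C f) (Cod C f)"] by simp

lemma neg_unique:
  "\<lbrakk>f \<in> Arr C; g \<in> Arr C; Dom C g = Dom C f; Cod C g = Cod C f; f \<boxplus> g = Zero C (Dom C f) (Cod C f)\<rbrakk>
    \<Longrightarrow> Neg C f = g"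
  using add_cancel[of f "Neg C f" g] by simp

lemma comp_zero [simp]:
  assumes "f \<in> Arr C" "a \<in> Obj C"
  shows "Dom C f = b \<Longrightarrow> f \<cdot> Zero C a b = Zero C a (Cod C f)"
    and "Cod C f = b \<Longrightarrow> Zero C b a \<cdot> f = Zero C (Dom C f) a"
proof -
  assume b: "Dom C f = b"
  have o: "b \<in> Obj C" using assms b by auto
  have "f \<cdot> Zero C a b \<boxplus> f \<cdot> Zero C a b = f \<cdot> (Zero C a b \<boxplus> Zero C a b)"
    using assms b o by (simp del: add_zero)
  then show "f \<cdot> Zero C a b = Zero C a (Cod C f)"
    using assms b o zero_unique[of "f \<cdot> Zero C a b"] by simp
next
  assume b: "Cod C f = b"
  have o: "b \<in> Obj C" using assms b by auto
  have "Zero C b a \<cdot> f \<boxplus> Zero C b a \<cdot> f = (Zero C b a \<boxplus> Zero C b a) \<cdot> f"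
    using assms b o by (simp del: add_zero)
  then show "Zero C b a \<cdot> f = Zero C (Dom C f) a"
    using assms b o zero_unique[of "Zero C b a \<cdot> f"] by simp
qed

lemma tarr_zero [simp]:
  assumes "f \<in> Arr C" "a \<in> Obj C" "b \<in> Obj C"
  shows "f \<star> Zero C a b = Zero C (Dom C f \<boxtimes> a) (Cod C f \<boxtimes> b)"
    "Zero C a b \<star> f = Zero C (a \<boxtimes> Dom C f) (b \<boxtimes> Cod C f)"
proof -
  have "f \<star> Zero C a b \<boxplus> f \<star> Zero C a b = f \<star> (Zero C a b \<boxplus> Zero C a b)"
    "Zero C a b \<star> f \<boxplus> Zero C a b \<star> f = (Zero C a b \<boxplus> Zero C a b) \<star> f"
    using assms by (simp_all del: add_zero)
  then show "f \<star> Zero C a b = Zero C (Dom C f \<boxtimes> a) (Cod C f \<boxtimes> b)"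
    "Zero C a b \<star> f = Zero C (a \<boxtimes> Dom C f) (b \<boxtimes> Cod C f)"
    using assms zero_unique[of "f \<star> Zero C a b"] zero_unique[of "Zero C a b \<star> f"] by simp_all
qed

lemma neg_comp [simp]:
  assumes "f \<in> Arr C" "g \<in> Arr C" "Cod C f = Dom C g"
  shows "Neg C g \<cdot> f = Neg C (g \<cdot> f)" "g \<cdot> Neg C f = Neg C (g \<cdot> f)"
proof -
  have "g \<cdot> f \<boxplus> Neg C g \<cdot> f = (g \<boxplus> Neg C g) \<cdot> f" using assms by (simp del: add_neg)
  then show "Neg C g \<cdot> f = Neg C (g \<cdot> f)" using assms neg_unique[of "g \<cdot> f" "Neg C g \<cdot> f"] by simp
  have "g \<cdot> f \<boxplus> g \<cdot> Neg C f = g \<cdot> (f \<boxplus> Neg C f)" using assms by (simp del: add_neg)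
  then show "g \<cdot> Neg C f = Neg C (g \<cdot> f)" using assms neg_unique[of "g \<cdot> f" "g \<cdot> Neg C f"] by simp
qed

lemma neg_tarr [simp]:
  assumes "f \<in> Arr C" "g \<in> Arr C"
  shows "Neg C g \<star> f = Neg C (g \<star> f)" "g \<star> Neg C f = Neg C (g \<star> f)"
proof -
  have "g \<star> f \<boxplus> Neg C g \<star> f = (g \<boxplus> Neg C g) \<star> f" using assms by (simp del: add_neg)
  then show "Neg C g \<star> f = Neg C (g \<star> f)" using assms neg_unique[of "g \<star> f" "Neg C g \<star> f"] by simp
  have "g \<star> f \<boxplus> g \<star> Neg C f = g \<star> (f \<boxplus> Neg C f)" using assms by (simp del: add_neg)
  then show "g \<star> Neg C f = Neg C (g \<star> f)" using assms neg_unique[of "g \<star> f" "g \<star> Neg C f"] by simp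
qed

lemma neg_neg [simp]: "f \<in> Arr C \<Longrightarrow> Neg C (Neg C f) = f"
  using neg_unique[of "Neg C f" f] by simp

lemma neg_add_distrib [simp]:
  assumes "f \<in> Arr C" "g \<in> Arr C" "Dom C g = Dom C f" "Cod C g = Cod C f"
  shows "Neg C (f \<boxplus> g) = Neg C f \<boxplus> Neg C g"
proof (rule neg_unique)
  have "f \<boxplus> g \<boxplus> (Neg C f \<boxplus> Neg C g) = (f \<boxplus> Neg C f) \<boxplus> (g \<boxplus> Neg C g)"
    using assms by (simp add: add_ac del: add_neg add_neg_cancel)
  then show "f \<boxplus> g \<boxplus> (Neg C f \<boxplus> Neg C g) = Zero C (Dom C (f \<boxplus> g)) (Cod C (f \<boxplus> g))"
    using assms by simp
qed (use assms in simp_all)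

lemma eq_iff_add_neg:
  "\<lbrakk>f \<in> Arr C; g \<in> Arr C; Dom C g = Dom C f; Cod C g = Cod C f\<rbrakk>
    \<Longrightarrow> f = g \<longleftrightarrow> f \<boxplus> Neg C g = Zero C (Dom C f) (Cod C f)"
  using add_cancel[of "Neg C g" f g] add_commute[of f "Neg C g"] by auto

section \<open>Tensor powers\<close>

lemma tpow_obj [simp]: "a \<in> Obj C \<Longrightarrow> tpow C a n \<in> Obj C"
  by (induction n) simp_all

lemma tpow_add: "a \<in> Obj C \<Longrightarrow> tpow C a (m + n) = tpow C a m \<boxtimes> tpow C a n"
  by (induction m) simp_all

lemma tpow_Suc_right: "a \<in> Obj C \<Longrightarrow> tpow C a n \<boxtimes> a = a \<boxtimes> tpow C a n"
  using tpow_add[of a n 1] by simp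

lemma tpow_arr_arr [simp]:
  assumes "f \<in> Arr C"
  shows "tpow_arr C f n \<in> Arr C" "Dom C (tpow_arr C f n) = tpow C (Dom C f) n"
    "Cod C (tpow_arr C f n) = tpow C (Cod C f) n"
  using assms by (induction n) simp_all

lemma tpow_arr_add: "f \<in> Arr C \<Longrightarrow> tpow_arr C f (m + n) = tpow_arr C f m \<star> tpow_arr C f n"
  by (induction m) simp_all

section \<open>Linear sections of the multiplication\<close>

text \<open>Keeps the calculation in \<open>connection_section\<close> free of subtraction: the
  identities there are sums of positive terms, and the difference that defines the section is formed
  only at the end.\<close>

lemma add_eq_imp_diff_eq:
  assumes "u \<in> Arr C" "v \<in> Arr C" "u' \<in> Arr C" "v' \<in> Arr C" "t \<in> Arr C"
    "Dom C v = Dom C u" "Dom C u' = Dom C u" "Dom C v' = Dom C u" "Dom C t = Dom C u"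
    "Cod C v = Cod C u" "Cod C u' = Cod C u" "Cod C v' = Cod C u" "Cod C t = Cod C u"
    and eq: "u' \<boxplus> v = (u \<boxplus> t) \<boxplus> v'"
  shows "u' \<boxplus> Neg C v' = (u \<boxplus> Neg C v) \<boxplus> t"
proof -
  have "u' = (u' \<boxplus> v) \<boxplus> Neg C v" using assms(1-13) by (simp add: add_add)
  also have "\<dots> = ((u \<boxplus> t) \<boxplus> v') \<boxplus> Neg C v" by (simp only: eq)
  finally have "u' \<boxplus> Neg C v' = (((u \<boxplus> t) \<boxplus> v') \<boxplus> Neg C v) \<boxplus> Neg C v'" by simp
  also have "\<dots> = ((u \<boxplus> Neg C v) \<boxplus> t) \<boxplus> (v' \<boxplus> Neg C v')"
    using assms(1-13) by (simp add: add_ac del: add_neg add_neg_cancel)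
  finally show ?thesis using assms(1-13) by simp
qed

text \<open>Associativity of an action with arbitrary arrows inserted in its arguments. With the
  multiplication itself as \<open>act\<close>, it serves as associativity of an algebra.\<close>

lemma act_assoc:
  assumes "act \<cdot> (\<mu> \<star> Ide C m) = act \<cdot> (Ide C d \<star> act)" "act \<in> Hom C (d \<boxtimes> m) m" "\<mu> \<in> Hom C (d \<boxtimes> d) d"
    "y \<in> Arr C" "Cod C y = m"
  shows "act \<cdot> (\<mu> \<star> y) = act \<cdot> (Ide C d \<star> (act \<cdot> (Ide C d \<star> y)))"
    and "\<lbrakk>x \<in> Arr C; Cod C x = d \<boxtimes> d\<rbrakk>
      \<Longrightarrow> act \<cdot> ((\<mu> \<cdot> x) \<star> y) = act \<cdot> ((Ide C d \<star> act) \<cdot> (x \<star> y))"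
proof -
  note [simp] = HomE[OF assms(2)] HomE[OF assms(3)] assms(4,5)
  have "act \<cdot> (\<mu> \<star> y) = (act \<cdot> (\<mu> \<star> Ide C m)) \<cdot> (Ide C d \<star> Ide C d \<star> y)" by simp
  also have "\<dots> = act \<cdot> (Ide C d \<star> (act \<cdot> (Ide C d \<star> y)))" unfolding assms(1) by simp
  finally show "act \<cdot> (\<mu> \<star> y) = act \<cdot> (Ide C d \<star> (act \<cdot> (Ide C d \<star> y)))" .
  assume [simp]: "x \<in> Arr C" "Cod C x = d \<boxtimes> d"
  have "act \<cdot> ((\<mu> \<cdot> x) \<star> y) = (act \<cdot> (\<mu> \<star> Ide C m)) \<cdot> (x \<star> y)" by simp
  also have "\<dots> = act \<cdot> ((Ide C d \<star> act) \<cdot> (x \<star> y))" unfolding assms(1) by simp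
  finally show "act \<cdot> ((\<mu> \<cdot> x) \<star> y) = act \<cdot> ((Ide C d \<star> act) \<cdot> (x \<star> y))" .
qed

text \<open>In element notation, \<open>\<phi>1\<close> and \<open>\<phi>2\<close> are the components \<open>a_0 da_1 da_2\<close> and \<open>da_1 da_2\<close> of a
  cochain whose coboundary is \<open>d \<union> d\<close>. The left linear map \<open>T (a_0 da_1 da_2) = a_0 \<otimes> a_1 \<rho> a_2 - a_0 a_1 \<otimes> \<rho> a_2\<close>
  kills \<open>\<phi> a x\<close> for \<open>x\<close> in the ideal, so that \<open>x \<mapsto> 1 \<otimes> x + T (\<phi> x)\<close> is a left linear section of the
  action of the unitalization on the ideal; \<open>S\<close> is its component without the unit.\<close>

lemma connection_section:
  assumes \<mu>A: "\<mu>A \<in> Hom C (a \<boxtimes> a) a"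
    and \<mu>B: "\<mu>B \<in> Hom C (b \<boxtimes> b) b"
    and \<mu>D: "\<mu>D \<in> Hom C (d \<boxtimes> d) d" and assocD: "\<mu>D \<cdot> (\<mu>D \<star> Ide C d) = \<mu>D \<cdot> (Ide C d \<star> \<mu>D)"
    and act: "act \<in> Hom C (d \<boxtimes> m) m" and act_act: "act \<cdot> (\<mu>D \<star> Ide C m) = act \<cdot> (Ide C d \<star> act)"
    and \<beta>: "\<beta> \<in> Hom C a b" and \<gamma>: "\<gamma> \<in> Hom C b d" and \<gamma>\<mu>: "\<gamma> \<cdot> \<mu>B = \<mu>D \<cdot> (\<gamma> \<star> \<gamma>)"
    and \<rho>: "\<rho> \<in> Hom C b m" and j: "j \<in> Hom C k a" and c: "c \<in> Hom C k m"
    and \<rho>j: "\<rho> \<cdot> (\<beta> \<cdot> j) = c"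
    and \<rho>\<mu>: "\<rho> \<cdot> (\<mu>B \<cdot> (Ide C b \<star> (\<beta> \<cdot> j))) = act \<cdot> (\<gamma> \<star> c)"
    and \<phi>1: "\<phi>1 \<in> Hom C a (b \<boxtimes> b \<boxtimes> b)" and \<phi>2: "\<phi>2 \<in> Hom C a (b \<boxtimes> b)"
    and eq1: "(\<mu>B \<star> Ide C b \<star> Ide C b) \<cdot> (\<beta> \<star> \<phi>1) \<boxplus> \<beta> \<star> \<phi>2 \<boxplus> (Ide C b \<star> Ide C b \<star> \<mu>B) \<cdot> (\<phi>1 \<star> \<beta>)
        \<boxplus> (\<mu>B \<star> Ide C b \<star> Ide C b) \<cdot> (\<phi>1 \<star> \<beta>) \<boxplus> \<phi>2 \<star> \<beta>
      = \<phi>1 \<cdot> \<mu>A \<boxplus> (Ide C b \<star> \<mu>B \<star> Ide C b) \<cdot> (\<phi>1 \<star> \<beta>)"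
    and eq2: "(Ide C b \<star> \<mu>B) \<cdot> (\<phi>2 \<star> \<beta>) = \<beta> \<star> \<beta> \<boxplus> \<phi>2 \<cdot> \<mu>A \<boxplus> (\<mu>B \<star> Ide C b) \<cdot> (\<phi>2 \<star> \<beta>)"
  obtains S e where "S \<in> Hom C a (d \<boxtimes> m)" "e \<in> Hom C k m"
    "S \<cdot> (\<mu>A \<cdot> (Ide C a \<star> j)) = (\<mu>D \<star> Ide C m) \<cdot> ((\<gamma> \<cdot> \<beta>) \<star> (S \<cdot> j)) \<boxplus> (\<gamma> \<cdot> \<beta>) \<star> e"
    "act \<cdot> (S \<cdot> j) \<boxplus> e = c"
proof -
  note [simp] = HomE[OF \<mu>A] HomE[OF \<mu>B] HomE[OF \<mu>D] HomE[OF act] HomE[OF \<beta>] HomE[OF \<gamma>] HomE[OF \<rho>]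
    HomE[OF j] HomE[OF c] HomE[OF \<phi>1] HomE[OF \<phi>2]
  \<comment> \<open>In elements, \<open>uU\<close> and \<open>uW\<close> send a_0 \<otimes> a_1
    \<otimes> a_2 to a_0 \<otimes> a_1 \<rho> a_2 and to a_0 a_1 \<otimes> \<rho> a_2, the two terms
    of T. On da_1 da_2, where a_0 = 1, the second term becomes \<open>uZ\<close>, and the first one,
    1 \<otimes> a_1 \<rho> a_2, has the unit component \<open>act \<cdot> uZ\<close>.\<close>
  define uU where "uU = \<gamma> \<star> (act \<cdot> (\<gamma> \<star> \<rho>))"
  define uW where "uW = (\<mu>D \<cdot> (\<gamma> \<star> \<gamma>)) \<star> \<rho>"
  define uZ where "uZ = \<gamma> \<star> \<rho>"
  note u_defs = uU_def uW_def uZ_def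
  have u_arr [simp]: "uU \<in> Arr C" "Dom C uU = b \<boxtimes> b \<boxtimes> b" "Cod C uU = d \<boxtimes> m"
    "uW \<in> Arr C" "Dom C uW = b \<boxtimes> b \<boxtimes> b" "Cod C uW = d \<boxtimes> m"
    "uZ \<in> Arr C" "Dom C uZ = b \<boxtimes> b" "Cod C uZ = d \<boxtimes> m"
    unfolding u_defs by simp_all
  define U where "U = uU \<cdot> \<phi>1"
  define W where "W = uW \<cdot> \<phi>1"
  define Z where "Z = uZ \<cdot> \<phi>2"
  note U_defs = U_def W_def Z_def
  have U_arr [simp]: "U \<in> Arr C" "Dom C U = a" "Cod C U = d \<boxtimes> m" "W \<in> Arr C" "Dom C W = a" "Cod C W = d \<boxtimes> m"
    "Z \<in> Arr C" "Dom C Z = a" "Cod C Z = d \<boxtimes> m"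
    unfolding U_defs by simp_all
  define X1 where "X1 = \<phi>1 \<star> Ide C k"
  define X2 where "X2 = \<phi>2 \<star> Ide C k"
  have X_arr [simp]: "X1 \<in> Arr C" "Dom C X1 = a \<boxtimes> k" "Cod C X1 = b \<boxtimes> b \<boxtimes> b \<boxtimes> k"
    "X2 \<in> Arr C" "Dom C X2 = a \<boxtimes> k" "Cod C X2 = b \<boxtimes> b \<boxtimes> k"
    unfolding X1_def X2_def by simp_all
  define bj where "bj = \<beta> \<cdot> j"
  have [simp]: "bj \<in> Arr C" "Dom C bj = k" "Cod C bj = b" unfolding bj_def by simp_all
  have X1: "\<phi>1 \<star> bj = (Ide C b \<star> Ide C b \<star> Ide C b \<star> bj) \<cdot> X1" and X2: "\<phi>2 \<star> bj = (Ide C b \<star> Ide C b \<star> bj) \<cdot> X2"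
    unfolding X1_def X2_def by simp_all
  have X_T: "((\<mu>B \<star> Ide C b) \<cdot> \<phi>1) \<star> bj = (\<mu>B \<star> Ide C b \<star> bj) \<cdot> X1"
    "((Ide C b \<star> \<mu>B) \<cdot> \<phi>1) \<star> bj = (Ide C b \<star> \<mu>B \<star> bj) \<cdot> X1"
    "(\<mu>B \<cdot> \<phi>2) \<star> bj = (\<mu>B \<star> bj) \<cdot> X2"
    unfolding X1_def X2_def by simp_all
  let ?aj = "Ide C a \<star> j"
  let ?A1 = "(\<mu>B \<star> Ide C b \<star> Ide C b) \<cdot> (\<beta> \<star> (\<phi>1 \<cdot> j))"
  let ?A2 = "\<beta> \<star> (\<phi>2 \<cdot> j)"
  let ?T3 = "(Ide C b \<star> Ide C b \<star> (\<mu>B \<cdot> (Ide C b \<star> bj))) \<cdot> X1"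
  let ?T4 = "(\<mu>B \<star> Ide C b \<star> bj) \<cdot> X1"
  let ?T5 = "(Ide C b \<star> bj) \<cdot> X2"
  let ?T6 = "(Ide C b \<star> \<mu>B \<star> bj) \<cdot> X1"
  \<comment> \<open>The cochain identity restricted to a \<otimes> x with x in the ideal. The terms
    \<open>?T3\<close>, \<open>?T6\<close> and \<open>?T4\<close> are those of the right action of x
    on \<open>\<phi>1\<close> a; \<open>?T6\<close>, which is subtracted there, stands on the other
    side.\<close>
  have eq1j: "?A1 \<boxplus> ?A2 \<boxplus> ?T3 \<boxplus> ?T4 \<boxplus> (Ide C b \<star> Ide C b \<star> bj) \<cdot> X2 = \<phi>1 \<cdot> (\<mu>A \<cdot> ?aj) \<boxplus> ?T6"
  proof -
    have "?A1 \<boxplus> ?A2 \<boxplus> ?T3 \<boxplus> ?T4 \<boxplus> (Ide C b \<star> Ide C b \<star> bj) \<cdot> X2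
      = ((\<mu>B \<star> Ide C b \<star> Ide C b) \<cdot> (\<beta> \<star> \<phi>1) \<boxplus> \<beta> \<star> \<phi>2 \<boxplus> (Ide C b \<star> Ide C b \<star> \<mu>B) \<cdot> (\<phi>1 \<star> \<beta>)
        \<boxplus> (\<mu>B \<star> Ide C b \<star> Ide C b) \<cdot> (\<phi>1 \<star> \<beta>) \<boxplus> \<phi>2 \<star> \<beta>) \<cdot> ?aj"
      by (simp flip: bj_def add: X1 X2 X_T)
    also have "\<dots> = (\<phi>1 \<cdot> \<mu>A \<boxplus> (Ide C b \<star> \<mu>B \<star> Ide C b) \<cdot> (\<phi>1 \<star> \<beta>)) \<cdot> ?aj" by (simp only: eq1)
    also have "\<dots> = \<phi>1 \<cdot> (\<mu>A \<cdot> ?aj) \<boxplus> ?T6" by (simp flip: bj_def add: X1 X2 X_T)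
    finally show ?thesis .
  qed
  have eq2j: "(Ide C b \<star> (\<mu>B \<cdot> (Ide C b \<star> bj))) \<cdot> X2
      = \<beta> \<star> bj \<boxplus> \<phi>2 \<cdot> (\<mu>A \<cdot> ?aj) \<boxplus> (\<mu>B \<star> bj) \<cdot> X2"
  proof -
    have "(Ide C b \<star> (\<mu>B \<cdot> (Ide C b \<star> bj))) \<cdot> X2 = ((Ide C b \<star> \<mu>B) \<cdot> (\<phi>2 \<star> \<beta>)) \<cdot> ?aj"
      by (simp flip: bj_def add: X2 X_T)
    also have "\<dots> = (\<beta> \<star> \<beta> \<boxplus> \<phi>2 \<cdot> \<mu>A \<boxplus> (\<mu>B \<star> Ide C b) \<cdot> (\<phi>2 \<star> \<beta>)) \<cdot> ?aj" by (simp only: eq2)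
    also have "\<dots> = \<beta> \<star> bj \<boxplus> \<phi>2 \<cdot> (\<mu>A \<cdot> ?aj) \<boxplus> (\<mu>B \<star> bj) \<cdot> X2" by (simp flip: bj_def add: X2 X_T)
    finally show ?thesis .
  qed
  note assocD' = act_assoc[OF assocD \<mu>D \<mu>D] and act_act' = act_assoc[OF act_act act \<mu>D]
  have \<rho>\<mu>': "\<rho> \<cdot> (\<mu>B \<cdot> (Ide C b \<star> bj)) = act \<cdot> (\<gamma> \<star> c)" using \<rho>\<mu> by (simp add: bj_def)
  have \<rho>j': "\<rho> \<cdot> bj = c" using \<rho>j by (simp add: bj_def)
  \<comment> \<open>T is left linear: multiplication on a_0 passes through both of its
    terms.\<close>
  have op1: "uU \<cdot> (\<mu>B \<star> Ide C b \<star> Ide C b) = (\<mu>D \<star> Ide C m) \<cdot> (\<gamma> \<star> uU)"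
    "uW \<cdot> (\<mu>B \<star> Ide C b \<star> Ide C b) = (\<mu>D \<star> Ide C m) \<cdot> (\<gamma> \<star> uW)"
    unfolding u_defs by (simp_all add: \<gamma>\<mu> assocD')
  \<comment> \<open>With \<open>\<phi>1\<close> a = a_0 da_1 da_2, the maps \<open>P1\<close>,
    \<open>P2\<close>, \<open>P3\<close> are a_0 \<otimes> a_1 a_2 x, a_0 a_1 \<otimes> a_2 x and
    a_0 a_1 a_2 \<otimes> x. \<open>Q1\<close> and \<open>Q2\<close> are a_1 \<otimes> a_2 x and a_1
    a_2 \<otimes> x, formed from \<open>\<phi>2\<close> a = da_1 da_2. T sends the three terms of
    the right action of x on \<open>\<phi>1\<close> a to P1 - P2, P1 - P3 and P2 - P3, whose
    alternating sum vanishes.\<close>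
  define P1 where "P1 = (\<gamma> \<star> (act \<cdot> (\<gamma> \<star> (act \<cdot> (\<gamma> \<star> c))))) \<cdot> X1"
  define P2 where "P2 = ((\<mu>D \<cdot> (\<gamma> \<star> \<gamma>)) \<star> (act \<cdot> (\<gamma> \<star> c))) \<cdot> X1"
  define P3 where "P3 = ((\<mu>D \<cdot> (\<gamma> \<star> (\<mu>D \<cdot> (\<gamma> \<star> \<gamma>)))) \<star> c) \<cdot> X1"
  define Q1 where "Q1 = (\<gamma> \<star> (act \<cdot> (\<gamma> \<star> c))) \<cdot> X2"
  define Q2 where "Q2 = ((\<mu>D \<cdot> (\<gamma> \<star> \<gamma>)) \<star> c) \<cdot> X2"
  \<comment> \<open>\<open>lin f\<close> sends a \<otimes> x to a f(x), with a acting on the first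
    factor of f(x).\<close>
  define lin where "lin f = (\<mu>D \<star> Ide C m) \<cdot> ((\<gamma> \<cdot> \<beta>) \<star> (f \<cdot> j))" for f
  define Y where "Y = (\<gamma> \<cdot> \<beta>) \<star> (act \<cdot> (Z \<cdot> j))"
  have [simp]: "P1 \<in> Arr C" "Dom C P1 = a \<boxtimes> k" "Cod C P1 = d \<boxtimes> m" "P2 \<in> Arr C" "Dom C P2 = a \<boxtimes> k" "Cod C P2 = d \<boxtimes> m"
    "P3 \<in> Arr C" "Dom C P3 = a \<boxtimes> k" "Cod C P3 = d \<boxtimes> m" "Q1 \<in> Arr C" "Dom C Q1 = a \<boxtimes> k" "Cod C Q1 = d \<boxtimes> m"
    "Q2 \<in> Arr C" "Dom C Q2 = a \<boxtimes> k" "Cod C Q2 = d \<boxtimes> m" "Y \<in> Arr C" "Dom C Y = a \<boxtimes> k" "Cod C Y = d \<boxtimes> m"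
    unfolding P1_def P2_def P3_def Q1_def Q2_def Y_def by simp_all
  have lin_arr [simp]: "lin f \<in> Arr C" "Dom C (lin f) = a \<boxtimes> k" "Cod C (lin f) = d \<boxtimes> m"
    if "f \<in> Arr C" "Dom C f = a" "Cod C f = d \<boxtimes> m" for f
    unfolding lin_def using that by simp_all
  have lin_add: "lin (f \<boxplus> g) = lin f \<boxplus> lin g"
    if "f \<in> Arr C" "Dom C f = a" "Cod C f = d \<boxtimes> m" "g \<in> Arr C" "Dom C g = a" "Cod C g = d \<boxtimes> m" for f g
    unfolding lin_def using that by simp
  have lin_neg: "lin (Neg C f) = Neg C (lin f)"
    if "f \<in> Arr C" "Dom C f = a" "Cod C f = d \<boxtimes> m" for f
    unfolding lin_def using that by simp
  have A1: "uU \<cdot> ?A1 = lin U" "uW \<cdot> ?A1 = lin W"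
  proof -
    have "uU \<cdot> ?A1 = (\<mu>D \<star> Ide C m) \<cdot> ((\<gamma> \<star> uU) \<cdot> (\<beta> \<star> (\<phi>1 \<cdot> j)))"
      "uW \<cdot> ?A1 = (\<mu>D \<star> Ide C m) \<cdot> ((\<gamma> \<star> uW) \<cdot> (\<beta> \<star> (\<phi>1 \<cdot> j)))"
      by (rule comp_eq_extend[OF op1(1)] comp_eq_extend[OF op1(2)]; simp)+
    then show "uU \<cdot> ?A1 = lin U" "uW \<cdot> ?A1 = lin W"
      unfolding lin_def U_defs by (simp_all del: interchange_comp)
  qed
  have "uW = (\<mu>D \<star> Ide C m) \<cdot> (\<gamma> \<star> uZ)" unfolding u_defs by simp
  then have "uW \<cdot> ?A2 = lin Z" unfolding lin_def Z_def by (simp del: interchange_comp)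
  moreover have "uU \<cdot> ?A2 = Y" unfolding U_defs Y_def u_defs by simp
  ultimately have A2: "uU \<cdot> ?A2 = Y" "uW \<cdot> ?A2 = lin Z" by simp_all
  have T3: "uU \<cdot> ?T3 = P1" "uW \<cdot> ?T3 = P2" unfolding P1_def P2_def u_defs by (simp_all add: \<rho>\<mu>')
  have T4: "uU \<cdot> ?T4 = P2" "uW \<cdot> ?T4 = P3"
    unfolding P2_def P3_def u_defs by (simp_all add: \<rho>j' \<gamma>\<mu> assocD')
  have T5: "uU \<cdot> ((Ide C b \<star> Ide C b \<star> bj) \<cdot> X2) = Q1" "uW \<cdot> ((Ide C b \<star> Ide C b \<star> bj) \<cdot> X2) = Q2"
    unfolding u_defs Q1_def Q2_def by (simp_all add: \<rho>j')
  have T6: "uU \<cdot> ?T6 = P1" "uW \<cdot> ?T6 = P3"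
    unfolding P1_def P3_def u_defs by (simp_all add: \<rho>j' \<gamma>\<mu> assocD' act_act')
  \<comment> \<open>\<open>uU\<close> applied to the cochain identity. The term \<open>P1\<close>
    comes from a_0 da_1 d(a_2 x) on the left and from a_0 d(a_1 a_2) dx on the right, and cancels.
    For \<open>uW\<close> below, the cancelling term is \<open>P3\<close>, and \<open>P2\<close> is
    left over in both cases.\<close>
  have U: "lin U \<boxplus> Y \<boxplus> P2 \<boxplus> Q1 = U \<cdot> (\<mu>A \<cdot> ?aj)"
  proof -
    have "lin U \<boxplus> Y \<boxplus> P1 \<boxplus> P2 \<boxplus> Q1 = uU \<cdot> (?A1 \<boxplus> ?A2 \<boxplus> ?T3 \<boxplus> ?T4 \<boxplus> (Ide C b \<star> Ide C b \<star> bj) \<cdot> X2)"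
      by (simp del: interchange_comp interchange_regroup interchange add: A1 A2 T3 T4 T5)
    also have "\<dots> = uU \<cdot> (\<phi>1 \<cdot> (\<mu>A \<cdot> ?aj) \<boxplus> ?T6)" by (simp only: eq1j)
    also have "\<dots> = U \<cdot> (\<mu>A \<cdot> ?aj) \<boxplus> P1"
      by (simp del: interchange_comp interchange_regroup interchange add: T6 U_def)
    finally have "P1 \<boxplus> (lin U \<boxplus> Y \<boxplus> P2 \<boxplus> Q1) = P1 \<boxplus> U \<cdot> (\<mu>A \<cdot> ?aj)" by (simp add: add_ac)
    then show ?thesis by (simp add: add_cancel)
  qed
  have W: "lin W \<boxplus> lin Z \<boxplus> P2 \<boxplus> Q2 = W \<cdot> (\<mu>A \<cdot> ?aj)"
  proof -
    have "lin W \<boxplus> lin Z \<boxplus> P2 \<boxplus> P3 \<boxplus> Q2 = uW \<cdot> (?A1 \<boxplus> ?A2 \<boxplus> ?T3 \<boxplus> ?T4 \<boxplus> (Ide C b \<star> Ide C b \<star> bj) \<cdot> X2)"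
      by (simp del: interchange_comp interchange_regroup interchange add: A1 A2 T3 T4 T5)
    also have "\<dots> = uW \<cdot> (\<phi>1 \<cdot> (\<mu>A \<cdot> ?aj) \<boxplus> ?T6)" by (simp only: eq1j)
    also have "\<dots> = W \<cdot> (\<mu>A \<cdot> ?aj) \<boxplus> P3"
      by (simp del: interchange_comp interchange_regroup interchange add: T6 W_def)
    finally have "P3 \<boxplus> (lin W \<boxplus> lin Z \<boxplus> P2 \<boxplus> Q2) = P3 \<boxplus> W \<cdot> (\<mu>A \<cdot> ?aj)" by (simp add: add_ac)
    then show ?thesis by (simp add: add_cancel)
  qed
  \<comment> \<open>The unit component of the cochain identity, pushed forward by \<open>uZ\<close>.
    It says that the difference of the leftover terms \<open>Q1\<close> and \<open>Q2\<close> is the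
    wanted a \<otimes> x plus the value of \<open>Z\<close> on a x.\<close>
  have Z: "Q1 = (\<gamma> \<cdot> \<beta>) \<star> c \<boxplus> Z \<cdot> (\<mu>A \<cdot> ?aj) \<boxplus> Q2"
  proof -
    have "Q1 = uZ \<cdot> ((Ide C b \<star> (\<mu>B \<cdot> (Ide C b \<star> bj))) \<cdot> X2)"
      unfolding uZ_def Q1_def by (simp add: \<rho>\<mu>')
    also have "\<dots> = uZ \<cdot> (\<beta> \<star> bj \<boxplus> \<phi>2 \<cdot> (\<mu>A \<cdot> ?aj) \<boxplus> (\<mu>B \<star> bj) \<cdot> X2)" by (simp only: eq2j)
    also have "\<dots> = (\<gamma> \<cdot> \<beta>) \<star> c \<boxplus> Z \<cdot> (\<mu>A \<cdot> ?aj) \<boxplus> Q2"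
      unfolding Q2_def Z_def uZ_def by (simp add: \<rho>j' \<gamma>\<mu>)
    finally show ?thesis .
  qed
  show thesis
  proof (rule that)
    \<comment> \<open>\<open>?e\<close> collects the terms with the unit, namely x itself and the
      first term of T on \<open>\<phi>2\<close> x; everything else goes into
      \<open>?S\<close>.\<close>
    let ?S = "U \<boxplus> Neg C (W \<boxplus> Z)" and ?e = "c \<boxplus> act \<cdot> (Z \<cdot> j)"
    show "?S \<in> Hom C a (d \<boxtimes> m)" "?e \<in> Hom C k m" by (simp_all add: Hom_def)
    have "U \<cdot> (\<mu>A \<cdot> ?aj) \<boxplus> (lin W \<boxplus> lin Z)
        = (lin U \<boxplus> (Y \<boxplus> (\<gamma> \<cdot> \<beta>) \<star> c)) \<boxplus> (W \<cdot> (\<mu>A \<cdot> ?aj) \<boxplus> Z \<cdot> (\<mu>A \<cdot> ?aj))"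
      unfolding U[symmetric] W[symmetric] by (subst Z) (simp add: add_ac)
    then have "U \<cdot> (\<mu>A \<cdot> ?aj) \<boxplus> Neg C (W \<cdot> (\<mu>A \<cdot> ?aj) \<boxplus> Z \<cdot> (\<mu>A \<cdot> ?aj))
        = (lin U \<boxplus> Neg C (lin W \<boxplus> lin Z)) \<boxplus> (Y \<boxplus> (\<gamma> \<cdot> \<beta>) \<star> c)"
      by (intro add_eq_imp_diff_eq) simp_all
    also have "lin U \<boxplus> Neg C (lin W \<boxplus> lin Z) = lin ?S" by (simp add: lin_add lin_neg)
    also have "Y \<boxplus> (\<gamma> \<cdot> \<beta>) \<star> c = (\<gamma> \<cdot> \<beta>) \<star> ?e" unfolding Y_def by (simp add: add_commute)
    finally show "?S \<cdot> (\<mu>A \<cdot> ?aj) = (\<mu>D \<star> Ide C m) \<cdot> ((\<gamma> \<cdot> \<beta>) \<star> (?S \<cdot> j)) \<boxplus> (\<gamma> \<cdot> \<beta>) \<star> ?e"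
      unfolding lin_def by simp
    \<comment> \<open>T takes values in the kernel of the action, since both of its terms act to a_0
      a_1 \<rho> a_2. Adding T (\<phi> x) to 1 \<otimes> x therefore preserves the section
      property.\<close>
    have "act \<cdot> uU = act \<cdot> uW" unfolding u_defs by (simp add: act_act')
    then have "act \<cdot> (uU \<cdot> (\<phi>1 \<cdot> j)) = act \<cdot> (uW \<cdot> (\<phi>1 \<cdot> j))" by (rule comp_eq_extend) simp_all
    then have "act \<cdot> (U \<cdot> j) = act \<cdot> (W \<cdot> j)" unfolding U_defs by simp
    then have "act \<cdot> (?S \<cdot> j) \<boxplus> ?e = c \<boxplus> (act \<cdot> (Z \<cdot> j) \<boxplus> Neg C (act \<cdot> (Z \<cdot> j)))"
      by (simp add: add_ac del: add_neg)
    then show "act \<cdot> (?S \<cdot> j) \<boxplus> ?e = c" by simp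
  qed
qed

text \<open>\<open>\<rho>\<close> is not linear, so applying it to the first factor of S(x) destroys
  linearity in general. For a product y x of elements of the ideal, however, S(y x) = y S(x) + y
  \<otimes> e(x) has its first factor in the ideal, where \<open>\<rho>\<close> restricts to the
  multiplicative map \<open>c'\<close>. Hence the conclusions are linearity and the section property
  of \<open>\<tau>\<close> on products.\<close>

lemma splitting_of_section:
  assumes \<mu>A: "\<mu>A \<in> Hom C (a \<boxtimes> a) a" and \<mu>D: "\<mu>D \<in> Hom C (d \<boxtimes> d) d"
    and \<mu>K: "\<mu>K \<in> Hom C (k \<boxtimes> k) k" and assocK: "\<mu>K \<cdot> (\<mu>K \<star> Ide C k) = \<mu>K \<cdot> (Ide C k \<star> \<mu>K)"
    and \<mu>M: "\<mu>M \<in> Hom C (m \<boxtimes> m) m" and \<mu>O: "\<mu>O \<in> Hom C (o' \<boxtimes> o') o'"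
    and act: "act \<in> Hom C (d \<boxtimes> m) m" and r: "r \<in> Hom C (m \<boxtimes> d) m"
    and r_act: "\<mu>M \<cdot> (r \<star> Ide C m) = \<mu>M \<cdot> (Ide C m \<star> act)"
    and r_mult: "r \<cdot> (\<mu>M \<star> Ide C d) = \<mu>M \<cdot> (Ide C m \<star> r)"
    and i: "i \<in> Hom C m d" and ir: "i \<cdot> r = \<mu>D \<cdot> (i \<star> Ide C d)"
    and j: "j \<in> Hom C k a" and j\<mu>: "j \<cdot> \<mu>K = \<mu>A \<cdot> (j \<star> j)"
    and c: "c \<in> Hom C k m" and c\<mu>: "c \<cdot> \<mu>K = \<mu>M \<cdot> (c \<star> c)"
    and g: "g \<in> Hom C a d" and gj: "g \<cdot> j = i \<cdot> c"
    and S: "S \<in> Hom C a (d \<boxtimes> m)" and e: "e \<in> Hom C k m"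
    and S_lin: "S \<cdot> (\<mu>A \<cdot> (Ide C a \<star> j)) = (\<mu>D \<star> Ide C m) \<cdot> (g \<star> (S \<cdot> j)) \<boxplus> g \<star> e"
    and S_sect: "act \<cdot> (S \<cdot> j) \<boxplus> e = c"
    and \<rho>: "\<rho> \<in> Hom C d o'" and c': "c' \<in> Hom C m o'" and c'\<mu>: "c' \<cdot> \<mu>M = \<mu>O \<cdot> (c' \<star> c')"
    and \<rho>i: "\<rho> \<cdot> i = c'"
  defines "\<tau> \<equiv> (\<rho> \<star> c') \<cdot> (S \<cdot> j)"
  shows "\<tau> \<in> Hom C k (o' \<boxtimes> o')"
    and "\<tau> \<cdot> (\<mu>K \<cdot> (Ide C k \<star> \<mu>K)) = (\<mu>O \<star> Ide C o') \<cdot> ((c' \<cdot> c) \<star> (\<tau> \<cdot> \<mu>K))"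
    and "\<mu>O \<cdot> (\<tau> \<cdot> \<mu>K) = c' \<cdot> (c \<cdot> \<mu>K)"
proof -
  note [simp] = HomE[OF \<mu>A] HomE[OF \<mu>K] HomE[OF \<mu>D] HomE[OF \<mu>M] HomE[OF \<mu>O] HomE[OF act] HomE[OF r] HomE[OF i]
    HomE[OF j] HomE[OF c] HomE[OF g] HomE[OF S] HomE[OF e] HomE[OF \<rho>] HomE[OF c']
  define T where "T = S \<cdot> j"
  have T [simp]: "T \<in> Arr C" "Dom C T = k" "Cod C T = d \<boxtimes> m" unfolding T_def by simp_all
  show "\<tau> \<in> Hom C k (o' \<boxtimes> o')" unfolding \<tau>_def by (simp add: Hom_def)
  \<comment> \<open>The value of \<open>S\<close> on a product of two elements y and x, lifted along
    \<open>i\<close> to a tensor product of two copies of the ideal: \<open>r\<close> multiplies y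
    with the first factor of S(x), and the result lies in the ideal.\<close>
  define s where "s = (r \<star> Ide C m) \<cdot> (c \<star> T) \<boxplus> c \<star> e"
  have s [simp]: "s \<in> Arr C" "Dom C s = k \<boxtimes> k" "Cod C s = m \<boxtimes> m" unfolding s_def by simp_all
  have ir': "(i \<star> Ide C m) \<cdot> (r \<star> Ide C m) = (\<mu>D \<star> Ide C m) \<cdot> (i \<star> Ide C d \<star> Ide C m)"
    by (simp add: ir)
  have "T \<cdot> \<mu>K = (S \<cdot> (\<mu>A \<cdot> (Ide C a \<star> j))) \<cdot> (j \<star> Ide C k)"
    unfolding T_def by (simp add: j\<mu>)
  also have "\<dots> = (\<mu>D \<star> Ide C m) \<cdot> ((g \<cdot> j) \<star> T) \<boxplus> (g \<cdot> j) \<star> e"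
    unfolding S_lin by (simp add: T_def)
  also have "(\<mu>D \<star> Ide C m) \<cdot> ((g \<cdot> j) \<star> T) = (\<mu>D \<star> Ide C m) \<cdot> ((i \<star> Ide C d \<star> Ide C m) \<cdot> (c \<star> T))"
    unfolding gj by simp
  also have "\<dots> = (i \<star> Ide C m) \<cdot> ((r \<star> Ide C m) \<cdot> (c \<star> T))"
    by (rule comp_eq_extend[OF ir', symmetric]) simp_all
  also have "\<dots> \<boxplus> (g \<cdot> j) \<star> e = (i \<star> Ide C m) \<cdot> s" unfolding s_def gj by simp
  finally have T\<mu>: "T \<cdot> \<mu>K = (i \<star> Ide C m) \<cdot> s" .
  have \<tau>\<mu>: "\<tau> \<cdot> \<mu>K = (c' \<star> c') \<cdot> s"
    unfolding \<tau>_def T_def[symmetric] by (simp add: T\<mu> \<rho>i)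
  have "r \<cdot> ((\<mu>M \<cdot> (c \<star> c)) \<star> Ide C d) = (r \<cdot> (\<mu>M \<star> Ide C d)) \<cdot> (c \<star> c \<star> Ide C d)" by simp
  also have "\<dots> = \<mu>M \<cdot> (c \<star> (r \<cdot> (c \<star> Ide C d)))" unfolding r_mult by simp
  finally have r_mult': "r \<cdot> ((\<mu>M \<cdot> (c \<star> c)) \<star> Ide C d) = \<mu>M \<cdot> (c \<star> (r \<cdot> (c \<star> Ide C d)))" .
  have "s \<cdot> (\<mu>K \<star> Ide C k) = (\<mu>M \<star> Ide C m) \<cdot> (c \<star> s)"
  proof -
    have 1: "(\<mu>M \<cdot> (c \<star> c)) \<star> T = ((\<mu>M \<cdot> (c \<star> c)) \<star> Ide C d \<star> Ide C m) \<cdot> (Ide C k \<star> Ide C k \<star> T)"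
      and 2: "c \<star> T = (c \<star> Ide C d \<star> Ide C m) \<cdot> (Ide C k \<star> T)" by simp_all
    have "s \<cdot> (\<mu>K \<star> Ide C k) = (r \<star> Ide C m) \<cdot> ((\<mu>M \<cdot> (c \<star> c)) \<star> T) \<boxplus> (\<mu>M \<cdot> (c \<star> c)) \<star> e"
      unfolding s_def by (simp add: c\<mu>)
    also have "(r \<star> Ide C m) \<cdot> ((\<mu>M \<cdot> (c \<star> c)) \<star> T)
        = ((\<mu>M \<cdot> (c \<star> (r \<cdot> (c \<star> Ide C d)))) \<star> Ide C m) \<cdot> (Ide C k \<star> Ide C k \<star> T)"
    proof -
      have "(r \<star> Ide C m) \<cdot> ((\<mu>M \<cdot> (c \<star> c)) \<star> Ide C d \<star> Ide C m) = (\<mu>M \<cdot> (c \<star> (r \<cdot> (c \<star> Ide C d)))) \<star> Ide C m"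
        by (simp add: r_mult')
      then show ?thesis unfolding 1 by (rule comp_eq_comp) simp_all
    qed
    also have "\<dots> = (\<mu>M \<star> Ide C m) \<cdot> (c \<star> ((r \<star> Ide C m) \<cdot> (c \<star> T)))"
    proof -
      have "(r \<star> Ide C m) \<cdot> (c \<star> Ide C d \<star> Ide C m) = (r \<cdot> (c \<star> Ide C d)) \<star> Ide C m" by simp
      then have "(r \<star> Ide C m) \<cdot> (c \<star> T) = ((r \<cdot> (c \<star> Ide C d)) \<star> Ide C m) \<cdot> (Ide C k \<star> T)"
        unfolding 2 by (rule comp_eq_comp) simp_all
      then have 3: "c \<star> ((r \<star> Ide C m) \<cdot> (c \<star> T))
          = (c \<star> (r \<cdot> (c \<star> Ide C d)) \<star> Ide C m) \<cdot> (Ide C k \<star> Ide C k \<star> T)" by simp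
      have 4: "(\<mu>M \<star> Ide C m) \<cdot> (c \<star> (r \<cdot> (c \<star> Ide C d)) \<star> Ide C m) = (\<mu>M \<cdot> (c \<star> (r \<cdot> (c \<star> Ide C d)))) \<star> Ide C m"
        by simp
      show ?thesis unfolding 3 by (rule comp_eq_comp[OF 4, symmetric]) simp_all
    qed
    finally show ?thesis unfolding s_def by simp
  qed
  moreover have "\<tau> \<cdot> (\<mu>K \<cdot> (\<mu>K \<star> Ide C k)) = (c' \<star> c') \<cdot> (s \<cdot> (\<mu>K \<star> Ide C k))"
    by (rule comp_eq_extend[OF \<tau>\<mu>]) (simp_all add: \<tau>_def)
  ultimately have "\<tau> \<cdot> (\<mu>K \<cdot> (\<mu>K \<star> Ide C k)) = (c' \<star> c') \<cdot> ((\<mu>M \<star> Ide C m) \<cdot> (c \<star> s))" by simp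
  also have "\<dots> = (\<mu>O \<star> Ide C o') \<cdot> ((c' \<star> c' \<star> c') \<cdot> (c \<star> s))"
    by (rule comp_eq_extend) (simp_all add: c'\<mu>)
  also have "(c' \<star> c' \<star> c') \<cdot> (c \<star> s) = (c' \<cdot> c) \<star> ((c' \<star> c') \<cdot> s)" by simp
  finally show "\<tau> \<cdot> (\<mu>K \<cdot> (Ide C k \<star> \<mu>K)) = (\<mu>O \<star> Ide C o') \<cdot> ((c' \<cdot> c) \<star> (\<tau> \<cdot> \<mu>K))"
    unfolding \<tau>\<mu> assocK[symmetric] .
  \<comment> \<open>The identity (y a) z = y (a z) turns the first factor of S(x) into an operator
    on the second, so that \<open>S_sect\<close> applies.\<close>
  have "\<mu>M \<cdot> ((r \<star> Ide C m) \<cdot> (c \<star> T)) = \<mu>M \<cdot> ((Ide C m \<star> act) \<cdot> (c \<star> T))"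
    by (rule comp_eq_extend[OF r_act]) simp_all
  then have "\<mu>M \<cdot> s = \<mu>M \<cdot> (c \<star> (act \<cdot> T \<boxplus> e))" unfolding s_def by simp
  also have "\<dots> = c \<cdot> \<mu>K" unfolding T_def S_sect c\<mu> ..
  finally have "\<mu>M \<cdot> s = c \<cdot> \<mu>K" .
  moreover have "\<mu>O \<cdot> ((c' \<star> c') \<cdot> s) = c' \<cdot> (\<mu>M \<cdot> s)"
    by (rule comp_eq_extend[OF c'\<mu>, symmetric]) simp_all
  ultimately show "\<mu>O \<cdot> (\<tau> \<cdot> \<mu>K) = c' \<cdot> (c \<cdot> \<mu>K)" unfolding \<tau>\<mu> by simp
qed

section \<open>Iterated multiplications and their splittings\<close>

lemma interchange_pairs:
  assumes "x \<in> Arr C" "y \<in> Arr C" "z \<in> Arr C" "f \<in> Arr C" "g \<in> Arr C" "h \<in> Arr C"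
    "Dom C x \<boxtimes> Dom C y = Cod C f \<boxtimes> Cod C g" "Dom C z = Cod C h"
  shows "(x \<star> y \<star> z) \<cdot> (f \<star> g \<star> h) = ((x \<star> y) \<cdot> (f \<star> g)) \<star> (z \<cdot> h)"
  using interchange[of "f \<star> g" h "x \<star> y" z] assms by (simp del: interchange interchange_regroup)

section \<open>Algebras and their homomorphisms\<close>

lemma algE:
  assumes "is_alg C R"
  shows "Mul R \<in> Hom C (Und R \<boxtimes> Und R) (Und R)" "Und R \<in> Obj C"
    "Mul R \<cdot> (Mul R \<star> Ide C (Und R)) = Mul R \<cdot> (Ide C (Und R) \<star> Mul R)"
  using assms by (simp_all add: is_alg_def)

lemma alg_arr [simp]:
  assumes "is_alg C R"
  shows "Mul R \<in> Arr C" "Dom C (Mul R) = Und R \<boxtimes> Und R" "Cod C (Mul R) = Und R" "Und R \<in> Obj C"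
  using HomE[OF algE(1)[OF assms]] algE(2)[OF assms] by simp_all

lemma mul_assoc:
  assumes "is_alg C R" "y \<in> Arr C" "Cod C y = Und R"
  shows "Mul R \<cdot> (Mul R \<star> y) = Mul R \<cdot> (Ide C (Und R) \<star> (Mul R \<cdot> (Ide C (Und R) \<star> y)))"
    and "\<lbrakk>x \<in> Arr C; Cod C x = Und R \<boxtimes> Und R\<rbrakk>
      \<Longrightarrow> Mul R \<cdot> ((Mul R \<cdot> x) \<star> y) = Mul R \<cdot> ((Ide C (Und R) \<star> Mul R) \<cdot> (x \<star> y))"
  using act_assoc[OF algE(3)[OF assms(1)] algE(1)[OF assms(1)] algE(1)[OF assms(1)] assms(2,3)]
  by simp_all

lemma alg_homE:
  assumes "is_alg_hom C R S f"
  shows "f \<in> Hom C (Und R) (Und S)" "f \<cdot> Mul R = Mul S \<cdot> (f \<star> f)"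
  using assms by (simp_all add: is_alg_hom_def)

lemma alg_hom_arr:
  assumes "is_alg_hom C R S f"
  shows "f \<in> Arr C" "Dom C f = Und R" "Cod C f = Und S"
  using HomE[OF alg_homE(1)[OF assms]] by simp_all

lemma alg_hom_comp:
  assumes "is_alg_hom C R S f" "is_alg_hom C S T g" "is_alg C R" "is_alg C S" "is_alg C T"
  shows "is_alg_hom C R T (g \<cdot> f)"
proof -
  note [simp] = alg_hom_arr[OF assms(1)] alg_hom_arr[OF assms(2)]
    alg_arr[OF assms(3)] alg_arr[OF assms(4)] alg_arr[OF assms(5)]
  have "g \<cdot> (Mul S \<cdot> (f \<star> f)) = Mul T \<cdot> ((g \<star> g) \<cdot> (f \<star> f))"
    by (rule comp_eq_extend[OF alg_homE(2)[OF assms(2)]]) simp_all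
  then show ?thesis by (simp add: is_alg_hom_def Hom_def alg_homE(2)[OF assms(1)])
qed

lemma alg_hom_ide: "is_alg C R \<Longrightarrow> is_alg_hom C R R (Ide C (Und R))"
  by (simp add: is_alg_hom_def Hom_def)

lemma nmult_1: "nmult C R (Suc 0) = Ide C (Und R)"
  and nmult_Suc_Suc: "nmult C R (Suc (Suc n)) = Mul R \<cdot> (Ide C (Und R) \<star> nmult C R (Suc n))"
  by simp_all

declare nmult.simps(2) [simp del]

lemma nmult_arr [simp]:
  assumes "is_alg C R"
  shows "nmult C R (Suc n) \<in> Arr C" "Dom C (nmult C R (Suc n)) = Und R \<boxtimes> tpow C (Und R) n"
    "Cod C (nmult C R (Suc n)) = Und R"
  using assms by (induction n) (simp_all add: nmult_1 nmult_Suc_Suc)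

text \<open>Merging the first two factors first is the recursion that suits left linear maps; the
  transition maps of powers use it too.\<close>

lemma nmult_mul_left:
  assumes "is_alg C R"
  shows "nmult C R (Suc n) \<cdot> (Mul R \<star> Ide C (tpow C (Und R) n)) = nmult C R (Suc (Suc n))"
proof (cases n)
  case 0
  then show ?thesis using assms by (simp add: nmult_1 nmult_Suc_Suc)
next
  case (Suc q)
  then show ?thesis using assms by (simp add: nmult_Suc_Suc mul_assoc)
qed

lemma nmult_add:
  assumes "is_alg C R"
  shows "nmult C R (Suc (Suc (m + n))) = Mul R \<cdot> (nmult C R (Suc m) \<star> nmult C R (Suc n))"
proof (induction m)
  case 0
  then show ?case by (simp add: nmult_1 nmult_Suc_Suc)
next
  case (Suc m)
  then show ?case using assms
    by (simp add: nmult_Suc_Suc[of R "Suc _"] nmult_Suc_Suc[of R m] mul_assoc)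
qed

lemma nmult_natural:
  assumes "is_alg C R" "is_alg C S" and f: "is_alg_hom C R S f"
  shows "f \<cdot> nmult C R (Suc n) = nmult C S (Suc n) \<cdot> (f \<star> tpow_arr C f n)"
proof (induction n)
  case 0
  then show ?case using assms alg_hom_arr[OF f] by (simp add: nmult_1)
next
  case (Suc n)
  note [simp] = alg_hom_arr[OF f]
  have "f \<cdot> (Mul R \<cdot> (Ide C (Und R) \<star> nmult C R (Suc n)))
      = Mul S \<cdot> ((f \<star> f) \<cdot> (Ide C (Und R) \<star> nmult C R (Suc n)))"
    by (rule comp_eq_extend[OF alg_homE(2)[OF f]]) (use assms in simp_all)
  then show ?case using assms Suc by (simp add: nmult_Suc_Suc)
qed

text \<open>The index \<open>n\<close> is one less than the number of tensor factors in the target.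
  The section property is demanded on products of n + 1 elements, and linearity for one further
  element multiplied from the left to such a product. The homomorphism \<open>f\<close>, later a
  transition map, takes the place of an identity.\<close>

definition splits :: "('o, 'm) alg \<Rightarrow> ('o, 'm) alg \<Rightarrow> 'm \<Rightarrow> nat \<Rightarrow> 'm \<Rightarrow> bool" where
  "splits R S f n \<tau> \<longleftrightarrow> \<tau> \<in> Hom C (Und R) (tpow C (Und S) (Suc n)) \<and>
    \<tau> \<cdot> nmult C R (Suc (Suc n)) = (Mul S \<star> Ide C (tpow C (Und S) n)) \<cdot> (f \<star> (\<tau> \<cdot> nmult C R (Suc n))) \<and>
    nmult C S (Suc n) \<cdot> (\<tau> \<cdot> nmult C R (Suc n)) = f \<cdot> nmult C R (Suc n)"

lemma splits_0:
  assumes "is_alg C R" "is_alg C S" "is_alg_hom C R S f"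
  shows "splits R S f 0 f"
proof -
  note [simp] = assms(1,2) alg_hom_arr[OF assms(3)]
  show ?thesis by (simp add: splits_def nmult_1 nmult_Suc_Suc Hom_def alg_homE(2)[OF assms(3)])
qed

text \<open>\<open>\<sigma>\<close> is linear only in the first of three multiplied elements. On a
  product of n + 3 elements \<open>\<tau>\<close> lets two of them through to the first tensor
  factor, which becomes x_0 (x_1 t), and \<open>\<sigma>\<close> then lets x_0 through. For the
  section property one element in front is enough, because \<open>\<sigma>\<close> splits products
  of two; this takes n + 2 elements.\<close>

lemma splits_Suc:
  assumes "is_alg C Q" "is_alg C R" "is_alg C S" and f: "is_alg_hom C Q R f" and g: "is_alg_hom C R S g"
    and \<tau>: "splits Q R f n \<tau>"
    and \<sigma>: "\<sigma> \<in> Hom C (Und R) (Und S \<boxtimes> Und S)"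
    and \<sigma>_lin: "\<sigma> \<cdot> (Mul R \<cdot> (Ide C (Und R) \<star> Mul R)) = (Mul S \<star> Ide C (Und S)) \<cdot> (g \<star> (\<sigma> \<cdot> Mul R))"
    and \<sigma>_sect: "Mul S \<cdot> (\<sigma> \<cdot> Mul R) = g \<cdot> Mul R"
  shows "splits Q S (g \<cdot> f) (Suc n) ((\<sigma> \<star> tpow_arr C g n) \<cdot> \<tau>)"
proof -
  have \<tau>_hom: "\<tau> \<in> Hom C (Und Q) (tpow C (Und R) (Suc n))" using \<tau> by (simp add: splits_def)
  note [simp] = assms(1-3) alg_hom_arr[OF f] alg_hom_arr[OF g] HomE(1-3)[OF \<sigma>] HomE(1-3)[OF \<tau>_hom]
  define w where "w = \<tau> \<cdot> nmult C Q (Suc n)"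
  have w [simp]: "w \<in> Arr C" "Dom C w = Und Q \<boxtimes> tpow C (Und Q) n" "Cod C w = Und R \<boxtimes> tpow C (Und R) n"
    unfolding w_def by simp_all
  define lR where "lR = Mul R \<star> Ide C (tpow C (Und R) n)"
  define lS where "lS = Mul S \<star> Ide C (Und S) \<star> Ide C (tpow C (Und S) n)"
  define \<sigma>' where "\<sigma>' = \<sigma> \<star> tpow_arr C g n"
  have arr [simp]: "lR \<in> Arr C" "Dom C lR = Und R \<boxtimes> Und R \<boxtimes> tpow C (Und R) n" "Cod C lR = Und R \<boxtimes> tpow C (Und R) n"
    "lS \<in> Arr C" "Dom C lS = Und S \<boxtimes> Und S \<boxtimes> Und S \<boxtimes> tpow C (Und S) n"
    "Cod C lS = Und S \<boxtimes> Und S \<boxtimes> tpow C (Und S) n"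
    "\<sigma>' \<in> Arr C" "Dom C \<sigma>' = Und R \<boxtimes> tpow C (Und R) n" "Cod C \<sigma>' = Und S \<boxtimes> Und S \<boxtimes> tpow C (Und S) n"
    unfolding lR_def lS_def \<sigma>'_def by simp_all
  have \<tau>_lin: "\<tau> \<cdot> nmult C Q (Suc (Suc n)) = lR \<cdot> (f \<star> w)"
    and \<tau>_sect: "nmult C R (Suc n) \<cdot> w = f \<cdot> nmult C Q (Suc n)"
    using \<tau> by (simp_all add: splits_def lR_def w_def)
  let ?l = "Mul R \<star> Ide C (Und R) \<star> Ide C (tpow C (Und R) n)"
  \<comment> \<open>Linearity of \<open>\<tau>\<close> is used for the product of the first two
    elements, so that both arrive in front of the first tensor factor.\<close>
  have "\<tau> \<cdot> nmult C Q (Suc (Suc (Suc n))) = (\<tau> \<cdot> nmult C Q (Suc (Suc n))) \<cdot> (Mul Q \<star> Ide C (tpow C (Und Q) (Suc n)))"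
    unfolding nmult_mul_left[OF assms(1), of "Suc n", symmetric] by (simp del: ide_tobj)
  also have "\<dots> = lR \<cdot> ((Mul R \<cdot> (f \<star> f)) \<star> w)" unfolding \<tau>_lin by (simp add: alg_homE(2)[OF f])
  also have "\<dots> = lR \<cdot> (?l \<cdot> (f \<star> f \<star> w))" by simp
  finally have lin1: "\<tau> \<cdot> nmult C Q (Suc (Suc (Suc n))) = lR \<cdot> (?l \<cdot> (f \<star> f \<star> w))" .
  have "\<sigma>' \<cdot> (lR \<cdot> ?l) = (\<sigma> \<cdot> (Mul R \<cdot> (Mul R \<star> Ide C (Und R)))) \<star> tpow_arr C g n"
    unfolding \<sigma>'_def lR_def by simp
  also have "\<dots> = lS \<cdot> (g \<star> (\<sigma>' \<cdot> lR))"
    unfolding algE(3)[OF assms(2)] \<sigma>_lin unfolding \<sigma>'_def lR_def lS_def by (simp add: interchange_pairs)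
  finally have lin2: "(\<sigma>' \<cdot> lR) \<cdot> ?l = lS \<cdot> (g \<star> (\<sigma>' \<cdot> lR))" by simp
  have "\<sigma>' \<cdot> (\<tau> \<cdot> nmult C Q (Suc (Suc (Suc n)))) = (\<sigma>' \<cdot> lR) \<cdot> (?l \<cdot> (f \<star> f \<star> w))"
    unfolding lin1 by (simp del: interchange interchange_regroup)
  also have "\<dots> = lS \<cdot> ((g \<star> (\<sigma>' \<cdot> lR)) \<cdot> (f \<star> f \<star> w))"
    by (rule comp_eq_extend[OF lin2]) simp_all
  also have "\<dots> = lS \<cdot> ((g \<cdot> f) \<star> (\<sigma>' \<cdot> (\<tau> \<cdot> nmult C Q (Suc (Suc n)))))"
    unfolding \<tau>_lin by (simp del: interchange_regroup)
  finally have lin: "\<sigma>' \<cdot> (\<tau> \<cdot> nmult C Q (Suc (Suc (Suc n))))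
    = lS \<cdot> ((g \<cdot> f) \<star> (\<sigma>' \<cdot> (\<tau> \<cdot> nmult C Q (Suc (Suc n)))))" .
  let ?m = "Mul S \<star> Ide C (tpow C (Und S) n)"
  have "?m \<cdot> (\<sigma>' \<cdot> lR) = (g \<star> tpow_arr C g n) \<cdot> lR"
    unfolding \<sigma>'_def lR_def by (simp add: \<sigma>_sect)
  then have "nmult C S (Suc n) \<cdot> (?m \<cdot> (\<sigma>' \<cdot> lR)) = (nmult C S (Suc n) \<cdot> (g \<star> tpow_arr C g n)) \<cdot> lR"
    by (simp del: interchange interchange_comp)
  also have "\<dots> = g \<cdot> (nmult C R (Suc n) \<cdot> lR)"
    unfolding nmult_natural[OF assms(2,3) g, symmetric] by simp
  also have "nmult C R (Suc n) \<cdot> lR = Mul R \<cdot> (Ide C (Und R) \<star> nmult C R (Suc n))"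
    unfolding lR_def nmult_mul_left[OF assms(2)] nmult_Suc_Suc ..
  finally have sect1: "nmult C S (Suc n) \<cdot> (?m \<cdot> (\<sigma>' \<cdot> lR)) = g \<cdot> (Mul R \<cdot> (Ide C (Und R) \<star> nmult C R (Suc n)))" .
  have "nmult C S (Suc (Suc n)) \<cdot> (\<sigma>' \<cdot> (\<tau> \<cdot> nmult C Q (Suc (Suc n))))
    = (nmult C S (Suc n) \<cdot> (?m \<cdot> (\<sigma>' \<cdot> lR))) \<cdot> (f \<star> w)"
    unfolding \<tau>_lin nmult_mul_left[OF assms(3), symmetric] by simp
  also have "\<dots> = g \<cdot> (Mul R \<cdot> (f \<star> (f \<cdot> nmult C Q (Suc n))))"
    unfolding sect1 by (simp add: \<tau>_sect)
  also have "\<dots> = g \<cdot> ((Mul R \<cdot> (f \<star> f)) \<cdot> (Ide C (Und Q) \<star> nmult C Q (Suc n)))" by simp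
  also have "\<dots> = g \<cdot> (f \<cdot> nmult C Q (Suc (Suc n)))"
    unfolding alg_homE(2)[OF f, symmetric] nmult_Suc_Suc by simp
  finally have sect: "nmult C S (Suc (Suc n)) \<cdot> (\<sigma>' \<cdot> (\<tau> \<cdot> nmult C Q (Suc (Suc n))))
    = g \<cdot> (f \<cdot> nmult C Q (Suc (Suc n)))" .
  show ?thesis unfolding splits_def \<sigma>'_def[symmetric] using lin sect
    by (simp add: Hom_def lS_def)
qed

section \<open>The bar complex\<close>

lemma tpow_Suc_right_assoc:
  "\<lbrakk>a \<in> Obj C; b \<in> Obj C\<rbrakk> \<Longrightarrow> tpow C a n \<boxtimes> a \<boxtimes> b = a \<boxtimes> tpow C a n \<boxtimes> b"
  using tpow_Suc_right[of a n] tobj_assoc[of "tpow C a n" a b] tobj_assoc[of a "tpow C a n" b] by simp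

lemmas tpow_right = tpow_Suc_right tpow_Suc_right_assoc

definition signed :: "nat \<Rightarrow> 'm \<Rightarrow> 'm" where
  "signed n f = (if even n then f else Neg C f)"

lemma signed_arr [simp]:
  assumes "f \<in> Arr C"
  shows "signed n f \<in> Arr C" "Dom C (signed n f) = Dom C f" "Cod C (signed n f) = Cod C f"
  using assms by (simp_all add: signed_def)

text \<open>The boundary of the bar complex in recursive form; the zero map in degree \<open>0\<close> only starts the
  recursion.\<close>

primrec bar_diff :: "('o, 'm) alg \<Rightarrow> nat \<Rightarrow> 'm" where
  "bar_diff R 0 = Zero C (Und R) (Unit C)"
| "bar_diff R (Suc n) = bar_diff R n \<star> Ide C (Und R) \<boxplus> signed n (Ide C (tpow C (Und R) n) \<star> Mul R)"

lemma bar_diff_arr [simp]: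
  assumes "is_alg C R"
  shows "bar_diff R n \<in> Arr C" "Dom C (bar_diff R n) = Und R \<boxtimes> tpow C (Und R) n"
    "Cod C (bar_diff R n) = tpow C (Und R) n"
proof -
  have "bar_diff R n \<in> Arr C \<and> Dom C (bar_diff R n) = Und R \<boxtimes> tpow C (Und R) n
    \<and> Cod C (bar_diff R n) = tpow C (Und R) n"
    using assms by (induction n) (simp_all add: tpow_right)
  then show "bar_diff R n \<in> Arr C" "Dom C (bar_diff R n) = Und R \<boxtimes> tpow C (Und R) n"
    "Cod C (bar_diff R n) = tpow C (Und R) n" by simp_all
qed

lemma finprod_tarr_ide:
  fixes n :: nat
  assumes "x \<in> Obj C" "y \<in> Obj C" "a \<in> Obj C" "\<And>i. i < n \<Longrightarrow> F i \<in> Hom C x y"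
  shows "finprod (hom_group C (x \<boxtimes> a) (y \<boxtimes> a)) (\<lambda>i. F i \<star> Ide C a) {0..<n}
      = finprod (hom_group C x y) F {0..<n} \<star> Ide C a \<and> finprod (hom_group C x y) F {0..<n} \<in> Hom C x y"
proof -
  interpret G: comm_group "hom_group C x y" using assms by (simp add: hom_comm_group)
  interpret H: comm_group "hom_group C (x \<boxtimes> a) (y \<boxtimes> a)" using assms by (simp add: hom_comm_group)
  show ?thesis using assms(4)
  proof (induct n)
    case 0
    then show ?case using assms by (simp add: Hom_def)
  next
    case (Suc n)
    then have F: "F i \<in> Arr C" "Dom C (F i) = x" "Cod C (F i) = y" if "i \<le> n" for i
      using that HomE[of "F i" x y] by auto
    then have "F \<in> {0..<n} \<rightarrow> Hom C x y" "(\<lambda>i. F i \<star> Ide C a) \<in> {0..<n} \<rightarrow> Hom C (x \<boxtimes> a) (y \<boxtimes> a)"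
      "F n \<in> Hom C x y" "F n \<star> Ide C a \<in> Hom C (x \<boxtimes> a) (y \<boxtimes> a)"
      using assms by (auto simp: Hom_def)
    moreover have "finprod (hom_group C x y) F {0..<n} \<in> Hom C x y" using Suc by simp
    moreover note HomE[OF this]
    ultimately show ?case using Suc F assms
      by (simp add: atLeast0_lessThan_Suc G.finprod_insert H.finprod_insert) (simp add: Hom_def)
  qed
qed

text \<open>Every summand but the last leaves the last tensor factor untouched, so these summands
  form the boundary of one degree lower tensored with an identity. The last summand multiplies the
  last two factors.\<close>

lemma bar_bd_eq_bar_diff:
  assumes R: "is_alg C R"
  shows "bar_bd C R (Suc n) = bar_diff R (Suc n)"
proof -
  let ?a = "Und R"
  define t where "t n i = signed i (Ide C (tpow C ?a i) \<star> Mul R \<star> Ide C (tpow C ?a (n - 1 - i)))" for n i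
  let ?G = "\<lambda>n. hom_group C (tpow C ?a (Suc n)) (tpow C ?a n)"
  note [simp] = R
  have tpow_split: "tpow C ?a i \<boxtimes> ?a \<boxtimes> tpow C ?a (n - 1 - i) = tpow C ?a n" if "i < n" for i n
    using tpow_add[of ?a i "Suc (n - 1 - i)"] that by simp
  have t: "t n i \<in> Hom C (tpow C ?a (Suc n)) (tpow C ?a n)" if "i < n" for i n
  proof -
    from that(1) obtain q where q: "n = Suc (i + q)" using less_imp_Suc_add by blast
    have "tpow C ?a i \<boxtimes> ?a \<boxtimes> ?a \<boxtimes> tpow C ?a (n - 1 - i) = tpow C ?a (Suc n)"
      using tpow_add[of ?a i "Suc (Suc q)"] by (simp add: q)
    then show ?thesis using tpow_split[OF that] by (simp add: t_def Hom_def)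
  qed
  have tpow_Suc: "tpow C ?a (Suc n) = tpow C ?a n \<boxtimes> ?a" for n by (simp add: tpow_right)
  have "finprod (?G n) (t n) {0..<n} = bar_diff R n" for n
  proof (induction n)
    case 0
    interpret G: comm_group "?G 0" by (intro hom_comm_group) simp_all
    show ?case using G.finprod_empty by simp
  next
    case (Suc n)
    interpret G: comm_group "?G (Suc n)" by (intro hom_comm_group) simp_all
    have t_Suc: "t (Suc n) i = t n i \<star> Ide C ?a" if "i < n" for i
    proof -
      have "tpow C ?a (n - i) = tpow C ?a (n - 1 - i) \<boxtimes> ?a"
        using tpow_Suc[of "n - 1 - i"] that by (simp add: Suc_diff_Suc)
      then have "Ide C (tpow C ?a (n - i)) = Ide C (tpow C ?a (n - 1 - i)) \<star> Ide C ?a" by simp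
      then show ?thesis by (simp add: t_def signed_def)
    qed
    have "finprod (?G (Suc n)) (t (Suc n)) {0..<Suc n} = t (Suc n) n \<boxplus> finprod (?G (Suc n)) (t (Suc n)) {0..<n}"
      unfolding atLeast0_lessThan_Suc using t[of _ "Suc n"]
      by (subst G.finprod_insert) (simp_all add: Pi_def del: tpow.simps)
    also have "finprod (?G (Suc n)) (t (Suc n)) {0..<n} = finprod (?G (Suc n)) (\<lambda>i. t n i \<star> Ide C ?a) {0..<n}"
      using t[of _ "Suc n"] by (intro G.finprod_cong') (simp_all add: Pi_def del: tpow.simps flip: t_Suc)
    also have "\<dots> = bar_diff R n \<star> Ide C ?a"
      using finprod_tarr_ide[of "tpow C ?a (Suc n)" "tpow C ?a n" ?a n "t n"] t[of _ n] Suc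
      by (simp only: tpow_Suc[symmetric]) simp
    also have "t (Suc n) n \<boxplus> \<dots> = bar_diff R (Suc n)"
      by (simp add: t_def add_commute tpow_right)
    finally show ?case .
  qed
  moreover have "t (Suc n) = (\<lambda>i. if even i then Ide C (tpow C ?a i) \<star> Mul R \<star> Ide C (tpow C ?a (n - i))
      else Neg C (Ide C (tpow C ?a i) \<star> Mul R \<star> Ide C (tpow C ?a (n - i))))"
    by (rule ext) (simp add: t_def signed_def)
  ultimately show ?thesis
    by (simp add: bar_bd_def bar_obj_def Let_def del: bar_diff.simps tpow.simps)
      (metis (no_types, lifting))
qed

text \<open>\<open>P\<close> and \<open>b\<close> abstract a tensor power and the boundary ending in
  it. In the product of two consecutive boundaries, the part where \<open>b\<close> meets the
  boundary before it vanishes by \<open>bb\<close>. Of the remaining four terms, the two mixed ones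
  with \<open>b\<close> and the multiplication have opposite signs, and the two on the last three
  factors cancel by associativity.\<close>

lemma bar_diff_step_comp:
  assumes R: "is_alg C R" and "P \<in> Obj C" and b: "b \<in> Hom C (P \<boxtimes> Und R) P"
    and bb: "b \<cdot> (b \<star> Ide C (Und R) \<boxplus> signed n (Ide C P \<star> Mul R)) = Zero C (P \<boxtimes> Und R \<boxtimes> Und R) P"
  shows "(b \<star> Ide C (Und R) \<boxplus> signed n (Ide C P \<star> Mul R)) \<cdot>
      ((b \<star> Ide C (Und R) \<boxplus> signed n (Ide C P \<star> Mul R)) \<star> Ide C (Und R)
        \<boxplus> signed (Suc n) (Ide C (P \<boxtimes> Und R) \<star> Mul R))
    = Zero C (P \<boxtimes> Und R \<boxtimes> Und R \<boxtimes> Und R) (P \<boxtimes> Und R)"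
proof -
  note [simp] = R assms(2) HomE[OF b]
  define b1 where "b1 = b \<star> Ide C (Und R) \<boxplus> signed n (Ide C P \<star> Mul R)"
  have b1 [simp]: "b1 \<in> Arr C" "Dom C b1 = P \<boxtimes> Und R \<boxtimes> Und R" "Cod C b1 = P \<boxtimes> Und R"
    unfolding b1_def by simp_all
  have "b1 \<cdot> (b1 \<star> Ide C (Und R))
      = (b \<star> Ide C (Und R)) \<cdot> (b1 \<star> Ide C (Und R)) \<boxplus> signed n (Ide C P \<star> Mul R) \<cdot> (b1 \<star> Ide C (Und R))"
    by (subst (1) b1_def) (simp del: interchange interchange_regroup)
  also have "(b \<star> Ide C (Und R)) \<cdot> (b1 \<star> Ide C (Und R)) = Zero C (P \<boxtimes> Und R \<boxtimes> Und R \<boxtimes> Und R) (P \<boxtimes> Und R)"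
    using bb[folded b1_def] by simp
  also have "signed n (Ide C P \<star> Mul R) \<cdot> (b1 \<star> Ide C (Und R))
      = signed n (b \<star> Mul R) \<boxplus> Ide C P \<star> (Mul R \<cdot> (Mul R \<star> Ide C (Und R)))"
    by (simp add: b1_def signed_def)
  finally have 1: "b1 \<cdot> (b1 \<star> Ide C (Und R))
      = signed n (b \<star> Mul R) \<boxplus> Ide C P \<star> (Mul R \<cdot> (Mul R \<star> Ide C (Und R)))" by simp
  have 2: "b1 \<cdot> signed (Suc n) (Ide C P \<star> Ide C (Und R) \<star> Mul R)
      = Neg C (signed n (b \<star> Mul R)) \<boxplus> Neg C (Ide C P \<star> (Mul R \<cdot> (Mul R \<star> Ide C (Und R))))"
    by (simp add: b1_def signed_def algE(3)[OF R])
  let ?x = "signed n (b \<star> Mul R)" and ?y = "Ide C P \<star> (Mul R \<cdot> (Mul R \<star> Ide C (Und R)))"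
  have "(?x \<boxplus> ?y) \<boxplus> (Neg C ?x \<boxplus> Neg C ?y) = ?x \<boxplus> (Neg C ?x \<boxplus> (?y \<boxplus> Neg C ?y))"
    by (simp add: add_ac del: add_neg add_neg_cancel)
  also have "\<dots> = Zero C (P \<boxtimes> Und R \<boxtimes> Und R \<boxtimes> Und R) (P \<boxtimes> Und R)" by simp
  finally show ?thesis unfolding b1_def[symmetric] by (simp add: 1 2 del: interchange_comp)
qed

lemma bar_diff_comp:
  assumes R: "is_alg C R"
  shows "bar_diff R n \<cdot> bar_diff R (Suc n) = Zero C (tpow C (Und R) (Suc (Suc n))) (tpow C (Und R) n)"
proof (induction n)
  case 0
  then show ?case using R by (simp add: signed_def)
next
  case (Suc n)
  have "tpow C (Und R) n \<boxtimes> Und R \<boxtimes> Und R \<boxtimes> Und R = tpow C (Und R) (Suc (Suc (Suc n)))"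
    "tpow C (Und R) n \<boxtimes> Und R \<boxtimes> Und R = tpow C (Und R) (Suc (Suc n))"
    "tpow C (Und R) n \<boxtimes> Und R = tpow C (Und R) (Suc n)"
    using R by (simp_all add: tpow_right)
  then show ?case using bar_diff_step_comp[OF R, of "tpow C (Und R) n" "bar_diff R n" n] Suc R
    by (simp add: Hom_def del: ide_tobj)
qed

lemma bar_diff_natural:
  assumes "is_alg C R" "is_alg C S" and f: "is_alg_hom C R S f"
  shows "tpow_arr C f n \<cdot> bar_diff R n = bar_diff S n \<cdot> (f \<star> tpow_arr C f n)"
proof (induction n)
  case 0
  then show ?case using assms alg_hom_arr[OF f] by simp
next
  case (Suc n)
  note [simp] = alg_hom_arr[OF f] assms(1,2)
  have right: "f \<star> tpow_arr C f n = tpow_arr C f n \<star> f"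
    using tpow_arr_add[of f n 1] by simp
  have "tpow_arr C f (Suc n) \<cdot> bar_diff R (Suc n)
      = (tpow_arr C f n \<cdot> bar_diff R n) \<star> f \<boxplus> signed n (tpow_arr C f n \<star> (f \<cdot> Mul R))"
    by (simp add: right signed_def tpow_right)
  also have "\<dots> = bar_diff S (Suc n) \<cdot> ((f \<star> tpow_arr C f n) \<star> f)"
    unfolding Suc alg_homE(2)[OF f] by (simp add: right signed_def tpow_right)
  also have "(f \<star> tpow_arr C f n) \<star> f = f \<star> tpow_arr C f (Suc n)" by (simp flip: right)
  finally show ?case .
qed

text \<open>With \<open>s\<close> applied to the last factor, the last summand of the boundary gives
  back \<open>f\<close> by the section property. The summand before it multiplies into the first
  half of \<open>s\<close>; by left linearity this is \<open>s\<close> after the multiplication. The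
  other summands do not meet \<open>s\<close>.\<close>

lemma bar_homotopy_step:
  assumes "is_alg C R" "is_alg C S" and f: "is_alg_hom C R S f"
    and s: "s \<in> Hom C (Und R) (Und S \<boxtimes> Und S)"
    and s_lin: "s \<cdot> Mul R = (Mul S \<star> Ide C (Und S)) \<cdot> (f \<star> s)" and s_sect: "Mul S \<cdot> s = f"
    and p: "p \<in> Hom C P' P" and b: "b \<in> Hom C (P \<boxtimes> Und S) P" and b': "b' \<in> Hom C (P' \<boxtimes> Und R) P'"
    and bp: "b \<cdot> (p \<star> f) = p \<cdot> b'"
  shows "((b \<star> Ide C (Und S) \<boxplus> signed n (Ide C P \<star> Mul S)) \<star> Ide C (Und S)
        \<boxplus> signed (Suc n) (Ide C (P \<boxtimes> Und S) \<star> Mul S)) \<cdot> (p \<star> f \<star> s)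
    = (p \<star> s) \<cdot> (b' \<star> Ide C (Und R) \<boxplus> signed n (Ide C P' \<star> Mul R)) \<boxplus> signed (Suc n) (p \<star> f \<star> f)"
proof -
  note [simp] = assms(1,2) alg_hom_arr[OF f] HomE[OF s] HomE[OF p] HomE[OF b] HomE[OF b']
  have 1: "(b \<star> Ide C (Und S) \<star> Ide C (Und S)) \<cdot> (p \<star> f \<star> s) = (p \<cdot> b') \<star> s"
    unfolding bp[symmetric] using interchange[of "p \<star> f" s b "Ide C (Und S \<boxtimes> Und S)"]
    by (simp del: interchange)
  have 2: "(Ide C P \<star> Mul S \<star> Ide C (Und S)) \<cdot> (p \<star> f \<star> s) = p \<star> (s \<cdot> Mul R)"
    unfolding s_lin by simp
  show ?thesis by (simp add: signed_def 1 2 s_sect add_add)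
qed

text \<open>For \<open>f\<close> an identity this would be a contraction of the bar complex up to
  sign. Here \<open>s\<close> passes between two algebras, later two levels, and the tensor powers
  of \<open>f\<close> replace the identity.\<close>

lemma bar_homotopy:
  assumes "is_alg C R" "is_alg C S" and f: "is_alg_hom C R S f"
    and s: "s \<in> Hom C (Und R) (Und S \<boxtimes> Und S)"
    and s_lin: "s \<cdot> Mul R = (Mul S \<star> Ide C (Und S)) \<cdot> (f \<star> s)" and s_sect: "Mul S \<cdot> s = f"
  shows "bar_diff S (Suc 0) \<cdot> s = f"
    and "bar_diff S (Suc (Suc n)) \<cdot> (tpow_arr C f (Suc n) \<star> s)
      = (tpow_arr C f n \<star> s) \<cdot> bar_diff R (Suc n) \<boxplus> signed (Suc n) (tpow_arr C f (Suc (Suc n)))"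
proof -
  note [simp] = assms(1,2) alg_hom_arr[OF f] HomE[OF s]
  show "bar_diff S (Suc 0) \<cdot> s = f" by (simp add: signed_def s_sect)
  have right: "f \<star> tpow_arr C f n = tpow_arr C f n \<star> f"
    using tpow_arr_add[of f n 1] by simp
  have eq: "tpow_arr C f (Suc n) \<star> s = tpow_arr C f n \<star> f \<star> s"
    "tpow_arr C f (Suc (Suc n)) = tpow_arr C f n \<star> f \<star> f"
    "Ide C (tpow C (Und S) (Suc n)) = Ide C (tpow C (Und S) n \<boxtimes> Und S)"
    using tpow_arr_add[of f n 2] by (simp_all add: right numeral_2_eq_2 tpow_Suc_right del: ide_tobj flip: tpow_Suc_right)
  have "bar_diff S (Suc (Suc n)) \<cdot> (tpow_arr C f n \<star> f \<star> s)
      = (tpow_arr C f n \<star> s) \<cdot> bar_diff R (Suc n) \<boxplus> signed (Suc n) (tpow_arr C f n \<star> f \<star> f)"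
    unfolding bar_diff.simps eq(3)
    by (rule bar_homotopy_step[OF assms(1-3) s s_lin s_sect])
      (simp_all add: Hom_def tpow_Suc_right bar_diff_natural[OF assms(1-3)] flip: right)
  then show "bar_diff S (Suc (Suc n)) \<cdot> (tpow_arr C f (Suc n) \<star> s)
      = (tpow_arr C f n \<star> s) \<cdot> bar_diff R (Suc n) \<boxplus> signed (Suc n) (tpow_arr C f (Suc (Suc n)))"
    unfolding eq .
qed

end

section \<open>Kernels, cokernels and powers\<close>

text \<open>The arrows 0 and 1 are the identities of the objects 0 and 1, while 2 and 3 are parallel
  arrows from 0 to 1. \<open>Comp\<close> is correct on composable arrows: if \<open>g\<close> is
  not an identity, then \<open>f\<close> is the identity of 0. Kernels and cokernels of an arrow are
  obtained as limits and colimits of the pair formed by that arrow and zero.\<close>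

definition parallel_pair :: "(nat, nat) category" where
  "parallel_pair = \<lparr>Obj = {0, 1}, Arr = {0, 1, 2, 3}, Dom = (\<lambda>f. if f = 1 then 1 else 0),
    Cod = (\<lambda>f. if f = 0 then 0 else 1), Ide = (\<lambda>a. a), Comp = (\<lambda>g f. if g \<le> 1 then f else g)\<rparr>"

lemma parallel_pair_sel [simp]:
  "Obj parallel_pair = {0, 1}" "Arr parallel_pair = {0, 1, 2, 3}" "Ide parallel_pair a = a"
  "Comp parallel_pair g f = (if g \<le> 1 then f else g)"
  "Dom parallel_pair f = (if f = 1 then 1 else 0)" "Cod parallel_pair f = (if f = 0 then 0 else 1)"
  by (simp_all add: parallel_pair_def)

lemma category_parallel_pair: "category parallel_pair"
proof
  fix a b c f g assume "f \<in> Hom parallel_pair a b" "g \<in> Hom parallel_pair b c"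
  then show "Comp parallel_pair g f \<in> Hom parallel_pair a c" by (simp add: Hom_def; elim conjE disjE; simp)
qed (auto simp: Hom_def)

context base_category
begin

definition pair_obj :: "'m \<Rightarrow> nat \<Rightarrow> 'o" where
  "pair_obj f i = (if i = 0 then Dom C f else Cod C f)"

definition pair_arr :: "'m \<Rightarrow> nat \<Rightarrow> 'm" where
  "pair_arr f m = (if m = 0 then Ide C (Dom C f) else if m = 1 then Ide C (Cod C f)
    else if m = 2 then f else Zero C (Dom C f) (Cod C f))"

lemma functor_pair:
  assumes "f \<in> Arr C"
  shows "is_functor parallel_pair C (pair_obj f) (pair_arr f)"
  using assms by (auto simp: is_functor_def Hom_def pair_obj_def pair_arr_def split: if_splits)

lemma ex_kernel:
  assumes f: "f \<in> Arr C"
  shows "\<exists>k. is_kernel C f k"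
proof -
  obtain x p where lim: "is_limit parallel_pair C (pair_obj f) (pair_arr f) x p"
    using finite_limits category_parallel_pair functor_pair[OF f] unfolding has_finite_limits_def
    by fastforce
  then have cone: "is_cone parallel_pair C (pair_obj f) (pair_arr f) x p" by (simp add: is_limit_def)
  then have p: "p 0 \<in> Hom C x (Dom C f)" "p 1 \<in> Hom C x (Cod C f)"
    by (auto simp: is_cone_def pair_obj_def)
  have "pair_arr f 2 \<cdot> p 0 = p 1" "pair_arr f 3 \<cdot> p 0 = p 1"
    using cone by (auto simp: is_cone_def Hom_def)
  note [simp] = HomE[OF p(1)] HomE[OF p(2)[unfolded One_nat_def]]
  have fp: "f \<cdot> p 0 = p 1" "p 1 = Zero C x (Cod C f)"
    using f \<open>pair_arr f 2 \<cdot> p 0 = p 1\<close> \<open>pair_arr f 3 \<cdot> p 0 = p 1\<close> by (simp_all add: pair_arr_def)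
  have "\<exists>!h. h \<in> Hom C y (Dom C (p 0)) \<and> p 0 \<cdot> h = g"
    if g: "g \<in> Hom C y (Dom C f)" and fg: "f \<cdot> g = Zero C y (Cod C f)" for y g
  proof -
    define q where "q i = (if i = 0 then g else Zero C y (Cod C f))" for i :: nat
    have "is_cone parallel_pair C (pair_obj f) (pair_arr f) y q"
      using f HomE[OF g] fg
      by (auto simp: is_cone_def q_def pair_obj_def pair_arr_def Hom_def split: if_splits)
    then have "\<exists>!h. h \<in> Hom C y x \<and> (\<forall>i \<in> {0, 1}. p i \<cdot> h = q i)"
      using lim by (simp add: is_limit_def)
    moreover have "(\<forall>i \<in> {0, 1}. p i \<cdot> h = q i) \<longleftrightarrow> p 0 \<cdot> h = g" if "h \<in> Hom C y x" for h
      using HomE[OF that] by (auto simp: q_def fp[unfolded One_nat_def])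
    ultimately show ?thesis by (metis (no_types, lifting) HomE(2) p(1))
  qed
  then have "is_kernel C f (p 0)" using f fp by (simp add: is_kernel_def Hom_def)
  then show ?thesis ..
qed

lemma ex_cokernel:
  assumes f: "f \<in> Arr C"
  shows "\<exists>q. is_cokernel C f q"
proof -
  obtain x p where lim: "is_colimit parallel_pair C (pair_obj f) (pair_arr f) x p"
    using finite_colimits category_parallel_pair functor_pair[OF f] unfolding has_finite_colimits_def
    by fastforce
  then have cone: "is_cocone parallel_pair C (pair_obj f) (pair_arr f) x p" by (simp add: is_colimit_def)
  then have p: "p 0 \<in> Hom C (Dom C f) x" "p 1 \<in> Hom C (Cod C f) x"
    by (auto simp: is_cocone_def pair_obj_def)
  have "p 1 \<cdot> pair_arr f 2 = p 0" "p 1 \<cdot> pair_arr f 3 = p 0"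
    using cone by (auto simp: is_cocone_def Hom_def)
  note [simp] = HomE[OF p(1)] HomE[OF p(2)[unfolded One_nat_def]]
  have fp: "p 1 \<cdot> f = p 0" "p 0 = Zero C (Dom C f) x"
    using f \<open>p 1 \<cdot> pair_arr f 2 = p 0\<close> \<open>p 1 \<cdot> pair_arr f 3 = p 0\<close> by (simp_all add: pair_arr_def)
  have "\<exists>!h. h \<in> Hom C (Cod C (p 1)) y \<and> h \<cdot> p 1 = g"
    if g: "g \<in> Hom C (Cod C f) y" and fg: "g \<cdot> f = Zero C (Dom C f) y" for y g
  proof -
    define q where "q i = (if i = 0 then Zero C (Dom C f) y else g)" for i :: nat
    have "is_cocone parallel_pair C (pair_obj f) (pair_arr f) y q"
      using f HomE[OF g] fg
      by (auto simp: is_cocone_def q_def pair_obj_def pair_arr_def Hom_def split: if_splits)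
    then have "\<exists>!h. h \<in> Hom C x y \<and> (\<forall>i \<in> {0, 1}. h \<cdot> p i = q i)"
      using lim by (simp add: is_colimit_def)
    moreover have "(\<forall>i \<in> {0, 1}. h \<cdot> p i = q i) \<longleftrightarrow> h \<cdot> p 1 = g" if "h \<in> Hom C x y" for h
      using HomE[OF that] f by (auto simp: q_def fp[unfolded One_nat_def])
    ultimately show ?thesis by (metis (no_types, lifting) HomE(3) p(2))
  qed
  then have "is_cokernel C f (p 1)" using f fp by (simp add: is_cokernel_def Hom_def)
  then show ?thesis ..
qed

lemma is_kernel_kernel_of: "f \<in> Arr C \<Longrightarrow> is_kernel C f (kernel_of C f)"
  unfolding kernel_of_def by (rule someI_ex) (rule ex_kernel)

lemma is_cokernel_cokernel_of: "f \<in> Arr C \<Longrightarrow> is_cokernel C f (cokernel_of C f)"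
  unfolding cokernel_of_def by (rule someI_ex) (rule ex_cokernel)

lemma cokernelE:
  assumes "is_cokernel C f q"
  shows "f \<in> Arr C" "q \<in> Arr C" "Dom C q = Cod C f" "q \<cdot> f = Zero C (Dom C f) (Cod C q)"
  using assms by (simp_all add: is_cokernel_def Hom_def)

lemma cokernel_factor:
  assumes "is_cokernel C f q" "g \<in> Arr C" "Dom C g = Cod C f" "g \<cdot> f = Zero C (Dom C f) (Cod C g)"
  obtains h where "h \<in> Hom C (Cod C q) (Cod C g)" "h \<cdot> q = g"
  using assms unfolding is_cokernel_def by (metis (no_types, lifting) Arr_Hom)

lemma cokernel_epi:
  assumes q: "is_cokernel C f q" and "g \<cdot> q = h \<cdot> q" and [simp]: "g \<in> Arr C" "h \<in> Arr C" "Dom C g = Cod C q"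
    "Dom C h = Cod C q"
    and cod: "Cod C g = Cod C h"
  shows "g = h"
proof -
  note [simp] = cokernelE(1-3)[OF q]
  have "(h \<cdot> q) \<cdot> f = Zero C (Dom C f) (Cod C h)" by (simp add: cokernelE(4)[OF q])
  then have "\<exists>!x. x \<in> Hom C (Cod C q) (Cod C h) \<and> x \<cdot> q = h \<cdot> q"
    using q unfolding is_cokernel_def by (metis (no_types, lifting) Arr_Hom assms(4,6) comp_arr cokernelE(2,3)[OF q])
  then show ?thesis using assms by (metis Arr_Hom)
qed

text \<open>\<open>p \<star> q\<close> is a composite of two arrows each of which is a cokernel,
  since tensoring with an object preserves cokernels.\<close>

lemma tarr_cokernel_epi:
  assumes p: "is_cokernel C f p" and q: "is_cokernel C f' q" and eq: "g \<cdot> (p \<star> q) = h \<cdot> (p \<star> q)"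
    and [simp]: "g \<in> Arr C" "h \<in> Arr C" "Dom C g = Cod C p \<boxtimes> Cod C q"
    "Dom C h = Cod C p \<boxtimes> Cod C q" "Cod C g = Cod C h"
  shows "g = h"
proof -
  note [simp] = cokernelE(1-3)[OF p] cokernelE(1-3)[OF q]
  have "g \<cdot> (Ide C (Cod C p) \<star> q) = h \<cdot> (Ide C (Cod C p) \<star> q)"
    by (rule cokernel_epi[OF tensor_cokernel(2)[OF _ p, of "Cod C f'"]]) (use eq in simp_all)
  then show ?thesis by (rule cokernel_epi[OF tensor_cokernel(1)[OF _ q, of "Cod C p"], rotated]) simp_all
qed

lemma tarr3_cokernel_epi:
  assumes p: "is_cokernel C k p" and eq: "g \<cdot> (p \<star> p \<star> p) = h \<cdot> (p \<star> p \<star> p)"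
    and [simp]: "g \<in> Arr C" "h \<in> Arr C" "Dom C g = Cod C p \<boxtimes> Cod C p \<boxtimes> Cod C p"
    "Dom C h = Cod C p \<boxtimes> Cod C p \<boxtimes> Cod C p" "Cod C g = Cod C h"
  shows "g = h"
proof -
  note [simp] = cokernelE(1-3)[OF p]
  let ?T = "Cod C k" and ?O = "Cod C p"
  have 1: "is_cokernel C (k \<star> Ide C (?T \<boxtimes> ?T)) (p \<star> Ide C (?T \<boxtimes> ?T))"
    by (rule tensor_cokernel(2)[OF _ p]) simp
  have 2: "is_cokernel C (Ide C ?O \<star> (k \<star> Ide C ?T)) (Ide C ?O \<star> (p \<star> Ide C ?T))"
    by (intro tensor_cokernel p) simp_all
  have 3: "is_cokernel C (Ide C (?O \<boxtimes> ?O) \<star> k) (Ide C (?O \<boxtimes> ?O) \<star> p)"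
    by (rule tensor_cokernel(1)[OF _ p]) simp
  have "g \<cdot> (Ide C ?O \<star> p \<star> p) = h \<cdot> (Ide C ?O \<star> p \<star> p)"
    by (rule cokernel_epi[OF 1]) (use eq in simp_all)
  then have "g \<cdot> (Ide C (?O \<boxtimes> ?O) \<star> p) = h \<cdot> (Ide C (?O \<boxtimes> ?O) \<star> p)"
    by (intro cokernel_epi[OF 2, of "g \<cdot> (Ide C (?O \<boxtimes> ?O) \<star> p)" "h \<cdot> (Ide C (?O \<boxtimes> ?O) \<star> p)"]) simp_all
  then show ?thesis by (rule cokernel_epi[OF 3]) simp_all
qed

text \<open>The factorization is made in two steps, through \<open>p\<close> tensored with an
  identity and then through an identity tensored with \<open>q\<close>. The condition for the second
  step may be checked after another epimorphism of the form \<open>p \<star> Ide C V\<close>, where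
  it becomes the hypothesis \<open>gf'\<close>.\<close>

lemma tarr_cokernel_factor:
  assumes p: "is_cokernel C f p" and q: "is_cokernel C f' q" and g [simp]: "g \<in> Arr C" "Dom C g = Cod C f \<boxtimes> Cod C f'"
    and gf: "g \<cdot> (f \<star> Ide C (Cod C f')) = Zero C (Dom C f \<boxtimes> Cod C f') (Cod C g)"
    and gf': "g \<cdot> (Ide C (Cod C f) \<star> f') = Zero C (Cod C f \<boxtimes> Dom C f') (Cod C g)"
  obtains h where "h \<in> Hom C (Cod C p \<boxtimes> Cod C q) (Cod C g)" "h \<cdot> (p \<star> q) = g"
proof -
  note [simp] = cokernelE(1-3)[OF p] cokernelE(1-3)[OF q]
  have p': "is_cokernel C (f \<star> Ide C V) (p \<star> Ide C V)" if "V \<in> Obj C" for V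
    by (rule tensor_cokernel(2)[OF that p])
  obtain h where h: "h \<in> Hom C (Cod C p \<boxtimes> Cod C f') (Cod C g)" and hp: "h \<cdot> (p \<star> Ide C (Cod C f')) = g"
    using cokernel_factor[OF p'[of "Cod C f'"], of g] gf by auto
  note [simp] = HomE(1-3)[OF h]
  have "(h \<cdot> (Ide C (Cod C p) \<star> f')) \<cdot> (p \<star> Ide C (Dom C f')) = (h \<cdot> (p \<star> Ide C (Cod C f'))) \<cdot> (Ide C (Cod C f) \<star> f')"
    by simp
  also have "\<dots> = Zero C (Cod C p \<boxtimes> Dom C f') (Cod C g) \<cdot> (p \<star> Ide C (Dom C f'))"
    unfolding hp gf' by simp
  finally have "h \<cdot> (Ide C (Cod C p) \<star> f') = Zero C (Cod C p \<boxtimes> Dom C f') (Cod C g)"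
    by (rule cokernel_epi[OF p'[of "Dom C f'"], rotated]) simp_all
  then obtain k where k: "k \<in> Hom C (Cod C p \<boxtimes> Cod C q) (Cod C g)" and kh: "k \<cdot> (Ide C (Cod C p) \<star> q) = h"
    using cokernel_factor[OF tensor_cokernel(1)[OF _ q, of "Cod C p"], of h] by auto
  note [simp] = HomE(1-3)[OF k]
  have "k \<cdot> (p \<star> q) = (k \<cdot> (Ide C (Cod C p) \<star> q)) \<cdot> (p \<star> Ide C (Cod C f'))" by simp
  then show thesis using that k by (simp add: kh hp)
qed

section \<open>Coimages and powers of an algebra\<close>

definition coimage :: "'m \<Rightarrow> 'm" where
  "coimage \<mu> = cokernel_of C (kernel_of C \<mu>)"

lemma kernel_arr [simp]:
  assumes "\<mu> \<in> Arr C"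
  shows "kernel_of C \<mu> \<in> Arr C" "Cod C (kernel_of C \<mu>) = Dom C \<mu>"
    "\<mu> \<cdot> kernel_of C \<mu> = Zero C (Dom C (kernel_of C \<mu>)) (Cod C \<mu>)"
  using is_kernel_kernel_of[OF assms] by (simp_all add: is_kernel_def Hom_def)

lemma is_cokernel_coimage: "\<mu> \<in> Arr C \<Longrightarrow> is_cokernel C (kernel_of C \<mu>) (coimage \<mu>)"
  unfolding coimage_def by (simp add: is_cokernel_cokernel_of)

lemma coimage_arr [simp]:
  assumes "\<mu> \<in> Arr C"
  shows "coimage \<mu> \<in> Arr C" "Dom C (coimage \<mu>) = Dom C \<mu>"
  using cokernelE[OF is_cokernel_coimage[OF assms]] assms by simp_all

lemmas coimage_epi = cokernel_epi[OF is_cokernel_coimage]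
lemmas tarr_coimage_epi = tarr_cokernel_epi[OF is_cokernel_coimage is_cokernel_coimage]

text \<open>The difference of \<open>u\<close> and \<open>v\<close> factors through the kernel of
  \<open>\<mu>\<close>, which the coimage kills. In this way an identity between maps into a power
  is reduced to one between iterated multiplications, although the map from the power to the algebra
  may fail to be monic.\<close>

lemma coimage_eqI:
  assumes [simp]: "\<mu> \<in> Arr C" "u \<in> Arr C" "v \<in> Arr C" "Dom C v = Dom C u" "Cod C u = Dom C \<mu>" "Cod C v = Dom C \<mu>"
    and eq: "\<mu> \<cdot> u = \<mu> \<cdot> v"
  shows "coimage \<mu> \<cdot> u = coimage \<mu> \<cdot> v"
proof -
  have "\<mu> \<cdot> (u \<boxplus> Neg C v) = Zero C (Dom C u) (Cod C \<mu>)" by (simp add: eq)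
  then obtain h where h: "h \<in> Hom C (Dom C u) (Dom C (kernel_of C \<mu>))" and "kernel_of C \<mu> \<cdot> h = u \<boxplus> Neg C v"
    using is_kernel_kernel_of[of \<mu>] unfolding is_kernel_def
    by (metis (no_types, lifting) Hom_I add_arr assms neg_arr(1-3))
  then have "coimage \<mu> \<cdot> (u \<boxplus> Neg C v) = coimage \<mu> \<cdot> (kernel_of C \<mu> \<cdot> h)" by simp
  also have "\<dots> = (coimage \<mu> \<cdot> kernel_of C \<mu>) \<cdot> h" using HomE[OF h] by simp
  also have "\<dots> = Zero C (Dom C u) (Cod C (coimage \<mu>))"
    using cokernelE(4)[OF is_cokernel_coimage, of \<mu>] HomE[OF h] by simp
  finally show ?thesis by (subst eq_iff_add_neg) simp_all
qed

lemma coimage_factor: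
  assumes [simp]: "\<mu> \<in> Arr C" "g \<in> Arr C" "Dom C g = Dom C \<mu>"
    "g \<cdot> kernel_of C \<mu> = Zero C (Dom C (kernel_of C \<mu>)) (Cod C g)"
  shows "\<exists>!h. h \<in> Hom C (Cod C (coimage \<mu>)) (Cod C g) \<and> h \<cdot> coimage \<mu> = g"
  using is_cokernel_coimage[of \<mu>] unfolding is_cokernel_def
  by (metis (no_types, lifting) Hom_I assms kernel_arr(2))

lemma power_proj_eq: "power_proj C R n = coimage (nmult C R n)"
  by (simp add: power_proj_def coimage_def)

lemma power_proj_arr [simp]:
  assumes "is_alg C R"
  shows "power_proj C R (Suc n) \<in> Arr C" "Dom C (power_proj C R (Suc n)) = Und R \<boxtimes> tpow C (Und R) n"
    "Cod C (power_proj C R (Suc n)) = power_obj C R (Suc n)" "power_obj C R (Suc n) \<in> Obj C"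
proof -
  show "power_proj C R (Suc n) \<in> Arr C" using assms by (simp add: power_proj_eq)
  then show "power_obj C R (Suc n) \<in> Obj C" by (simp add: power_obj_def)
qed (use assms in \<open>simp_all add: power_proj_eq power_obj_def\<close>)

text \<open>An arrow \<open>g\<close> lying over an arrow \<open>h\<close> between the targets of
  the two multiplications maps the kernel of the first into that of the second, hence descends to
  coimages.\<close>

lemma power_proj_factor:
  assumes R: "is_alg C R" and g: "g \<in> Hom C (Und R \<boxtimes> tpow C (Und R) n) y"
    and gk: "\<mu> \<cdot> g = h \<cdot> nmult C R (Suc n)" "\<mu> \<in> Arr C" "Dom C \<mu> = y" "h \<in> Hom C (Und R) (Cod C \<mu>)"
  shows "\<exists>!t. t \<in> Hom C (power_obj C R (Suc n)) (Cod C (coimage \<mu>)) \<and> t \<cdot> power_proj C R (Suc n) = coimage \<mu> \<cdot> g"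
proof -
  note [simp] = R HomE[OF g] gk(2,3) HomE(1-3)[OF gk(4)]
  let ?k = "kernel_of C (nmult C R (Suc n))"
  have "\<mu> \<cdot> (g \<cdot> ?k) = (h \<cdot> nmult C R (Suc n)) \<cdot> ?k" by (simp flip: gk(1))
  also have "\<dots> = \<mu> \<cdot> Zero C (Dom C ?k) y" by simp
  finally have "coimage \<mu> \<cdot> (g \<cdot> ?k) = coimage \<mu> \<cdot> Zero C (Dom C ?k) y"
    by (rule coimage_eqI[rotated -1]) simp_all
  then have "(coimage \<mu> \<cdot> g) \<cdot> ?k = Zero C (Dom C ?k) (Cod C (coimage \<mu>))" by simp
  then show ?thesis using coimage_factor[of "nmult C R (Suc n)" "coimage \<mu> \<cdot> g"]
    by (simp add: power_proj_eq power_obj_def)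
qed

lemma power_proj_epi:
  assumes "is_alg C R" "f \<cdot> power_proj C R (Suc n) = g \<cdot> power_proj C R (Suc n)"
    "f \<in> Arr C" "g \<in> Arr C" "Dom C f = power_obj C R (Suc n)" "Dom C g = power_obj C R (Suc n)" "Cod C f = Cod C g"
  shows "f = g"
  by (rule coimage_epi[of "nmult C R (Suc n)"]) (use assms in \<open>simp_all add: power_proj_eq power_obj_def\<close>)

lemma tarr_power_proj_epi:
  assumes "is_alg C R" "f \<cdot> (power_proj C R (Suc n) \<star> power_proj C R (Suc n)) = g \<cdot> (power_proj C R (Suc n) \<star> power_proj C R (Suc n))"
    "f \<in> Arr C" "g \<in> Arr C" "Dom C f = power_obj C R (Suc n) \<boxtimes> power_obj C R (Suc n)"
    "Dom C g = power_obj C R (Suc n) \<boxtimes> power_obj C R (Suc n)" "Cod C f = Cod C g"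
  shows "f = g"
  by (rule tarr_coimage_epi[of "nmult C R (Suc n)" "nmult C R (Suc n)"])
    (use assms in \<open>simp_all add: power_proj_eq power_obj_def\<close>)

lemma power_incl:
  assumes R: "is_alg C R"
  shows "power_incl C R (Suc n) \<in> Hom C (power_obj C R (Suc n)) (Und R)"
    and "power_incl C R (Suc n) \<cdot> power_proj C R (Suc n) = nmult C R (Suc n)"
proof -
  note [simp] = R
  have "\<exists>!j. j \<in> Hom C (power_obj C R (Suc n)) (Und R) \<and> j \<cdot> power_proj C R (Suc n) = nmult C R (Suc n)"
    using coimage_factor[of "nmult C R (Suc n)" "nmult C R (Suc n)"]
    by (simp add: power_proj_eq power_obj_def)
  from theI'[OF this] show "power_incl C R (Suc n) \<in> Hom C (power_obj C R (Suc n)) (Und R)"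
    and "power_incl C R (Suc n) \<cdot> power_proj C R (Suc n) = nmult C R (Suc n)"
    unfolding power_incl_def by blast+
qed

lemma power_proj_eqI:
  assumes "is_alg C R" "u \<in> Arr C" "v \<in> Arr C" "Dom C v = Dom C u" "Cod C u = Und R \<boxtimes> tpow C (Und R) n"
    "Cod C v = Und R \<boxtimes> tpow C (Und R) n" "nmult C R (Suc n) \<cdot> u = nmult C R (Suc n) \<cdot> v"
  shows "power_proj C R (Suc n) \<cdot> u = power_proj C R (Suc n) \<cdot> v"
  unfolding power_proj_eq by (rule coimage_eqI) (use assms in simp_all)

text \<open>The product of the power with exponent n + 1, as prescribed on tensor powers: all n + 1
  factors of the first argument are merged with the first factor of the second.\<close>

definition mult_lift :: "('o, 'm) alg \<Rightarrow> nat \<Rightarrow> 'm" where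
  "mult_lift R n = nmult C R (Suc (Suc n)) \<star> Ide C (tpow C (Und R) n)"

lemma mult_lift:
  assumes R: "is_alg C R"
  shows "mult_lift R n \<in> Arr C" "Dom C (mult_lift R n) = Und R \<boxtimes> Und R \<boxtimes> tpow C (Und R) n \<boxtimes> tpow C (Und R) n"
    "Cod C (mult_lift R n) = Und R \<boxtimes> tpow C (Und R) n"
    and mult_lift_eq: "mult_lift R n = (Mul R \<star> Ide C (tpow C (Und R) n)) \<cdot> (nmult C R (Suc n) \<star> Ide C (Und R) \<star> Ide C (tpow C (Und R) n))"
    and nmult_mult_lift: "nmult C R (Suc n) \<cdot> mult_lift R n = Mul R \<cdot> (nmult C R (Suc n) \<star> nmult C R (Suc n))"
proof -
  note [simp] = R
  show "mult_lift R n \<in> Arr C" "Dom C (mult_lift R n) = Und R \<boxtimes> Und R \<boxtimes> tpow C (Und R) n \<boxtimes> tpow C (Und R) n"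
    "Cod C (mult_lift R n) = Und R \<boxtimes> tpow C (Und R) n"
    by (simp_all add: mult_lift_def)
  have "nmult C R (Suc (Suc n)) = Mul R \<cdot> (nmult C R (Suc n) \<star> Ide C (Und R))"
    using nmult_add[OF R, of n 0] by (simp add: nmult_1)
  then show eq: "mult_lift R n = (Mul R \<star> Ide C (tpow C (Und R) n)) \<cdot> (nmult C R (Suc n) \<star> Ide C (Und R) \<star> Ide C (tpow C (Und R) n))"
    by (simp add: mult_lift_def)
  have "nmult C R (Suc n) \<cdot> ((Mul R \<star> Ide C (tpow C (Und R) n)) \<cdot> (nmult C R (Suc n) \<star> Ide C (Und R) \<star> Ide C (tpow C (Und R) n)))
    = (Mul R \<cdot> (Ide C (Und R) \<star> nmult C R (Suc n))) \<cdot> (nmult C R (Suc n) \<star> Ide C (Und R) \<star> Ide C (tpow C (Und R) n))"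
    by (rule comp_eq_comp) (simp_all add: nmult_mul_left nmult_Suc_Suc)
  then show "nmult C R (Suc n) \<cdot> mult_lift R n = Mul R \<cdot> (nmult C R (Suc n) \<star> nmult C R (Suc n))"
    unfolding eq by simp
qed

lemma Und_power_alg [simp]: "Und (power_alg C R n) = power_obj C R n"
  by (simp add: power_alg_def)

text \<open>\<open>mult_lift\<close> lies over the multiplication of \<open>R\<close>. If one
  argument is in the kernel of the iterated multiplication, then so is the result, and the
  projection kills it; this gives existence of the arrow described in \<open>power_alg\<close>. It
  is unique because a tensor product of projections is epi.\<close>

lemma power_mult:
  fixes n :: nat
  assumes R: "is_alg C R"
  defines "p \<equiv> power_proj C R (Suc n)"
  shows "Mul (power_alg C R (Suc n)) \<in> Hom C (power_obj C R (Suc n) \<boxtimes> power_obj C R (Suc n)) (power_obj C R (Suc n))"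
    and "Mul (power_alg C R (Suc n)) \<cdot> (p \<star> p) = p \<cdot> mult_lift R n"
proof -
  let ?\<mu> = "nmult C R (Suc n)" and ?k = "kernel_of C (nmult C R (Suc n))"
  let ?T = "Und R \<boxtimes> tpow C (Und R) n" and ?O = "power_obj C R (Suc n)"
  note [simp] = R mult_lift(1-3)[OF R]
  have p [simp]: "p \<in> Arr C" "Dom C p = ?T" "Cod C p = ?O" unfolding p_def by simp_all
  have cok: "is_cokernel C ?k p" unfolding p_def power_proj_eq by (rule is_cokernel_coimage) simp
  have T: "?T \<boxtimes> ?T = Und R \<boxtimes> Und R \<boxtimes> tpow C (Und R) n \<boxtimes> tpow C (Und R) n" by (simp add: tpow_right)
  \<comment> \<open>Vanishing under \<open>?\<mu> \<star> ?\<mu>\<close> suffices; the conditions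
    for factoring in either argument are both instances.\<close>
  have kill: "p \<cdot> (mult_lift R n \<cdot> x) = Zero C (Dom C x) ?O"
    if x: "x \<in> Arr C" "Cod C x = ?T \<boxtimes> ?T" and "(?\<mu> \<star> ?\<mu>) \<cdot> x = Zero C (Dom C x) (Und R \<boxtimes> Und R)" for x
  proof -
    note [simp] = x[unfolded T]
    have "?\<mu> \<cdot> (mult_lift R n \<cdot> x) = (Mul R \<cdot> (?\<mu> \<star> ?\<mu>)) \<cdot> x"
      by (rule comp_eq_comp[OF nmult_mult_lift[OF R]]) simp_all
    also have "\<dots> = ?\<mu> \<cdot> Zero C (Dom C x) ?T"
      using that(3) by (simp add: tpow_right)
    finally have "p \<cdot> (mult_lift R n \<cdot> x) = p \<cdot> Zero C (Dom C x) ?T"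
      unfolding p_def by (rule power_proj_eqI[OF R, rotated -1]) simp_all
    then show ?thesis by simp
  qed
  have "\<exists>!m. m \<in> Hom C (?O \<boxtimes> ?O) ?O \<and> m \<cdot> (p \<star> p) = p \<cdot> mult_lift R n"
  proof -
    obtain m where m: "m \<in> Hom C (?O \<boxtimes> ?O) ?O" "m \<cdot> (p \<star> p) = p \<cdot> mult_lift R n"
    proof (rule tarr_cokernel_factor[OF cok cok, of "p \<cdot> mult_lift R n"])
      show "(p \<cdot> mult_lift R n) \<cdot> (?k \<star> Ide C (Cod C ?k)) = Zero C (Dom C ?k \<boxtimes> Cod C ?k) (Cod C (p \<cdot> mult_lift R n))"
        using kill[of "?k \<star> Ide C ?T"] by (simp add: tpow_right)
      show "(p \<cdot> mult_lift R n) \<cdot> (Ide C (Cod C ?k) \<star> ?k) = Zero C (Cod C ?k \<boxtimes> Dom C ?k) (Cod C (p \<cdot> mult_lift R n))"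
        using kill[of "Ide C ?T \<star> ?k"] interchange[of "Ide C ?T" ?k ?\<mu> ?\<mu>] by (simp add: tpow_right)
    qed (simp_all add: tpow_right)
    moreover have "m' = m" if "m' \<in> Hom C (?O \<boxtimes> ?O) ?O \<and> m' \<cdot> (p \<star> p) = p \<cdot> mult_lift R n" for m'
    proof -
      have m': "m' \<in> Hom C (?O \<boxtimes> ?O) ?O" "m' \<cdot> (p \<star> p) = p \<cdot> mult_lift R n" using that by auto
      show "m' = m"
        by (rule tarr_power_proj_epi[OF R, folded p_def])
          (simp_all only: m(2)[unfolded p_def] m'(2)[unfolded p_def] HomE[OF m(1)] HomE[OF m'(1)])
    qed
    ultimately show ?thesis by blast
  qed
  from theI'[OF this] show "Mul (power_alg C R (Suc n)) \<in> Hom C (?O \<boxtimes> ?O) ?O"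
    and "Mul (power_alg C R (Suc n)) \<cdot> (p \<star> p) = p \<cdot> mult_lift R n"
    unfolding power_alg_def p_def mult_lift_def by simp_all
qed

text \<open>After composition with three projections both bracketings come from maps of tensor
  powers. The iterated multiplication turns these into the two bracketings of a triple product in
  \<open>R\<close>.\<close>

lemma power_alg_is_alg:
  assumes R: "is_alg C R"
  shows "is_alg C (power_alg C R (Suc n))"
proof -
  let ?\<mu> = "nmult C R (Suc n)" and ?L = "mult_lift R n" and ?T = "Und R \<boxtimes> tpow C (Und R) n"
    and ?O = "power_obj C R (Suc n)"
  define p where "p = power_proj C R (Suc n)"
  define m where "m = Mul (power_alg C R (Suc n))"
  note [simp] = R mult_lift(1-3)[OF R]
  have p [simp]: "p \<in> Arr C" "Dom C p = ?T" "Cod C p = ?O" unfolding p_def by simp_all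
  have m_hom: "m \<in> Hom C (?O \<boxtimes> ?O) ?O" and mp: "m \<cdot> (p \<star> p) = p \<cdot> ?L"
    using power_mult[OF R] by (simp_all add: m_def p_def)
  note [simp] = HomE(1-3)[OF m_hom]
  have T: "?T \<boxtimes> ?T = Und R \<boxtimes> Und R \<boxtimes> tpow C (Und R) n \<boxtimes> tpow C (Und R) n" by (simp add: tpow_right)
  have mp': "m \<cdot> ((p \<star> p) \<cdot> x) = p \<cdot> (?L \<cdot> x)" if "x \<in> Arr C" "Cod C x = ?T \<boxtimes> ?T" for x
    using that by (intro comp_eq_extend[OF mp]) (simp_all add: tpow_right)
  have \<mu>L: "?\<mu> \<cdot> (?L \<cdot> x) = Mul R \<cdot> ((?\<mu> \<star> ?\<mu>) \<cdot> x)" if "x \<in> Arr C" "Cod C x = ?T \<boxtimes> ?T" for x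
    using that by (intro comp_eq_extend[OF nmult_mult_lift[OF R]]) (simp_all add: tpow_right)
  have cok: "is_cokernel C (kernel_of C ?\<mu>) p" unfolding p_def power_proj_eq by (rule is_cokernel_coimage) simp
  have l: "(m \<cdot> (m \<star> Ide C ?O)) \<cdot> (p \<star> p \<star> p) = p \<cdot> (?L \<cdot> (?L \<star> Ide C ?T))"
  proof -
    have "(m \<cdot> (m \<star> Ide C ?O)) \<cdot> (p \<star> p \<star> p) = m \<cdot> ((m \<cdot> (p \<star> p)) \<star> p)" by simp
    also have "\<dots> = m \<cdot> ((p \<star> p) \<cdot> (?L \<star> Ide C ?T))" unfolding mp by (simp del: ide_tobj)
    also have "\<dots> = p \<cdot> (?L \<cdot> (?L \<star> Ide C ?T))" by (rule mp') simp_all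
    finally show ?thesis .
  qed
  have r: "(m \<cdot> (Ide C ?O \<star> m)) \<cdot> (p \<star> p \<star> p) = p \<cdot> (?L \<cdot> (Ide C ?T \<star> ?L))"
  proof -
    have "(m \<cdot> (Ide C ?O \<star> m)) \<cdot> (p \<star> p \<star> p) = m \<cdot> (p \<star> (m \<cdot> (p \<star> p)))" by simp
    also have "\<dots> = m \<cdot> ((p \<star> p) \<cdot> (Ide C ?T \<star> ?L))" unfolding mp by (simp del: ide_tobj)
    also have "\<dots> = p \<cdot> (?L \<cdot> (Ide C ?T \<star> ?L))" by (rule mp') simp_all
    finally show ?thesis .
  qed
  have "?\<mu> \<cdot> (?L \<cdot> (?L \<star> Ide C ?T)) = Mul R \<cdot> ((?\<mu> \<star> ?\<mu>) \<cdot> (?L \<star> Ide C ?T))"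
    by (rule \<mu>L) simp_all
  also have "\<dots> = Mul R \<cdot> ((Mul R \<cdot> (?\<mu> \<star> ?\<mu>)) \<star> ?\<mu>)"
    by (simp add: nmult_mult_lift del: ide_tobj)
  also have "\<dots> = Mul R \<cdot> ((Ide C (Und R) \<star> Mul R) \<cdot> ((?\<mu> \<star> ?\<mu>) \<star> ?\<mu>))"
    by (rule mul_assoc(2)) simp_all
  also have "\<dots> = Mul R \<cdot> ((?\<mu> \<star> ?\<mu>) \<cdot> (Ide C ?T \<star> ?L))"
    by (simp add: nmult_mult_lift del: ide_tobj)
  also have "\<dots> = ?\<mu> \<cdot> (?L \<cdot> (Ide C ?T \<star> ?L))"
    by (rule \<mu>L[symmetric]) simp_all
  finally have "p \<cdot> (?L \<cdot> (?L \<star> Ide C ?T)) = p \<cdot> (?L \<cdot> (Ide C ?T \<star> ?L))"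
    unfolding p_def by (rule power_proj_eqI[OF R, rotated -1]) (simp_all add: tpow_right del: ide_tobj)
  then have "(m \<cdot> (m \<star> Ide C ?O)) \<cdot> (p \<star> p \<star> p) = (m \<cdot> (Ide C ?O \<star> m)) \<cdot> (p \<star> p \<star> p)"
    unfolding l r .
  then have "m \<cdot> (m \<star> Ide C ?O) = m \<cdot> (Ide C ?O \<star> m)"
    by (rule tarr3_cokernel_epi[OF cok]) simp_all
  then show ?thesis using m_hom power_proj_arr(4)[OF R, of n] by (simp add: is_alg_def m_def)
qed

lemma power_incl_hom:
  assumes R: "is_alg C R"
  shows "is_alg_hom C (power_alg C R (Suc n)) R (power_incl C R (Suc n))"
proof -
  let ?p = "power_proj C R (Suc n)" and ?j = "power_incl C R (Suc n)" and ?P = "power_alg C R (Suc n)"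
  note [simp] = R mult_lift(1-3)[OF R] HomE(1-3)[OF power_incl(1)[OF R]] HomE(1-3)[OF power_mult(1)[OF R]]
  have "(?j \<cdot> Mul ?P) \<cdot> (?p \<star> ?p) = (?j \<cdot> ?p) \<cdot> mult_lift R n"
    by (simp add: power_mult(2)[OF R])
  also have "\<dots> = (Mul R \<cdot> (?j \<star> ?j)) \<cdot> (?p \<star> ?p)"
    by (simp add: power_incl(2)[OF R] nmult_mult_lift[OF R])
  finally have "?j \<cdot> Mul ?P = Mul R \<cdot> (?j \<star> ?j)"
    by (rule tarr_power_proj_epi[OF R]) simp_all
  then show ?thesis using power_incl(1)[OF R] by (simp add: is_alg_hom_def)
qed

text \<open>\<open>e\<close> is the prescription on tensor powers. It lies over \<open>f\<close>,
  which is the third conclusion; the others follow by descending to coimages and comparing iterated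
  multiplications.\<close>

lemma power_trans:
  fixes n :: nat
  assumes R: "is_alg C R" and S: "is_alg C S" and f: "is_alg_hom C R S f"
  defines "t \<equiv> power_trans C R S f (Suc n)"
    and "e \<equiv> tpow_arr C f (Suc n) \<cdot> (Mul R \<star> Ide C (tpow C (Und R) n))"
  shows "t \<in> Hom C (power_obj C R (Suc (Suc n))) (power_obj C S (Suc n))"
    and "t \<cdot> power_proj C R (Suc (Suc n)) = power_proj C S (Suc n) \<cdot> e"
    and "nmult C S (Suc n) \<cdot> e = f \<cdot> nmult C R (Suc (Suc n))"
    and "is_alg_hom C (power_alg C R (Suc (Suc n))) (power_alg C S (Suc n)) t"
    and "power_incl C S (Suc n) \<cdot> t = f \<cdot> power_incl C R (Suc (Suc n))"
proof -
  note [simp] = R S alg_hom_arr[OF f] mult_lift(1-3)[OF R] mult_lift(1-3)[OF S]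
    HomE(1-3)[OF power_incl(1)[OF R]] HomE(1-3)[OF power_incl(1)[OF S]]
    HomE(1-3)[OF power_mult(1)[OF R]] HomE(1-3)[OF power_mult(1)[OF S]]
  have e [simp]: "e \<in> Arr C" "Dom C e = Und R \<boxtimes> Und R \<boxtimes> tpow C (Und R) n" "Cod C e = Und S \<boxtimes> tpow C (Und S) n"
    unfolding e_def by simp_all
  let ?pR = "power_proj C R (Suc (Suc n))" and ?pS = "power_proj C S (Suc n)"
    and ?mR = "nmult C R (Suc (Suc n))" and ?mS = "nmult C S (Suc n)"
  have "?mS \<cdot> e = (?mS \<cdot> tpow_arr C f (Suc n)) \<cdot> (Mul R \<star> Ide C (tpow C (Und R) n))"
    unfolding e_def by simp
  also have "\<dots> = f \<cdot> (nmult C R (Suc n) \<cdot> (Mul R \<star> Ide C (tpow C (Und R) n)))"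
    using nmult_natural[OF R S f, of n] by (simp del: interchange interchange_comp flip: comp_comp)
  finally show me: "?mS \<cdot> e = f \<cdot> ?mR" unfolding nmult_mul_left[OF R] .
  have "\<exists>!t. t \<in> Hom C (power_obj C R (Suc (Suc n))) (power_obj C S (Suc n)) \<and> t \<cdot> ?pR = ?pS \<cdot> e"
    using power_proj_factor[OF R, of e "Suc n" "Und S \<boxtimes> tpow C (Und S) n" ?mS f] me
    by (simp add: power_proj_eq power_obj_def Hom_def)
  from theI'[OF this] have t: "t \<in> Hom C (power_obj C R (Suc (Suc n))) (power_obj C S (Suc n)) \<and> t \<cdot> ?pR = ?pS \<cdot> e"
    unfolding t_def power_trans_def e_def by simp
  then show t_hom: "t \<in> Hom C (power_obj C R (Suc (Suc n))) (power_obj C S (Suc n))" and tp: "t \<cdot> ?pR = ?pS \<cdot> e" by simp_all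
  note [simp] = HomE(1-3)[OF t_hom]
  have "(power_incl C S (Suc n) \<cdot> t) \<cdot> ?pR = (power_incl C S (Suc n) \<cdot> ?pS) \<cdot> e" by (simp add: tp)
  also have "\<dots> = (f \<cdot> power_incl C R (Suc (Suc n))) \<cdot> ?pR"
    by (simp add: power_incl(2)[OF R] power_incl(2)[OF S] me)
  finally show "power_incl C S (Suc n) \<cdot> t = f \<cdot> power_incl C R (Suc (Suc n))"
    by (rule power_proj_epi[OF R]) simp_all
  let ?PR = "power_alg C R (Suc (Suc n))" and ?PS = "power_alg C S (Suc n)"
  have "?mS \<cdot> (e \<cdot> mult_lift R (Suc n)) = f \<cdot> (?mR \<cdot> mult_lift R (Suc n))"
    by (rule comp_eq_extend[OF me]) simp_all
  also have "\<dots> = Mul S \<cdot> ((f \<star> f) \<cdot> (?mR \<star> ?mR))"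
    unfolding nmult_mult_lift[OF R] by (rule comp_eq_extend[OF alg_homE(2)[OF f]]) simp_all
  also have "\<dots> = (?mS \<cdot> mult_lift S n) \<cdot> (e \<star> e)"
    unfolding nmult_mult_lift[OF S] by (simp add: me)
  also have "\<dots> = ?mS \<cdot> (mult_lift S n \<cdot> (e \<star> e))" by (simp add: tpow_right)
  finally have pe: "?pS \<cdot> (e \<cdot> mult_lift R (Suc n)) = ?pS \<cdot> (mult_lift S n \<cdot> (e \<star> e))"
    by (rule power_proj_eqI[OF S, rotated -1]) (simp_all add: tpow_right)
  have "(t \<cdot> Mul ?PR) \<cdot> (?pR \<star> ?pR) = (t \<cdot> ?pR) \<cdot> mult_lift R (Suc n)"
    by (simp add: power_mult(2)[OF R])
  also have "\<dots> = (?pS \<cdot> mult_lift S n) \<cdot> (e \<star> e)" unfolding tp using pe by (simp add: tpow_right)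
  also have "\<dots> = (Mul ?PS \<cdot> (t \<star> t)) \<cdot> (?pR \<star> ?pR)"
    unfolding power_mult(2)[OF S, symmetric] by (simp add: tp)
  finally have "t \<cdot> Mul ?PR = Mul ?PS \<cdot> (t \<star> t)"
    by (rule tarr_power_proj_epi[OF R]) simp_all
  then show "is_alg_hom C ?PR ?PS t" using t_hom by (simp add: is_alg_hom_def)
qed

text \<open>Surplus factors are merged at the front. Identities that a splitting satisfies on
  products of q + 1 elements thereby become available on the longer products that make up a deeper
  power.\<close>

lemma nmult_factor:
  assumes R: "is_alg C R" and "q \<le> M"
  obtains y where "y \<in> Hom C (Und R \<boxtimes> tpow C (Und R) M) (Und R \<boxtimes> tpow C (Und R) q)"
    "nmult C R (Suc M) = nmult C R (Suc q) \<cdot> y"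
proof -
  note [simp] = R
  have "\<exists>y. y \<in> Hom C (Und R \<boxtimes> tpow C (Und R) (q + d)) (Und R \<boxtimes> tpow C (Und R) q) \<and>
    nmult C R (Suc (q + d)) = nmult C R (Suc q) \<cdot> y" for d
  proof (induction d)
    case 0
    show ?case by (rule exI[of _ "Ide C (Und R \<boxtimes> tpow C (Und R) q)"]) (simp add: Hom_def del: ide_tobj)
  next
    case (Suc d)
    then obtain y where y: "y \<in> Hom C (Und R \<boxtimes> tpow C (Und R) (q + d)) (Und R \<boxtimes> tpow C (Und R) q)"
      and eq: "nmult C R (Suc (q + d)) = nmult C R (Suc q) \<cdot> y" by blast
    note [simp] = HomE(1-3)[OF y]
    let ?y = "y \<cdot> (Mul R \<star> Ide C (tpow C (Und R) (q + d)))"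
    have "nmult C R (Suc (q + Suc d)) = (nmult C R (Suc q) \<cdot> y) \<cdot> (Mul R \<star> Ide C (tpow C (Und R) (q + d)))"
      unfolding eq[symmetric] by (simp add: nmult_mul_left)
    also have "\<dots> = nmult C R (Suc q) \<cdot> ?y" by simp
    finally show ?case by (intro exI[of _ ?y]) (simp add: Hom_def)
  qed
  from this[of "M - q"] show thesis using assms(2) that by auto
qed

text \<open>Here \<open>T\<close> and \<open>TR\<close> stand for tensor powers, \<open>p\<close> and \<open>pR\<close> for the projections to the corresponding
  powers of the algebras, and \<open>\<tau>\<close> splits the multiplication with an even number of factors.\<close>

lemma power_section_step:
  assumes "\<mu> \<in> Hom C T u" "l \<in> Hom C (u \<boxtimes> T) T" "p \<in> Hom C T O'" "m \<in> Hom C (O' \<boxtimes> O') O'"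
    and mp: "m \<cdot> (p \<star> p) = p \<cdot> (l \<cdot> (\<mu> \<star> Ide C T))"
    and "pR \<in> Hom C TR OR" "j \<in> Hom C OR a" "\<tau> \<in> Hom C a (T \<boxtimes> T)" "mR \<in> Hom C (OR \<boxtimes> OR) OR"
    "mu \<in> Hom C (a \<boxtimes> a) a" "f \<in> Hom C a u" "t \<in> Hom C OR O'" "w \<in> Hom C TR T"
    and jm: "j \<cdot> mR = mu \<cdot> (j \<star> j)" and tp: "t \<cdot> pR = p \<cdot> w" and w: "\<mu> \<cdot> w = f \<cdot> (j \<cdot> pR)"
    and lin: "\<tau> \<cdot> (mu \<cdot> (Ide C a \<star> (j \<cdot> pR))) = (l \<star> Ide C T) \<cdot> (f \<star> (\<tau> \<cdot> (j \<cdot> pR)))"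
    and sect: "p \<cdot> (l \<cdot> ((\<mu> \<star> Ide C T) \<cdot> (\<tau> \<cdot> (j \<cdot> pR)))) = p \<cdot> w"
  shows "(((p \<star> p) \<cdot> (\<tau> \<cdot> j)) \<cdot> mR) \<cdot> (pR \<star> pR) = ((m \<star> Ide C O') \<cdot> (t \<star> ((p \<star> p) \<cdot> (\<tau> \<cdot> j)))) \<cdot> (pR \<star> pR)"
    and "(m \<cdot> ((p \<star> p) \<cdot> (\<tau> \<cdot> j))) \<cdot> pR = t \<cdot> pR"
proof -
  note [simp] = HomE(1-5)[OF assms(1)] HomE(1-5)[OF assms(2)] HomE(1-5)[OF assms(3)] HomE(1-5)[OF assms(4)]
    HomE(1-5)[OF assms(6)] HomE(1-5)[OF assms(7)] HomE(1-5)[OF assms(8)] HomE(1-5)[OF assms(9)]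
    HomE(1-5)[OF assms(10)] HomE(1-5)[OF assms(11)] HomE(1-5)[OF assms(12)] HomE(1-5)[OF assms(13)]
  \<comment> \<open>\<open>z\<close> splits the product that a pure tensor represents.\<close>
  define z where "z = \<tau> \<cdot> (j \<cdot> pR)"
  have z [simp]: "z \<in> Arr C" "Dom C z = TR" "Cod C z = T \<boxtimes> T" unfolding z_def by simp_all
  have "(m \<cdot> ((p \<star> p) \<cdot> (\<tau> \<cdot> j))) \<cdot> pR = (p \<cdot> (l \<cdot> (\<mu> \<star> Ide C T))) \<cdot> z"
    unfolding mp[symmetric] z_def by simp
  also have "\<dots> = t \<cdot> pR" unfolding tp sect[folded z_def, symmetric] by simp
  finally show "(m \<cdot> ((p \<star> p) \<cdot> (\<tau> \<cdot> j))) \<cdot> pR = t \<cdot> pR" .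
  have "(((p \<star> p) \<cdot> (\<tau> \<cdot> j)) \<cdot> mR) \<cdot> (pR \<star> pR) = (p \<star> p) \<cdot> (\<tau> \<cdot> ((j \<cdot> mR) \<cdot> (pR \<star> pR)))" by simp
  also have "\<tau> \<cdot> ((j \<cdot> mR) \<cdot> (pR \<star> pR)) = (\<tau> \<cdot> (mu \<cdot> (Ide C a \<star> (j \<cdot> pR)))) \<cdot> ((j \<cdot> pR) \<star> Ide C TR)"
    unfolding jm by simp
  also have "\<dots> = (l \<star> Ide C T) \<cdot> ((f \<cdot> (j \<cdot> pR)) \<star> z)" unfolding lin by (simp add: z_def)
  \<comment> \<open>The first argument enters only through its image under \<open>f\<close>, which
    can be rewritten as the iterated product of its lift \<open>w\<close>. This matches the formula
    \<open>mp\<close> for the multiplication of the power.\<close>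
  also have "\<dots> = (l \<star> Ide C T) \<cdot> ((\<mu> \<cdot> w) \<star> z)" unfolding w ..
  finally have 1: "(((p \<star> p) \<cdot> (\<tau> \<cdot> j)) \<cdot> mR) \<cdot> (pR \<star> pR)
      = ((p \<cdot> l) \<star> p) \<cdot> ((\<mu> \<cdot> w) \<star> z)" by simp
  have "((m \<star> Ide C O') \<cdot> (t \<star> ((p \<star> p) \<cdot> (\<tau> \<cdot> j)))) \<cdot> (pR \<star> pR) = (m \<star> Ide C O') \<cdot> ((t \<cdot> pR) \<star> ((p \<star> p) \<cdot> z))"
    unfolding z_def by simp
  also have "\<dots> = (m \<star> Ide C O') \<cdot> ((p \<star> p \<star> p) \<cdot> (w \<star> z))" unfolding tp by simp
  also have "\<dots> = ((m \<cdot> (p \<star> p)) \<star> p) \<cdot> (w \<star> z)" by (rule comp_eq_comp) simp_all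
  also have "\<dots> = ((p \<cdot> l) \<star> p) \<cdot> ((\<mu> \<star> Ide C T \<star> Ide C T) \<cdot> (w \<star> z))"
    unfolding mp by (rule comp_eq_comp[symmetric]) simp_all
  also have "\<dots> = ((p \<cdot> l) \<star> p) \<cdot> ((\<mu> \<cdot> w) \<star> z)" by simp
  finally show "(((p \<star> p) \<cdot> (\<tau> \<cdot> j)) \<cdot> mR) \<cdot> (pR \<star> pR) = ((m \<star> Ide C O') \<cdot> (t \<star> ((p \<star> p) \<cdot> (\<tau> \<cdot> j)))) \<cdot> (pR \<star> pR)"
    unfolding 1 ..
qed

text \<open>The splitting has 2 n + 2 tensor factors, that is, two blocks of n + 1; projecting each
  block to the power gives \<open>s\<close>. Elements of the power with exponent M + 1 are products
  of at least 2 n + 2 elements, so the partial properties of \<open>\<tau>\<close> become linearity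
  and the section property without restriction.\<close>

lemma power_section:
  assumes R: "is_alg C R" and S: "is_alg C S" and f: "is_alg_hom C R S f"
    and \<tau>: "splits R S f (n + Suc n) \<tau>" and M: "n + Suc n \<le> M"
    and t: "t \<in> Hom C (power_obj C R (Suc M)) (power_obj C S (Suc n))"
    and w: "w \<in> Hom C (Und R \<boxtimes> tpow C (Und R) M) (Und S \<boxtimes> tpow C (Und S) n)"
    and tp: "t \<cdot> power_proj C R (Suc M) = power_proj C S (Suc n) \<cdot> w"
    and \<mu>w: "nmult C S (Suc n) \<cdot> w = f \<cdot> nmult C R (Suc M)"
  obtains s where "s \<in> Hom C (power_obj C R (Suc M)) (power_obj C S (Suc n) \<boxtimes> power_obj C S (Suc n))"
    "s \<cdot> Mul (power_alg C R (Suc M)) = (Mul (power_alg C S (Suc n)) \<star> Ide C (power_obj C S (Suc n))) \<cdot> (t \<star> s)"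
    "Mul (power_alg C S (Suc n)) \<cdot> s = t"
proof -
  define T where "T = Und S \<boxtimes> tpow C (Und S) n"
  define l where "l = Mul S \<star> Ide C (tpow C (Und S) n)"
  note [simp] = R S alg_hom_arr[OF f]
  have T [simp]: "T \<in> Obj C" and l: "l \<in> Hom C (Und S \<boxtimes> T) T" unfolding T_def l_def by (simp_all add: Hom_def)
  have ideT: "Ide C T = Ide C (Und S) \<star> Ide C (tpow C (Und S) n)" unfolding T_def by simp
  have \<tau>_hom: "\<tau> \<in> Hom C (Und R) (T \<boxtimes> T)"
    using \<tau> tpow_add[of "Und S" "Suc n" "Suc n"] by (simp add: splits_def T_def)
  let ?\<mu> = "nmult C S (Suc n)" and ?p = "power_proj C S (Suc n)" and ?m = "Mul (power_alg C S (Suc n))"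
    and ?pR = "power_proj C R (Suc M)" and ?j = "power_incl C R (Suc M)" and ?mR = "Mul (power_alg C R (Suc M))"
  let ?q = "n + Suc n"
  have \<mu>: "?\<mu> \<in> Hom C T (Und S)" and p: "?p \<in> Hom C T (power_obj C S (Suc n))"
    and pR: "?pR \<in> Hom C (Und R \<boxtimes> tpow C (Und R) M) (power_obj C R (Suc M))"
    unfolding T_def by (simp_all add: Hom_def)
  have lift: "mult_lift S n = l \<cdot> (?\<mu> \<star> Ide C T)"
    unfolding ideT l_def by (rule mult_lift_eq[OF S])
  obtain y where y: "y \<in> Hom C (Und R \<boxtimes> tpow C (Und R) M) (Und R \<boxtimes> tpow C (Und R) ?q)"
    and \<mu>y: "nmult C R (Suc M) = nmult C R (Suc ?q) \<cdot> y"
    using nmult_factor[OF R M] by blast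
  note [simp] = HomE(1-3)[OF \<tau>_hom] HomE(1-3)[OF y] HomE(1-3)[OF \<mu>] HomE(1-3)[OF p] HomE(1-3)[OF l] HomE(1-3)[OF w]
  have jp: "?j \<cdot> ?pR = nmult C R (Suc M)" by (rule power_incl(2)[OF R])
  have "Ide C (tpow C (Und S) ?q) = Ide C (tpow C (Und S) n) \<star> Ide C T"
    unfolding ideT using tpow_add[of "Und S" n "Suc n"] by simp
  then have \<tau>_lin: "\<tau> \<cdot> (Mul R \<cdot> (Ide C (Und R) \<star> nmult C R (Suc ?q))) = (l \<star> Ide C T) \<cdot> (f \<star> (\<tau> \<cdot> nmult C R (Suc ?q)))"
    using \<tau> by (simp add: splits_def l_def nmult_Suc_Suc del: add_Suc_right)
  have lin: "\<tau> \<cdot> (Mul R \<cdot> (Ide C (Und R) \<star> (?j \<cdot> ?pR))) = (l \<star> Ide C T) \<cdot> (f \<star> (\<tau> \<cdot> (?j \<cdot> ?pR)))"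
  proof -
    have "\<tau> \<cdot> (Mul R \<cdot> (Ide C (Und R) \<star> nmult C R (Suc M)))
        = (\<tau> \<cdot> (Mul R \<cdot> (Ide C (Und R) \<star> nmult C R (Suc ?q)))) \<cdot> (Ide C (Und R) \<star> y)"
      unfolding \<mu>y by (simp del: add_Suc_right)
    also have "\<dots> = (l \<star> Ide C T) \<cdot> (f \<star> (\<tau> \<cdot> nmult C R (Suc M)))"
      unfolding \<tau>_lin \<mu>y by (simp del: add_Suc_right)
    finally show ?thesis unfolding jp .
  qed
  have "?\<mu> \<cdot> (l \<cdot> ((?\<mu> \<star> Ide C T) \<cdot> (\<tau> \<cdot> nmult C R (Suc M)))) = (?\<mu> \<cdot> mult_lift S n) \<cdot> (\<tau> \<cdot> nmult C R (Suc M))"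
    unfolding lift by simp
  also have "\<dots> = (nmult C S (Suc ?q) \<cdot> (\<tau> \<cdot> nmult C R (Suc ?q))) \<cdot> y"
    unfolding nmult_mult_lift[OF S] \<mu>y using nmult_add[OF S, of n n] tpow_add[of "Und S" n "Suc n"]
    by (simp add: T_def)
  also have "nmult C S (Suc ?q) \<cdot> (\<tau> \<cdot> nmult C R (Suc ?q)) = f \<cdot> nmult C R (Suc ?q)"
    using \<tau> by (simp add: splits_def)
  also have "\<dots> \<cdot> y = ?\<mu> \<cdot> w" unfolding \<mu>w \<mu>y by (simp del: add_Suc_right)
  finally have "?p \<cdot> (l \<cdot> ((?\<mu> \<star> Ide C T) \<cdot> (\<tau> \<cdot> nmult C R (Suc M)))) = ?p \<cdot> w"
    by (rule power_proj_eqI[OF S, rotated -1]) (simp_all add: T_def)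
  then have sect: "?p \<cdot> (l \<cdot> ((?\<mu> \<star> Ide C T) \<cdot> (\<tau> \<cdot> (?j \<cdot> ?pR)))) = ?p \<cdot> w" unfolding jp .
  define s where "s = (?p \<star> ?p) \<cdot> (\<tau> \<cdot> ?j)"
  note step = power_section_step[OF \<mu> l p power_mult(1)[OF S] _ pR power_incl(1)[OF R] \<tau>_hom power_mult(1)[OF R]
      algE(1)[OF R] alg_homE(1)[OF f] t w[folded T_def] alg_homE(2)[OF power_incl_hom[OF R], unfolded Und_power_alg]
      tp _ lin sect, folded s_def]
  note [simp] = HomE(1-3)[OF power_incl(1)[OF R]] HomE(1-3)[OF power_mult(1)[OF R]] HomE(1-3)[OF power_mult(1)[OF S]]
    HomE(1-3)[OF t]
  have s [simp]: "s \<in> Arr C" "Dom C s = power_obj C R (Suc M)" "Cod C s = power_obj C S (Suc n) \<boxtimes> power_obj C S (Suc n)"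
    unfolding s_def by simp_all
  show thesis
  proof (rule that)
    show "s \<in> Hom C (power_obj C R (Suc M)) (power_obj C S (Suc n) \<boxtimes> power_obj C S (Suc n))" by (simp add: Hom_def)
    show "s \<cdot> ?mR = (?m \<star> Ide C (power_obj C S (Suc n))) \<cdot> (t \<star> s)"
      by (rule tarr_power_proj_epi[OF R step(1)]) (simp_all add: power_mult(2)[OF S] lift jp \<mu>w)
    show "?m \<cdot> s = t"
      by (rule power_proj_epi[OF R step(2)]) (simp_all add: power_mult(2)[OF S] lift jp \<mu>w)
  qed
qed

end

section \<open>The category of pro-objects\<close>

text \<open>Operations on pro-maps are defined by closing the set of results for all representatives
  under the equivalence; this identifies such a closure with the class of a single result.\<close>

lemma equiv_Image_eq:
  assumes r: "equiv S r" and "X \<subseteq> r `` {x}" "X \<noteq> {}"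
  shows "r `` X = r `` {x}"
proof
  show "r `` X \<subseteq> r `` {x}" using assms(2) equivE[OF r] by (fast dest: transD)
  obtain y where "y \<in> X" "(x, y) \<in> r" using assms by blast
  moreover have "(y, z) \<in> r" if "(x, z) \<in> r" for z
    using \<open>(x, y) \<in> r\<close> that equivE[OF r] by (meson symD transD)
  ultimately show "r `` {x} \<subseteq> r `` X" by blast
qed

context base_category
begin

text \<open>\<open>bond\<close> counts steps, whereas \<open>bnd A n k\<close> names the levels: it
  goes from level \<open>k\<close> to level \<open>n\<close> and is meant for n \<le> k.\<close>

definition bnd :: "('o, 'm) inv_sys \<Rightarrow> nat \<Rightarrow> nat \<Rightarrow> 'm" where
  "bnd A n k = bond C A n (k - n)"

lemma inv_sysE [simp]:
  assumes "is_inv_sys C A"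
  shows "Lev A n \<in> Obj C" "Tr A n \<in> Arr C" "Dom C (Tr A n) = Lev A (Suc n)" "Cod C (Tr A n) = Lev A n"
  using assms by (auto simp: is_inv_sys_def Hom_def)

lemma bond_arr [simp]:
  assumes "is_inv_sys C A"
  shows "bond C A n d \<in> Arr C" "Dom C (bond C A n d) = Lev A (n + d)" "Cod C (bond C A n d) = Lev A n"
  using assms by (induction d) simp_all

lemma bond_comp:
  assumes "is_inv_sys C A"
  shows "bond C A n d \<cdot> bond C A (n + d) e = bond C A n (d + e)"
proof (induction e)
  case (Suc e)
  then show ?case using assms comp_comp[of "Tr A (n + d + e)" "bond C A (n + d) e" "bond C A n d"]
    by (simp add: add.assoc)
qed (use assms in simp)

lemma bnd_arr [simp]:
  assumes "is_inv_sys C A" "n \<le> k"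
  shows "bnd A n k \<in> Arr C" "Dom C (bnd A n k) = Lev A k" "Cod C (bnd A n k) = Lev A n"
  using assms by (simp_all add: bnd_def)

lemma bnd_simps [simp]:
  "bnd A n n = Ide C (Lev A n)" "is_inv_sys C A \<Longrightarrow> bnd A n (Suc n) = Tr A n"
  by (simp_all add: bnd_def)

lemma bnd_comp:
  assumes "is_inv_sys C A" "n \<le> m" "m \<le> k"
  shows "bnd A n m \<cdot> bnd A m k = bnd A n k"
  using bond_comp[OF assms(1), of n "m - n" "k - m"] assms(2,3) by (simp add: bnd_def)

section \<open>Germs of arrows out of an inverse system\<close>

definition germ :: "('o, 'm) inv_sys \<Rightarrow> 'o \<Rightarrow> nat \<Rightarrow> 'm \<Rightarrow> (nat \<times> 'm) set" where
  "germ A Y m f = germ_rel C A Y `` {(m, f)}"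

lemma germ_rel_iff:
  "((m, f), (m', f')) \<in> germ_rel C A Y \<longleftrightarrow> f \<in> Hom C (Lev A m) Y \<and> f' \<in> Hom C (Lev A m') Y \<and>
    (\<exists>k. m \<le> k \<and> m' \<le> k \<and> f \<cdot> bnd A m k = f' \<cdot> bnd A m' k)"
proof -
  have "(\<exists>d d'. m + d = m' + d' \<and> f \<cdot> bond C A m d = f' \<cdot> bond C A m' d')
      \<longleftrightarrow> (\<exists>k. m \<le> k \<and> m' \<le> k \<and> f \<cdot> bnd A m k = f' \<cdot> bnd A m' k)" (is "?l \<longleftrightarrow> ?r")
  proof
    assume ?l
    then obtain d d' where d: "m + d = m' + d'" "f \<cdot> bond C A m d = f' \<cdot> bond C A m' d'" by blast
    have "m' + d' - m = d" "m' + d' - m' = d'" "m \<le> m' + d'" using d(1) by simp_all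
    then show ?r using d(2) by (intro exI[of _ "m' + d'"]) (simp add: bnd_def)
  next
    assume ?r
    then obtain k where "m \<le> k" "m' \<le> k" "f \<cdot> bnd A m k = f' \<cdot> bnd A m' k" by blast
    then show ?l by (intro exI[of _ "k - m"] exI[of _ "k - m'"]) (simp add: bnd_def)
  qed
  then show ?thesis by (simp add: germ_rel_def)
qed

lemma res_mono:
  assumes A: "is_inv_sys C A" and "f \<in> Hom C (Lev A m) Y" "f' \<in> Hom C (Lev A m') Y"
    and le: "m \<le> k" "m' \<le> k" "k \<le> l" and eq: "f \<cdot> bnd A m k = f' \<cdot> bnd A m' k"
  shows "f \<cdot> bnd A m l = f' \<cdot> bnd A m' l"
proof -
  note [simp] = A HomE(1-3)[OF assms(2)] HomE(1-3)[OF assms(3)]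
  have "f \<cdot> bnd A m l = (f \<cdot> bnd A m k) \<cdot> bnd A k l" using le by (simp add: bnd_comp)
  also have "\<dots> = f' \<cdot> bnd A m' l" unfolding eq using le by (simp add: bnd_comp)
  finally show ?thesis .
qed

lemma equiv_germ_rel:
  assumes A: "is_inv_sys C A"
  shows "equiv (SIGMA m : UNIV. Hom C (Lev A m) Y) (germ_rel C A Y)"
proof (rule equivI)
  show "refl_on (SIGMA m : UNIV. Hom C (Lev A m) Y) (germ_rel C A Y)"
    by (auto simp: refl_on_def germ_rel_iff)
  show "germ_rel C A Y \<subseteq> (SIGMA m : UNIV. Hom C (Lev A m) Y) \<times> (SIGMA m : UNIV. Hom C (Lev A m) Y)"
    by (auto simp: germ_rel_iff)
  show "sym (germ_rel C A Y)" by (rule symI) (auto simp: germ_rel_iff, metis)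
  show "trans (germ_rel C A Y)"
  proof (rule transI)
    fix x y z assume xy: "(x, y) \<in> germ_rel C A Y" and yz: "(y, z) \<in> germ_rel C A Y"
    obtain m f m' f' m'' f'' where e: "x = (m, f)" "y = (m', f')" "z = (m'', f'')" by (metis surj_pair)
    obtain k l where k: "f \<in> Hom C (Lev A m) Y" "f' \<in> Hom C (Lev A m') Y" "f'' \<in> Hom C (Lev A m'') Y"
      "m \<le> k" "m' \<le> k" "f \<cdot> bnd A m k = f' \<cdot> bnd A m' k"
      "m' \<le> l" "m'' \<le> l" "f' \<cdot> bnd A m' l = f'' \<cdot> bnd A m'' l"
      using xy yz unfolding e germ_rel_iff by blast
    have "f \<cdot> bnd A m (max k l) = f' \<cdot> bnd A m' (max k l)" "f' \<cdot> bnd A m' (max k l) = f'' \<cdot> bnd A m'' (max k l)"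
      using res_mono[OF A k(1,2,4,5) _ k(6), of "max k l"] res_mono[OF A k(2,3,7,8) _ k(9), of "max k l"] by simp_all
    then have "m \<le> max k l \<and> m'' \<le> max k l \<and> f \<cdot> bnd A m (max k l) = f'' \<cdot> bnd A m'' (max k l)"
      using k by (simp add: le_max_iff_disj)
    then show "(x, z) \<in> germ_rel C A Y" unfolding e germ_rel_iff using k by blast
  qed
qed

lemma germ_eq_iff:
  assumes "is_inv_sys C A" "f \<in> Hom C (Lev A m) Y" "f' \<in> Hom C (Lev A m') Y"
  shows "germ A Y m f = germ A Y m' f' \<longleftrightarrow> (\<exists>k. m \<le> k \<and> m' \<le> k \<and> f \<cdot> bnd A m k = f' \<cdot> bnd A m' k)"
  unfolding germ_def using eq_equiv_class_iff[OF equiv_germ_rel[OF assms(1)], of "(m, f)" Y "(m', f')"] assms(2,3)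
  by (simp add: germ_rel_iff)

lemma mem_germ_iff:
  assumes "is_inv_sys C A" "f \<in> Hom C (Lev A m) Y"
  shows "(m', f') \<in> germ A Y m f \<longleftrightarrow> f' \<in> Hom C (Lev A m') Y \<and> germ A Y m' f' = germ A Y m f"
proof -
  have "(m', f') \<in> germ A Y m f \<longleftrightarrow> ((m, f), (m', f')) \<in> germ_rel C A Y" by (simp add: germ_def)
  then show ?thesis using germ_eq_iff[OF assms(1,2), of f' m'] assms(2) by (metis germ_rel_iff)
qed

lemma germ_res:
  assumes A: "is_inv_sys C A" and f: "f \<in> Hom C (Lev A m) Y" and "m \<le> k"
  shows "f \<cdot> bnd A m k \<in> Hom C (Lev A k) Y" "germ A Y k (f \<cdot> bnd A m k) = germ A Y m f"
proof -
  note [simp] = A HomE(1-3)[OF f] \<open>m \<le> k\<close>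
  show "f \<cdot> bnd A m k \<in> Hom C (Lev A k) Y" by (simp add: Hom_def)
  then show "germ A Y k (f \<cdot> bnd A m k) = germ A Y m f"
    by (subst germ_eq_iff[OF A _ f]) (auto intro!: exI[of _ k])
qed

lemma germ_post:
  assumes A: "is_inv_sys C A" and "f \<in> Hom C (Lev A m) Y" "f' \<in> Hom C (Lev A m') Y" "h \<in> Hom C Y Z"
    and eq: "germ A Y m f = germ A Y m' f'"
  shows "germ A Z m (h \<cdot> f) = germ A Z m' (h \<cdot> f')"
proof -
  note [simp] = A HomE(1-3)[OF assms(2)] HomE(1-3)[OF assms(3)] HomE(1-3)[OF assms(4)]
  obtain k where k: "m \<le> k" "m' \<le> k" "f \<cdot> bnd A m k = f' \<cdot> bnd A m' k"
    using eq germ_eq_iff[OF A assms(2,3)] by blast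
  show ?thesis using k by (subst germ_eq_iff[OF A]) (auto simp: Hom_def intro!: exI[of _ k])
qed

lemma colim_homE:
  assumes A: "is_inv_sys C A" and X: "X \<in> colim_hom C A Y"
  obtains m f where "f \<in> Hom C (Lev A m) Y" "X = germ A Y m f"
  using X unfolding colim_hom_def germ_def by (auto elim!: quotientE)

lemma germ_in_colim_hom: "f \<in> Hom C (Lev A m) Y \<Longrightarrow> germ A Y m f \<in> colim_hom C A Y"
  unfolding colim_hom_def germ_def by (auto intro: quotientI)

lemma germ_Image_eq:
  assumes A: "is_inv_sys C A" and f: "f \<in> Hom C (Lev A m) Y" and "(m, f) \<in> X"
    and X: "\<And>m' f'. (m', f') \<in> X \<Longrightarrow> f' \<in> Hom C (Lev A m') Y \<and> germ A Y m' f' = germ A Y m f"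
  shows "germ_rel C A Y `` X = germ A Y m f"
  unfolding germ_def
proof (rule equiv_Image_eq[OF equiv_germ_rel[OF A]])
  show "X \<noteq> {}" using assms(3) by blast
  show "X \<subseteq> germ_rel C A Y `` {(m, f)}"
    using X mem_germ_iff[OF A f] unfolding germ_def by auto
qed

section \<open>Pro-maps and their representatives\<close>

definition pro_map :: "('o, 'm) inv_sys \<Rightarrow> ('o, 'm) inv_sys \<Rightarrow> (nat \<Rightarrow> nat) \<Rightarrow> (nat \<Rightarrow> 'm) \<Rightarrow> ('o, 'm) pro_arr" where
  "pro_map A B u f = \<lparr>PDom = A, PCod = B, Germ = (\<lambda>n. germ A (Lev B n) (u n) (f n))\<rparr>"

text \<open>\<open>u n\<close> is the source level of the chosen representative of component
  \<open>n\<close>. Neighbouring components agree only as germs, that is, after restriction to a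
  deeper level which may depend on \<open>n\<close>.\<close>

definition represents :: "('o, 'm) inv_sys \<Rightarrow> ('o, 'm) inv_sys \<Rightarrow> (nat \<Rightarrow> nat) \<Rightarrow> (nat \<Rightarrow> 'm) \<Rightarrow> bool" where
  "represents A B u f \<longleftrightarrow> is_inv_sys C A \<and> is_inv_sys C B \<and> (\<forall>n. f n \<in> Hom C (Lev A (u n)) (Lev B n)) \<and>
    (\<forall>n. germ A (Lev B n) (u (Suc n)) (Tr B n \<cdot> f (Suc n)) = germ A (Lev B n) (u n) (f n))"

lemma pro_map_sel [simp]:
  "PDom (pro_map A B u f) = A" "PCod (pro_map A B u f) = B"
  "Germ (pro_map A B u f) n = germ A (Lev B n) (u n) (f n)"
  by (simp_all add: pro_map_def)

lemma pro_map_eq_iff: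
  "pro_map A B u f = pro_map A B v g \<longleftrightarrow> (\<forall>n. germ A (Lev B n) (u n) (f n) = germ A (Lev B n) (v n) (g n))"
  by (simp add: pro_map_def fun_eq_iff)

lemma representsE:
  assumes "represents A B u f"
  shows "is_inv_sys C A" "is_inv_sys C B" "f n \<in> Hom C (Lev A (u n)) (Lev B n)"
  using assms by (auto simp: represents_def)

lemma represents_compat:
  "represents A B u f \<Longrightarrow> germ A (Lev B n) (u (Suc n)) (Tr B n \<cdot> f (Suc n)) = germ A (Lev B n) (u n) (f n)"
  by (simp add: represents_def)

lemma represents_arr:
  assumes "represents A B u f"
  shows "f n \<in> Arr C" "Dom C (f n) = Lev A (u n)" "Cod C (f n) = Lev B n"
  using HomE[OF representsE(3)[OF assms]] by simp_all

lemma trans_germ: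
  assumes A: "is_inv_sys C A" and B: "is_inv_sys C B" and f: "f \<in> Hom C (Lev A m) (Lev B (Suc n))"
    and eq: "germ A (Lev B (Suc n)) m' f' = germ A (Lev B (Suc n)) m f"
  shows "germ_rel C A (Lev B n) `` {(m, Tr B n \<cdot> f) | m f. (m, f) \<in> germ A (Lev B (Suc n)) m' f'} =
      germ A (Lev B n) m (Tr B n \<cdot> f)"
proof -
  have Tr: "Tr B n \<in> Hom C (Lev B (Suc n)) (Lev B n)" using B by (simp add: is_inv_sys_def)
  show ?thesis unfolding eq
  proof (rule germ_Image_eq[OF A])
    show "Tr B n \<cdot> f \<in> Hom C (Lev A m) (Lev B n)" by (rule comp_hom[OF f Tr])
    show "(m, Tr B n \<cdot> f) \<in> {(m', Tr B n \<cdot> f') | m' f'. (m', f') \<in> germ A (Lev B (Suc n)) m f}"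
      using mem_germ_iff[OF A f] f by blast
  next
    fix m'' g assume "(m'', g) \<in> {(m', Tr B n \<cdot> f') | m' f'. (m', f') \<in> germ A (Lev B (Suc n)) m f}"
    then obtain f' where "g = Tr B n \<cdot> f'" "f' \<in> Hom C (Lev A m'') (Lev B (Suc n))"
      "germ A (Lev B (Suc n)) m'' f' = germ A (Lev B (Suc n)) m f"
      using mem_germ_iff[OF A f] by blast
    then show "g \<in> Hom C (Lev A m'') (Lev B n) \<and> germ A (Lev B n) m'' g = germ A (Lev B n) m (Tr B n \<cdot> f)"
      using comp_hom[OF _ Tr] germ_post[OF A _ f Tr] by blast
  qed
qed

lemma pro_map_in_pro_arrs: "represents A B u f \<Longrightarrow> pro_map A B u f \<in> pro_arrs C"
  using trans_germ[of A B "f (Suc _)" "u (Suc _)" _ "u (Suc _)" "f (Suc _)"]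
  by (simp add: pro_arrs_def represents_def germ_in_colim_hom)

lemma pro_arrE:
  assumes F: "F \<in> pro_arrs C"
  obtains u f where "represents (PDom F) (PCod F) u f" "F = pro_map (PDom F) (PCod F) u f"
proof -
  let ?A = "PDom F" and ?B = "PCod F"
  have sys: "is_inv_sys C ?A" "is_inv_sys C ?B" using F by (auto simp: pro_arrs_def)
  have "\<exists>x. snd x \<in> Hom C (Lev ?A (fst x)) (Lev ?B n) \<and> Germ F n = germ ?A (Lev ?B n) (fst x) (snd x)" for n
  proof -
    have "Germ F n \<in> colim_hom C ?A (Lev ?B n)" using F by (simp add: pro_arrs_def)
    then obtain m f where "f \<in> Hom C (Lev ?A m) (Lev ?B n)" "Germ F n = germ ?A (Lev ?B n) m f"
      by (rule colim_homE[OF sys(1)])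
    then show ?thesis by (intro exI[of _ "(m, f)"]) simp
  qed
  then obtain x where x: "\<And>n. snd (x n) \<in> Hom C (Lev ?A (fst (x n))) (Lev ?B n)"
    "\<And>n. Germ F n = germ ?A (Lev ?B n) (fst (x n)) (snd (x n))" by metis
  define u f where "u = (\<lambda>n. fst (x n))" and "f = (\<lambda>n. snd (x n))"
  have f: "f n \<in> Hom C (Lev ?A (u n)) (Lev ?B n)" and germ: "Germ F n = germ ?A (Lev ?B n) (u n) (f n)" for n
    using x by (simp_all add: u_def f_def)
  have "germ ?A (Lev ?B n) (u (Suc n)) (Tr ?B n \<cdot> f (Suc n)) = germ ?A (Lev ?B n) (u n) (f n)" for n
    using F trans_germ[OF sys f[of "Suc n"], of "u (Suc n)" "f (Suc n)"] unfolding pro_arrs_def by (simp add: germ)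
  then have "represents ?A ?B u f" using f sys by (simp add: represents_def)
  moreover have "F = pro_map ?A ?B u f" by (rule pro_arr.equality) (simp_all add: fun_eq_iff germ)
  ultimately show thesis by (rule that)
qed

text \<open>Sums and tensor products are computed on representatives at common levels; raising
  \<open>u\<close> provides these.\<close>

lemma represents_raise:
  assumes f: "represents A B u f" and le: "\<And>n. u n \<le> v n"
  shows "represents A B v (\<lambda>n. f n \<cdot> bnd A (u n) (v n))"
    and "pro_map A B v (\<lambda>n. f n \<cdot> bnd A (u n) (v n)) = pro_map A B u f"
proof -
  note sys [simp] = representsE(1,2)[OF f] represents_arr[OF f]
  note hom = representsE(3)[OF f]
  have raise: "germ A (Lev B n) (v n) (f n \<cdot> bnd A (u n) (v n)) = germ A (Lev B n) (u n) (f n)" for n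
    by (rule germ_res(2)[OF sys(1) hom le])
  then show "pro_map A B v (\<lambda>n. f n \<cdot> bnd A (u n) (v n)) = pro_map A B u f"
    by (simp add: pro_map_eq_iff)
  have "germ A (Lev B n) (v (Suc n)) (Tr B n \<cdot> (f (Suc n) \<cdot> bnd A (u (Suc n)) (v (Suc n))))
      = germ A (Lev B n) (u (Suc n)) (Tr B n \<cdot> f (Suc n))" for n
    by (rule germ_post[OF sys(1) _ hom _ raise]) (use le in \<open>simp_all add: Hom_def\<close>)
  then show "represents A B v (\<lambda>n. f n \<cdot> bnd A (u n) (v n))"
    using f le by (simp add: represents_def germ_res raise Hom_def)
qed

lemma represents_bnd:
  assumes f: "represents A B u f" and "l \<le> k"
  shows "germ A (Lev B l) (u k) (bnd B l k \<cdot> f k) = germ A (Lev B l) (u l) (f l)"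
  using assms(2)
proof (induction rule: dec_induct)
  case base
  then show ?case using represents_arr[OF f] by simp
next
  case (step k)
  note [simp] = representsE(1,2)[OF f] represents_arr[OF f]
  have "bnd B l (Suc k) \<cdot> f (Suc k) = bnd B l k \<cdot> (Tr B k \<cdot> f (Suc k))"
    using bnd_comp[of B l k "Suc k"] step(1) comp_comp[of "f (Suc k)" "Tr B k" "bnd B l k"] by simp
  moreover have "germ A (Lev B l) (u (Suc k)) (bnd B l k \<cdot> (Tr B k \<cdot> f (Suc k))) = germ A (Lev B l) (u k) (bnd B l k \<cdot> f k)"
    by (rule germ_post[OF _ _ _ _ represents_compat[OF f]]) (use step(1) in \<open>simp_all add: Hom_def\<close>)
  ultimately show ?case using step by simp
qed

lemma Pro_sel [simp]:
  "Obj (Pro C) = {A. is_inv_sys C A}" "Arr (Pro C) = pro_arrs C" "Dom (Pro C) = PDom" "Cod (Pro C) = PCod"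
  "Ide (Pro C) A = level_map C A A (\<lambda>n. Ide C (Lev A n))"
  "Zero (Pro C) A B = level_map C A B (\<lambda>n. Zero C (Lev A n) (Lev B n))"
  "Tobj (Pro C) = tensor_pro C" "Unit (Pro C) = const_pro C (Unit C)"
  by (simp_all add: Pro_def)

lemma level_map_eq: "level_map C A B u = pro_map A B (\<lambda>n. n) u"
  by (simp add: level_map_def pro_map_def germ_def)

lemma Hom_ProE:
  assumes "F \<in> Hom (Pro C) A B"
  obtains u f where "represents A B u f" "F = pro_map A B u f"
  using assms pro_arrE[of F] by (auto simp: Hom_def)

lemma pro_map_in_Hom: "represents A B u f \<Longrightarrow> pro_map A B u f \<in> Hom (Pro C) A B"
  by (simp add: Hom_def pro_map_in_pro_arrs)

lemma Hom_Pro_common: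
  assumes "F \<in> Hom (Pro C) A B"
  shows "\<exists>u. \<forall>v. (\<forall>n. u n \<le> v n) \<longrightarrow> (\<exists>f. represents A B v f \<and> F = pro_map A B v f)"
proof -
  obtain u f where f: "represents A B u f" "F = pro_map A B u f" using assms by (rule Hom_ProE)
  show ?thesis
  proof (intro exI[of _ u] allI impI)
    fix v assume "\<forall>n. u n \<le> v n"
    then show "\<exists>f. represents A B v f \<and> F = pro_map A B v f"
      using represents_raise[OF f(1), of v] f(2) by auto
  qed
qed

text \<open>The point is independence of the representatives. Two representatives \<open>g'\<close>
  and \<open>g n\<close> of a germ agree only on a deeper level \<open>k\<close> of
  \<open>B\<close>. Before one is exchanged for the other, the representative of the first map at
  level \<open>l\<close> is therefore replaced by the one at level \<open>k\<close> followed by a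
  transition map.\<close>

lemma pro_comp:
  assumes f: "represents A B u f" and g: "represents B D v g"
  shows "pro_map B D v g \<cdot>\<^bsub>Pro C\<^esub> pro_map A B u f = pro_map A D (\<lambda>n. u (v n)) (\<lambda>n. g n \<cdot> f (v n))"
    and "represents A D (\<lambda>n. u (v n)) (\<lambda>n. g n \<cdot> f (v n))"
proof -
  note sys [simp] = representsE(1,2)[OF f] representsE(2)[OF g] represents_arr[OF f] represents_arr[OF g]
  note hom = representsE(3)[OF f] representsE(3)[OF g]
  have gf: "g n \<cdot> f (v n) \<in> Hom C (Lev A (u (v n))) (Lev D n)" for n by (simp add: Hom_def)
  have key: "germ A (Lev D n) m (g' \<cdot> f') = germ A (Lev D n) (u (v n)) (g n \<cdot> f (v n))"
    if g': "g' \<in> Hom C (Lev B l) (Lev D n)" "germ B (Lev D n) l g' = germ B (Lev D n) (v n) (g n)"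
      and f': "f' \<in> Hom C (Lev A m) (Lev B l)" "germ A (Lev B l) m f' = germ A (Lev B l) (u l) (f l)" for n l m g' f'
  proof -
    note [simp] = HomE(1-3)[OF g'(1)] HomE(1-3)[OF f'(1)]
    obtain k where k: "l \<le> k" "v n \<le> k" "g' \<cdot> bnd B l k = g n \<cdot> bnd B (v n) k"
      using germ_eq_iff[OF sys(2) g'(1) hom(2)] g'(2) by blast
    have "germ A (Lev D n) m (g' \<cdot> f') = germ A (Lev D n) (u l) (g' \<cdot> f l)"
      by (rule germ_post[OF sys(1) f'(1) hom(1) g'(1) f'(2)])
    also have "\<dots> = germ A (Lev D n) (u k) (g' \<cdot> (bnd B l k \<cdot> f k))"
      by (rule germ_post[OF sys(1) hom(1) _ g'(1) represents_bnd[OF f k(1), symmetric]]) (use k in \<open>simp add: Hom_def\<close>)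
    also have "g' \<cdot> (bnd B l k \<cdot> f k) = g n \<cdot> (bnd B (v n) k \<cdot> f k)"
      by (rule comp_eq_extend[OF k(3)]) (use k in simp_all)
    also have "germ A (Lev D n) (u k) (g n \<cdot> (bnd B (v n) k \<cdot> f k)) = germ A (Lev D n) (u (v n)) (g n \<cdot> f (v n))"
      by (rule germ_post[OF sys(1) _ hom(1) hom(2) represents_bnd[OF f k(2)]]) (use k in \<open>simp add: Hom_def\<close>)
    finally show ?thesis .
  qed
  have "germ_rel C A (Lev D n) `` {(m, g' \<cdot> f') | l g' m f'. (l, g') \<in> germ B (Lev D n) (v n) (g n)
      \<and> (m, f') \<in> germ A (Lev B l) (u l) (f l)} = germ A (Lev D n) (u (v n)) (g n \<cdot> f (v n))" for n
  proof (rule germ_Image_eq[OF sys(1) gf])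
    show "(u (v n), g n \<cdot> f (v n)) \<in> {(m, g' \<cdot> f') | l g' m f'. (l, g') \<in> germ B (Lev D n) (v n) (g n)
      \<and> (m, f') \<in> germ A (Lev B l) (u l) (f l)}"
      using mem_germ_iff[OF sys(1) hom(1)] mem_germ_iff[OF sys(2) hom(2)] hom by blast
  next
    fix m x assume "(m, x) \<in> {(m, g' \<cdot> f') | l g' m f'. (l, g') \<in> germ B (Lev D n) (v n) (g n)
      \<and> (m, f') \<in> germ A (Lev B l) (u l) (f l)}"
    then show "x \<in> Hom C (Lev A m) (Lev D n) \<and> germ A (Lev D n) m x = germ A (Lev D n) (u (v n)) (g n \<cdot> f (v n))"
      using key comp_hom by (fastforce simp: mem_germ_iff[OF sys(1) hom(1)] mem_germ_iff[OF sys(2) hom(2)])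
  qed
  then show "pro_map B D v g \<cdot>\<^bsub>Pro C\<^esub> pro_map A B u f = pro_map A D (\<lambda>n. u (v n)) (\<lambda>n. g n \<cdot> f (v n))"
    by (simp add: Pro_def) (simp add: pro_map_def)
  have "germ A (Lev D n) (u (v (Suc n))) (Tr D n \<cdot> (g (Suc n) \<cdot> f (v (Suc n)))) = germ A (Lev D n) (u (v n)) (g n \<cdot> f (v n))" for n
    using key[of "Tr D n \<cdot> g (Suc n)" "v (Suc n)" n "f (v (Suc n))" "u (v (Suc n))"] g hom
    by (simp add: represents_def Hom_def)
  then show "represents A D (\<lambda>n. u (v n)) (\<lambda>n. g n \<cdot> f (v n))"
    using gf by (simp add: represents_def)
qed

lemma germ_add:
  assumes A: "is_inv_sys C A" and f: "f \<in> Hom C (Lev A u) Y" "f' \<in> Hom C (Lev A m) Y" "germ A Y m f' = germ A Y u f"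
    and g: "g \<in> Hom C (Lev A u) Y" "g' \<in> Hom C (Lev A m) Y" "germ A Y m g' = germ A Y u g"
  shows "germ A Y m (f' \<boxplus> g') = germ A Y u (f \<boxplus> g)"
proof -
  note [simp] = A HomE(1-3)[OF f(1)] HomE(1-3)[OF f(2)] HomE(1-3)[OF g(1)] HomE(1-3)[OF g(2)]
  obtain k where k: "m \<le> k" "u \<le> k" "f' \<cdot> bnd A m k = f \<cdot> bnd A u k"
    using f(3) germ_eq_iff[OF A f(2,1)] by blast
  obtain l where l: "m \<le> l" "u \<le> l" "g' \<cdot> bnd A m l = g \<cdot> bnd A u l"
    using g(3) germ_eq_iff[OF A g(2,1)] by blast
  have "f' \<cdot> bnd A m (max k l) = f \<cdot> bnd A u (max k l)" "g' \<cdot> bnd A m (max k l) = g \<cdot> bnd A u (max k l)"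
    using res_mono[OF A f(2,1) k(1,2) _ k(3), of "max k l"] res_mono[OF A g(2,1) l(1,2) _ l(3), of "max k l"] by simp_all
  then show ?thesis using k(1,2)
    by (subst germ_eq_iff[OF A]) (auto simp: Hom_def le_max_iff_disj intro!: exI[of _ "max k l"])
qed

lemma pro_add:
  assumes f: "represents A B u f" and g: "represents A B u g"
  shows "pro_map A B u f \<boxplus>\<^bsub>Pro C\<^esub> pro_map A B u g = pro_map A B u (\<lambda>n. f n \<boxplus> g n)"
    and "represents A B u (\<lambda>n. f n \<boxplus> g n)"
proof -
  note sys [simp] = representsE(1,2)[OF f] represents_arr[OF f] represents_arr[OF g]
  note hom = representsE(3)[OF f] representsE(3)[OF g]
  have fg: "f n \<boxplus> g n \<in> Hom C (Lev A (u n)) (Lev B n)" for n by (simp add: Hom_def)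
  have "germ_rel C A (Lev B n) `` {(m, f' \<boxplus> g') | m f' g'. (m, f') \<in> germ A (Lev B n) (u n) (f n)
      \<and> (m, g') \<in> germ A (Lev B n) (u n) (g n)} = germ A (Lev B n) (u n) (f n \<boxplus> g n)" for n
  proof (rule germ_Image_eq[OF sys(1) fg])
    show "(u n, f n \<boxplus> g n) \<in> {(m, f' \<boxplus> g') | m f' g'. (m, f') \<in> germ A (Lev B n) (u n) (f n)
      \<and> (m, g') \<in> germ A (Lev B n) (u n) (g n)}"
      using mem_germ_iff[OF sys(1) hom(1)] mem_germ_iff[OF sys(1) hom(2)] hom by blast
  next
    fix m x assume "(m, x) \<in> {(m, f' \<boxplus> g') | m f' g'. (m, f') \<in> germ A (Lev B n) (u n) (f n)
      \<and> (m, g') \<in> germ A (Lev B n) (u n) (g n)}"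
    then obtain f' g' where x: "x = f' \<boxplus> g'" "f' \<in> Hom C (Lev A m) (Lev B n)" "g' \<in> Hom C (Lev A m) (Lev B n)"
      "germ A (Lev B n) m f' = germ A (Lev B n) (u n) (f n)" "germ A (Lev B n) m g' = germ A (Lev B n) (u n) (g n)"
      using mem_germ_iff[OF sys(1) hom(1)] mem_germ_iff[OF sys(1) hom(2)] by blast
    show "x \<in> Hom C (Lev A m) (Lev B n) \<and> germ A (Lev B n) m x = germ A (Lev B n) (u n) (f n \<boxplus> g n)"
      unfolding x(1) using germ_add[OF sys(1) hom(1) x(2,4) hom(2) x(3,5)] HomE[OF x(2)] HomE[OF x(3)]
      by (simp add: Hom_def)
  qed
  then show "pro_map A B u f \<boxplus>\<^bsub>Pro C\<^esub> pro_map A B u g = pro_map A B u (\<lambda>n. f n \<boxplus> g n)"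
    by (simp add: Pro_def) (simp add: pro_map_def)
  have "germ A (Lev B n) (u (Suc n)) (Tr B n \<cdot> f (Suc n) \<boxplus> Tr B n \<cdot> g (Suc n)) = germ A (Lev B n) (u n) (f n \<boxplus> g n)" for n
    by (rule germ_add) (use f g in \<open>simp_all add: represents_def Hom_def\<close>)
  then show "represents A B u (\<lambda>n. f n \<boxplus> g n)"
    using fg by (simp add: represents_def)
qed

lemma tensor_pro_sel [simp]:
  "Lev (tensor_pro C A B) n = Lev A n \<boxtimes> Lev B n" "Tr (tensor_pro C A B) n = Tr A n \<star> Tr B n"
  by (simp_all add: tensor_pro_def)

lemma const_pro_sel [simp]: "Lev (const_pro C V) n = V" "Tr (const_pro C V) n = Ide C V"
  by (simp_all add: const_pro_def)

lemma inv_sys_tensor [simp]: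
  "\<lbrakk>is_inv_sys C A; is_inv_sys C B\<rbrakk> \<Longrightarrow> is_inv_sys C (tensor_pro C A B)"
  by (auto simp: is_inv_sys_def intro: tarr_hom)

lemma inv_sys_const [simp]: "V \<in> Obj C \<Longrightarrow> is_inv_sys C (const_pro C V)"
  by (simp add: is_inv_sys_def Hom_def)

lemma bnd_tensor:
  assumes "is_inv_sys C A" "is_inv_sys C B" "n \<le> k"
  shows "bnd (tensor_pro C A B) n k = bnd A n k \<star> bnd B n k"
  using assms(3)
proof (induction rule: dec_induct)
  case base
  then show ?case using assms by simp
next
  case (step k)
  then show ?case using assms bnd_comp[of _ n k "Suc k"]
    by (simp flip: bnd_comp[of _ n k "Suc k"])
qed

lemma bnd_const:
  assumes "V \<in> Obj C" "n \<le> k"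
  shows "bnd (const_pro C V) n k = Ide C V"
  using assms(2)
proof (induction rule: dec_induct)
  case (step k)
  then show ?case using assms by (simp flip: bnd_comp[of _ n k "Suc k"])
qed simp

lemma germ_tarr:
  assumes A: "is_inv_sys C A" and B: "is_inv_sys C B"
    and f: "f \<in> Hom C (Lev A u) Y" "f' \<in> Hom C (Lev A m) Y" "germ A Y m f' = germ A Y u f"
    and g: "g \<in> Hom C (Lev B u) Z" "g' \<in> Hom C (Lev B m) Z" "germ B Z m g' = germ B Z u g"
  shows "germ (tensor_pro C A B) (Y \<boxtimes> Z) m (f' \<star> g') = germ (tensor_pro C A B) (Y \<boxtimes> Z) u (f \<star> g)"
proof -
  note [simp] = A B HomE(1-3)[OF f(1)] HomE(1-3)[OF f(2)] HomE(1-3)[OF g(1)] HomE(1-3)[OF g(2)]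
  obtain k where k: "m \<le> k" "u \<le> k" "f' \<cdot> bnd A m k = f \<cdot> bnd A u k"
    using f(3) germ_eq_iff[OF A f(2,1)] by blast
  obtain l where l: "m \<le> l" "u \<le> l" "g' \<cdot> bnd B m l = g \<cdot> bnd B u l"
    using g(3) germ_eq_iff[OF B g(2,1)] by blast
  have "f' \<cdot> bnd A m (max k l) = f \<cdot> bnd A u (max k l)" "g' \<cdot> bnd B m (max k l) = g \<cdot> bnd B u (max k l)"
    using res_mono[OF A f(2,1) k(1,2) _ k(3), of "max k l"] res_mono[OF B g(2,1) l(1,2) _ l(3), of "max k l"] by simp_all
  then show ?thesis using k(1,2)
    by (subst germ_eq_iff) (auto simp: Hom_def bnd_tensor le_max_iff_disj intro!: exI[of _ "max k l"])
qed

lemma pro_tarr: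
  assumes f: "represents A B u f" and g: "represents A' B' u g"
  shows "pro_map A B u f \<star>\<^bsub>Pro C\<^esub> pro_map A' B' u g = pro_map (tensor_pro C A A') (tensor_pro C B B') u (\<lambda>n. f n \<star> g n)"
    and "represents (tensor_pro C A A') (tensor_pro C B B') u (\<lambda>n. f n \<star> g n)"
proof -
  note sys [simp] = representsE(1,2)[OF f] representsE(1,2)[OF g] represents_arr[OF f] represents_arr[OF g]
  note hom = representsE(3)[OF f] representsE(3)[OF g]
  let ?A = "tensor_pro C A A'" and ?B = "tensor_pro C B B'"
  have fg: "f n \<star> g n \<in> Hom C (Lev ?A (u n)) (Lev B n \<boxtimes> Lev B' n)" for n by (simp add: Hom_def)
  have "germ_rel C ?A (Lev B n \<boxtimes> Lev B' n) `` {(m, f' \<star> g') | m f' g'. (m, f') \<in> germ A (Lev B n) (u n) (f n)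
      \<and> (m, g') \<in> germ A' (Lev B' n) (u n) (g n)} = germ ?A (Lev B n \<boxtimes> Lev B' n) (u n) (f n \<star> g n)" for n
  proof (rule germ_Image_eq[OF _ fg])
    show "(u n, f n \<star> g n) \<in> {(m, f' \<star> g') | m f' g'. (m, f') \<in> germ A (Lev B n) (u n) (f n)
      \<and> (m, g') \<in> germ A' (Lev B' n) (u n) (g n)}"
      using mem_germ_iff[OF sys(1) hom(1)] mem_germ_iff[OF sys(3) hom(2)] hom by blast
  next
    fix m x assume "(m, x) \<in> {(m, f' \<star> g') | m f' g'. (m, f') \<in> germ A (Lev B n) (u n) (f n)
      \<and> (m, g') \<in> germ A' (Lev B' n) (u n) (g n)}"
    then obtain f' g' where x: "x = f' \<star> g'" "f' \<in> Hom C (Lev A m) (Lev B n)" "g' \<in> Hom C (Lev A' m) (Lev B' n)"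
      "germ A (Lev B n) m f' = germ A (Lev B n) (u n) (f n)" "germ A' (Lev B' n) m g' = germ A' (Lev B' n) (u n) (g n)"
      using mem_germ_iff[OF sys(1) hom(1)] mem_germ_iff[OF sys(3) hom(2)] by blast
    show "x \<in> Hom C (Lev ?A m) (Lev B n \<boxtimes> Lev B' n) \<and>
        germ ?A (Lev B n \<boxtimes> Lev B' n) m x = germ ?A (Lev B n \<boxtimes> Lev B' n) (u n) (f n \<star> g n)"
      unfolding x(1) using germ_tarr[OF sys(1,3) hom(1) x(2,4) hom(2) x(3,5)] HomE[OF x(2)] HomE[OF x(3)]
      by (simp add: Hom_def)
  qed simp
  then show "pro_map A B u f \<star>\<^bsub>Pro C\<^esub> pro_map A' B' u g = pro_map ?A ?B u (\<lambda>n. f n \<star> g n)"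
    by (simp add: Pro_def) (simp add: pro_map_def)
  have "germ ?A (Lev B n \<boxtimes> Lev B' n) (u (Suc n)) ((Tr B n \<cdot> f (Suc n)) \<star> (Tr B' n \<cdot> g (Suc n)))
      = germ ?A (Lev B n \<boxtimes> Lev B' n) (u n) (f n \<star> g n)" for n
    by (rule germ_tarr) (use f g in \<open>simp_all add: represents_def Hom_def\<close>)
  then show "represents ?A ?B u (\<lambda>n. f n \<star> g n)"
    using fg by (simp add: represents_def)
qed

lemma represents_level:
  assumes "is_inv_sys C A" "is_inv_sys C B" and u: "\<And>n. u n \<in> Hom C (Lev A n) (Lev B n)"
    and nat: "\<And>n. Tr B n \<cdot> u (Suc n) = u n \<cdot> Tr A n"
  shows "represents A B (\<lambda>n. n) u"
proof -
  have "germ A (Lev B n) (Suc n) (u n \<cdot> Tr A n) = germ A (Lev B n) n (u n)" for n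
    using germ_res(2)[OF assms(1) u, of n "Suc n"] assms(1) by simp
  then show ?thesis using assms(1,2) u by (simp add: represents_def nat)
qed

lemma Zero_Pro:
  assumes A: "is_inv_sys C A" and B: "is_inv_sys C B"
  shows "represents A B u (\<lambda>n. Zero C (Lev A (u n)) (Lev B n))"
    and "Zero (Pro C) A B = pro_map A B u (\<lambda>n. Zero C (Lev A (u n)) (Lev B n))"
proof -
  note [simp] = A B
  have z: "Zero C (Lev A m) (Lev B n) \<in> Hom C (Lev A m) (Lev B n)" for m n by (simp add: Hom_def)
  have eq: "germ A (Lev B n) m (Zero C (Lev A m) (Lev B n)) = germ A (Lev B n) m' (Zero C (Lev A m') (Lev B n))" for m m' n
    by (subst germ_eq_iff[OF A z z]) (auto simp: le_max_iff_disj intro!: exI[of _ "max m m'"])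
  show "represents A B u (\<lambda>n. Zero C (Lev A (u n)) (Lev B n))"
    unfolding represents_def by (intro conjI allI A B z) (simp, rule eq)
  show "Zero (Pro C) A B = pro_map A B u (\<lambda>n. Zero C (Lev A (u n)) (Lev B n))"
    unfolding Pro_sel level_map_eq pro_map_eq_iff by (intro allI eq)
qed

lemma represents_ide: "is_inv_sys C A \<Longrightarrow> represents A A (\<lambda>n. n) (\<lambda>n. Ide C (Lev A n))"
  by (rule represents_level) (simp_all add: Hom_def)

text \<open>To tensor a pro-map with an identity on representatives, the identity has to be
  represented at the levels of the other factor.\<close>

lemma Ide_Pro:
  assumes A: "is_inv_sys C A" and u: "\<And>n. n \<le> u n"
  shows "represents A A u (\<lambda>n. bnd A n (u n))" "Ide (Pro C) A = pro_map A A u (\<lambda>n. bnd A n (u n))"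
  using represents_raise[OF represents_ide[OF A] u] A u by (simp_all add: level_map_eq)

lemma Ide_Pro_level: "Ide (Pro C) A = pro_map A A (\<lambda>n. n) (\<lambda>n. Ide C (Lev A n))"
  by (simp add: level_map_eq)

text \<open>The bound n \<le> u n allows identities to be raised to the same levels by
  \<open>Ide_Pro\<close>.\<close>

lemma Hom_Pro_common2:
  assumes "F \<in> Hom (Pro C) A B" "G \<in> Hom (Pro C) A' B'"
  obtains u f g where "\<And>n. n \<le> u n" "represents A B u f" "F = pro_map A B u f" "represents A' B' u g" "G = pro_map A' B' u g"
proof -
  obtain u where u: "\<And>v. \<forall>n. u n \<le> v n \<Longrightarrow> \<exists>f. represents A B v f \<and> F = pro_map A B v f"
    using Hom_Pro_common[OF assms(1)] by blast
  obtain u' where u': "\<And>v. \<forall>n. u' n \<le> v n \<Longrightarrow> \<exists>f. represents A' B' v f \<and> G = pro_map A' B' v f"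
    using Hom_Pro_common[OF assms(2)] by blast
  show thesis
    using u[of "\<lambda>n. max n (max (u n) (u' n))"] u'[of "\<lambda>n. max n (max (u n) (u' n))"]
      that[of "\<lambda>n. max n (max (u n) (u' n))"] by fastforce
qed

lemma Hom_Pro_common3:
  assumes "F \<in> Hom (Pro C) A B" "G \<in> Hom (Pro C) A' B'" "H \<in> Hom (Pro C) A'' B''"
  obtains u f g h where "represents A B u f" "F = pro_map A B u f" "represents A' B' u g" "G = pro_map A' B' u g"
    "represents A'' B'' u h" "H = pro_map A'' B'' u h"
proof -
  obtain u f g where u: "represents A B u f" "F = pro_map A B u f" "represents A' B' u g" "G = pro_map A' B' u g"
    using Hom_Pro_common2[OF assms(1,2)] by blast
  obtain u' where u': "\<And>v. \<forall>n. u' n \<le> v n \<Longrightarrow> \<exists>f. represents A'' B'' v f \<and> H = pro_map A'' B'' v f"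
    using Hom_Pro_common[OF assms(3)] by blast
  let ?v = "\<lambda>n. max (u n) (u' n)"
  obtain h where h: "represents A'' B'' ?v h" "H = pro_map A'' B'' ?v h" using u'[of ?v] by auto
  show thesis
    by (rule that[OF represents_raise(1)[OF u(1), of ?v] _ represents_raise(1)[OF u(3), of ?v] _ h])
      (simp_all add: u(2,4) represents_raise(2)[OF u(1), of ?v] represents_raise(2)[OF u(3), of ?v])
qed

section \<open>The axioms of an additive monoidal category for pro-objects\<close>

lemma tensor_pro_assoc:
  "\<lbrakk>is_inv_sys C A; is_inv_sys C B; is_inv_sys C D\<rbrakk>
    \<Longrightarrow> tensor_pro C (tensor_pro C A B) D = tensor_pro C A (tensor_pro C B D)"
  by (rule inv_sys.equality) (simp_all add: fun_eq_iff tensor_pro_def)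

lemma tensor_pro_unit:
  "is_inv_sys C A \<Longrightarrow> tensor_pro C (const_pro C (Unit C)) A = A"
  "is_inv_sys C A \<Longrightarrow> tensor_pro C A (const_pro C (Unit C)) = A"
  by (rule inv_sys.equality; simp add: fun_eq_iff tensor_pro_def const_pro_def)+

lemma category_Pro: "category (Pro C)"
proof
  fix F assume "F \<in> Arr (Pro C)"
  then show "Dom (Pro C) F \<in> Obj (Pro C)" "Cod (Pro C) F \<in> Obj (Pro C)" by (simp_all add: pro_arrs_def)
next
  fix A assume "A \<in> Obj (Pro C)"
  then show "Ide (Pro C) A \<in> Hom (Pro C) A A"
    unfolding Ide_Pro_level by (simp add: pro_map_in_Hom represents_ide)
next
  fix A B D F G assume "F \<in> Hom (Pro C) A B" "G \<in> Hom (Pro C) B D"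
  then show "G \<cdot>\<^bsub>Pro C\<^esub> F \<in> Hom (Pro C) A D"
    by (elim Hom_ProE) (simp add: pro_comp pro_map_in_Hom)
next
  fix A B F assume "F \<in> Hom (Pro C) A B"
  then obtain u f where f: "represents A B u f" "F = pro_map A B u f" by (rule Hom_ProE)
  note [simp] = representsE(1,2)[OF f(1)] represents_arr[OF f(1)]
  show "F \<cdot>\<^bsub>Pro C\<^esub> Ide (Pro C) A = F"
    unfolding Ide_Pro_level f(2) using pro_comp(1)[OF represents_ide f(1)] by simp
  show "Ide (Pro C) B \<cdot>\<^bsub>Pro C\<^esub> F = F"
    unfolding Ide_Pro_level f(2) using pro_comp(1)[OF f(1) represents_ide] by simp
next
  fix A B D E F G H assume "F \<in> Hom (Pro C) A B" "G \<in> Hom (Pro C) B D" "H \<in> Hom (Pro C) D E"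
  then obtain u f v g w h where f: "represents A B u f" "F = pro_map A B u f"
    and g: "represents B D v g" "G = pro_map B D v g" and h: "represents D E w h" "H = pro_map D E w h"
    by (metis Hom_ProE)
  note [simp] = represents_arr[OF f(1)] represents_arr[OF g(1)] represents_arr[OF h(1)]
  show "H \<cdot>\<^bsub>Pro C\<^esub> (G \<cdot>\<^bsub>Pro C\<^esub> F) = (H \<cdot>\<^bsub>Pro C\<^esub> G) \<cdot>\<^bsub>Pro C\<^esub> F"
    unfolding f(2) g(2) h(2) pro_comp(1)[OF f(1) g(1)] pro_comp(1)[OF g(1) h(1)]
      pro_comp(1)[OF pro_comp(2)[OF f(1) g(1)] h(1)] pro_comp(1)[OF f(1) pro_comp(2)[OF g(1) h(1)]]
    by simp
qed

lemma comm_group_Pro: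
  assumes "A \<in> Obj (Pro C)" "B \<in> Obj (Pro C)"
  shows "comm_group (hom_group (Pro C) A B)"
proof (rule comm_groupI)
  have sys [simp]: "is_inv_sys C A" "is_inv_sys C B" using assms by simp_all
  note hg = hom_group_def
  show "\<one>\<^bsub>hom_group (Pro C) A B\<^esub> \<in> carrier (hom_group (Pro C) A B)"
    using pro_map_in_Hom[OF Zero_Pro(1)[OF sys, of "\<lambda>n. n"]] by (simp add: hg level_map_eq)
  fix F assume F: "F \<in> carrier (hom_group (Pro C) A B)"
  then obtain u f where f: "represents A B u f" "F = pro_map A B u f" by (auto simp: hg elim: Hom_ProE)
  note [simp] = represents_arr[OF f(1)]
  show "\<one>\<^bsub>hom_group (Pro C) A B\<^esub> \<otimes>\<^bsub>hom_group (Pro C) A B\<^esub> F = F"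
    using pro_add(1)[OF Zero_Pro(1)[OF sys] f(1)] by (simp add: hg f(2) Zero_Pro(2)[OF sys, of u] del: Pro_sel)
  \<comment> \<open>Negation is composition with the negative of an identity, so it respects
    equality of germs.\<close>
  have neg: "represents A B u (\<lambda>n. Neg C (f n))"
  proof -
    have "germ A (Lev B n) (u (Suc n)) (Neg C (Ide C (Lev B n)) \<cdot> (Tr B n \<cdot> f (Suc n)))
        = germ A (Lev B n) (u n) (Neg C (Ide C (Lev B n)) \<cdot> f n)" for n
      by (rule germ_post[OF sys(1) _ _ _ represents_compat[OF f(1)]]) (simp_all add: Hom_def)
    then show ?thesis by (simp add: represents_def Hom_def)
  qed
  show "\<exists>G \<in> carrier (hom_group (Pro C) A B). G \<otimes>\<^bsub>hom_group (Pro C) A B\<^esub> F = \<one>\<^bsub>hom_group (Pro C) A B\<^esub>"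
    using pro_add(1)[OF neg f(1)] pro_map_in_Hom[OF neg]
    by (intro bexI[of _ "pro_map A B u (\<lambda>n. Neg C (f n))"])
      (simp_all add: hg f(2) Zero_Pro(2)[OF sys, of u] del: Pro_sel)
next
  fix F G assume "F \<in> carrier (hom_group (Pro C) A B)" "G \<in> carrier (hom_group (Pro C) A B)"
  then obtain u f g where f: "represents A B u f" "F = pro_map A B u f" and g: "represents A B u g" "G = pro_map A B u g"
    by (auto simp: hom_group_def elim: Hom_Pro_common2)
  note [simp] = represents_arr[OF f(1)] represents_arr[OF g(1)]
  show "F \<otimes>\<^bsub>hom_group (Pro C) A B\<^esub> G \<in> carrier (hom_group (Pro C) A B)"
    using pro_add[OF f(1) g(1)] pro_map_in_Hom by (simp add: hom_group_def f(2) g(2))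
  show "F \<otimes>\<^bsub>hom_group (Pro C) A B\<^esub> G = G \<otimes>\<^bsub>hom_group (Pro C) A B\<^esub> F"
    using pro_add(1)[OF f(1) g(1)] pro_add(1)[OF g(1) f(1)] by (simp add: hom_group_def f(2) g(2) add_commute)
next
  fix F G H assume "F \<in> carrier (hom_group (Pro C) A B)" "G \<in> carrier (hom_group (Pro C) A B)"
    "H \<in> carrier (hom_group (Pro C) A B)"
  then obtain u f g h where f: "represents A B u f" "F = pro_map A B u f" and g: "represents A B u g" "G = pro_map A B u g"
    and h: "represents A B u h" "H = pro_map A B u h"
    unfolding hom_group_def by (auto elim: Hom_Pro_common3)
  note [simp] = represents_arr[OF f(1)] represents_arr[OF g(1)] represents_arr[OF h(1)]
  show "F \<otimes>\<^bsub>hom_group (Pro C) A B\<^esub> G \<otimes>\<^bsub>hom_group (Pro C) A B\<^esub> H = F \<otimes>\<^bsub>hom_group (Pro C) A B\<^esub> (G \<otimes>\<^bsub>hom_group (Pro C) A B\<^esub> H)"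
    using pro_add(1)[OF f(1) g(1)] pro_add(1)[OF g(1) h(1)]
      pro_add(1)[OF pro_add(2)[OF f(1) g(1)] h(1)] pro_add(1)[OF f(1) pro_add(2)[OF g(1) h(1)]]
    by (simp add: hom_group_def f(2) g(2) h(2) add_add)
qed

text \<open>With the arrows represented at suitable levels, each law for arrows holds on
  representatives because it holds in \<open>C\<close>. The associativity and unit laws for objects
  are equalities of the inverse systems themselves.\<close>

lemma additive_monoidal_Pro: "additive_monoidal (Pro C)"
proof (intro additive_monoidal.intro additive_monoidal_axioms.intro category_Pro)
  show "comm_group (hom_group (Pro C) A B)" if "A \<in> Obj (Pro C)" "B \<in> Obj (Pro C)" for A B
    using that by (rule comm_group_Pro)
next
  fix F A B G D G' assume "F \<in> Hom (Pro C) A B" "G \<in> Hom (Pro C) B D" "G' \<in> Hom (Pro C) B D"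
  then obtain u f v g g' where f: "represents A B u f" "F = pro_map A B u f"
    and g: "represents B D v g" "G = pro_map B D v g" "represents B D v g'" "G' = pro_map B D v g'"
    by (metis Hom_ProE Hom_Pro_common2)
  note [simp] = represents_arr[OF f(1)] represents_arr[OF g(1)] represents_arr[OF g(3)]
  show "(G \<boxplus>\<^bsub>Pro C\<^esub> G') \<cdot>\<^bsub>Pro C\<^esub> F = G \<cdot>\<^bsub>Pro C\<^esub> F \<boxplus>\<^bsub>Pro C\<^esub> G' \<cdot>\<^bsub>Pro C\<^esub> F"
    unfolding f(2) g(2,4) pro_add(1)[OF g(1,3)] pro_comp(1)[OF f(1) g(1)] pro_comp(1)[OF f(1) g(3)]
      pro_add(1)[OF pro_comp(2)[OF f(1) g(1)] pro_comp(2)[OF f(1) g(3)]] pro_comp(1)[OF f(1) pro_add(2)[OF g(1,3)]]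
    by simp
next
  fix F A B F' G D assume "F \<in> Hom (Pro C) A B" "F' \<in> Hom (Pro C) A B" "G \<in> Hom (Pro C) B D"
  then obtain u f f' v g where f: "represents A B u f" "F = pro_map A B u f" "represents A B u f'" "F' = pro_map A B u f'"
    and g: "represents B D v g" "G = pro_map B D v g"
    by (metis Hom_ProE Hom_Pro_common2)
  note [simp] = represents_arr[OF f(1)] represents_arr[OF f(3)] represents_arr[OF g(1)]
  show "G \<cdot>\<^bsub>Pro C\<^esub> (F \<boxplus>\<^bsub>Pro C\<^esub> F') = G \<cdot>\<^bsub>Pro C\<^esub> F \<boxplus>\<^bsub>Pro C\<^esub> G \<cdot>\<^bsub>Pro C\<^esub> F'"
    unfolding f(2,4) g(2) pro_add(1)[OF f(1,3)] pro_comp(1)[OF f(1) g(1)] pro_comp(1)[OF f(3) g(1)]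
      pro_add(1)[OF pro_comp(2)[OF f(1) g(1)] pro_comp(2)[OF f(3) g(1)]] pro_comp(1)[OF pro_add(2)[OF f(1,3)] g(1)]
    by simp
next
  fix F A B G D E assume "F \<in> Hom (Pro C) A B" "G \<in> Hom (Pro C) D E"
  then show "F \<star>\<^bsub>Pro C\<^esub> G \<in> Hom (Pro C) (A \<boxtimes>\<^bsub>Pro C\<^esub> D) (B \<boxtimes>\<^bsub>Pro C\<^esub> E)"
    by (rule Hom_Pro_common2) (simp add: pro_tarr pro_map_in_Hom)
next
  fix A B assume "A \<in> Obj (Pro C)" "B \<in> Obj (Pro C)"
  then have [simp]: "is_inv_sys C A" "is_inv_sys C B" by simp_all
  show "Ide (Pro C) A \<star>\<^bsub>Pro C\<^esub> Ide (Pro C) B = Ide (Pro C) (A \<boxtimes>\<^bsub>Pro C\<^esub> B)"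
    unfolding Ide_Pro_level using pro_tarr(1)[OF represents_ide represents_ide] by simp
next
  fix F A B F' D G X Y G' Z
  assume "F \<in> Hom (Pro C) A B" "F' \<in> Hom (Pro C) B D" "G \<in> Hom (Pro C) X Y" "G' \<in> Hom (Pro C) Y Z"
  then obtain u f g v f' g' where f: "represents A B u f" "F = pro_map A B u f" "represents X Y u g" "G = pro_map X Y u g"
    and g: "represents B D v f'" "F' = pro_map B D v f'" "represents Y Z v g'" "G' = pro_map Y Z v g'"
    by (metis Hom_Pro_common2)
  note [simp] = represents_arr[OF f(1)] represents_arr[OF f(3)] represents_arr[OF g(1)] represents_arr[OF g(3)]
  show "(F' \<cdot>\<^bsub>Pro C\<^esub> F) \<star>\<^bsub>Pro C\<^esub> (G' \<cdot>\<^bsub>Pro C\<^esub> G) = (F' \<star>\<^bsub>Pro C\<^esub> G') \<cdot>\<^bsub>Pro C\<^esub> (F \<star>\<^bsub>Pro C\<^esub> G)"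
    unfolding f(2,4) g(2,4) pro_comp(1)[OF f(1) g(1)] pro_comp(1)[OF f(3) g(3)] pro_tarr(1)[OF f(1,3)] pro_tarr(1)[OF g(1,3)]
      pro_tarr(1)[OF pro_comp(2)[OF f(1) g(1)] pro_comp(2)[OF f(3) g(3)]]
      pro_comp(1)[OF pro_tarr(2)[OF f(1,3)] pro_tarr(2)[OF g(1,3)]]
    by simp
next
  fix F G H assume "F \<in> Arr (Pro C)" "G \<in> Arr (Pro C)" "H \<in> Arr (Pro C)"
  then have "F \<in> Hom (Pro C) (PDom F) (PCod F)" "G \<in> Hom (Pro C) (PDom G) (PCod G)" "H \<in> Hom (Pro C) (PDom H) (PCod H)"
    by (simp_all add: Hom_def)
  then obtain A B A' B' A'' B'' u f g h where f: "represents A B u f" "F = pro_map A B u f"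
    and g: "represents A' B' u g" "G = pro_map A' B' u g" and h: "represents A'' B'' u h" "H = pro_map A'' B'' u h"
    by (metis Hom_Pro_common3)
  note [simp] = representsE(1,2)[OF f(1)] representsE(1,2)[OF g(1)] representsE(1,2)[OF h(1)]
    represents_arr[OF f(1)] represents_arr[OF g(1)] represents_arr[OF h(1)]
  show "(F \<star>\<^bsub>Pro C\<^esub> G) \<star>\<^bsub>Pro C\<^esub> H = F \<star>\<^bsub>Pro C\<^esub> (G \<star>\<^bsub>Pro C\<^esub> H)"
    unfolding f(2) g(2) h(2) pro_tarr(1)[OF f(1) g(1)] pro_tarr(1)[OF g(1) h(1)]
      pro_tarr(1)[OF pro_tarr(2)[OF f(1) g(1)] h(1)] pro_tarr(1)[OF f(1) pro_tarr(2)[OF g(1) h(1)]]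
    by (simp add: tensor_pro_assoc)
next
  fix F assume "F \<in> Arr (Pro C)"
  then have "F \<in> Hom (Pro C) (PDom F) (PCod F)" by (simp add: Hom_def)
  then obtain A B u f where u: "\<And>n. n \<le> u n" and f: "represents A B u f" "F = pro_map A B u f"
    by (metis Hom_Pro_common2)
  note [simp] = representsE(1,2)[OF f(1)] represents_arr[OF f(1)]
  let ?k = "const_pro C (Unit C)"
  have k: "is_inv_sys C ?k" by simp
  note i = Ide_Pro(1,2)[OF k u]
  show "Ide (Pro C) (Unit (Pro C)) \<star>\<^bsub>Pro C\<^esub> F = F" "F \<star>\<^bsub>Pro C\<^esub> Ide (Pro C) (Unit (Pro C)) = F"
    using pro_tarr(1)[OF i(1) f(1)] pro_tarr(1)[OF f(1) i(1)] u
    by (simp_all add: i(2) f(2) tensor_pro_unit bnd_const del: Pro_sel(5))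
next
  fix V F G A B assume V: "V \<in> Obj (Pro C)" and "F \<in> Hom (Pro C) A B" "G \<in> Hom (Pro C) A B"
  then obtain u f g where u: "\<And>n. n \<le> u n" and f: "represents A B u f" "F = pro_map A B u f"
    and g: "represents A B u g" "G = pro_map A B u g"
    by (metis Hom_Pro_common2)
  have V [simp]: "is_inv_sys C V" using V by simp
  note [simp] = represents_arr[OF f(1)] represents_arr[OF g(1)] u
  note i = Ide_Pro(1,2)[OF V u]
  show "Ide (Pro C) V \<star>\<^bsub>Pro C\<^esub> (F \<boxplus>\<^bsub>Pro C\<^esub> G) = Ide (Pro C) V \<star>\<^bsub>Pro C\<^esub> F \<boxplus>\<^bsub>Pro C\<^esub> Ide (Pro C) V \<star>\<^bsub>Pro C\<^esub> G"
    unfolding i(2) f(2) g(2) pro_add(1)[OF f(1) g(1)] pro_tarr(1)[OF i(1) f(1)] pro_tarr(1)[OF i(1) g(1)]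
      pro_add(1)[OF pro_tarr(2)[OF i(1) f(1)] pro_tarr(2)[OF i(1) g(1)]] pro_tarr(1)[OF i(1) pro_add(2)[OF f(1) g(1)]]
    by simp
  show "(F \<boxplus>\<^bsub>Pro C\<^esub> G) \<star>\<^bsub>Pro C\<^esub> Ide (Pro C) V = F \<star>\<^bsub>Pro C\<^esub> Ide (Pro C) V \<boxplus>\<^bsub>Pro C\<^esub> G \<star>\<^bsub>Pro C\<^esub> Ide (Pro C) V"
    unfolding i(2) f(2) g(2) pro_add(1)[OF f(1) g(1)] pro_tarr(1)[OF f(1) i(1)] pro_tarr(1)[OF g(1) i(1)]
      pro_add(1)[OF pro_tarr(2)[OF f(1) i(1)] pro_tarr(2)[OF g(1) i(1)]] pro_tarr(1)[OF pro_add(2)[OF f(1) g(1)] i(1)]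
    by simp
qed (simp_all add: tensor_pro_assoc tensor_pro_unit)

end

declare (in base_category) Pro_sel [simp del]

section \<open>Quasi-free pro-algebras\<close>

context additive_monoidal
begin

lemma add_neg_eq_iff:
  assumes "x \<in> Arr C" "y \<in> Arr C" "z \<in> Arr C" "Dom C y = Dom C x" "Cod C y = Cod C x" "Dom C z = Dom C x" "Cod C z = Cod C x"
  shows "x \<boxplus> Neg C y = z \<longleftrightarrow> x = z \<boxplus> y"
proof -
  have "x = (x \<boxplus> Neg C y) \<boxplus> y" using assms by (simp add: add_add)
  moreover have "(z \<boxplus> y) \<boxplus> Neg C y = z" using assms by (simp add: add_add)
  ultimately show ?thesis by metis
qed

text \<open>The two shapes in which the components of the Hochschild identity arise. Negative terms
  are moved across to reach the form that \<open>connection_section\<close> expects.\<close>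

lemma add_neg_rearrange:
  shows "\<lbrakk>x1 \<in> Hom C a b; x2 \<in> Hom C a b; x3 \<in> Hom C a b; x4 \<in> Hom C a b; x5 \<in> Hom C a b; y \<in> Hom C a b; z \<in> Hom C a b;
      (x1 \<boxplus> x2) \<boxplus> Neg C y \<boxplus> (x3 \<boxplus> Neg C z \<boxplus> (x4 \<boxplus> x5)) = Zero C a b\<rbrakk>
    \<Longrightarrow> x1 \<boxplus> x2 \<boxplus> x3 \<boxplus> x4 \<boxplus> x5 = y \<boxplus> z"
    and "\<lbrakk>x \<in> Hom C a b; w \<in> Hom C a b; y \<in> Hom C a b; z \<in> Hom C a b;
      Zero C a b \<boxplus> Neg C y \<boxplus> (x \<boxplus> Neg C z) = w\<rbrakk> \<Longrightarrow> x = w \<boxplus> y \<boxplus> z"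
proof -
  assume h: "x1 \<in> Hom C a b" "x2 \<in> Hom C a b" "x3 \<in> Hom C a b" "x4 \<in> Hom C a b" "x5 \<in> Hom C a b" "y \<in> Hom C a b"
    "z \<in> Hom C a b" and eq: "(x1 \<boxplus> x2) \<boxplus> Neg C y \<boxplus> (x3 \<boxplus> Neg C z \<boxplus> (x4 \<boxplus> x5)) = Zero C a b"
  note [simp] = HomE[OF h(1)] HomE[OF h(2)] HomE[OF h(3)] HomE[OF h(4)] HomE[OF h(5)] HomE[OF h(6)] HomE[OF h(7)]
  have "(x1 \<boxplus> x2 \<boxplus> x3 \<boxplus> x4 \<boxplus> x5) \<boxplus> Neg C (y \<boxplus> z) = Zero C a b"
    using eq by (simp add: add_ac)
  then show "x1 \<boxplus> x2 \<boxplus> x3 \<boxplus> x4 \<boxplus> x5 = y \<boxplus> z" by (subst (asm) add_neg_eq_iff) simp_all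
next
  assume h: "x \<in> Hom C a b" "w \<in> Hom C a b" "y \<in> Hom C a b" "z \<in> Hom C a b"
    and eq: "Zero C a b \<boxplus> Neg C y \<boxplus> (x \<boxplus> Neg C z) = w"
  note [simp] = HomE[OF h(1)] HomE[OF h(2)] HomE[OF h(3)] HomE[OF h(4)]
  have "x \<boxplus> Neg C (y \<boxplus> z) = w" using eq by (simp add: add_ac)
  then show "x = w \<boxplus> y \<boxplus> z" by (subst (asm) add_neg_eq_iff) (simp_all add: add_add)
qed

lemma biproductE:
  assumes "is_biproduct C a b B" "a \<in> Obj C" "b \<in> Obj C"
  shows "Sum B \<in> Obj C" "In1 B \<in> Arr C" "Dom C (In1 B) = a" "Cod C (In1 B) = Sum B"
    "In2 B \<in> Arr C" "Dom C (In2 B) = b" "Cod C (In2 B) = Sum B"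
    "Pr1 B \<in> Arr C" "Dom C (Pr1 B) = Sum B" "Cod C (Pr1 B) = a"
    "Pr2 B \<in> Arr C" "Dom C (Pr2 B) = Sum B" "Cod C (Pr2 B) = b"
    "Pr1 B \<cdot> In1 B = Ide C a" "Pr2 B \<cdot> In2 B = Ide C b" "Pr2 B \<cdot> In1 B = Zero C a b" "Pr1 B \<cdot> In2 B = Zero C b a"
  using assms by (simp_all add: is_biproduct_def Hom_def)

text \<open>The projections of the unitalization split a 2-form into its parts a_0 da_1 da_2 and
  da_1 da_2. Left multiplication has values in the first part, so the unit part of the identity
  contains no left action; d \<union> d lies in the unit part and contributes only there.\<close>

lemma hochschild_components:
  assumes A: "is_alg C A" and B: "is_biproduct C (Und A) (Unit C) (unitalization C A)"
    and \<phi>: "\<phi> \<in> Hom C (Und A) (Omega2 C A)" and eq: "hochschild_coboundary C A \<phi> = cup_d_d C A"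
  obtains \<phi>1 \<phi>2 where "\<phi>1 \<in> Hom C (Und A) (Und A \<boxtimes> Und A \<boxtimes> Und A)" "\<phi>2 \<in> Hom C (Und A) (Und A \<boxtimes> Und A)"
    and "(Mul A \<star> Ide C (Und A) \<star> Ide C (Und A)) \<cdot> (Ide C (Und A) \<star> \<phi>1) \<boxplus> Ide C (Und A) \<star> \<phi>2
        \<boxplus> (Ide C (Und A) \<star> Ide C (Und A) \<star> Mul A) \<cdot> (\<phi>1 \<star> Ide C (Und A))
        \<boxplus> (Mul A \<star> Ide C (Und A) \<star> Ide C (Und A)) \<cdot> (\<phi>1 \<star> Ide C (Und A)) \<boxplus> \<phi>2 \<star> Ide C (Und A)
      = \<phi>1 \<cdot> Mul A \<boxplus> (Ide C (Und A) \<star> Mul A \<star> Ide C (Und A)) \<cdot> (\<phi>1 \<star> Ide C (Und A))"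
    and "(Ide C (Und A) \<star> Mul A) \<cdot> (\<phi>2 \<star> Ide C (Und A))
      = Ide C (Und A) \<star> Ide C (Und A) \<boxplus> \<phi>2 \<cdot> Mul A \<boxplus> (Mul A \<star> Ide C (Und A)) \<cdot> (\<phi>2 \<star> Ide C (Und A))"
proof -
  let ?a = "Und A"
  define U where "U = unitalization C A"
  let ?i = "Ide C (Und A)"
  note [simp] = A
  note U [simp] = biproductE[OF B[folded U_def] alg_arr(4)[OF A] obj_simps(1)]
  note [simp] = HomE[OF \<phi>[unfolded Omega2_def, folded U_def]]
  define P where "P = Pr1 U \<star> ?i \<star> ?i"
  define Q where "Q = Pr2 U \<star> ?i \<star> ?i"
  define \<phi>1 where "\<phi>1 = P \<cdot> \<phi>"
  define \<phi>2 where "\<phi>2 = Q \<cdot> \<phi>"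
  have PQ [simp]: "P \<in> Arr C" "Dom C P = Sum U \<boxtimes> ?a \<boxtimes> ?a" "Cod C P = ?a \<boxtimes> ?a \<boxtimes> ?a"
    "Q \<in> Arr C" "Dom C Q = Sum U \<boxtimes> ?a \<boxtimes> ?a" "Cod C Q = ?a \<boxtimes> ?a"
    unfolding P_def Q_def by simp_all
  have \<phi>12 [simp]: "\<phi>1 \<in> Arr C" "Dom C \<phi>1 = ?a" "Cod C \<phi>1 = ?a \<boxtimes> ?a \<boxtimes> ?a"
    "\<phi>2 \<in> Arr C" "Dom C \<phi>2 = ?a" "Cod C \<phi>2 = ?a \<boxtimes> ?a"
    unfolding \<phi>1_def \<phi>2_def by simp_all
  define X where "X = \<phi> \<star> ?i"
  have X [simp]: "X \<in> Arr C" "Dom C X = ?a \<boxtimes> ?a" "Cod C X = Sum U \<boxtimes> ?a \<boxtimes> ?a \<boxtimes> ?a"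
    unfolding X_def by simp_all
  have \<phi>1X: "\<phi>1 \<star> ?i = (P \<star> ?i) \<cdot> X" and \<phi>2X: "\<phi>2 \<star> ?i = (Q \<star> ?i) \<cdot> X"
    unfolding X_def \<phi>1_def \<phi>2_def by simp_all
  define l where "l = unitalization_lmult C A"
  define r where "r = unitalization_rmult C A"
  have l_eq: "l = In1 U \<cdot> (Mul A \<cdot> (?i \<star> Pr1 U) \<boxplus> ?i \<star> Pr2 U)"
    and r_eq: "r = In1 U \<cdot> (Mul A \<cdot> (Pr1 U \<star> ?i) \<boxplus> Pr2 U \<star> ?i)"
    by (simp_all add: l_def r_def unitalization_lmult_def unitalization_rmult_def Let_def U_def del: comp_add)
  have lr [simp]: "l \<in> Arr C" "Dom C l = ?a \<boxtimes> Sum U" "Cod C l = Sum U"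
    "r \<in> Arr C" "Dom C r = Sum U \<boxtimes> ?a" "Cod C r = Sum U"
    unfolding l_eq r_eq by simp_all
  have Pr_In: "Pr1 U \<cdot> (In1 U \<cdot> x) = Ide C ?a \<cdot> x" "Pr2 U \<cdot> (In1 U \<cdot> x) = Zero C ?a (Unit C) \<cdot> x"
    if "x \<in> Arr C" "Cod C x = ?a" for x
    by (rule comp_eq_comp[OF U(14)] comp_eq_comp[OF U(16)]; simp add: that)+
  have Pr1_lr: "Pr1 U \<cdot> l = Mul A \<cdot> (?i \<star> Pr1 U) \<boxplus> ?i \<star> Pr2 U" "Pr1 U \<cdot> r = Mul A \<cdot> (Pr1 U \<star> ?i) \<boxplus> Pr2 U \<star> ?i"
    unfolding l_eq r_eq by (simp_all add: Pr_In del: comp_add)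
  have Pr2_lr: "Pr2 U \<cdot> l = Zero C (?a \<boxtimes> Sum U) (Unit C)" "Pr2 U \<cdot> r = Zero C (Sum U \<boxtimes> ?a) (Unit C)"
    unfolding l_eq r_eq by (simp_all add: Pr_In del: comp_add)
  let ?u = "Ide C (Sum U)"
  define ract where "ract = ?u \<star> ?i \<star> Mul A \<boxplus> Neg C (?u \<star> Mul A \<star> ?i) \<boxplus> r \<star> ?i \<star> ?i"
  have ract [simp]: "ract \<in> Arr C" "Dom C ract = Sum U \<boxtimes> ?a \<boxtimes> ?a \<boxtimes> ?a" "Cod C ract = Sum U \<boxtimes> ?a \<boxtimes> ?a"
    unfolding ract_def by simp_all
  have cob: "(l \<star> ?i \<star> ?i) \<cdot> (?i \<star> \<phi>) \<boxplus> Neg C (\<phi> \<cdot> Mul A) \<boxplus> ract \<cdot> X = In2 U \<star> ?i \<star> ?i"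
    using eq unfolding hochschild_coboundary_def cup_d_d_def Omega2_lact_def Omega2_ract_def Let_def
      U_def[symmetric] l_def[symmetric] r_def[symmetric] ract_def[symmetric] X_def[symmetric] .
  have 1: "P \<cdot> ((l \<star> ?i \<star> ?i) \<cdot> (?i \<star> \<phi>)) = (Mul A \<star> ?i \<star> ?i) \<cdot> (?i \<star> \<phi>1) \<boxplus> ?i \<star> \<phi>2"
  proof -
    have "P \<cdot> (l \<star> ?i \<star> ?i) = (Mul A \<star> ?i \<star> ?i) \<cdot> (?i \<star> P) \<boxplus> ?i \<star> Q"
      unfolding P_def Q_def by (simp add: Pr1_lr)
    then have "P \<cdot> ((l \<star> ?i \<star> ?i) \<cdot> (?i \<star> \<phi>)) = ((Mul A \<star> ?i \<star> ?i) \<cdot> (?i \<star> P) \<boxplus> ?i \<star> Q) \<cdot> (?i \<star> \<phi>)"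
      by (rule comp_eq_comp) simp_all
    then show ?thesis unfolding \<phi>1_def \<phi>2_def by (simp del: interchange_comp)
  qed
  have ir: "P \<cdot> ract = (?i \<star> ?i \<star> Mul A) \<cdot> (P \<star> ?i) \<boxplus> Neg C ((?i \<star> Mul A \<star> ?i) \<cdot> (P \<star> ?i))
      \<boxplus> ((Mul A \<star> ?i \<star> ?i) \<cdot> (P \<star> ?i) \<boxplus> Q \<star> ?i)"
    unfolding ract_def P_def Q_def by (simp add: Pr1_lr)
  have 2: "P \<cdot> (ract \<cdot> X) = (?i \<star> ?i \<star> Mul A) \<cdot> (\<phi>1 \<star> ?i) \<boxplus> Neg C ((?i \<star> Mul A \<star> ?i) \<cdot> (\<phi>1 \<star> ?i))
      \<boxplus> ((Mul A \<star> ?i \<star> ?i) \<cdot> (\<phi>1 \<star> ?i) \<boxplus> \<phi>2 \<star> ?i)"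
  proof -
    have "P \<cdot> (ract \<cdot> X) = ((?i \<star> ?i \<star> Mul A) \<cdot> (P \<star> ?i) \<boxplus> Neg C ((?i \<star> Mul A \<star> ?i) \<cdot> (P \<star> ?i))
      \<boxplus> ((Mul A \<star> ?i \<star> ?i) \<cdot> (P \<star> ?i) \<boxplus> Q \<star> ?i)) \<cdot> X"
      by (rule comp_eq_comp[OF ir]) simp_all
    then show ?thesis unfolding \<phi>1X \<phi>2X
      by (simp del: interchange interchange_regroup interchange_comp)
  qed
  have "P \<cdot> (In2 U \<star> ?i \<star> ?i) = Zero C (?a \<boxtimes> ?a) (?a \<boxtimes> ?a \<boxtimes> ?a)" unfolding P_def by simp
  then have "P \<cdot> ((l \<star> ?i \<star> ?i) \<cdot> (?i \<star> \<phi>)) \<boxplus> Neg C (\<phi>1 \<cdot> Mul A) \<boxplus> P \<cdot> (ract \<cdot> X) = Zero C (?a \<boxtimes> ?a) (?a \<boxtimes> ?a \<boxtimes> ?a)"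
    unfolding cob[symmetric] \<phi>1_def by (simp del: interchange interchange_regroup interchange_comp)
  note eq1 = this[unfolded 1 2]
  have 3: "Q \<cdot> ((l \<star> ?i \<star> ?i) \<cdot> (?i \<star> \<phi>)) = Zero C (?a \<boxtimes> ?a) (?a \<boxtimes> ?a)"
  proof -
    have "Q \<cdot> (l \<star> ?i \<star> ?i) = Zero C (?a \<boxtimes> Sum U \<boxtimes> ?a \<boxtimes> ?a) (?a \<boxtimes> ?a)"
      unfolding Q_def by (simp add: Pr2_lr)
    then have "Q \<cdot> ((l \<star> ?i \<star> ?i) \<cdot> (?i \<star> \<phi>)) = Zero C (?a \<boxtimes> Sum U \<boxtimes> ?a \<boxtimes> ?a) (?a \<boxtimes> ?a) \<cdot> (?i \<star> \<phi>)"
      by (rule comp_eq_comp) simp_all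
    then show ?thesis by simp
  qed
  \<comment> \<open>By strictness the unit object is invisible in a tensor product. The interchange
    law needs it as a separate factor, so its identity is inserted explicitly.\<close>
  have unit1: "(?i \<star> Mul A) \<cdot> (Pr2 U \<star> ?i \<star> ?i \<star> ?i) = Pr2 U \<star> ?i \<star> Mul A"
    and unit2: "(Mul A \<star> ?i) \<cdot> (Pr2 U \<star> ?i \<star> ?i \<star> ?i) = Pr2 U \<star> Mul A \<star> ?i"
  proof -
    have "(Ide C (Unit C) \<star> (?i \<star> Mul A)) \<cdot> (Pr2 U \<star> (?i \<star> ?i \<star> ?i)) = Pr2 U \<star> ?i \<star> Mul A"
      "(Ide C (Unit C) \<star> (Mul A \<star> ?i)) \<cdot> (Pr2 U \<star> (?i \<star> ?i \<star> ?i)) = Pr2 U \<star> Mul A \<star> ?i"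
      by (subst interchange; simp)+
    then show "(?i \<star> Mul A) \<cdot> (Pr2 U \<star> ?i \<star> ?i \<star> ?i) = Pr2 U \<star> ?i \<star> Mul A"
      and "(Mul A \<star> ?i) \<cdot> (Pr2 U \<star> ?i \<star> ?i \<star> ?i) = Pr2 U \<star> Mul A \<star> ?i" by simp_all
  qed
  have iq: "Q \<cdot> ract = (?i \<star> Mul A) \<cdot> (Q \<star> ?i) \<boxplus> Neg C ((Mul A \<star> ?i) \<cdot> (Q \<star> ?i))"
    unfolding ract_def Q_def by (simp add: Pr2_lr unit1 unit2)
  have 4: "Q \<cdot> (ract \<cdot> X) = (?i \<star> Mul A) \<cdot> (\<phi>2 \<star> ?i) \<boxplus> Neg C ((Mul A \<star> ?i) \<cdot> (\<phi>2 \<star> ?i))"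
  proof -
    have "Q \<cdot> (ract \<cdot> X) = ((?i \<star> Mul A) \<cdot> (Q \<star> ?i) \<boxplus> Neg C ((Mul A \<star> ?i) \<cdot> (Q \<star> ?i))) \<cdot> X"
      by (rule comp_eq_comp[OF iq]) simp_all
    then show ?thesis unfolding \<phi>2X
      by (simp del: interchange interchange_regroup interchange_comp)
  qed
  have "Q \<cdot> (In2 U \<star> ?i \<star> ?i) = ?i \<star> ?i" unfolding Q_def by simp
  then have "Q \<cdot> ((l \<star> ?i \<star> ?i) \<cdot> (?i \<star> \<phi>)) \<boxplus> Neg C (\<phi>2 \<cdot> Mul A) \<boxplus> Q \<cdot> (ract \<cdot> X) = ?i \<star> ?i"
    unfolding cob[symmetric] \<phi>2_def by (simp del: interchange interchange_regroup interchange_comp)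
  note eq2 = this[unfolded 3 4]
  show thesis
  proof (rule that)
    show "\<phi>1 \<in> Hom C ?a (?a \<boxtimes> ?a \<boxtimes> ?a)" "\<phi>2 \<in> Hom C ?a (?a \<boxtimes> ?a)" by (simp_all add: Hom_def)
    show "(Mul A \<star> ?i \<star> ?i) \<cdot> (?i \<star> \<phi>1) \<boxplus> ?i \<star> \<phi>2 \<boxplus> (?i \<star> ?i \<star> Mul A) \<cdot> (\<phi>1 \<star> ?i)
        \<boxplus> (Mul A \<star> ?i \<star> ?i) \<cdot> (\<phi>1 \<star> ?i) \<boxplus> \<phi>2 \<star> ?i
      = \<phi>1 \<cdot> Mul A \<boxplus> (?i \<star> Mul A \<star> ?i) \<cdot> (\<phi>1 \<star> ?i)"
      by (rule add_neg_rearrange(1)[OF _ _ _ _ _ _ _ eq1]) (simp_all add: Hom_def)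
    show "(?i \<star> Mul A) \<cdot> (\<phi>2 \<star> ?i) = ?i \<star> ?i \<boxplus> \<phi>2 \<cdot> Mul A \<boxplus> (Mul A \<star> ?i) \<cdot> (\<phi>2 \<star> ?i)"
      by (rule add_neg_rearrange(2)[OF _ _ _ _ eq2]) (simp_all add: Hom_def)
  qed
qed

end

context base_category
begin

section \<open>Strict maps of inverse systems and the pro-maps they induce\<close>

definition level_nat :: "('o, 'm) inv_sys \<Rightarrow> ('o, 'm) inv_sys \<Rightarrow> (nat \<Rightarrow> 'm) \<Rightarrow> bool" where
  "level_nat A B u \<longleftrightarrow> is_inv_sys C A \<and> is_inv_sys C B \<and> (\<forall>n. u n \<in> Hom C (Lev A n) (Lev B n)) \<and>
    (\<forall>n. Tr B n \<cdot> u (Suc n) = u n \<cdot> Tr A n)"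

lemma level_natE:
  assumes "level_nat A B u"
  shows "is_inv_sys C A" "is_inv_sys C B" "u n \<in> Hom C (Lev A n) (Lev B n)" "Tr B n \<cdot> u (Suc n) = u n \<cdot> Tr A n"
    "u n \<in> Arr C" "Dom C (u n) = Lev A n" "Cod C (u n) = Lev B n" "represents A B (\<lambda>n. n) u"
  using assms represents_level[of A B u] by (auto simp: level_nat_def Hom_def)

lemma level_nat_bnd:
  assumes u: "level_nat A B u" and "n \<le> k"
  shows "bnd B n k \<cdot> u k = u n \<cdot> bnd A n k"
  using assms(2)
proof (induction rule: dec_induct)
  case base
  then show ?case using level_natE(1,2,5-7)[OF u] by simp
next
  case (step k)
  note [simp] = level_natE(1,2,5-7)[OF u]
  have "bnd B n (Suc k) \<cdot> u (Suc k) = bnd B n k \<cdot> (Tr B k \<cdot> u (Suc k))"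
    using step(1) by (simp flip: bnd_comp[of B n k "Suc k"])
  also have "\<dots> = (bnd B n k \<cdot> u k) \<cdot> Tr A k" using step(1) by (simp add: level_natE(4)[OF u])
  also have "\<dots> = u n \<cdot> bnd A n (Suc k)" unfolding step(3) using step(1) by (simp flip: bnd_comp[of A n k "Suc k"])
  finally show ?case .
qed

lemma level_map_Hom: "level_nat A B u \<Longrightarrow> level_map C A B u \<in> Hom (Pro C) A B"
  unfolding level_map_eq by (rule pro_map_in_Hom) (rule level_natE(8))

lemma level_map_comp:
  assumes u: "level_nat A B u" and v: "level_nat B D v"
  shows "level_map C B D v \<cdot>\<^bsub>Pro C\<^esub> level_map C A B u = level_map C A D (\<lambda>n. v n \<cdot> u n)"
    and "level_nat A D (\<lambda>n. v n \<cdot> u n)"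
proof -
  note [simp] = level_natE(1,2,5-7)[OF u] level_natE(1,2,5-7)[OF v]
  show "level_map C B D v \<cdot>\<^bsub>Pro C\<^esub> level_map C A B u = level_map C A D (\<lambda>n. v n \<cdot> u n)"
    unfolding level_map_eq using pro_comp(1)[OF level_natE(8)[OF u] level_natE(8)[OF v]] by simp
  have "Tr D n \<cdot> (v (Suc n) \<cdot> u (Suc n)) = v n \<cdot> (u n \<cdot> Tr A n)" for n
  proof -
    have "Tr D n \<cdot> (v (Suc n) \<cdot> u (Suc n)) = v n \<cdot> (Tr B n \<cdot> u (Suc n))"
      by (rule comp_eq_extend[OF level_natE(4)[OF v]]) simp_all
    then show ?thesis unfolding level_natE(4)[OF u] .
  qed
  then show "level_nat A D (\<lambda>n. v n \<cdot> u n)" by (simp add: level_nat_def Hom_def)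
qed

lemma level_map_tarr:
  assumes u: "level_nat A B u" and v: "level_nat A' B' v"
  shows "level_map C A B u \<star>\<^bsub>Pro C\<^esub> level_map C A' B' v
      = level_map C (tensor_pro C A A') (tensor_pro C B B') (\<lambda>n. u n \<star> v n)"
    and "level_nat (tensor_pro C A A') (tensor_pro C B B') (\<lambda>n. u n \<star> v n)"
proof -
  note [simp] = level_natE(1,2,5-7)[OF u] level_natE(1,2,5-7)[OF v]
  show "level_map C A B u \<star>\<^bsub>Pro C\<^esub> level_map C A' B' v
      = level_map C (tensor_pro C A A') (tensor_pro C B B') (\<lambda>n. u n \<star> v n)"
    unfolding level_map_eq using pro_tarr(1)[OF level_natE(8)[OF u] level_natE(8)[OF v]] by simp
  show "level_nat (tensor_pro C A A') (tensor_pro C B B') (\<lambda>n. u n \<star> v n)"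
    by (simp add: level_nat_def Hom_def level_natE(4)[OF u] level_natE(4)[OF v])
qed

lemma level_map_add:
  assumes u: "level_nat A B u" and v: "level_nat A B v"
  shows "level_map C A B u \<boxplus>\<^bsub>Pro C\<^esub> level_map C A B v = level_map C A B (\<lambda>n. u n \<boxplus> v n)"
    and "level_nat A B (\<lambda>n. u n \<boxplus> v n)"
proof -
  note [simp] = level_natE(1,2,5-7)[OF u] level_natE(1,2,5-7)[OF v]
  show "level_map C A B u \<boxplus>\<^bsub>Pro C\<^esub> level_map C A B v = level_map C A B (\<lambda>n. u n \<boxplus> v n)"
    unfolding level_map_eq using pro_add(1)[OF level_natE(8)[OF u] level_natE(8)[OF v]] by simp
  show "level_nat A B (\<lambda>n. u n \<boxplus> v n)"
    by (simp add: level_nat_def Hom_def level_natE(4)[OF u] level_natE(4)[OF v])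
qed

lemma level_nat_ide: "is_inv_sys C A \<Longrightarrow> level_nat A A (\<lambda>n. Ide C (Lev A n))"
  and level_nat_zero: "\<lbrakk>is_inv_sys C A; is_inv_sys C B\<rbrakk> \<Longrightarrow> level_nat A B (\<lambda>n. Zero C (Lev A n) (Lev B n))"
  by (simp_all add: level_nat_def Hom_def)

lemma level_map_neg:
  assumes u: "level_nat A B u"
  shows "Neg (Pro C) (level_map C A B u) = level_map C A B (\<lambda>n. Neg C (u n))"
    and "level_nat A B (\<lambda>n. Neg C (u n))"
proof -
  note [simp] = level_natE(1,2,5-7)[OF u]
  show v: "level_nat A B (\<lambda>n. Neg C (u n))" by (simp add: level_nat_def Hom_def level_natE(4)[OF u])
  have "level_map C A B u \<boxplus>\<^bsub>Pro C\<^esub> level_map C A B (\<lambda>n. Neg C (u n)) = Zero (Pro C) A B"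
    by (simp add: level_map_add(1)[OF u v] Pro_sel)
  then show "Neg (Pro C) (level_map C A B u) = level_map C A B (\<lambda>n. Neg C (u n))"
    by (intro additive_monoidal.neg_unique[OF additive_monoidal_Pro])
      (use HomD[OF level_map_Hom[OF u]] HomD[OF level_map_Hom[OF v]] in simp_all)
qed

lemma pro_algE:
  assumes "is_pro_alg C R"
  shows "is_alg C (Lev R n)" "is_alg_hom C (Lev R (Suc n)) (Lev R n) (Tr R n)"
    "is_inv_sys C (und_sys R)" "Lev (und_sys R) n = Und (Lev R n)" "Tr (und_sys R) n = Tr R n"
  using assms alg_homE(1) by (auto simp: is_pro_alg_def und_sys_def is_inv_sys_def is_alg_def)

lemma bnd_alg_hom:
  assumes R: "is_pro_alg C R" and "n \<le> k"
  shows "is_alg_hom C (Lev R k) (Lev R n) (bnd (und_sys R) n k)"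
  using assms(2)
proof (induction rule: dec_induct)
  case base
  show ?case using alg_hom_ide[OF pro_algE(1)[OF R]] by (simp add: pro_algE(4)[OF R])
next
  case (step k)
  have "is_alg_hom C (Lev R (Suc k)) (Lev R n) (bnd (und_sys R) n k \<cdot> Tr R k)"
    by (rule alg_hom_comp[OF pro_algE(2)[OF R] step(3)]) (rule pro_algE(1)[OF R])+
  then show ?case using step(1) pro_algE(3,5)[OF R] by (simp flip: bnd_comp[of "und_sys R" n k "Suc k"])
qed

lemma level_nat_mul:
  assumes R: "is_pro_alg C R"
  shows "level_nat (tensor_pro C (und_sys R) (und_sys R)) (und_sys R) (\<lambda>n. Mul (Lev R n))"
  using pro_algE[OF R] alg_homE(2)[OF pro_algE(2)[OF R]] algE(1)[OF pro_algE(1)[OF R]]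
  by (simp add: level_nat_def)

lemma pro_alg_is_alg:
  assumes R: "is_pro_alg C R"
  shows "is_alg (Pro C) (pro_alg C R)"
proof -
  let ?A = "und_sys R" and ?m = "\<lambda>n. Mul (Lev R n)"
  note [simp] = pro_algE[OF R]
  note m = level_nat_mul[OF R]
  have i: "level_nat ?A ?A (\<lambda>n. Ide C (Und (Lev R n)))"
    using level_nat_ide[OF pro_algE(3)[OF R]] by simp
  have assoc: "tensor_pro C (tensor_pro C ?A ?A) ?A = tensor_pro C ?A (tensor_pro C ?A ?A)"
    by (simp add: tensor_pro_assoc)
  note mi = level_map_tarr[OF m i, unfolded assoc] and im = level_map_tarr[OF i m]
  show ?thesis
    unfolding is_alg_def pro_alg_def using level_map_Hom[OF m] level_map_comp(1)[OF mi(2) m] level_map_comp(1)[OF im(2) m]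
    by (simp add: Pro_sel mi(1) im(1) algE(3))
qed

text \<open>Levelwise biproducts with diagonal transition maps. Existence ensures that the choice in
  \<open>unitalization\<close> yields a biproduct in \<open>Pro C\<close>.\<close>

lemma ex_biproduct_Pro:
  assumes A: "is_inv_sys C A" and B: "is_inv_sys C B"
  shows "\<exists>S. is_biproduct (Pro C) A B S"
proof -
  note [simp] = A B
  define S where "S n = (SOME S. is_biproduct C (Lev A n) (Lev B n) S)" for n
  have S: "is_biproduct C (Lev A n) (Lev B n) (S n)" for n
    unfolding S_def by (rule someI_ex) (simp add: biproducts)
  note S' [simp] = biproductE[OF S inv_sysE(1)[OF A] inv_sysE(1)[OF B]]
  have S_sum: "In1 (S n) \<cdot> Pr1 (S n) \<boxplus> In2 (S n) \<cdot> Pr2 (S n) = Ide C (Sum (S n))" for n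
    using S by (simp add: is_biproduct_def)
  have PI: "Pr1 (S n) \<cdot> (In1 (S n) \<cdot> x) = Ide C (Lev A n) \<cdot> x" "Pr2 (S n) \<cdot> (In1 (S n) \<cdot> x) = Zero C (Lev A n) (Lev B n) \<cdot> x"
    if "x \<in> Arr C" "Cod C x = Lev A n" for x n
    by (rule comp_eq_comp[OF S'(14)] comp_eq_comp[OF S'(16)]; simp add: that)+
  have PI': "Pr2 (S n) \<cdot> (In2 (S n) \<cdot> x) = Ide C (Lev B n) \<cdot> x" "Pr1 (S n) \<cdot> (In2 (S n) \<cdot> x) = Zero C (Lev B n) (Lev A n) \<cdot> x"
    if "x \<in> Arr C" "Cod C x = Lev B n" for x n
    by (rule comp_eq_comp[OF S'(15)] comp_eq_comp[OF S'(17)]; simp add: that)+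
  define X where "X = \<lparr>Lev = \<lambda>n. Sum (S n), Tr = \<lambda>n. In1 (S n) \<cdot> (Tr A n \<cdot> Pr1 (S (Suc n))) \<boxplus> In2 (S n) \<cdot> (Tr B n \<cdot> Pr2 (S (Suc n)))\<rparr>"
  have X [simp]: "Lev X n = Sum (S n)" "Tr X n = In1 (S n) \<cdot> (Tr A n \<cdot> Pr1 (S (Suc n))) \<boxplus> In2 (S n) \<cdot> (Tr B n \<cdot> Pr2 (S (Suc n)))" for n
    by (simp_all add: X_def)
  have X_sys [simp]: "is_inv_sys C X" unfolding is_inv_sys_def by (simp add: Hom_def)
  have i1: "level_nat A X (\<lambda>n. In1 (S n))" and i2: "level_nat B X (\<lambda>n. In2 (S n))"
    and p1: "level_nat X A (\<lambda>n. Pr1 (S n))" and p2: "level_nat X B (\<lambda>n. Pr2 (S n))"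
    by (simp_all add: level_nat_def Hom_def PI PI')
  note comps = level_map_comp[OF i1 p1] level_map_comp[OF i2 p2] level_map_comp[OF i1 p2] level_map_comp[OF i2 p1]
    level_map_comp[OF p1 i1] level_map_comp[OF p2 i2]
  have "is_biproduct (Pro C) A B \<lparr>Sum = X, In1 = level_map C A X (\<lambda>n. In1 (S n)), In2 = level_map C B X (\<lambda>n. In2 (S n)),
      Pr1 = level_map C X A (\<lambda>n. Pr1 (S n)), Pr2 = level_map C X B (\<lambda>n. Pr2 (S n))\<rparr>"
    unfolding is_biproduct_def biproduct.simps comps(1,3,5,7,9,11) level_map_add(1)[OF comps(10,12)]
    by (simp add: level_map_Hom[OF i1] level_map_Hom[OF i2] level_map_Hom[OF p1] level_map_Hom[OF p2] Pro_sel S_sum)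
  then show ?thesis ..
qed

lemma pro_comp_level:
  assumes f: "represents A B u f"
  shows "level_nat B D v \<Longrightarrow> level_map C B D v \<cdot>\<^bsub>Pro C\<^esub> pro_map A B u f = pro_map A D u (\<lambda>n. v n \<cdot> f n)"
    and "level_nat B D v \<Longrightarrow> represents A D u (\<lambda>n. v n \<cdot> f n)"
    and "level_nat E A w \<Longrightarrow> pro_map A B u f \<cdot>\<^bsub>Pro C\<^esub> level_map C E A w = pro_map E B u (\<lambda>n. f n \<cdot> w (u n))"
    and "level_nat E A w \<Longrightarrow> represents E B u (\<lambda>n. f n \<cdot> w (u n))"
  using pro_comp[OF f level_natE(8)] pro_comp[OF level_natE(8) f] by (simp_all add: level_map_eq)

lemma represents_eqD:
  assumes "pro_map A B u f = pro_map A B u g" "represents A B u f" "represents A B u g"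
  obtains k where "u n \<le> k" "f n \<cdot> bnd A (u n) k = g n \<cdot> bnd A (u n) k"
  using assms(1) germ_eq_iff[OF representsE(1)[OF assms(2)] representsE(3)[OF assms(2), of n] representsE(3)[OF assms(3), of n]]
  by (auto simp: pro_map_eq_iff)

text \<open>At level \<open>n\<close>, the two component identities of pro-maps are equalities of
  germs, and they become equalities of arrows on a deeper level \<open>m\<close>. Since transition
  maps are multiplicative, the product at the level of the representatives can be exchanged for the
  one at \<open>m\<close>.\<close>

lemma quasi_free_levels:
  assumes qf: "quasi_free C A"
  obtains m \<phi>1 \<phi>2 where "n \<le> m"
    "\<phi>1 \<in> Hom C (Und (Lev A m)) (Und (Lev A n) \<boxtimes> Und (Lev A n) \<boxtimes> Und (Lev A n))"
    "\<phi>2 \<in> Hom C (Und (Lev A m)) (Und (Lev A n) \<boxtimes> Und (Lev A n))"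
    "(Mul (Lev A n) \<star> Ide C (Und (Lev A n)) \<star> Ide C (Und (Lev A n))) \<cdot> (bnd (und_sys A) n m \<star> \<phi>1)
        \<boxplus> bnd (und_sys A) n m \<star> \<phi>2
        \<boxplus> (Ide C (Und (Lev A n)) \<star> Ide C (Und (Lev A n)) \<star> Mul (Lev A n)) \<cdot> (\<phi>1 \<star> bnd (und_sys A) n m)
        \<boxplus> (Mul (Lev A n) \<star> Ide C (Und (Lev A n)) \<star> Ide C (Und (Lev A n))) \<cdot> (\<phi>1 \<star> bnd (und_sys A) n m)
        \<boxplus> \<phi>2 \<star> bnd (und_sys A) n m
      = \<phi>1 \<cdot> Mul (Lev A m) \<boxplus> (Ide C (Und (Lev A n)) \<star> Mul (Lev A n) \<star> Ide C (Und (Lev A n))) \<cdot> (\<phi>1 \<star> bnd (und_sys A) n m)"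
    "(Ide C (Und (Lev A n)) \<star> Mul (Lev A n)) \<cdot> (\<phi>2 \<star> bnd (und_sys A) n m)
      = bnd (und_sys A) n m \<star> bnd (und_sys A) n m \<boxplus> \<phi>2 \<cdot> Mul (Lev A m)
        \<boxplus> (Mul (Lev A n) \<star> Ide C (Und (Lev A n))) \<cdot> (\<phi>2 \<star> bnd (und_sys A) n m)"
proof -
  have A: "is_pro_alg C A" using qf by (simp add: quasi_free_def)
  let ?R = "pro_alg C A" and ?a = "und_sys A" and ?t = "tensor_pro C"
  note [simp] = pro_algE(1,3-5)[OF A]
  obtain \<Phi> where \<Phi>: "\<Phi> \<in> Hom (Pro C) ?a (Omega2 (Pro C) ?R)"
    "hochschild_coboundary (Pro C) ?R \<Phi> = cup_d_d (Pro C) ?R"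
    using qf by (auto simp: quasi_free_def)
  have R: "Und ?R = ?a" "Mul ?R = level_map C (?t ?a ?a) ?a (\<lambda>n. Mul (Lev A n))" by (simp_all add: pro_alg_def)
  have bip: "is_biproduct (Pro C) (Und ?R) (Unit (Pro C)) (unitalization (Pro C) ?R)"
    unfolding unitalization_def R by (rule someI_ex, rule ex_biproduct_Pro) (simp_all add: Pro_sel)
  let ?I = "Ide (Pro C) ?a" and ?M = "level_map C (?t ?a ?a) ?a (\<lambda>n. Mul (Lev A n))"
  \<comment> \<open>The chosen unitalization need not be the levelwise sum, but its projections lead
    to tensor powers of \<open>?a\<close>, so the components have targets that are known at each
    level.\<close>
  obtain \<Phi>1 \<Phi>2 where h: "\<Phi>1 \<in> Hom (Pro C) ?a (?t ?a (?t ?a ?a))" "\<Phi>2 \<in> Hom (Pro C) ?a (?t ?a ?a)"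
    and eq1: "(?M \<star>\<^bsub>Pro C\<^esub> ?I \<star>\<^bsub>Pro C\<^esub> ?I) \<cdot>\<^bsub>Pro C\<^esub> (?I \<star>\<^bsub>Pro C\<^esub> \<Phi>1) \<boxplus>\<^bsub>Pro C\<^esub> ?I \<star>\<^bsub>Pro C\<^esub> \<Phi>2
        \<boxplus>\<^bsub>Pro C\<^esub> (?I \<star>\<^bsub>Pro C\<^esub> ?I \<star>\<^bsub>Pro C\<^esub> ?M) \<cdot>\<^bsub>Pro C\<^esub> (\<Phi>1 \<star>\<^bsub>Pro C\<^esub> ?I)
        \<boxplus>\<^bsub>Pro C\<^esub> (?M \<star>\<^bsub>Pro C\<^esub> ?I \<star>\<^bsub>Pro C\<^esub> ?I) \<cdot>\<^bsub>Pro C\<^esub> (\<Phi>1 \<star>\<^bsub>Pro C\<^esub> ?I) \<boxplus>\<^bsub>Pro C\<^esub> \<Phi>2 \<star>\<^bsub>Pro C\<^esub> ?I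
      = \<Phi>1 \<cdot>\<^bsub>Pro C\<^esub> ?M \<boxplus>\<^bsub>Pro C\<^esub> (?I \<star>\<^bsub>Pro C\<^esub> ?M \<star>\<^bsub>Pro C\<^esub> ?I) \<cdot>\<^bsub>Pro C\<^esub> (\<Phi>1 \<star>\<^bsub>Pro C\<^esub> ?I)"
    and eq2: "(?I \<star>\<^bsub>Pro C\<^esub> ?M) \<cdot>\<^bsub>Pro C\<^esub> (\<Phi>2 \<star>\<^bsub>Pro C\<^esub> ?I)
      = ?I \<star>\<^bsub>Pro C\<^esub> ?I \<boxplus>\<^bsub>Pro C\<^esub> \<Phi>2 \<cdot>\<^bsub>Pro C\<^esub> ?M \<boxplus>\<^bsub>Pro C\<^esub> (?M \<star>\<^bsub>Pro C\<^esub> ?I) \<cdot>\<^bsub>Pro C\<^esub> (\<Phi>2 \<star>\<^bsub>Pro C\<^esub> ?I)"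
    by (rule additive_monoidal.hochschild_components[OF additive_monoidal_Pro pro_alg_is_alg[OF A] bip, of \<Phi>])
      (use \<Phi> in \<open>simp_all add: R Pro_sel(7)\<close>)
  obtain u f1 f2 where u: "\<And>n. n \<le> u n" and f1: "represents ?a (?t ?a (?t ?a ?a)) u f1" "\<Phi>1 = pro_map ?a (?t ?a (?t ?a ?a)) u f1"
    and f2: "represents ?a (?t ?a ?a) u f2" "\<Phi>2 = pro_map ?a (?t ?a ?a) u f2"
    using Hom_Pro_common2[OF h] by blast
  have a: "is_inv_sys C ?a" by simp
  note I = Ide_Pro[OF a u]
  note m = level_nat_mul[OF A]
  have i: "level_nat ?a ?a (\<lambda>n. Ide C (Und (Lev A n)))" using level_nat_ide[OF a] by simp
  have I_level: "?I = level_map C ?a ?a (\<lambda>n. Ide C (Und (Lev A n)))" by (simp add: Pro_sel)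
  have assoc: "?t (?t ?a ?a) X = ?t ?a (?t ?a X)" if "is_inv_sys C X" for X using that by (simp add: tensor_pro_assoc)
  note mul = level_map_tarr[OF m i] level_map_tarr[OF i m]
  note mul3 = level_map_tarr[OF m level_map_tarr(2)[OF i i], folded level_map_tarr(1)[OF i i] I_level]
    level_map_tarr[OF i level_map_tarr(2)[OF m i], folded level_map_tarr(1)[OF m i] I_level]
    level_map_tarr[OF i level_map_tarr(2)[OF i m], folded level_map_tarr(1)[OF i m] I_level]
  note tensors = pro_tarr[OF I(1) f1(1), folded f1(2) I(2)] pro_tarr[OF f1(1) I(1), folded f1(2) I(2)]
    pro_tarr[OF I(1) f2(1), folded f2(2) I(2)] pro_tarr[OF f2(1) I(1), folded f2(2) I(2)] pro_tarr[OF I(1) I(1), folded I(2)]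
  have as: "?t (?t ?a ?a) ?a = ?t ?a (?t ?a ?a)" "?t (?t ?a ?a) (?t ?a ?a) = ?t ?a (?t ?a (?t ?a ?a))"
    "?t (?t ?a (?t ?a ?a)) ?a = ?t ?a (?t ?a (?t ?a ?a))" by (simp_all add: tensor_pro_assoc)
  note [simp] = represents_arr[OF f1(1)] represents_arr[OF f2(1)] u
  let ?b = "\<lambda>n. bnd ?a n (u n)" and ?i = "\<lambda>n. Ide C (Und (Lev A n))" and ?m = "\<lambda>n. Mul (Lev A n)"
  note T = tensors[unfolded as] and M3 = mul3[unfolded as I_level[symmetric]] and M2 = mul[unfolded as, folded I_level]
  note t1 = pro_comp_level(1,2)[OF T(2) M3(2), folded T(1) M3(1)]
    and t3 = pro_comp_level(1,2)[OF T(4) M3(6), folded T(3) M3(5)]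
    and t4 = pro_comp_level(1,2)[OF T(4) M3(2), folded T(3) M3(1)]
    and t6 = pro_comp_level(3,4)[OF f1(1) m, folded f1(2)]
    and t7 = pro_comp_level(1,2)[OF T(4) M3(4), folded T(3) M3(3)]
    and s1 = pro_comp_level(1,2)[OF T(8) M2(4), folded T(7) M2(3)]
    and s3 = pro_comp_level(3,4)[OF f2(1) m, folded f2(2)]
    and s4 = pro_comp_level(1,2)[OF T(8) M2(2), folded T(7) M2(1)]
  note L12 = pro_add[OF t1(2) T(6), folded t1(1) T(5)]
  note L123 = pro_add[OF L12(2) t3(2), folded L12(1) t3(1)]
  note L1234 = pro_add[OF L123(2) t4(2), folded L123(1) t4(1)]
  note L = pro_add[OF L1234(2) T(8), folded L1234(1) T(7)]
  note R = pro_add[OF t6(2) t7(2), folded t6(1) t7(1)]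
  note S12 = pro_add[OF T(10) s3(2), folded T(9) s3(1)]
  note S = pro_add[OF S12(2) s4(2), folded S12(1) s4(1)]
  obtain k where k: "u n \<le> k" and e1: "((?m n \<star> ?i n \<star> ?i n) \<cdot> (?b n \<star> f1 n) \<boxplus> ?b n \<star> f2 n
        \<boxplus> (?i n \<star> ?i n \<star> ?m n) \<cdot> (f1 n \<star> ?b n) \<boxplus> (?m n \<star> ?i n \<star> ?i n) \<cdot> (f1 n \<star> ?b n) \<boxplus> f2 n \<star> ?b n)
        \<cdot> bnd (?t ?a ?a) (u n) k
      = (f1 n \<cdot> ?m (u n) \<boxplus> (?i n \<star> ?m n \<star> ?i n) \<cdot> (f1 n \<star> ?b n)) \<cdot> bnd (?t ?a ?a) (u n) k"
    using represents_eqD[OF eq1[unfolded L(1) R(1)] L(2) R(2)] by blast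
  obtain l where l: "u n \<le> l" and e2: "((?i n \<star> ?m n) \<cdot> (f2 n \<star> ?b n)) \<cdot> bnd (?t ?a ?a) (u n) l
      = (?b n \<star> ?b n \<boxplus> f2 n \<cdot> ?m (u n) \<boxplus> (?m n \<star> ?i n) \<cdot> (f2 n \<star> ?b n)) \<cdot> bnd (?t ?a ?a) (u n) l"
    using represents_eqD[OF eq2[unfolded S(1) s1(1)] s1(2) S(2)] by blast
  \<comment> \<open>Each of the two identities has its own depth; both persist at the larger
    one.\<close>
  let ?k = "max k l"
  have kl: "u n \<le> ?k" "n \<le> ?k" using k u[of n] by (simp_all add: le_max_iff_disj le_trans[OF u[of n] k])
  note e1' = res_mono[OF representsE(1)[OF L(2)] representsE(3)[OF L(2)] representsE(3)[OF R(2)] k k max.cobounded1[of k l] e1]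
  note e2' = res_mono[OF representsE(1)[OF S(2)] representsE(3)[OF s1(2)] representsE(3)[OF S(2)] l l max.cobounded2[of l k] e2]
  let ?r = "bnd ?a (u n) ?k"
  have bt: "bnd (?t ?a ?a) (u n) ?k = ?r \<star> ?r" using kl by (simp add: bnd_tensor)
  have bb: "?b n \<cdot> ?r = bnd ?a n ?k" using kl by (simp add: bnd_comp)
  have mr: "?m (u n) \<cdot> (?r \<star> ?r) = ?r \<cdot> ?m ?k" using alg_homE(2)[OF bnd_alg_hom[OF A kl(1)]] by simp
  note [simp] = kl
  show thesis
  proof (rule that)
    show "n \<le> ?k" "f1 n \<cdot> ?r \<in> Hom C (Und (Lev A ?k)) (Und (Lev A n) \<boxtimes> Und (Lev A n) \<boxtimes> Und (Lev A n))"
      "f2 n \<cdot> ?r \<in> Hom C (Und (Lev A ?k)) (Und (Lev A n) \<boxtimes> Und (Lev A n))" by (simp_all add: Hom_def)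
  qed (use e1' e2' in \<open>simp_all add: bt bb mr del: interchange_regroup interchange_comp\<close>)
qed

section \<open>Splittings of cof-pro-ideals\<close>

lemma is_monoD:
  assumes "is_mono C i" "f \<in> Arr C" "g \<in> Arr C" "Cod C f = Dom C i" "Cod C g = Dom C i" "Dom C f = Dom C g" "i \<cdot> f = i \<cdot> g"
  shows "f = g"
  using assms unfolding is_mono_def by (metis Hom_I)

text \<open>The actions exist by the definition of an ideal. As \<open>i\<close> is monic, their
  compatibilities follow from associativity in \<open>A\<close>.\<close>

lemma ideal_actions:
  assumes "is_ideal C A K i"
  obtains l r where "l \<in> Hom C (Und A \<boxtimes> Und K) (Und K)" "i \<cdot> l = Mul A \<cdot> (Ide C (Und A) \<star> i)"
    "r \<in> Hom C (Und K \<boxtimes> Und A) (Und K)" "i \<cdot> r = Mul A \<cdot> (i \<star> Ide C (Und A))"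
    "l \<cdot> (Mul A \<star> Ide C (Und K)) = l \<cdot> (Ide C (Und A) \<star> l)"
    "Mul K \<cdot> (r \<star> Ide C (Und K)) = Mul K \<cdot> (Ide C (Und K) \<star> l)"
    "r \<cdot> (Mul K \<star> Ide C (Und A)) = Mul K \<cdot> (Ide C (Und K) \<star> r)"
proof -
  have A: "is_alg C A" and K: "is_alg C K" and i: "is_alg_hom C K A i" and mono: "is_mono C i"
    using assms by (simp_all add: is_ideal_def)
  obtain l r where l: "l \<in> Hom C (Und A \<boxtimes> Und K) (Und K)" "i \<cdot> l = Mul A \<cdot> (Ide C (Und A) \<star> i)"
    and r: "r \<in> Hom C (Und K \<boxtimes> Und A) (Und K)" "i \<cdot> r = Mul A \<cdot> (i \<star> Ide C (Und A))"
    using assms unfolding is_ideal_def by blast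
  note [simp] = A K alg_hom_arr[OF i] HomE(1-3)[OF l(1)] HomE(1-3)[OF r(1)]
  have il: "i \<cdot> (l \<cdot> x) = Mul A \<cdot> ((Ide C (Und A) \<star> i) \<cdot> x)" if "x \<in> Arr C" "Cod C x = Und A \<boxtimes> Und K" for x
    by (rule comp_eq_extend[OF l(2)]) (simp_all add: that)
  have ir: "i \<cdot> (r \<cdot> x) = Mul A \<cdot> ((i \<star> Ide C (Und A)) \<cdot> x)" if "x \<in> Arr C" "Cod C x = Und K \<boxtimes> Und A" for x
    by (rule comp_eq_extend[OF r(2)]) (simp_all add: that)
  have im: "i \<cdot> (Mul K \<cdot> x) = Mul A \<cdot> ((i \<star> i) \<cdot> x)" if "x \<in> Arr C" "Cod C x = Und K \<boxtimes> Und K" for x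
    by (rule comp_eq_extend[OF alg_homE(2)[OF i]]) (simp_all add: that)
  show thesis
  proof (rule that[OF l r])
    show "l \<cdot> (Mul A \<star> Ide C (Und K)) = l \<cdot> (Ide C (Und A) \<star> l)"
      by (rule is_monoD[OF mono]) (simp_all add: il l(2) mul_assoc)
    show "Mul K \<cdot> (r \<star> Ide C (Und K)) = Mul K \<cdot> (Ide C (Und K) \<star> l)"
      by (rule is_monoD[OF mono]) (simp_all add: im l(2) r(2) mul_assoc)
    show "r \<cdot> (Mul K \<star> Ide C (Und A)) = Mul K \<cdot> (Ide C (Und K) \<star> r)"
      by (rule is_monoD[OF mono]) (simp_all add: im ir r(2) alg_homE(2)[OF i] mul_assoc)
  qed
qed

section \<open>Maps to constant pro-objects and cofibrations\<close>

lemma represents_const: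
  assumes A: "is_inv_sys C A" and f: "f \<in> Hom C (Lev A m) V"
  shows "represents A (const_pro C V) (\<lambda>_. m) (\<lambda>_. f)"
  using HomE[OF f] A by (simp add: represents_def f)

lemma Hom_const_proE:
  assumes "F \<in> Hom (Pro C) A (const_pro C V)"
  obtains m f where "f \<in> Hom C (Lev A m) V" "F = pro_map A (const_pro C V) (\<lambda>_. m) (\<lambda>_. f)"
proof -
  obtain u f where f: "represents A (const_pro C V) u f" "F = pro_map A (const_pro C V) u f"
    using assms by (rule Hom_ProE)
  have hom: "f n \<in> Hom C (Lev A (u n)) V" for n using representsE(3)[OF f(1), of n] by simp
  have "germ A V (u n) (f n) = germ A V (u 0) (f 0)" for n
  proof (induction n)
    case (Suc n)
    then show ?case using represents_compat[OF f(1), of n] HomE[OF hom[of "Suc n"]] by simp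
  qed simp
  then have "F = pro_map A (const_pro C V) (\<lambda>_. u 0) (\<lambda>_. f 0)" unfolding f(2) pro_map_eq_iff by simp
  then show thesis using that hom by blast
qed

lemma const_pro_map_eq_iff:
  assumes "is_inv_sys C A" "f \<in> Hom C (Lev A m) V" "g \<in> Hom C (Lev A n) V"
  shows "pro_map A (const_pro C V) (\<lambda>_. m) (\<lambda>_. f) = pro_map A (const_pro C V) (\<lambda>_. n) (\<lambda>_. g)
    \<longleftrightarrow> (\<exists>k. m \<le> k \<and> n \<le> k \<and> f \<cdot> bnd A m k = g \<cdot> bnd A n k)"
  using germ_eq_iff[OF assms] by (simp add: pro_map_eq_iff)

text \<open>When all objects are relatively injective, every constant pro-object is a test object. A
  map to it is given by an arrow out of a single level, and equality with an extension means
  equality after restriction to a deeper level \<open>k\<close>.\<close>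

lemma level_cofibration_iff:
  assumes rel: "rel_injectives C J = Obj C" and u: "level_nat A B u"
  shows "level_map C A B u \<in> pro_cofibrations C J \<longleftrightarrow>
    (\<forall>V m f. f \<in> Hom C (Lev A m) V \<longrightarrow> (\<exists>k g. m \<le> k \<and> g \<in> Hom C (Lev B k) V \<and> g \<cdot> u k = f \<cdot> bnd A m k))"
    (is "_ = ?r")
proof
  note [simp] = level_natE(1,2,5-7)[OF u]
  have arr: "level_map C A B u \<in> Arr (Pro C)" "Dom (Pro C) (level_map C A B u) = A" "Cod (Pro C) (level_map C A B u) = B"
    using level_map_Hom[OF u] by (simp_all add: Hom_def)
  have comp: "pro_map B (const_pro C V) (\<lambda>_. k) (\<lambda>_. g) \<cdot>\<^bsub>Pro C\<^esub> level_map C A B u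
      = pro_map A (const_pro C V) (\<lambda>_. k) (\<lambda>_. g \<cdot> u k)" if "g \<in> Hom C (Lev B k) V" for V k g
    using pro_comp_level(3)[OF represents_const[OF _ that] u] by simp
  {
    assume cof: "level_map C A B u \<in> pro_cofibrations C J"
    show ?r
    proof (intro allI impI)
      fix V m f assume f: "f \<in> Hom C (Lev A m) V"
      note [simp] = HomE[OF f]
      have "const_pro C V \<in> pro_test_objects C J" unfolding pro_test_objects_def rel by simp
      moreover have "pro_map A (const_pro C V) (\<lambda>_. m) (\<lambda>_. f) \<in> Hom (Pro C) A (const_pro C V)"
        by (rule pro_map_in_Hom[OF represents_const[OF _ f]]) simp
      ultimately obtain G where "G \<in> Hom (Pro C) B (const_pro C V)"
        and G: "G \<cdot>\<^bsub>Pro C\<^esub> level_map C A B u = pro_map A (const_pro C V) (\<lambda>_. m) (\<lambda>_. f)"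
        using cof unfolding pro_cofibrations_def cofibrations_def by (auto simp: arr)
      then obtain l g where g: "g \<in> Hom C (Lev B l) V" "G = pro_map B (const_pro C V) (\<lambda>_. l) (\<lambda>_. g)"
        using Hom_const_proE by blast
      note [simp] = HomE[OF g(1)]
      have gu: "g \<cdot> u l \<in> Hom C (Lev A l) V" by (simp add: Hom_def)
      obtain k where k: "l \<le> k" "m \<le> k" "(g \<cdot> u l) \<cdot> bnd A l k = f \<cdot> bnd A m k"
        using G unfolding g(2) comp[OF g(1)] const_pro_map_eq_iff[OF level_natE(1)[OF u] gu f] by blast
      have "(g \<cdot> bnd B l k) \<cdot> u k = f \<cdot> bnd A m k"
        using k by (simp add: level_nat_bnd[OF u])
      then show "\<exists>k g. m \<le> k \<and> g \<in> Hom C (Lev B k) V \<and> g \<cdot> u k = f \<cdot> bnd A m k"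
        using k by (intro exI[of _ k] exI[of _ "g \<cdot> bnd B l k"]) (simp add: Hom_def)
    qed
  }
  {
    assume r: ?r
    have "\<exists>G \<in> Hom (Pro C) B F. G \<cdot>\<^bsub>Pro C\<^esub> level_map C A B u = H"
      if F: "F \<in> pro_test_objects C J" and H: "H \<in> Hom (Pro C) A F" for F H
    proof -
      obtain V where V: "F = const_pro C V" using F by (auto simp: pro_test_objects_def)
      obtain m f where f: "f \<in> Hom C (Lev A m) V" "H = pro_map A F (\<lambda>_. m) (\<lambda>_. f)"
        using H Hom_const_proE unfolding V by metis
      obtain k g where k: "m \<le> k" and g: "g \<in> Hom C (Lev B k) V" and eq: "g \<cdot> u k = f \<cdot> bnd A m k"
        using r f(1) by blast
      note [simp] = HomE[OF f(1)] HomE[OF g]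
      have "pro_map B F (\<lambda>_. k) (\<lambda>_. g) \<cdot>\<^bsub>Pro C\<^esub> level_map C A B u = H"
        unfolding V comp[OF g] f(2) eq using k
        by (subst const_pro_map_eq_iff[OF _ _ f(1)]) (auto simp: Hom_def intro!: exI[of _ k])
      moreover have "pro_map B F (\<lambda>_. k) (\<lambda>_. g) \<in> Hom (Pro C) B F"
        unfolding V by (rule pro_map_in_Hom[OF represents_const[OF _ g]]) simp
      ultimately show ?thesis by blast
    qed
    then show "level_map C A B u \<in> pro_cofibrations C J"
      unfolding pro_cofibrations_def cofibrations_def by (simp add: arr)
  }
qed

text \<open>Four levels n \<le> p \<le> q \<le> m are involved. The map from
  \<open>connection_section\<close> uses a retraction \<open>\<rho>\<close> from level q of
  \<open>A\<close> to level p of \<open>K\<close>, and its first factor lies in level p of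
  \<open>A\<close>. A second retraction \<open>\<rho>0\<close>, from there to level n of
  \<open>K\<close>, brings this factor back to the ideal. The Hochschild identity with values at
  level q holds on level m.\<close>

lemma ex_splitting:
  assumes rel: "rel_injectives C J = Obj C" and qf: "quasi_free C A" and cof: "is_cof_pro_ideal C J A K i"
  obtains m \<tau> where "n \<le> m" "\<tau> \<in> Hom C (Und (Lev K m)) (Und (Lev K n) \<boxtimes> Und (Lev K n))"
    "\<tau> \<cdot> (Mul (Lev K m) \<cdot> (Ide C (Und (Lev K m)) \<star> Mul (Lev K m)))
      = (Mul (Lev K n) \<star> Ide C (Und (Lev K n))) \<cdot> (bnd (und_sys K) n m \<star> (\<tau> \<cdot> Mul (Lev K m)))"
    "Mul (Lev K n) \<cdot> (\<tau> \<cdot> Mul (Lev K m)) = bnd (und_sys K) n m \<cdot> Mul (Lev K m)"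
proof -
  have A: "is_pro_alg C A" and K: "is_pro_alg C K" and ideal: "is_ideal C (Lev A n) (Lev K n) (i n)"
    and nat: "Tr A n \<cdot> i (Suc n) = i n \<cdot> Tr K n" for n
    using cof by (auto simp: is_cof_pro_ideal_def is_pro_ideal_def)
  have i: "is_alg_hom C (Lev K n) (Lev A n) (i n)" and mono: "is_mono C (i n)" for n
    using ideal[of n] by (simp_all add: is_ideal_def)
  note [simp] = pro_algE(1,3-5)[OF A] pro_algE(1,3-5)[OF K] alg_hom_arr[OF i]
  have i_nat: "level_nat (und_sys K) (und_sys A) i" using alg_homE(1)[OF i] nat by (simp add: level_nat_def)
  \<comment> \<open>The cofibration criterion is applied to the identity of level n of
    \<open>K\<close>, viewed as an arrow to a constant object; the result is a retraction up to a
    transition map.\<close>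
  have retract: "\<exists>k \<rho>. n \<le> k \<and> \<rho> \<in> Hom C (Und (Lev A k)) (Und (Lev K n)) \<and> \<rho> \<cdot> i k = bnd (und_sys K) n k" for n
  proof -
    have "Ide C (Und (Lev K n)) \<in> Hom C (Lev (und_sys K) n) (Und (Lev K n))" by (simp add: Hom_def)
    then obtain k \<rho> where "n \<le> k" "\<rho> \<in> Hom C (Und (Lev A k)) (Und (Lev K n))"
      "\<rho> \<cdot> i k = Ide C (Und (Lev K n)) \<cdot> bnd (und_sys K) n k"
      using cof unfolding is_cof_pro_ideal_def level_cofibration_iff[OF rel i_nat] by fastforce
    then show ?thesis by fastforce
  qed
  obtain p \<rho>0 where p: "n \<le> p" and \<rho>0: "\<rho>0 \<in> Hom C (Und (Lev A p)) (Und (Lev K n))" "\<rho>0 \<cdot> i p = bnd (und_sys K) n p"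
    using retract by blast
  obtain q \<rho> where q: "p \<le> q" and \<rho>: "\<rho> \<in> Hom C (Und (Lev A q)) (Und (Lev K p))" "\<rho> \<cdot> i q = bnd (und_sys K) p q"
    using retract by blast
  obtain m \<phi>1 \<phi>2 where m: "q \<le> m" and \<phi>: "\<phi>1 \<in> Hom C (Und (Lev A m)) (Und (Lev A q) \<boxtimes> Und (Lev A q) \<boxtimes> Und (Lev A q))"
      "\<phi>2 \<in> Hom C (Und (Lev A m)) (Und (Lev A q) \<boxtimes> Und (Lev A q))"
    and eqs: "(Mul (Lev A q) \<star> Ide C (Und (Lev A q)) \<star> Ide C (Und (Lev A q))) \<cdot> (bnd (und_sys A) q m \<star> \<phi>1)
        \<boxplus> bnd (und_sys A) q m \<star> \<phi>2
        \<boxplus> (Ide C (Und (Lev A q)) \<star> Ide C (Und (Lev A q)) \<star> Mul (Lev A q)) \<cdot> (\<phi>1 \<star> bnd (und_sys A) q m)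
        \<boxplus> (Mul (Lev A q) \<star> Ide C (Und (Lev A q)) \<star> Ide C (Und (Lev A q))) \<cdot> (\<phi>1 \<star> bnd (und_sys A) q m)
        \<boxplus> \<phi>2 \<star> bnd (und_sys A) q m
      = \<phi>1 \<cdot> Mul (Lev A m) \<boxplus> (Ide C (Und (Lev A q)) \<star> Mul (Lev A q) \<star> Ide C (Und (Lev A q))) \<cdot> (\<phi>1 \<star> bnd (und_sys A) q m)"
    "(Ide C (Und (Lev A q)) \<star> Mul (Lev A q)) \<cdot> (\<phi>2 \<star> bnd (und_sys A) q m)
      = bnd (und_sys A) q m \<star> bnd (und_sys A) q m \<boxplus> \<phi>2 \<cdot> Mul (Lev A m)
        \<boxplus> (Mul (Lev A q) \<star> Ide C (Und (Lev A q))) \<cdot> (\<phi>2 \<star> bnd (und_sys A) q m)"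
    by (rule quasi_free_levels[OF qf])
  note [simp] = p q m le_trans[OF p q] le_trans[OF q m] le_trans[OF le_trans[OF p q] m] HomE[OF \<rho>0(1)] HomE[OF \<rho>(1)]
  obtain act r where act: "act \<in> Hom C (Und (Lev A p) \<boxtimes> Und (Lev K p)) (Und (Lev K p))"
      "i p \<cdot> act = Mul (Lev A p) \<cdot> (Ide C (Und (Lev A p)) \<star> i p)"
    and r: "r \<in> Hom C (Und (Lev K p) \<boxtimes> Und (Lev A p)) (Und (Lev K p))"
      "i p \<cdot> r = Mul (Lev A p) \<cdot> (i p \<star> Ide C (Und (Lev A p)))"
    and act_act: "act \<cdot> (Mul (Lev A p) \<star> Ide C (Und (Lev K p))) = act \<cdot> (Ide C (Und (Lev A p)) \<star> act)"
    and r_act: "Mul (Lev K p) \<cdot> (r \<star> Ide C (Und (Lev K p))) = Mul (Lev K p) \<cdot> (Ide C (Und (Lev K p)) \<star> act)"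
    and r_mul: "r \<cdot> (Mul (Lev K p) \<star> Ide C (Und (Lev A p))) = Mul (Lev K p) \<cdot> (Ide C (Und (Lev K p)) \<star> r)"
    by (rule ideal_actions[OF ideal])
  obtain act' where act': "act' \<in> Hom C (Und (Lev A q) \<boxtimes> Und (Lev K q)) (Und (Lev K q))"
      "i q \<cdot> act' = Mul (Lev A q) \<cdot> (Ide C (Und (Lev A q)) \<star> i q)"
    using ideal_actions[OF ideal] by metis
  note [simp] = HomE(1-3)[OF act(1)] HomE(1-3)[OF act'(1)]
  let ?\<beta> = "bnd (und_sys A) q m" and ?\<gamma> = "bnd (und_sys A) p q" and ?b = "bnd (und_sys K) q m" and ?c = "bnd (und_sys K) p q"
  have \<gamma>: "is_alg_hom C (Lev A q) (Lev A p) ?\<gamma>" by (rule bnd_alg_hom[OF A q])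
  have \<beta>i: "?\<beta> \<cdot> i m = i q \<cdot> ?b" and \<gamma>i: "?\<gamma> \<cdot> i q = i p \<cdot> ?c"
    using level_nat_bnd[OF i_nat] by simp_all
  have cb: "?c \<cdot> ?b = bnd (und_sys K) p m" by (simp add: bnd_comp)
  \<comment> \<open>Transition maps respect the module structures of the ideals; this can be checked
    in \<open>A\<close>, because \<open>i p\<close> is monic.\<close>
  have c_act: "?c \<cdot> act' = act \<cdot> (?\<gamma> \<star> ?c)"
  proof (rule is_monoD[OF mono[of p]])
    have "i p \<cdot> (?c \<cdot> act') = ?\<gamma> \<cdot> (i q \<cdot> act')" by (rule comp_eq_extend[OF \<gamma>i[symmetric]]) simp_all
    also have "\<dots> = Mul (Lev A p) \<cdot> ((?\<gamma> \<star> ?\<gamma>) \<cdot> (Ide C (Und (Lev A q)) \<star> i q))"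
      unfolding act'(2) by (rule comp_eq_extend[OF alg_homE(2)[OF \<gamma>]]) simp_all
    also have "\<dots> = Mul (Lev A p) \<cdot> ((Ide C (Und (Lev A p)) \<star> i p) \<cdot> (?\<gamma> \<star> ?c))" by (simp add: \<gamma>i)
    also have "\<dots> = i p \<cdot> (act \<cdot> (?\<gamma> \<star> ?c))" by (rule comp_eq_extend[OF act(2)[symmetric]]) simp_all
    finally show "i p \<cdot> (?c \<cdot> act') = i p \<cdot> (act \<cdot> (?\<gamma> \<star> ?c))" .
  qed simp_all
  have \<rho>j: "\<rho> \<cdot> (?\<beta> \<cdot> i m) = bnd (und_sys K) p m"
  proof -
    have "\<rho> \<cdot> (i q \<cdot> ?b) = ?c \<cdot> ?b" by (rule comp_eq_comp[OF \<rho>(2)]) simp_all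
    then show ?thesis unfolding \<beta>i cb .
  qed
  \<comment> \<open>\<open>\<rho>\<close> is merely an arrow of the base category, but the product
    of an element of \<open>A\<close> with one of the ideal lies in the ideal, where
    \<open>\<rho>\<close> is a transition map and hence linear.\<close>
  have \<rho>\<mu>: "\<rho> \<cdot> (Mul (Lev A q) \<cdot> (Ide C (Und (Lev A q)) \<star> (?\<beta> \<cdot> i m))) = act \<cdot> (?\<gamma> \<star> bnd (und_sys K) p m)"
  proof -
    have "Mul (Lev A q) \<cdot> (Ide C (Und (Lev A q)) \<star> (i q \<cdot> ?b)) = i q \<cdot> (act' \<cdot> (Ide C (Und (Lev A q)) \<star> ?b))"
    proof -
      have "Mul (Lev A q) \<cdot> (Ide C (Und (Lev A q)) \<star> (i q \<cdot> ?b))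
          = Mul (Lev A q) \<cdot> ((Ide C (Und (Lev A q)) \<star> i q) \<cdot> (Ide C (Und (Lev A q)) \<star> ?b))" by simp
      also have "\<dots> = i q \<cdot> (act' \<cdot> (Ide C (Und (Lev A q)) \<star> ?b))"
        by (rule comp_eq_extend[OF act'(2)[symmetric]]) simp_all
      finally show ?thesis .
    qed
    moreover have "\<rho> \<cdot> (i q \<cdot> (act' \<cdot> (Ide C (Und (Lev A q)) \<star> ?b))) = ?c \<cdot> (act' \<cdot> (Ide C (Und (Lev A q)) \<star> ?b))"
      by (rule comp_eq_comp[OF \<rho>(2)]) simp_all
    moreover have "?c \<cdot> (act' \<cdot> (Ide C (Und (Lev A q)) \<star> ?b)) = act \<cdot> ((?\<gamma> \<star> ?c) \<cdot> (Ide C (Und (Lev A q)) \<star> ?b))"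
      by (rule comp_eq_extend[OF c_act]) simp_all
    ultimately show ?thesis unfolding \<beta>i by (simp add: cb)
  qed
  have homs: "?\<beta> \<in> Hom C (Und (Lev A m)) (Und (Lev A q))" "?\<gamma> \<in> Hom C (Und (Lev A q)) (Und (Lev A p))"
    "bnd (und_sys K) p m \<in> Hom C (Und (Lev K m)) (Und (Lev K p))"
    "bnd (und_sys K) n p \<in> Hom C (Und (Lev K p)) (Und (Lev K n))"
    "?\<gamma> \<cdot> ?\<beta> \<in> Hom C (Und (Lev A m)) (Und (Lev A p))"
    by (simp_all add: Hom_def)
  obtain S e where S: "S \<in> Hom C (Und (Lev A m)) (Und (Lev A p) \<boxtimes> Und (Lev K p))" "e \<in> Hom C (Und (Lev K m)) (Und (Lev K p))"
    "S \<cdot> (Mul (Lev A m) \<cdot> (Ide C (Und (Lev A m)) \<star> i m))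
      = (Mul (Lev A p) \<star> Ide C (Und (Lev K p))) \<cdot> ((?\<gamma> \<cdot> ?\<beta>) \<star> (S \<cdot> i m)) \<boxplus> (?\<gamma> \<cdot> ?\<beta>) \<star> e"
    "act \<cdot> (S \<cdot> i m) \<boxplus> e = bnd (und_sys K) p m"
    using connection_section[OF algE(1)[OF pro_algE(1)[OF A]] algE(1)[OF pro_algE(1)[OF A]]
        algE(1,3)[OF pro_algE(1)[OF A]] act(1) act_act homs(1,2) alg_homE(2)[OF \<gamma>] \<rho>(1) alg_homE(1)[OF i] homs(3)
        \<rho>j \<rho>\<mu> \<phi> eqs] by blast
  have gj: "(?\<gamma> \<cdot> ?\<beta>) \<cdot> i m = i p \<cdot> bnd (und_sys K) p m"
    using level_nat_bnd[OF i_nat, of p m] by (simp add: bnd_comp)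
  note split = splitting_of_section[OF algE(1)[OF pro_algE(1)[OF A]] algE(1)[OF pro_algE(1)[OF A]]
      algE(1,3)[OF pro_algE(1)[OF K]] algE(1)[OF pro_algE(1)[OF K]] algE(1)[OF pro_algE(1)[OF K]] act(1) r(1) r_act r_mul
      alg_homE(1)[OF i] r(2) alg_homE[OF i] homs(3) alg_homE(2)[OF bnd_alg_hom[OF K]] homs(5) gj S
      \<rho>0(1) homs(4) alg_homE(2)[OF bnd_alg_hom[OF K p]] \<rho>0(2)]
  have nm: "bnd (und_sys K) n p \<cdot> bnd (und_sys K) p m = bnd (und_sys K) n m" by (simp add: bnd_comp)
  let ?\<tau> = "(\<rho>0 \<star> bnd (und_sys K) n p) \<cdot> (S \<cdot> i m)"
  show thesis
  proof (rule that[of m ?\<tau>])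
    show "n \<le> m" "?\<tau> \<in> Hom C (Und (Lev K m)) (Und (Lev K n) \<boxtimes> Und (Lev K n))" using split(1) by simp_all
    show "?\<tau> \<cdot> (Mul (Lev K m) \<cdot> (Ide C (Und (Lev K m)) \<star> Mul (Lev K m)))
      = (Mul (Lev K n) \<star> Ide C (Und (Lev K n))) \<cdot> (bnd (und_sys K) n m \<star> (?\<tau> \<cdot> Mul (Lev K m)))"
      using split(2) unfolding nm by simp
    have "bnd (und_sys K) n p \<cdot> (bnd (und_sys K) p m \<cdot> Mul (Lev K m)) = bnd (und_sys K) n m \<cdot> Mul (Lev K m)"
      by (rule comp_eq_comp[OF nm]) simp_all
    then show "Mul (Lev K n) \<cdot> (?\<tau> \<cdot> Mul (Lev K m)) = bnd (und_sys K) n m \<cdot> Mul (Lev K m)"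
      using split(3) by simp
  qed
qed

text \<open>The bound \<open>l\<close> makes the source deep enough for its power to have as many
  factors as an application requires. In the induction a further splitting is attached at the
  target, so the hypothesis is used at the level where that splitting starts.\<close>

lemma ex_splits:
  assumes rel: "rel_injectives C J = Obj C" and qf: "quasi_free C A" and cof: "is_cof_pro_ideal C J A K i"
  shows "\<exists>m \<tau>. n \<le> m \<and> l \<le> m \<and> splits (Lev K m) (Lev K n) (bnd (und_sys K) n m) N \<tau>"
proof (induction N arbitrary: n l)
  case 0
  have K: "is_pro_alg C K" using cof by (simp add: is_cof_pro_ideal_def is_pro_ideal_def)
  show ?case
    using splits_0[OF pro_algE(1)[OF K] pro_algE(1)[OF K] bnd_alg_hom[OF K, of n "max n l"]]
    by (intro exI[of _ "max n l"] exI) auto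
next
  case (Suc N)
  have K: "is_pro_alg C K" using cof by (simp add: is_cof_pro_ideal_def is_pro_ideal_def)
  note alg = pro_algE(1)[OF K]
  obtain q \<sigma> where q: "n \<le> q" and \<sigma>: "\<sigma> \<in> Hom C (Und (Lev K q)) (Und (Lev K n) \<boxtimes> Und (Lev K n))"
    "\<sigma> \<cdot> (Mul (Lev K q) \<cdot> (Ide C (Und (Lev K q)) \<star> Mul (Lev K q)))
      = (Mul (Lev K n) \<star> Ide C (Und (Lev K n))) \<cdot> (bnd (und_sys K) n q \<star> (\<sigma> \<cdot> Mul (Lev K q)))"
    "Mul (Lev K n) \<cdot> (\<sigma> \<cdot> Mul (Lev K q)) = bnd (und_sys K) n q \<cdot> Mul (Lev K q)"
    by (rule ex_splitting[OF assms])
  obtain m \<tau> where m: "q \<le> m" "l \<le> m" and \<tau>: "splits (Lev K m) (Lev K q) (bnd (und_sys K) q m) N \<tau>"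
    using Suc by blast
  have "bnd (und_sys K) n q \<cdot> bnd (und_sys K) q m = bnd (und_sys K) n m"
    by (rule bnd_comp[OF pro_algE(3)[OF K] q m(1)])
  then show ?case
    using splits_Suc[OF alg alg alg bnd_alg_hom[OF K m(1)] bnd_alg_hom[OF K q] \<tau> \<sigma>] q m
    by (intro exI[of _ m] exI) auto
qed

section \<open>The pro-algebra of infinite order powers\<close>

lemma power_inf_sel [simp]:
  "Lev (power_inf C K) n = power_alg C (Lev K n) (Suc n)"
  "Tr (power_inf C K) n = power_trans C (Lev K (Suc n)) (Lev K n) (Tr K n) (Suc n)"
  by (simp_all add: power_inf_def)

lemma is_pro_alg_power_inf:
  assumes K: "is_pro_alg C K"
  shows "is_pro_alg C (power_inf C K)"
  using power_alg_is_alg[OF pro_algE(1)[OF K]] power_trans(4)[OF pro_algE(1)[OF K] pro_algE(1)[OF K] pro_algE(2)[OF K]]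
  by (simp add: is_pro_alg_def)

text \<open>\<open>w\<close> lifts a composite transition map of powers to tensor powers. By the
  last conclusion it lies over the transition map of \<open>K\<close>, and this determines its
  projection to the power.\<close>

lemma bnd_power_inf:
  assumes K: "is_pro_alg C K" and "n \<le> k"
  obtains w where "w \<in> Hom C (Und (Lev K k) \<boxtimes> tpow C (Und (Lev K k)) k) (Und (Lev K n) \<boxtimes> tpow C (Und (Lev K n)) n)"
    "bnd (und_sys (power_inf C K)) n k \<cdot> power_proj C (Lev K k) (Suc k) = power_proj C (Lev K n) (Suc n) \<cdot> w"
    "nmult C (Lev K n) (Suc n) \<cdot> w = bnd (und_sys K) n k \<cdot> nmult C (Lev K k) (Suc k)"
proof -
  let ?T = "\<lambda>n. Und (Lev K n) \<boxtimes> tpow C (Und (Lev K n)) n" and ?R = "und_sys (power_inf C K)"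
  note [simp] = pro_algE(1,3-5)[OF K] pro_algE(3-5)[OF is_pro_alg_power_inf[OF K]]
  note alg = pro_algE(1)[OF K] and tr = power_trans[OF pro_algE(1)[OF K] pro_algE(1)[OF K] pro_algE(2)[OF K]]
  have "\<exists>w. w \<in> Hom C (?T k) (?T n) \<and> bnd ?R n k \<cdot> power_proj C (Lev K k) (Suc k) = power_proj C (Lev K n) (Suc n) \<cdot> w \<and>
    nmult C (Lev K n) (Suc n) \<cdot> w = bnd (und_sys K) n k \<cdot> nmult C (Lev K k) (Suc k)"
    using assms(2)
  proof (induction rule: dec_induct)
    case base
    show ?case by (intro exI[of _ "Ide C (?T n)"]) (simp add: Hom_def del: ide_tobj)
  next
    case (step k)
    then obtain w where w: "w \<in> Hom C (?T k) (?T n)"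
      "bnd ?R n k \<cdot> power_proj C (Lev K k) (Suc k) = power_proj C (Lev K n) (Suc n) \<cdot> w"
      "nmult C (Lev K n) (Suc n) \<cdot> w = bnd (und_sys K) n k \<cdot> nmult C (Lev K k) (Suc k)" by blast
    define e where "e = tpow_arr C (Tr K k) (Suc k) \<cdot> (Mul (Lev K (Suc k)) \<star> Ide C (tpow C (Und (Lev K (Suc k))) k))"
    note tr' = tr[of k k, folded e_def]
    note [simp] = HomE(1-3)[OF w(1)] alg_hom_arr[OF pro_algE(2)[OF K]] HomE(1-3)[OF tr'(1)] step(1)
    have e [simp]: "e \<in> Arr C" "Dom C e = ?T (Suc k)" "Cod C e = ?T k" unfolding e_def by simp_all
    have b: "bnd ?R n (Suc k) = bnd ?R n k \<cdot> power_trans C (Lev K (Suc k)) (Lev K k) (Tr K k) (Suc k)"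
      "bnd (und_sys K) n (Suc k) = bnd (und_sys K) n k \<cdot> Tr K k"
      using bnd_comp[of ?R n k "Suc k"] bnd_comp[of "und_sys K" n k "Suc k"] by simp_all
    have "bnd ?R n (Suc k) \<cdot> power_proj C (Lev K (Suc k)) (Suc (Suc k))
        = bnd ?R n k \<cdot> (power_proj C (Lev K k) (Suc k) \<cdot> e)"
      unfolding b by (simp add: tr'(2))
    also have "\<dots> = power_proj C (Lev K n) (Suc n) \<cdot> (w \<cdot> e)"
      by (rule comp_eq_extend[OF w(2)]) simp_all
    finally have 1: "bnd ?R n (Suc k) \<cdot> power_proj C (Lev K (Suc k)) (Suc (Suc k)) = power_proj C (Lev K n) (Suc n) \<cdot> (w \<cdot> e)" .
    have "nmult C (Lev K n) (Suc n) \<cdot> (w \<cdot> e) = bnd (und_sys K) n k \<cdot> (nmult C (Lev K k) (Suc k) \<cdot> e)"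
      by (rule comp_eq_extend[OF w(3)]) simp_all
    then have 2: "nmult C (Lev K n) (Suc n) \<cdot> (w \<cdot> e) = bnd (und_sys K) n (Suc k) \<cdot> nmult C (Lev K (Suc k)) (Suc (Suc k))"
      unfolding b tr'(3) by simp
    have "w \<cdot> e \<in> Hom C (?T (Suc k)) (?T n)" unfolding Hom_def by simp
    with 1 2 show ?case by blast
  qed
  then show thesis using that by blast
qed

lemma power_inf_incl_cofibration:
  assumes rel: "rel_injectives C J = Obj C" and qf: "quasi_free C A" and cof: "is_cof_pro_ideal C J A K i"
  shows "power_inf_incl C K \<in> pro_cofibrations C J"
proof -
  have K: "is_pro_alg C K" using cof by (simp add: is_cof_pro_ideal_def is_pro_ideal_def)
  let ?R = "und_sys (power_inf C K)"
  note alg = pro_algE(1)[OF K]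
  note [simp] = pro_algE(1,3-5)[OF K] pro_algE(3-5)[OF is_pro_alg_power_inf[OF K]] HomE(1-3)[OF power_incl(1)[OF alg]]
  have nat: "level_nat ?R (und_sys K) (\<lambda>n. power_incl C (Lev K n) (Suc n))"
    using power_trans(5)[OF alg alg pro_algE(2)[OF K]] power_incl(1)[OF alg] by (simp add: level_nat_def)
  have "\<exists>k g. n \<le> k \<and> g \<in> Hom C (Lev (und_sys K) k) V \<and> g \<cdot> power_incl C (Lev K k) (Suc k) = f \<cdot> bnd ?R n k"
    if f: "f \<in> Hom C (Lev ?R n) V" for V n f
  proof -
    obtain k \<tau> where k: "n \<le> k" and \<tau>: "splits (Lev K k) (Lev K n) (bnd (und_sys K) n k) n \<tau>"
      using ex_splits[OF assms, of n n n] by blast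
    obtain w where w: "w \<in> Hom C (Und (Lev K k) \<boxtimes> tpow C (Und (Lev K k)) k) (Und (Lev K n) \<boxtimes> tpow C (Und (Lev K n)) n)"
      "bnd ?R n k \<cdot> power_proj C (Lev K k) (Suc k) = power_proj C (Lev K n) (Suc n) \<cdot> w"
      "nmult C (Lev K n) (Suc n) \<cdot> w = bnd (und_sys K) n k \<cdot> nmult C (Lev K k) (Suc k)"
      by (rule bnd_power_inf[OF K k])
    \<comment> \<open>\<open>\<tau>\<close> is controlled on products of n + 1 elements, and the
      power at level \<open>k\<close> consists of products of k + 1 elements, where k + 1 \<ge> n +
      1.\<close>
    obtain y where y: "y \<in> Hom C (Und (Lev K k) \<boxtimes> tpow C (Und (Lev K k)) k) (Und (Lev K k) \<boxtimes> tpow C (Und (Lev K k)) n)"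
      "nmult C (Lev K k) (Suc k) = nmult C (Lev K k) (Suc n) \<cdot> y"
      by (rule nmult_factor[OF alg k])
    have \<tau>_hom: "\<tau> \<in> Hom C (Und (Lev K k)) (Und (Lev K n) \<boxtimes> tpow C (Und (Lev K n)) n)"
      and \<tau>_sect: "nmult C (Lev K n) (Suc n) \<cdot> (\<tau> \<cdot> nmult C (Lev K k) (Suc n)) = bnd (und_sys K) n k \<cdot> nmult C (Lev K k) (Suc n)"
      using \<tau> by (simp_all add: splits_def)
    note [simp] = HomE[OF f] HomE(1-3)[OF w(1)] HomE(1-3)[OF y(1)] HomE(1-3)[OF \<tau>_hom] k
    let ?p = "power_proj C (Lev K n) (Suc n)"
    have "nmult C (Lev K n) (Suc n) \<cdot> (\<tau> \<cdot> nmult C (Lev K k) (Suc k))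
        = (nmult C (Lev K n) (Suc n) \<cdot> (\<tau> \<cdot> nmult C (Lev K k) (Suc n))) \<cdot> y"
      unfolding y(2) by simp
    also have "\<dots> = nmult C (Lev K n) (Suc n) \<cdot> w" unfolding \<tau>_sect w(3) y(2) by simp
    finally have pw: "?p \<cdot> (\<tau> \<cdot> nmult C (Lev K k) (Suc k)) = ?p \<cdot> w"
      by (rule power_proj_eqI[OF alg, rotated -1]) simp_all
    \<comment> \<open>\<open>f\<close> is extended to \<open>K\<close> by splitting an element into
      n + 1 factors and taking their class in the power at level \<open>n\<close>. On products of k
      + 1 elements that class is given by the transition map, by \<open>pw\<close>.\<close>
    let ?g = "f \<cdot> (?p \<cdot> \<tau>)"
    have "(?g \<cdot> power_incl C (Lev K k) (Suc k)) \<cdot> power_proj C (Lev K k) (Suc k)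
        = (f \<cdot> bnd ?R n k) \<cdot> power_proj C (Lev K k) (Suc k)"
      by (simp add: power_incl(2)[OF alg] pw w(2))
    then have "?g \<cdot> power_incl C (Lev K k) (Suc k) = f \<cdot> bnd ?R n k"
      by (rule power_proj_epi[OF alg]) simp_all
    moreover have "?g \<in> Hom C (Lev (und_sys K) k) V" by (simp add: Hom_def)
    ultimately show ?thesis using k by blast
  qed
  then have "level_map C ?R (und_sys K) (\<lambda>n. power_incl C (Lev K n) (Suc n)) \<in> pro_cofibrations C J"
    unfolding level_cofibration_iff[OF rel nat] by blast
  then show ?thesis by (simp add: power_inf_incl_def)
qed

lemma ex_power_inf_section:
  assumes rel: "rel_injectives C J = Obj C" and qf: "quasi_free C A" and cof: "is_cof_pro_ideal C J A K i"
  defines "R \<equiv> power_inf C K"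
  obtains m s where "n \<le> m" "s \<in> Hom C (Und (Lev R m)) (Und (Lev R n) \<boxtimes> Und (Lev R n))"
    "s \<cdot> Mul (Lev R m) = (Mul (Lev R n) \<star> Ide C (Und (Lev R n))) \<cdot> (bnd (und_sys R) n m \<star> s)"
    "Mul (Lev R n) \<cdot> s = bnd (und_sys R) n m"
proof -
  have K: "is_pro_alg C K" using cof by (simp add: is_cof_pro_ideal_def is_pro_ideal_def)
  note alg = pro_algE(1)[OF K]
  note [simp] = pro_algE(3-5)[OF is_pro_alg_power_inf[OF K]]
  \<comment> \<open>The power at level \<open>n\<close> has exponent n + 1, so two copies of it
    require a splitting into 2 n + 2 factors, whose index is n + (n + 1). The same number bounds
    \<open>m\<close> from below, since elements of the source must be products of at least 2 n + 2
    elements.\<close>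
  obtain m \<tau> where m: "n \<le> m" "n + Suc n \<le> m" and \<tau>: "splits (Lev K m) (Lev K n) (bnd (und_sys K) n m) (n + Suc n) \<tau>"
    using ex_splits[OF assms(1-3), of n "n + Suc n" "n + Suc n"] by blast
  obtain w where w: "w \<in> Hom C (Und (Lev K m) \<boxtimes> tpow C (Und (Lev K m)) m) (Und (Lev K n) \<boxtimes> tpow C (Und (Lev K n)) n)"
    "bnd (und_sys R) n m \<cdot> power_proj C (Lev K m) (Suc m) = power_proj C (Lev K n) (Suc n) \<cdot> w"
    "nmult C (Lev K n) (Suc n) \<cdot> w = bnd (und_sys K) n m \<cdot> nmult C (Lev K m) (Suc m)"
    unfolding R_def by (rule bnd_power_inf[OF K m(1)])
  have t: "bnd (und_sys R) n m \<in> Hom C (power_obj C (Lev K m) (Suc m)) (power_obj C (Lev K n) (Suc n))"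
    unfolding R_def using m by (simp add: Hom_def)
  show thesis
    using power_section[OF alg alg bnd_alg_hom[OF K m(1)] \<tau> m(2) t w] that[OF m(1)] by (auto simp: R_def)
qed

section \<open>Weak contractibility\<close>

text \<open>Exactness is reduced to constant objects: it says that the map \<open>e\<close> from the cokernel \<open>Q\<close> of one
  boundary map to the target of the next is a cofibration.\<close>

lemma HOM_exact_Pro:
  assumes D: "\<And>p. level_nat (X (Suc p)) (X p) (D p)"
    and DD: "\<And>p n. D p n \<cdot> D (Suc p) n = Zero C (Lev (X (Suc (Suc p))) n) (Lev (X p) n)"
    and d: "\<And>p. d (Suc p) = level_map C (X (Suc p)) (X p) (D p)"
    and contr0: "\<And>n. \<exists>m h. n \<le> m \<and> h \<in> Hom C (Lev (X 0) m) (Lev (X 1) n) \<and> D 0 n \<cdot> h = bnd (X 0) n m"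
    and contr: "\<And>p n. \<exists>m h k. n \<le> m \<and> h \<in> Hom C (Lev (X (Suc p)) m) (Lev (X (Suc (Suc p))) n) \<and>
      k \<in> Hom C (Lev (X p) m) (Lev (X (Suc p)) n) \<and> bnd (X (Suc p)) n m = D (Suc p) n \<cdot> h \<boxplus> k \<cdot> D p m"
    and rel: "rel_injectives C J = Obj C" and F: "F \<in> pro_rel_injectives C J"
  shows "HOM_exact (Pro C) X d F"
proof -
  interpret P: additive_monoidal "Pro C" by (rule additive_monoidal_Pro)
  have F_sys [simp]: "is_inv_sys C F" using F by (simp add: pro_rel_injectives_def rel_injectives_def Pro_sel)
  note D' [simp] = level_natE(1,2,5-7)[OF D]
  have X [simp]: "is_inv_sys C (X p)" for p using level_natE(2)[OF D] .
  have zero_comp: "Zero (Pro C) (X p) F \<cdot>\<^bsub>Pro C\<^esub> d (Suc p) = Zero (Pro C) (X (Suc p)) F" for p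
    using P.comp_zero(2)[of "d (Suc p)" F "X p"] level_map_Hom[OF D[of p]] by (simp add: d Hom_def Pro_sel)
  have dd: "d (Suc p) \<cdot>\<^bsub>Pro C\<^esub> d (Suc (Suc p)) = Zero (Pro C) (X (Suc (Suc p))) (X p)" for p
    unfolding d level_map_comp(1)[OF D D] DD by (simp add: Pro_sel)
  \<comment> \<open>The vanishing of a composite in \<open>Pro C\<close> concerns germs. In each
    component it becomes the vanishing of an arrow after restriction to a deeper level, and
    restriction commutes with the boundary.\<close>
  have vanish: "\<exists>k\<ge>u n. (f n \<cdot> bnd (X p) (u n) k) \<cdot> D p k = Zero C (Lev (X (Suc p)) k) (Lev F n)"
    if f: "represents (X p) F u f" and "pro_map (X p) F u f \<cdot>\<^bsub>Pro C\<^esub> d (Suc p) = Zero (Pro C) (X (Suc p)) F" for p u f n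
  proof -
    have "pro_map (X (Suc p)) F u (\<lambda>n. f n \<cdot> D p (u n)) = pro_map (X (Suc p)) F u (\<lambda>n. Zero C (Lev (X (Suc p)) (u n)) (Lev F n))"
      using that(2) unfolding d pro_comp_level(3)[OF f D] Zero_Pro(2)[OF X F_sys, of _ u] .
    from represents_eqD[OF this pro_comp_level(4)[OF f D] Zero_Pro(1)[OF X F_sys], of n]
    obtain k where k: "u n \<le> k" "(f n \<cdot> D p (u n)) \<cdot> bnd (X (Suc p)) (u n) k
      = Zero C (Lev (X (Suc p)) (u n)) (Lev F n) \<cdot> bnd (X (Suc p)) (u n) k" by blast
    note [simp] = represents_arr[OF f] k(1)
    show ?thesis using k by (intro exI[of _ k]) (simp add: level_nat_bnd[OF D])
  qed
  have exact0: "{f \<in> Hom (Pro C) (X 0) F. f \<cdot>\<^bsub>Pro C\<^esub> d 1 = Zero (Pro C) (X 1) F} = {Zero (Pro C) (X 0) F}"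
  proof (intro equalityI subsetI)
    fix G assume "G \<in> {f \<in> Hom (Pro C) (X 0) F. f \<cdot>\<^bsub>Pro C\<^esub> d 1 = Zero (Pro C) (X 1) F}"
    then obtain u f where f: "represents (X 0) F u f" "G = pro_map (X 0) F u f"
      and Gd: "pro_map (X 0) F u f \<cdot>\<^bsub>Pro C\<^esub> d (Suc 0) = Zero (Pro C) (X (Suc 0)) F" by (auto elim: Hom_ProE)
    note [simp] = represents_arr[OF f(1)]
    have "\<exists>m\<ge>u n. f n \<cdot> bnd (X 0) (u n) m = Zero C (Lev (X 0) (u n)) (Lev F n) \<cdot> bnd (X 0) (u n) m" for n
    proof -
      obtain k where k: "u n \<le> k" "(f n \<cdot> bnd (X 0) (u n) k) \<cdot> D 0 k = Zero C (Lev (X (Suc 0)) k) (Lev F n)"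
        using vanish[OF f(1) Gd] by blast
      obtain m h where m: "k \<le> m" "h \<in> Hom C (Lev (X 0) m) (Lev (X 1) k)" "D 0 k \<cdot> h = bnd (X 0) k m"
        using contr0 by blast
      note [simp] = HomE[OF m(2)[unfolded One_nat_def]] k(1) m(1) le_trans[OF k(1) m(1)]
      have "f n \<cdot> bnd (X 0) (u n) m = f n \<cdot> (bnd (X 0) (u n) k \<cdot> (D 0 k \<cdot> h))"
        unfolding m(3) by (simp add: bnd_comp)
      also have "\<dots> = ((f n \<cdot> bnd (X 0) (u n) k) \<cdot> D 0 k) \<cdot> h" by simp
      finally show ?thesis unfolding k(2) by (intro exI[of _ m]) simp
    qed
    then show "G \<in> {Zero (Pro C) (X 0) F}"
      unfolding f(2) Zero_Pro(2)[OF X F_sys, of 0 u]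
      by (simp add: pro_map_eq_iff germ_eq_iff[OF X representsE(3)[OF f(1)] representsE(3)[OF Zero_Pro(1)[OF X F_sys]]])
  next
    fix G assume "G \<in> {Zero (Pro C) (X 0) F}"
    then show "G \<in> {f \<in> Hom (Pro C) (X 0) F. f \<cdot>\<^bsub>Pro C\<^esub> d 1 = Zero (Pro C) (X 1) F}"
      using zero_comp[of 0] P.zero_arr[of "X 0" F] by (simp add: Hom_def Pro_sel(1))
  qed
  have exact: "{f \<in> Hom (Pro C) (X (p + 1)) F. f \<cdot>\<^bsub>Pro C\<^esub> d (p + 2) = Zero (Pro C) (X (p + 2)) F}
      = {g \<cdot>\<^bsub>Pro C\<^esub> d (p + 1) | g. g \<in> Hom (Pro C) (X p) F}" for p
  proof (intro equalityI subsetI)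
    fix G assume "G \<in> {g \<cdot>\<^bsub>Pro C\<^esub> d (p + 1) | g. g \<in> Hom (Pro C) (X p) F}"
    then obtain g where g: "g \<in> Hom (Pro C) (X p) F" "G = g \<cdot>\<^bsub>Pro C\<^esub> d (Suc p)" by auto
    have dp: "d (Suc p) \<in> Hom (Pro C) (X (Suc p)) (X p)" "d (Suc (Suc p)) \<in> Hom (Pro C) (X (Suc (Suc p))) (X (Suc p))"
      unfolding d by (rule level_map_Hom[OF D])+
    have "G \<cdot>\<^bsub>Pro C\<^esub> d (Suc (Suc p)) = g \<cdot>\<^bsub>Pro C\<^esub> Zero (Pro C) (X (Suc (Suc p))) (X p)"
      unfolding g(2) dd[symmetric] by (rule P.comp_assoc[OF dp(2,1) g(1), symmetric])
    also have "\<dots> = Zero (Pro C) (X (Suc (Suc p))) F"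
      using P.comp_zero(1)[of g "X (Suc (Suc p))" "X p"] HomD[OF g(1)] by (simp add: Pro_sel(1))
    finally show "G \<in> {f \<in> Hom (Pro C) (X (p + 1)) F. f \<cdot>\<^bsub>Pro C\<^esub> d (p + 2) = Zero (Pro C) (X (p + 2)) F}"
      using P.comp_hom[OF dp(1) g(1)] g(2) by simp
  next
    fix G assume "G \<in> {f \<in> Hom (Pro C) (X (p + 1)) F. f \<cdot>\<^bsub>Pro C\<^esub> d (p + 2) = Zero (Pro C) (X (p + 2)) F}"
    then have G: "G \<in> Hom (Pro C) (X (Suc p)) F" and Gd: "G \<cdot>\<^bsub>Pro C\<^esub> d (Suc (Suc p)) = Zero (Pro C) (X (Suc (Suc p))) F"
      by simp_all
    \<comment> \<open>The cokernels of the boundary from degree p + 2 form a pro-object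
      \<open>Q\<close>. Maps from degree p + 1 to \<open>F\<close> that vanish on this boundary come
      from \<open>Q\<close>, and those in the image of the differential extend from \<open>Q\<close>
      along \<open>e\<close> to degree p.\<close>
    define q where "q n = cokernel_of C (D (Suc p) n)" for n
    have cok: "is_cokernel C (D (Suc p) n) (q n)" for n unfolding q_def by (rule is_cokernel_cokernel_of) simp
    note q [simp] = cokernelE(2,3)[OF cok]
    have q_zero: "q n \<cdot> D (Suc p) n = Zero C (Lev (X (Suc (Suc p))) n) (Cod C (q n))" for n
      using cokernelE(4)[OF cok] by simp
    have q_zero': "q n \<cdot> (D (Suc p) n \<cdot> x) = Zero C (Dom C x) (Cod C (q n))"
      if x: "x \<in> Arr C" "Cod C x = Lev (X (Suc (Suc p))) n" for n x
    proof -
      have "q n \<cdot> (D (Suc p) n \<cdot> x) = Zero C (Lev (X (Suc (Suc p))) n) (Cod C (q n)) \<cdot> x"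
        by (rule comp_eq_comp[OF q_zero]) (simp_all add: x)
      then show ?thesis by (simp add: x)
    qed
    have "\<exists>t. t \<in> Hom C (Cod C (q (Suc n))) (Cod C (q n)) \<and> t \<cdot> q (Suc n) = q n \<cdot> Tr (X (Suc p)) n" for n
    proof -
      have "(q n \<cdot> Tr (X (Suc p)) n) \<cdot> D (Suc p) (Suc n) = q n \<cdot> (D (Suc p) n \<cdot> Tr (X (Suc (Suc p))) n)"
        by (simp add: level_natE(4)[OF D])
      also have "\<dots> = Zero C (Lev (X (Suc (Suc p))) (Suc n)) (Cod C (q n))"
        by (simp add: q_zero')
      finally show ?thesis using cokernel_factor[OF cok[of "Suc n"], of "q n \<cdot> Tr (X (Suc p)) n"] by auto
    qed
    then obtain t where t: "\<And>n. t n \<in> Hom C (Cod C (q (Suc n))) (Cod C (q n))" "\<And>n. t n \<cdot> q (Suc n) = q n \<cdot> Tr (X (Suc p)) n"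
      by metis
    define Q where "Q = \<lparr>Lev = \<lambda>n. Cod C (q n), Tr = t\<rparr>"
    have Q_sel [simp]: "Lev Q n = Cod C (q n)" "Tr Q n = t n" for n by (simp_all add: Q_def)
    have Q [simp]: "is_inv_sys C Q" unfolding is_inv_sys_def by (simp add: t(1))
    have q_nat: "level_nat (X (Suc p)) Q q" by (simp add: level_nat_def Hom_def t(2))
    have "\<exists>e. e \<in> Hom C (Cod C (q n)) (Lev (X p) n) \<and> e \<cdot> q n = D p n" for n
      using cokernel_factor[OF cok[of n], of "D p n"] DD[of p n] by auto
    then obtain e where e: "\<And>n. e n \<in> Hom C (Cod C (q n)) (Lev (X p) n)" "\<And>n. e n \<cdot> q n = D p n" by metis
    note [simp] = HomE(1-3)[OF t(1)] HomE(1-3)[OF e(1)]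
    have e_nat: "level_nat Q (X p) e"
    proof -
      have "Tr (X p) n \<cdot> e (Suc n) = e n \<cdot> t n" for n
      proof (rule cokernel_epi[OF cok[of "Suc n"]])
        have "(e n \<cdot> t n) \<cdot> q (Suc n) = (e n \<cdot> q n) \<cdot> Tr (X (Suc p)) n" by (simp add: t(2))
        then show "(Tr (X p) n \<cdot> e (Suc n)) \<cdot> q (Suc n) = (e n \<cdot> t n) \<cdot> q (Suc n)"
          by (simp add: e(2) level_natE(4)[OF D])
      qed simp_all
      then show ?thesis by (simp add: level_nat_def e(1))
    qed
    have "level_map C Q (X p) e \<in> pro_cofibrations C J"
      unfolding level_cofibration_iff[OF rel e_nat]
    proof (intro allI impI)
      fix V n y assume y: "y \<in> Hom C (Lev Q n) V"
      note [simp] = HomE[OF y]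
      obtain m h k where m: "n \<le> m" and h: "h \<in> Hom C (Lev (X (Suc p)) m) (Lev (X (Suc (Suc p))) n)"
        and k: "k \<in> Hom C (Lev (X p) m) (Lev (X (Suc p)) n)" and eq: "bnd (X (Suc p)) n m = D (Suc p) n \<cdot> h \<boxplus> k \<cdot> D p m"
        using contr by blast
      note [simp] = HomE[OF h] HomE[OF k] m
      \<comment> \<open>The homotopy \<open>k\<close> supplies the extension: in the cokernel the
        summand with \<open>h\<close> disappears, and \<open>k\<close> after the boundary becomes
        the transition map.\<close>
      let ?g = "y \<cdot> (q n \<cdot> k)"
      have "?g \<cdot> e m = y \<cdot> bnd Q n m"
      proof (rule cokernel_epi[OF cok[of m]])
        have "q n \<cdot> (D (Suc p) n \<cdot> h) = Zero C (Lev (X (Suc p)) m) (Cod C (q n))"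
          by (simp add: q_zero')
        then have "q n \<cdot> (k \<cdot> D p m) = q n \<cdot> bnd (X (Suc p)) n m" unfolding eq by simp
        also have "\<dots> = bnd Q n m \<cdot> q m" using level_nat_bnd[OF q_nat m] by simp
        finally show "(?g \<cdot> e m) \<cdot> q m = (y \<cdot> bnd Q n m) \<cdot> q m" by (simp add: e(2))
      qed simp_all
      then show "\<exists>k g. n \<le> k \<and> g \<in> Hom C (Lev (X p) k) V \<and> g \<cdot> e k = y \<cdot> bnd Q n k"
        by (intro exI[of _ m] exI[of _ ?g]) (simp add: Hom_def)
    qed
    \<comment> \<open>The relative injectivity of \<open>F\<close> is used here. \<open>F\<close>
      need not be constant, while \<open>e\<close> had to be tested against constant objects
      only.\<close>
    then have ext: "\<exists>H \<in> Hom (Pro C) (X p) F. H \<cdot>\<^bsub>Pro C\<^esub> level_map C Q (X p) e = Y" if "Y \<in> Hom (Pro C) Q F" for Y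
      using F that HomD[OF level_map_Hom[OF e_nat]]
      unfolding pro_rel_injectives_def rel_injectives_def pro_cofibrations_def by fastforce
    obtain u f where f: "represents (X (Suc p)) F u f" "G = pro_map (X (Suc p)) F u f" using G by (rule Hom_ProE)
    \<comment> \<open>At level \<open>v n\<close> the composite with the boundary is zero as an
      arrow, so the restriction of \<open>f n\<close> to that level factors through the cokernel
      there.\<close>
    obtain v where v: "\<And>n. u n \<le> v n" "\<And>n. (f n \<cdot> bnd (X (Suc p)) (u n) (v n)) \<cdot> D (Suc p) (v n) = Zero C (Lev (X (Suc (Suc p))) (v n)) (Lev F n)"
      using vanish[OF f(1) Gd[unfolded f(2)]] by metis
    define f' where "f' n = f n \<cdot> bnd (X (Suc p)) (u n) (v n)" for n
    have f': "represents (X (Suc p)) F v f'" "G = pro_map (X (Suc p)) F v f'"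
      unfolding f'_def f(2) using represents_raise[OF f(1) v(1)] by simp_all
    note [simp] = represents_arr[OF f'(1)]
    have "\<exists>y. y \<in> Hom C (Cod C (q (v n))) (Lev F n) \<and> y \<cdot> q (v n) = f' n" for n
      using cokernel_factor[OF cok[of "v n"], of "f' n"] v(2)[of n, folded f'_def] by auto
    then obtain y where y: "\<And>n. y n \<in> Hom C (Cod C (q (v n))) (Lev F n)" "\<And>n. y n \<cdot> q (v n) = f' n" by metis
    note [simp] = HomE(1-3)[OF y(1)]
    \<comment> \<open>Compatibility is tested after composition with the epimorphism
      \<open>q k\<close>, where it is the compatibility of \<open>f'\<close>.\<close>
    have y_rep: "represents Q F v y"
    proof -
      have "germ Q (Lev F n) (v (Suc n)) (Tr F n \<cdot> y (Suc n)) = germ Q (Lev F n) (v n) (y n)" for n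
      proof -
        obtain k where k: "v (Suc n) \<le> k" "v n \<le> k"
          "(Tr F n \<cdot> f' (Suc n)) \<cdot> bnd (X (Suc p)) (v (Suc n)) k = f' n \<cdot> bnd (X (Suc p)) (v n) k"
          using represents_compat[OF f'(1), of n]
            germ_eq_iff[OF X, of "Tr F n \<cdot> f' (Suc n)" "Suc p" "v (Suc n)" "Lev F n" "f' n" "v n"] by (auto simp: Hom_def)
        note [simp] = k(1,2)
        have "(Tr F n \<cdot> y (Suc n)) \<cdot> bnd Q (v (Suc n)) k = y n \<cdot> bnd Q (v n) k"
        proof (rule cokernel_epi[OF cok[of k]])
          have "((Tr F n \<cdot> y (Suc n)) \<cdot> bnd Q (v (Suc n)) k) \<cdot> q k = (Tr F n \<cdot> (y (Suc n) \<cdot> q (v (Suc n)))) \<cdot> bnd (X (Suc p)) (v (Suc n)) k"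
            by (simp add: level_nat_bnd[OF q_nat])
          also have "\<dots> = (y n \<cdot> q (v n)) \<cdot> bnd (X (Suc p)) (v n) k" unfolding y(2) k(3) ..
          also have "\<dots> = (y n \<cdot> bnd Q (v n) k) \<cdot> q k" by (simp add: level_nat_bnd[OF q_nat])
          finally show "((Tr F n \<cdot> y (Suc n)) \<cdot> bnd Q (v (Suc n)) k) \<cdot> q k = (y n \<cdot> bnd Q (v n) k) \<cdot> q k" .
        qed simp_all
        then show ?thesis by (subst germ_eq_iff[OF Q]) (auto simp: Hom_def intro!: exI[of _ k])
      qed
      then show ?thesis by (simp add: represents_def y(1))
    qed
    obtain H where H: "H \<in> Hom (Pro C) (X p) F" "H \<cdot>\<^bsub>Pro C\<^esub> level_map C Q (X p) e = pro_map Q F v y"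
      using ext[OF pro_map_in_Hom[OF y_rep]] by blast
    have "d (Suc p) = level_map C Q (X p) e \<cdot>\<^bsub>Pro C\<^esub> level_map C (X (Suc p)) Q q"
      unfolding d level_map_comp(1)[OF q_nat e_nat] by (simp add: e(2))
    then have "H \<cdot>\<^bsub>Pro C\<^esub> d (Suc p) = pro_map Q F v y \<cdot>\<^bsub>Pro C\<^esub> level_map C (X (Suc p)) Q q"
      using P.comp_assoc[OF level_map_Hom[OF q_nat] level_map_Hom[OF e_nat] H(1)] H(2) by simp
    also have "\<dots> = G" unfolding pro_comp_level(3)[OF y_rep q_nat] y(2) f'(2) ..
    finally show "G \<in> {g \<cdot>\<^bsub>Pro C\<^esub> d (p + 1) | g. g \<in> Hom (Pro C) (X p) F}" using H(1) by auto
  qed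
  show ?thesis unfolding HOM_exact_def using exact0 exact by blast
qed

section \<open>The bar complex of a pro-algebra, level by level\<close>

lemma tpow_Pro_sel [simp]:
  "Lev (tpow (Pro C) A n) k = tpow C (Lev A k) n" "Tr (tpow (Pro C) A n) k = tpow_arr C (Tr A k) n"
  by (induction n) (simp_all add: Pro_sel)

lemma inv_sys_tpow_Pro [simp]: "is_inv_sys C A \<Longrightarrow> is_inv_sys C (tpow (Pro C) A n)"
  by (induction n) (simp_all add: Pro_sel)

lemma bnd_tpow_Pro: "\<lbrakk>is_inv_sys C A; n \<le> k\<rbrakk> \<Longrightarrow> bnd (tpow (Pro C) A p) n k = tpow_arr C (bnd A n k) p"
  by (induction p) (simp_all add: Pro_sel bnd_const bnd_tensor)

text \<open>The recursion builds the boundary from tensor products, sums and negatives, which are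
  all computed levelwise on strict maps.\<close>

lemma bar_diff_Pro:
  assumes R: "is_pro_alg C R"
  defines "A \<equiv> und_sys R"
  shows "additive_monoidal.bar_diff (Pro C) (pro_alg C R) n
      = level_map C (tpow (Pro C) A (Suc n)) (tpow (Pro C) A n) (\<lambda>k. bar_diff (Lev R k) n)"
    and "level_nat (tpow (Pro C) A (Suc n)) (tpow (Pro C) A n) (\<lambda>k. bar_diff (Lev R k) n)"
proof -
  interpret P: additive_monoidal "Pro C" by (rule additive_monoidal_Pro)
  note [simp] = pro_algE(1)[OF R] pro_algE(3-5)[OF R, folded A_def]
  have A: "is_inv_sys C A" by simp
  have und: "Und (pro_alg C R) = A" "Mul (pro_alg C R) = level_map C (tensor_pro C A A) A (\<lambda>n. Mul (Lev R n))"
    by (simp_all add: pro_alg_def A_def)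
  note m = level_nat_mul[OF R, folded A_def]
  have i: "level_nat (tpow (Pro C) A n) (tpow (Pro C) A n) (\<lambda>k. Ide C (tpow C (Und (Lev R k)) n))" for n
    using level_nat_ide[of "tpow (Pro C) A n"] by simp
  have i1: "level_nat A A (\<lambda>k. Ide C (Und (Lev R k)))" using level_nat_ide[OF A] by simp
  have Ide: "Ide (Pro C) A = level_map C A A (\<lambda>k. Ide C (Und (Lev R k)))"
    "Ide (Pro C) (tpow (Pro C) A n) = level_map C (tpow (Pro C) A n) (tpow (Pro C) A n) (\<lambda>k. Ide C (tpow C (Und (Lev R k)) n))" for n
    by (simp_all add: Pro_sel)
  have right: "tensor_pro C (tpow (Pro C) A n) A = tpow (Pro C) A (Suc n)" for n
    using P.tpow_Suc_right[of A n] by (simp add: Pro_sel)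
  have right2: "tensor_pro C (tpow (Pro C) A n) (tensor_pro C A A) = tpow (Pro C) A (Suc (Suc n))" for n
    using right[of n] right[of "Suc n"] tensor_pro_assoc[of "tpow (Pro C) A n" A A] by simp
  have "P.bar_diff (pro_alg C R) n = level_map C (tpow (Pro C) A (Suc n)) (tpow (Pro C) A n) (\<lambda>k. bar_diff (Lev R k) n)
    \<and> level_nat (tpow (Pro C) A (Suc n)) (tpow (Pro C) A n) (\<lambda>k. bar_diff (Lev R k) n)"
  proof (induction n)
    case 0
    show ?case using level_nat_zero[of A "const_pro C (Unit C)"] by (simp add: und Pro_sel tensor_pro_unit)
  next
    case (Suc n)
    note b = level_map_tarr[OF conjunct2[OF Suc] i1, unfolded right]
    note t = level_map_tarr[OF i[of n] m, unfolded right right2]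
    have "P.signed n (Ide (Pro C) (tpow (Pro C) A n) \<star>\<^bsub>Pro C\<^esub> level_map C (tensor_pro C A A) A (\<lambda>n. Mul (Lev R n)))
        = level_map C (tpow (Pro C) A (Suc (Suc n))) (tpow (Pro C) A (Suc n)) (\<lambda>k. signed n (Ide C (tpow C (Und (Lev R k)) n) \<star> Mul (Lev R k)))
      \<and> level_nat (tpow (Pro C) A (Suc (Suc n))) (tpow (Pro C) A (Suc n)) (\<lambda>k. signed n (Ide C (tpow C (Und (Lev R k)) n) \<star> Mul (Lev R k)))"
      unfolding Ide t(1) P.signed_def signed_def using level_map_neg[OF t(2)] t(2) by (cases "even n") simp_all
    then show ?case
      using level_map_add[OF b(2)] b(1) conjunct1[OF Suc] by (simp add: und Ide(1) del: tpow.simps)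
  qed
  then show "P.bar_diff (pro_alg C R) n = level_map C (tpow (Pro C) A (Suc n)) (tpow (Pro C) A n) (\<lambda>k. bar_diff (Lev R k) n)"
    and "level_nat (tpow (Pro C) A (Suc n)) (tpow (Pro C) A n) (\<lambda>k. bar_diff (Lev R k) n)" by simp_all
qed

text \<open>The homotopies of \<open>bar_homotopy\<close> go from level \<open>m\<close> to level
  \<open>n\<close>. Tensored with the transition map of \<open>V\<close>, they are the data that
  \<open>HOM_exact_Pro\<close> asks for, in which a transition map replaces the identity.\<close>

lemma H_unital_of_sections:
  assumes rel: "rel_injectives C J = Obj C" and R: "is_pro_alg C R"
    and sect: "\<And>n. \<exists>m s. n \<le> m \<and> s \<in> Hom C (Und (Lev R m)) (Und (Lev R n) \<boxtimes> Und (Lev R n)) \<and>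
      s \<cdot> Mul (Lev R m) = (Mul (Lev R n) \<star> Ide C (Und (Lev R n))) \<cdot> (bnd (und_sys R) n m \<star> s) \<and>
      Mul (Lev R n) \<cdot> s = bnd (und_sys R) n m"
  shows "H_unital C J R"
  unfolding H_unital_def weakly_contractible_def
proof (intro conjI R ballI)
  fix V F assume "V \<in> Obj (Pro C)" and F: "F \<in> pro_rel_injectives C J"
  then have V [simp]: "is_inv_sys C V" by (simp add: Pro_sel)
  interpret P: additive_monoidal "Pro C" by (rule additive_monoidal_Pro)
  let ?A = "und_sys R"
  note [simp] = pro_algE(1,3-5)[OF R]
  note alg = pro_algE(1)[OF R]
  define X where "X p = tensor_pro C V (tpow (Pro C) ?A (Suc p))" for p
  define D where "D p k = Ide C (Lev V k) \<star> bar_diff (Lev R k) (Suc p)" for p k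
  have obj: "V \<boxtimes>\<^bsub>Pro C\<^esub> bar_obj (Pro C) (pro_alg C R) n = X n" for n
    by (simp add: X_def bar_obj_def pro_alg_def Pro_sel)
  note diff = level_map_tarr[OF level_nat_ide[OF V] bar_diff_Pro(2)[OF R]]
  have bd: "Ide (Pro C) V \<star>\<^bsub>Pro C\<^esub> bar_bd (Pro C) (pro_alg C R) (Suc p) = level_map C (X (Suc p)) (X p) (D p)" for p
    unfolding P.bar_bd_eq_bar_diff[OF pro_alg_is_alg[OF R]] bar_diff_Pro(1)[OF R] Pro_sel(5) diff(1)
    by (simp only: X_def D_def[abs_def])
  have bndX: "bnd (X p) n m = bnd V n m \<star> tpow_arr C (bnd ?A n m) (Suc p)" if "n \<le> m" for p n m
    unfolding X_def using that by (simp add: bnd_tensor bnd_tpow_Pro del: tpow_arr.simps tpow.simps)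
  have X_Lev: "Lev (X p) n = Lev V n \<boxtimes> Und (Lev R n) \<boxtimes> tpow C (Und (Lev R n)) p" for p n by (simp add: X_def Pro_sel)
  show "HOM_exact (Pro C) (\<lambda>n. V \<boxtimes>\<^bsub>Pro C\<^esub> bar_obj (Pro C) (pro_alg C R) n)
      (\<lambda>n. Ide (Pro C) V \<star>\<^bsub>Pro C\<^esub> bar_bd (Pro C) (pro_alg C R) n) F"
    unfolding obj
  proof (rule HOM_exact_Pro[where D = D, OF _ _ bd _ _ rel F])
    show "level_nat (X (Suc p)) (X p) (D p)" for p
      using diff(2)[of "Suc p"] by (simp only: X_def D_def[abs_def])
    show "D p n \<cdot> D (Suc p) n = Zero C (Lev (X (Suc (Suc p))) n) (Lev (X p) n)" for p n
      using bar_diff_comp[OF alg, of n "Suc p"] by (simp add: D_def X_Lev del: bar_diff.simps)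
  next
    fix n
    obtain m s where m: "n \<le> m" and s: "s \<in> Hom C (Und (Lev R m)) (Und (Lev R n) \<boxtimes> Und (Lev R n))"
      "s \<cdot> Mul (Lev R m) = (Mul (Lev R n) \<star> Ide C (Und (Lev R n))) \<cdot> (bnd ?A n m \<star> s)" "Mul (Lev R n) \<cdot> s = bnd ?A n m"
      using sect by blast
    note [simp] = HomE(1-3)[OF s(1)] m
    note homotopy = bar_homotopy[OF alg alg bnd_alg_hom[OF R m] s]
    \<comment> \<open>In degree 0 there is no lower term, and the section property alone gives the
      contraction.\<close>
    show "\<exists>m h. n \<le> m \<and> h \<in> Hom C (Lev (X 0) m) (Lev (X 1) n) \<and> D 0 n \<cdot> h = bnd (X 0) n m"
      by (intro exI[of _ m] exI[of _ "bnd V n m \<star> s"])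
        (simp add: Hom_def D_def X_Lev bndX homotopy(1) del: bar_diff.simps)
    fix p
    let ?B = "bar_diff (Lev R n) (Suc (Suc p))" and ?B' = "bar_diff (Lev R m) (Suc p)" and ?b = "bnd ?A n m"
    let ?h = "tpow_arr C ?b (Suc p) \<star> s" and ?k = "tpow_arr C ?b p \<star> s"
    have arr [simp]: "?h \<in> Arr C" "Dom C ?h = Und (Lev R m) \<boxtimes> Und (Lev R m) \<boxtimes> tpow C (Und (Lev R m)) p"
      "Cod C ?h = Und (Lev R n) \<boxtimes> Und (Lev R n) \<boxtimes> Und (Lev R n) \<boxtimes> tpow C (Und (Lev R n)) p"
      "?k \<in> Arr C" "Dom C ?k = Und (Lev R m) \<boxtimes> tpow C (Und (Lev R m)) p"
      "Cod C ?k = Und (Lev R n) \<boxtimes> Und (Lev R n) \<boxtimes> tpow C (Und (Lev R n)) p"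
      by (simp_all add: tpow_right)
    \<comment> \<open>In \<open>bar_homotopy\<close> the tensor power of the transition map carries
      the sign of degree p + 1, and the two homotopy terms stand on opposite sides. The signs put
      into \<open>h\<close> and \<open>k\<close> turn this into a sum equal to that tensor
      power.\<close>
    define h where "h = signed (Suc p) ?h"
    define k where "k = signed (Suc (Suc p)) ?k"
    have hk [simp]: "h \<in> Arr C" "Dom C h = Und (Lev R m) \<boxtimes> Und (Lev R m) \<boxtimes> tpow C (Und (Lev R m)) p"
      "Cod C h = Und (Lev R n) \<boxtimes> Und (Lev R n) \<boxtimes> Und (Lev R n) \<boxtimes> tpow C (Und (Lev R n)) p"
      "k \<in> Arr C" "Dom C k = Und (Lev R m) \<boxtimes> tpow C (Und (Lev R m)) p"
      "Cod C k = Und (Lev R n) \<boxtimes> Und (Lev R n) \<boxtimes> tpow C (Und (Lev R n)) p"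
      unfolding h_def k_def by (simp_all add: tpow_right)
    have eq: "tpow_arr C ?b (Suc (Suc p)) = ?B \<cdot> h \<boxplus> k \<cdot> ?B'"
    proof -
      have [simp]: "?B \<in> Arr C" "Dom C ?B = Cod C h" "?B' \<in> Arr C" "Cod C ?B' = Dom C k"
        "Dom C ?B' = Dom C h" "Cod C ?B = Cod C k" by (simp_all del: bar_diff.simps)
      define x where "x = ?B \<cdot> ?h"
      define y where "y = ?k \<cdot> ?B'"
      define z where "z = tpow_arr C ?b (Suc (Suc p))"
      have [simp]: "x \<in> Arr C" "y \<in> Arr C" "z \<in> Arr C" "Dom C y = Dom C x" "Cod C y = Cod C x"
        "Dom C z = Dom C x" "Cod C z = Cod C x"
        unfolding x_def y_def z_def by (simp_all del: bar_diff.simps)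
      have xyz: "x = y \<boxplus> signed (Suc p) z" unfolding x_def y_def z_def by (rule homotopy(2))
      have "y \<boxplus> (z \<boxplus> Neg C y) = z" by (subst add_left_commute) simp_all
      then have "z = signed (Suc p) x \<boxplus> signed (Suc (Suc p)) y"
        unfolding xyz by (simp add: signed_def add_ac)
      also have "\<dots> = ?B \<cdot> h \<boxplus> k \<cdot> ?B'"
        unfolding x_def y_def h_def k_def by (simp add: signed_def del: bar_diff.simps tpow_arr.simps)
      finally show ?thesis unfolding z_def .
    qed
    show "\<exists>m h k. n \<le> m \<and> h \<in> Hom C (Lev (X (Suc p)) m) (Lev (X (Suc (Suc p))) n) \<and>
      k \<in> Hom C (Lev (X p) m) (Lev (X (Suc p)) n) \<and> bnd (X (Suc p)) n m = D (Suc p) n \<cdot> h \<boxplus> k \<cdot> D p m"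
    proof (intro exI conjI)
      show "bnd V n m \<star> h \<in> Hom C (Lev (X (Suc p)) m) (Lev (X (Suc (Suc p))) n)"
        "bnd V n m \<star> k \<in> Hom C (Lev (X p) m) (Lev (X (Suc p)) n)" by (simp_all add: Hom_def X_Lev)
      show "bnd (X (Suc p)) n m = D (Suc p) n \<cdot> (bnd V n m \<star> h) \<boxplus> (bnd V n m \<star> k) \<cdot> D p m"
        unfolding bndX[OF m] eq D_def by (simp del: bar_diff.simps)
    qed (rule m)
  qed
qed

end

theorem theorem6p3:
  fixes C :: "('o, 'm) tensor_category" and J :: "'o set"
    and A K :: "(('o, 'm) alg, 'm) inv_sys" and i :: "nat \<Rightarrow> 'm"
  assumes "base_category C J"
    and "rel_injectives C J = Obj C"
    and "is_pro_alg C A" and "quasi_free C A"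
    and "is_cof_pro_ideal C J A K i"
  shows "H_unital C J (power_inf C K) \<and> power_inf_incl C K \<in> pro_cofibrations C J"
proof
  interpret base_category C J by (rule assms(1))
  have K: "is_pro_alg C K" using assms(5) by (simp add: is_cof_pro_ideal_def is_pro_ideal_def)
  show "H_unital C J (power_inf C K)"
    by (rule H_unital_of_sections[OF assms(2) is_pro_alg_power_inf[OF K]])
      (metis ex_power_inf_section[OF assms(2,4,5)])
  show "power_inf_incl C K \<in> pro_cofibrations C J"
    by (rule power_inf_incl_cofibration[OF assms(2,4,5)])
qed

end
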